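(* Let $X$ be a complex projective variety (not necessarily smooth), let $i:Y\hookrightarrow X$ be a closed subvariety, and let $\mathcal F$ be a coherent sheaf on $Y$. Let $i_!\mathcal F$ be the coherent sheaf on $X$ obtained by extending $\mathcal F$ by zero, and let $i_*:H_*(Y;\mathbb Q)\to H_*(X;\mathbb Q)$ be the homomorphism induced by $i$ on rational singular homology. Then the charges satisfy $$i_*Q(\mathcal F)=Q(i_!\mathcal F)\quad\text{in } H_*(X;\mathbb Q).$$
   Context: Varieties are complex projective algebraic varieties, possibly singular; homology and cohomology have rational coefficients. For a variety $Z$, $D^b(Z)$ is the bounded derived category of coherent sheaves on $Z$ (its objects are called branes), and $K_0Z$ is the Grothendieck group of coherent sheaves on $Z$. For $\mathcal G\in D^b(Z)$ put $[\mathcal G]:=\sum_k(-1)^k[\mathcal G^k]=\sum_k(-1)^k[\mathcal H^k(\mathcal G)]\in K_0Z$. A coherent sheaf is regarded as a complex concentrated in degree $0$. Definition of the Baum-Fulton-MacPherson transformation $\tau:K_0Z\to H_*(Z;\mathbb Q)$. Given a coherent sheaf $\mathcal F$ on $Z$, choose a closed embedding $j:Z\hookrightarrow M$ into a smooth variety $M$ and a finite locally free resolution $0\to E_r\to\dots\to E_0\to j_!\mathcal F\to 0$ on $M$, with $d_i:E_i\to E_{i-1}$. The complex $E_\bullet$ is exact on $M\setminus Z$; choosing splittings $E_i|_{M\setminus Z}\simeq \ker(d_i)|_{M\setminus Z}\oplus\ker(d_{i-1})|_{M\setminus Z}$ gives an isomorphism $\beta:E_{\rm even}=\bigoplus_i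 E_{2i}\to E_{\rm odd}=\bigoplus_i E_{2i+1}$ over $M\setminus Z$. The difference bundle $d(E_{\rm even},E_{\rm odd},\beta)$ is an element of the relative topological $K$-group $K^0(M,M\setminus Z)$; its Chern character in $H^*(M,M\setminus Z;\mathbb Q)$ corresponds under the Alexander-Lefschetz duality isomorphism $H^*(M,M\setminus Z;\mathbb Q)\simeq H_*(Z;\mathbb Q)$ to a class ${\rm ch}^M_Z(E_\bullet)\in H_*(Z;\mathbb Q)$. Then $\tau(\mathcal F):={\rm td}(M)\cap{\rm ch}^M_Z(E_\bullet)$, where ${\rm td}(M)$ is the Todd class of the tangent bundle of $M$ (restricted to $Z$ via $j^*$ to form the cap product). This is independent of the choices and additive on short exact sequences, hence defines $\tau$ on $K_0Z$. The charge of $\mathcal G\in D^b(Z)$ is $Q(\mathcal G):=\tau([\mathcal G])\in H_*(Z;\mathbb Q)$. *)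

theory Defs
  imports
    "HOL-Homology.Homology"
    "HOL-Algebra.Module"
    "HOL-Computational_Algebra.Formal_Power_Series"
begin

section \<open>Complex projective varieties\<close>

text \<open>
  A point of projective space is a punctured line, that is, the set of all its homogeneous
  coordinate vectors. Coordinate vectors are finitely supported sequences, so that all
  projective spaces \<open>\<P>\<^sup>0 \<subseteq> \<P>\<^sup>1 \<subseteq> \<dots>\<close> live in one type.
\<close>

type_synonym pt = "(nat \<Rightarrow> complex) set"

definition coord_vecs :: "(nat \<Rightarrow> complex) set" where
  "coord_vecs = {v. finite {i. v i \<noteq> 0} \<and> (\<exists>i. v i \<noteq> 0)}"

definition pline :: "(nat \<Rightarrow> complex) \<Rightarrow> pt" where
  "pline v = {(\<lambda>i. c * v i) |c. c \<noteq> 0}"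

definition proj_space :: "nat \<Rightarrow> pt set" where
  "proj_space n = pline ` {v \<in> coord_vecs. \<forall>i>n. v i = 0}"

text \<open>\<open>hpoly d f\<close>: \<open>f\<close> is the function defined by a homogeneous polynomial of degree \<open>d\<close>.\<close>

inductive hpoly :: "nat \<Rightarrow> ((nat \<Rightarrow> complex) \<Rightarrow> complex) \<Rightarrow> bool" where
  const: "hpoly 0 (\<lambda>v. c)"
| coord: "hpoly 1 (\<lambda>v. v i)"
| add: "hpoly d f \<Longrightarrow> hpoly d g \<Longrightarrow> hpoly d (\<lambda>v. f v + g v)"
| mult: "hpoly d f \<Longrightarrow> hpoly e g \<Longrightarrow> hpoly (d + e) (\<lambda>v. f v * g v)"

text \<open>
  Varieties are the Zariski closed subsets of projective spaces, with their reduced structure;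
  they may be singular and reducible.
\<close>

definition variety :: "pt set \<Rightarrow> bool" where
  "variety Z \<longleftrightarrow> (\<exists>n P. (\<forall>f\<in>P. \<exists>d. hpoly d f) \<and>
      Z = {p \<in> proj_space n. \<forall>f\<in>P. \<forall>v\<in>p. f v = 0})"

definition zopen :: "pt set \<Rightarrow> pt set \<Rightarrow> bool" where
  "zopen Z U \<longleftrightarrow> U \<subseteq> Z \<and> variety (Z - U)"

definition regular_on :: "pt set \<Rightarrow> pt set \<Rightarrow> (pt \<Rightarrow> complex) \<Rightarrow> bool" where
  "regular_on Z U f \<longleftrightarrow> (\<forall>x\<in>U. \<exists>V d g h. zopen Z V \<and> x \<in> V \<and> V \<subseteq> U \<and> hpoly d g \<and> hpoly d h \<and>
      (\<forall>y\<in>V. \<forall>v\<in>y. h v \<noteq> 0 \<and> f y = g v / h v))"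

definition oring :: "pt set \<Rightarrow> pt set \<Rightarrow> (pt \<Rightarrow> complex) ring" where
  "oring Z U = \<lparr>carrier = {f \<in> extensional U. regular_on Z U f},
     monoid.mult = (\<lambda>f g. restrict (\<lambda>x. f x * g x) U), one = restrict (\<lambda>x. 1) U,
     zero = restrict (\<lambda>x. 0) U, add = (\<lambda>f g. restrict (\<lambda>x. f x + g x) U)\<rparr>"

definition regular_map :: "pt set \<Rightarrow> pt set \<Rightarrow> (pt \<Rightarrow> pt) \<Rightarrow> bool" where
  "regular_map Z W j \<longleftrightarrow> j \<in> Z \<rightarrow> W \<and> (\<forall>U. zopen W U \<longrightarrow> zopen Z {x \<in> Z. j x \<in> U} \<and>
      (\<forall>f. regular_on W U f \<longrightarrow> regular_on Z {x \<in> Z. j x \<in> U} (f \<circ> j)))"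

definition closed_embedding :: "pt set \<Rightarrow> pt set \<Rightarrow> (pt \<Rightarrow> pt) \<Rightarrow> bool" where
  "closed_embedding Z M j \<longleftrightarrow> regular_map Z M j \<and> inj_on j Z \<and> variety (j ` Z) \<and>
      regular_map (j ` Z) Z (inv_into Z j)"

text \<open>
  The classical topology. The quotient map from the nonzero vectors is open and its restriction
  to the vectors of a fixed \<open>\<P>\<^sup>n\<close> is saturated, so each \<open>\<P>\<^sup>n\<close> receives its usual topology as a
  subspace.
\<close>

definition cp_top :: "pt topology" where
  "cp_top = topology (\<lambda>U. U \<subseteq> pline ` coord_vecs \<and>
      openin (top_of_set coord_vecs) {v \<in> coord_vecs. pline v \<in> U})"

lemma openin_cp_top:
  "openin cp_top U \<longleftrightarrow> U \<subseteq> pline ` coord_vecs \<and>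
      openin (top_of_set coord_vecs) {v \<in> coord_vecs. pline v \<in> U}"
proof -
  have "istopology (\<lambda>U. U \<subseteq> pline ` coord_vecs \<and>
      openin (top_of_set coord_vecs) {v \<in> coord_vecs. pline v \<in> U})"
    unfolding istopology_def
  proof (intro conjI allI impI)
    fix S T
    assume "S \<subseteq> pline ` coord_vecs \<and> openin (top_of_set coord_vecs) {v \<in> coord_vecs. pline v \<in> S}"
      and "T \<subseteq> pline ` coord_vecs \<and> openin (top_of_set coord_vecs) {v \<in> coord_vecs. pline v \<in> T}"
    moreover have "{v \<in> coord_vecs. pline v \<in> S \<inter> T} =
        {v \<in> coord_vecs. pline v \<in> S} \<inter> {v \<in> coord_vecs. pline v \<in> T}"
      by auto
    ultimately show "S \<inter> T \<subseteq> pline ` coord_vecs"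
      and "openin (top_of_set coord_vecs) {v \<in> coord_vecs. pline v \<in> S \<inter> T}"
      by (auto intro: openin_Int)
  next
    fix \<K>
    assume K: "\<forall>K\<in>\<K>. K \<subseteq> pline ` coord_vecs \<and>
        openin (top_of_set coord_vecs) {v \<in> coord_vecs. pline v \<in> K}"
    then show "\<Union>\<K> \<subseteq> pline ` coord_vecs"
      by blast
    have "openin (top_of_set coord_vecs) (\<Union>((\<lambda>K. {v \<in> coord_vecs. pline v \<in> K}) ` \<K>))"
      by (rule openin_Union) (use K in blast)
    moreover have "\<Union>((\<lambda>K. {v \<in> coord_vecs. pline v \<in> K}) ` \<K>) =
        {v \<in> coord_vecs. pline v \<in> \<Union>\<K>}"
      by blast
    ultimately show "openin (top_of_set coord_vecs) {v \<in> coord_vecs. pline v \<in> \<Union>\<K>}"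
      by simp
  qed
  then show ?thesis
    by (simp add: cp_top_def topology_inverse')
qed

definition ctop :: "pt set \<Rightarrow> pt topology" where
  "ctop Z = subtopology cp_top Z"


section \<open>Sheaves of modules\<close>

text \<open>
  \<open>Rst F U V\<close> is the restriction map from \<open>Sec F U\<close> to \<open>Sec F V\<close>. Only the additive group and the
  scalar multiplication of the module records are relevant.
\<close>

record 'a modsheaf =
  Sec :: "pt set \<Rightarrow> (pt \<Rightarrow> complex, 'a) module"
  Rst :: "pt set \<Rightarrow> pt set \<Rightarrow> 'a \<Rightarrow> 'a"

definition modsheaf_on :: "pt set \<Rightarrow> 'a modsheaf \<Rightarrow> bool" where
  "modsheaf_on Z F \<longleftrightarrow>
    (\<forall>U. zopen Z U \<longrightarrow> module (oring Z U) (Sec F U)) \<and>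
    (\<forall>U V. zopen Z U \<and> zopen Z V \<and> V \<subseteq> U \<longrightarrow>
       Rst F U V \<in> carrier (Sec F U) \<rightarrow> carrier (Sec F V) \<and>
       (\<forall>s\<in>carrier (Sec F U). \<forall>t\<in>carrier (Sec F U).
          Rst F U V (s \<oplus>\<^bsub>Sec F U\<^esub> t) = Rst F U V s \<oplus>\<^bsub>Sec F V\<^esub> Rst F U V t) \<and>
       (\<forall>f\<in>carrier (oring Z U). \<forall>s\<in>carrier (Sec F U).
          Rst F U V (f \<odot>\<^bsub>Sec F U\<^esub> s) = restrict f V \<odot>\<^bsub>Sec F V\<^esub> Rst F U V s)) \<and>
    (\<forall>U. zopen Z U \<longrightarrow> (\<forall>s\<in>carrier (Sec F U). Rst F U U s = s)) \<and>
    (\<forall>U V W. zopen Z U \<and> zopen Z V \<and> zopen Z W \<and> W \<subseteq> V \<and> V \<subseteq> U \<longrightarrow>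
       (\<forall>s\<in>carrier (Sec F U). Rst F V W (Rst F U V s) = Rst F U W s)) \<and>
    (\<forall>\<V> s. (\<forall>V\<in>\<V>. zopen Z V \<and> s V \<in> carrier (Sec F V)) \<and> zopen Z (\<Union>\<V>) \<and>
       (\<forall>V\<in>\<V>. \<forall>W\<in>\<V>. Rst F V (V \<inter> W) (s V) = Rst F W (V \<inter> W) (s W)) \<longrightarrow>
       (\<exists>!t. t \<in> carrier (Sec F (\<Union>\<V>)) \<and> (\<forall>V\<in>\<V>. Rst F (\<Union>\<V>) V t = s V)))"

definition lincomb :: "'a modsheaf \<Rightarrow> pt set \<Rightarrow> nat \<Rightarrow> (nat \<Rightarrow> pt \<Rightarrow> complex) \<Rightarrow> (nat \<Rightarrow> 'a) \<Rightarrow> 'a" where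
  "lincomb F U n f s = finsum (Sec F U) (\<lambda>i. f i \<odot>\<^bsub>Sec F U\<^esub> s i) {..<n}"

definition finite_type :: "pt set \<Rightarrow> 'a modsheaf \<Rightarrow> bool" where
  "finite_type Z F \<longleftrightarrow> (\<forall>x\<in>Z. \<exists>U n s. zopen Z U \<and> x \<in> U \<and> (\<forall>i<n. s i \<in> carrier (Sec F U)) \<and>
     (\<forall>V t. zopen Z V \<and> V \<subseteq> U \<and> t \<in> carrier (Sec F V) \<longrightarrow>
        (\<forall>y\<in>V. \<exists>W f. zopen Z W \<and> y \<in> W \<and> W \<subseteq> V \<and> (\<forall>i<n. f i \<in> carrier (oring Z W)) \<and>
           Rst F V W t = lincomb F W n f (\<lambda>i. Rst F U W (s i)))))"

text \<open>
  For every homomorphism from a finite free sheaf on an open set to the sheaf, the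
  kernel is of finite type.
\<close>

definition finite_type_relations :: "pt set \<Rightarrow> 'a modsheaf \<Rightarrow> bool" where
  "finite_type_relations Z F \<longleftrightarrow>
    (\<forall>U n s. zopen Z U \<and> (\<forall>i<n. s i \<in> carrier (Sec F U)) \<longrightarrow>
      (\<forall>x\<in>U. \<exists>V (m::nat) g. zopen Z V \<and> x \<in> V \<and> V \<subseteq> U \<and>
        (\<forall>k<m. (\<forall>i<n. g k i \<in> carrier (oring Z V)) \<and>
               lincomb F V n (g k) (\<lambda>i. Rst F U V (s i)) = \<zero>\<^bsub>Sec F V\<^esub>) \<and>
        (\<forall>W h. zopen Z W \<and> W \<subseteq> V \<and> (\<forall>i<n. h i \<in> carrier (oring Z W)) \<and>
               lincomb F W n h (\<lambda>i. Rst F U W (s i)) = \<zero>\<^bsub>Sec F W\<^esub> \<longrightarrow>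
           (\<forall>y\<in>W. \<exists>W' a. zopen Z W' \<and> y \<in> W' \<and> W' \<subseteq> W \<and> (\<forall>k<m. a k \<in> carrier (oring Z W')) \<and>
              (\<forall>i<n. \<forall>z\<in>W'. h i z = (\<Sum>k<m. a k z * g k i z))))))"

definition coherent :: "pt set \<Rightarrow> 'a modsheaf \<Rightarrow> bool" where
  "coherent Z F \<longleftrightarrow> modsheaf_on Z F \<and> finite_type Z F \<and> finite_type_relations Z F"

definition sheaf_hom :: "pt set \<Rightarrow> 'a modsheaf \<Rightarrow> 'b modsheaf \<Rightarrow> (pt set \<Rightarrow> 'a \<Rightarrow> 'b) \<Rightarrow> bool" where
  "sheaf_hom Z F G \<phi> \<longleftrightarrow>
    (\<forall>U. zopen Z U \<longrightarrow>
       \<phi> U \<in> carrier (Sec F U) \<rightarrow> carrier (Sec G U) \<and>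
       (\<forall>s\<in>carrier (Sec F U). \<forall>t\<in>carrier (Sec F U).
          \<phi> U (s \<oplus>\<^bsub>Sec F U\<^esub> t) = \<phi> U s \<oplus>\<^bsub>Sec G U\<^esub> \<phi> U t) \<and>
       (\<forall>f\<in>carrier (oring Z U). \<forall>s\<in>carrier (Sec F U).
          \<phi> U (f \<odot>\<^bsub>Sec F U\<^esub> s) = f \<odot>\<^bsub>Sec G U\<^esub> \<phi> U s)) \<and>
    (\<forall>U V. zopen Z U \<and> zopen Z V \<and> V \<subseteq> U \<longrightarrow>
       (\<forall>s\<in>carrier (Sec F U). \<phi> V (Rst F U V s) = Rst G U V (\<phi> U s)))"

definition locally_in_image ::
    "pt set \<Rightarrow> 'a modsheaf \<Rightarrow> (pt set \<Rightarrow> 'a \<Rightarrow> 'b) \<Rightarrow> 'b modsheaf \<Rightarrow> pt set \<Rightarrow> 'b \<Rightarrow> bool" where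
  "locally_in_image Z F \<phi> G U t \<longleftrightarrow>
    (\<forall>x\<in>U. \<exists>V s. zopen Z V \<and> x \<in> V \<and> V \<subseteq> U \<and> s \<in> carrier (Sec F V) \<and> \<phi> V s = Rst G U V t)"

definition sheaf_exact ::
    "pt set \<Rightarrow> 'a modsheaf \<Rightarrow> (pt set \<Rightarrow> 'a \<Rightarrow> 'b) \<Rightarrow> 'b modsheaf \<Rightarrow> (pt set \<Rightarrow> 'b \<Rightarrow> 'c) \<Rightarrow> 'c modsheaf \<Rightarrow> bool"
  where
  "sheaf_exact Z F \<phi> G \<psi> H \<longleftrightarrow> (\<forall>U. zopen Z U \<longrightarrow> (\<forall>t\<in>carrier (Sec G U).
      \<psi> U t = \<zero>\<^bsub>Sec H U\<^esub> \<longleftrightarrow> locally_in_image Z F \<phi> G U t))"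

definition sheaf_surj :: "pt set \<Rightarrow> 'a modsheaf \<Rightarrow> (pt set \<Rightarrow> 'a \<Rightarrow> 'b) \<Rightarrow> 'b modsheaf \<Rightarrow> bool" where
  "sheaf_surj Z F \<phi> G \<longleftrightarrow> (\<forall>U. zopen Z U \<longrightarrow> (\<forall>t\<in>carrier (Sec G U). locally_in_image Z F \<phi> G U t))"

definition sheaf_inj :: "pt set \<Rightarrow> 'a modsheaf \<Rightarrow> (pt set \<Rightarrow> 'a \<Rightarrow> 'b) \<Rightarrow> 'b modsheaf \<Rightarrow> bool" where
  "sheaf_inj Z F \<phi> G \<longleftrightarrow> (\<forall>U. zopen Z U \<longrightarrow> inj_on (\<phi> U) (carrier (Sec F U)))"

definition short_exact ::
    "pt set \<Rightarrow> 'a modsheaf \<Rightarrow> (pt set \<Rightarrow> 'a \<Rightarrow> 'b) \<Rightarrow> 'b modsheaf \<Rightarrow> (pt set \<Rightarrow> 'b \<Rightarrow> 'c) \<Rightarrow> 'c modsheaf \<Rightarrow> bool"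
  where
  "short_exact Z F' \<phi> F \<psi> F'' \<longleftrightarrow> sheaf_hom Z F' F \<phi> \<and> sheaf_hom Z F F'' \<psi> \<and>
     sheaf_inj Z F' \<phi> F \<and> sheaf_exact Z F' \<phi> F \<psi> F'' \<and> sheaf_surj Z F \<psi> F''"

text \<open>
  The direct image of a sheaf on \<open>Z\<close> under \<open>j\<close>; functions act through composition with \<open>j\<close>. For a
  closed embedding this is extension by zero.
\<close>

definition direct_image :: "pt set \<Rightarrow> (pt \<Rightarrow> pt) \<Rightarrow> 'a modsheaf \<Rightarrow> 'a modsheaf" where
  "direct_image Z j F = \<lparr>
     Sec = (\<lambda>U. let V = {x \<in> Z. j x \<in> U} in
        (Sec F V)\<lparr>smult := (\<lambda>f s. restrict (f \<circ> j) V \<odot>\<^bsub>Sec F V\<^esub> s)\<rparr>),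
     Rst = (\<lambda>U U'. Rst F {x \<in> Z. j x \<in> U} {x \<in> Z. j x \<in> U'})\<rparr>"

definition extend_by_zero :: "pt set \<Rightarrow> 'a modsheaf \<Rightarrow> 'a modsheaf" where
  "extend_by_zero Y F = direct_image Y (\<lambda>x. x) F"


section \<open>Branes and the Grothendieck group\<close>

definition zero_sheaf :: "'a modsheaf" where
  "zero_sheaf = \<lparr>
     Sec = (\<lambda>U. \<lparr>carrier = {undefined}, monoid.mult = (\<lambda>s t. undefined), one = undefined,
        zero = undefined, add = (\<lambda>s t. undefined), smult = (\<lambda>f s. undefined)\<rparr>),
     Rst = (\<lambda>U V s. s)\<rparr>"

definition is_zero_sheaf :: "pt set \<Rightarrow> 'a modsheaf \<Rightarrow> bool" where
  "is_zero_sheaf Z F \<longleftrightarrow> (\<forall>U. zopen Z U \<longrightarrow> carrier (Sec F U) = {\<zero>\<^bsub>Sec F U\<^esub>})"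

record 'a sheaf_complex =
  Obj :: "int \<Rightarrow> 'a modsheaf"
  Dif :: "int \<Rightarrow> pt set \<Rightarrow> 'a \<Rightarrow> 'a"

definition brane :: "pt set \<Rightarrow> 'a sheaf_complex \<Rightarrow> bool" where
  "brane Z G \<longleftrightarrow> (\<forall>k. coherent Z (Obj G k) \<and> sheaf_hom Z (Obj G k) (Obj G (k + 1)) (Dif G k) \<and>
       (\<forall>U. zopen Z U \<longrightarrow> (\<forall>s\<in>carrier (Sec (Obj G k) U).
          Dif G (k + 1) U (Dif G k U s) = \<zero>\<^bsub>Sec (Obj G (k + 2)) U\<^esub>))) \<and>
     finite {k. \<not> is_zero_sheaf Z (Obj G k)}"

definition in_degree_0 :: "'a modsheaf \<Rightarrow> 'a sheaf_complex" where
  "in_degree_0 F = \<lparr>Obj = (\<lambda>k. if k = 0 then F else zero_sheaf),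
     Dif = (\<lambda>k U s. \<zero>\<^bsub>Sec (if k + 1 = 0 then F else zero_sheaf) U\<^esub>)\<rparr>"

text \<open>\<open>K\<^sub>0\<close> is the free abelian group on the coherent sheaves modulo the subgroup \<open>K0_rel\<close>.\<close>

inductive_set K0_rel :: "pt set \<Rightarrow> ('a modsheaf \<Rightarrow>\<^sub>0 int) set" for Z where
  zero: "0 \<in> K0_rel Z"
| diff: "a \<in> K0_rel Z \<Longrightarrow> b \<in> K0_rel Z \<Longrightarrow> a - b \<in> K0_rel Z"
| ses: "coherent Z F' \<Longrightarrow> coherent Z F \<Longrightarrow> coherent Z F'' \<Longrightarrow> short_exact Z F' \<phi> F \<psi> F'' \<Longrightarrow>
    frag_of F - frag_of F' - frag_of F'' \<in> K0_rel Z"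

definition K0_class :: "pt set \<Rightarrow> ('a modsheaf \<Rightarrow>\<^sub>0 int) \<Rightarrow> ('a modsheaf \<Rightarrow>\<^sub>0 int) set" where
  "K0_class Z a = {b. Poly_Mapping.keys b \<subseteq> {F. coherent Z F} \<and> b - a \<in> K0_rel Z}"

definition K0 :: "pt set \<Rightarrow> ('a modsheaf \<Rightarrow>\<^sub>0 int) set set" where
  "K0 Z = K0_class Z ` {a. Poly_Mapping.keys a \<subseteq> {F. coherent Z F}}"

definition brane_class :: "pt set \<Rightarrow> 'a sheaf_complex \<Rightarrow> ('a modsheaf \<Rightarrow>\<^sub>0 int) set" where
  "brane_class Z G = K0_class Z (\<Sum>k\<in>{k. \<not> is_zero_sheaf Z (Obj G k)}.
      frag_cmul (if even k then 1 else -1) (frag_of (Obj G k)))"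

text \<open>Addition of cosets, both in \<open>K\<^sub>0\<close> and in homology.\<close>

definition coset_add :: "'g::plus set \<Rightarrow> 'g set \<Rightarrow> 'g set" where
  "coset_add A B = {a + b |a b. a \<in> A \<and> b \<in> B}"


section \<open>Rational singular homology and cohomology\<close>

text \<open>
  Chains of all dimensions are collected in one group, so a homology class below is an element
  of the direct sum of all \<open>H\<^sub>k\<close>. A simplex is tagged with its dimension. Cochains may
  have components in infinitely many degrees.
\<close>

type_synonym 'b simplex = "nat \<times> ((nat \<Rightarrow> real) \<Rightarrow> 'b)"
type_synonym 'b qchain = "'b simplex \<Rightarrow>\<^sub>0 rat"
type_synonym 'b qcochain = "'b simplex \<Rightarrow> rat"

definition simplices :: "'b topology \<Rightarrow> 'b simplex set" where
  "simplices X = {(p, f). singular_simplex p X f}"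

definition qchains :: "'b topology \<Rightarrow> 'b qchain set" where
  "qchains X = {c. Poly_Mapping.keys c \<subseteq> simplices X}"

definition qextend :: "('b simplex \<Rightarrow> 'c qchain) \<Rightarrow> 'b qchain \<Rightarrow> 'c qchain" where
  "qextend g c = (\<Sum>s\<in>Poly_Mapping.keys c. Poly_Mapping.map ((*) (Poly_Mapping.lookup c s)) (g s))"

definition bdry :: "'b qchain \<Rightarrow> 'b qchain" where
  "bdry = qextend (\<lambda>(p, f). if p = 0 then 0
     else (\<Sum>k\<le>p. Poly_Mapping.single (p - 1, singular_face p k f) ((-1) ^ k)))"

definition push_chain :: "('b \<Rightarrow> 'c) \<Rightarrow> 'b qchain \<Rightarrow> 'c qchain" where
  "push_chain g = qextend (\<lambda>(p, f). Poly_Mapping.single (p, simplex_map p g f) 1)"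

definition cycle :: "'b topology \<Rightarrow> 'b qchain \<Rightarrow> bool" where
  "cycle X c \<longleftrightarrow> c \<in> qchains X \<and> bdry c = 0"

text \<open>Congruence modulo boundaries in \<open>X\<close> and chains in the subset \<open>A\<close>.\<close>

definition homologous :: "'b topology \<Rightarrow> 'b set \<Rightarrow> 'b qchain \<Rightarrow> 'b qchain \<Rightarrow> bool" where
  "homologous X A c c' \<longleftrightarrow> (\<exists>b\<in>qchains X. \<exists>a\<in>qchains (subtopology X A). c - c' = bdry b + a)"

definition hom_class :: "'b topology \<Rightarrow> 'b qchain \<Rightarrow> 'b qchain set" where
  "hom_class X c = {c' \<in> qchains X. homologous X {} c' c}"

definition homology :: "'b topology \<Rightarrow> 'b qchain set set" where
  "homology X = hom_class X ` {c. cycle X c}"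

definition hom_push :: "'c topology \<Rightarrow> ('b \<Rightarrow> 'c) \<Rightarrow> 'b qchain set \<Rightarrow> 'c qchain set" where
  "hom_push X' f \<kappa> = (\<Union>c\<in>\<kappa>. hom_class X' (push_chain f c))"

definition pairing :: "'b qcochain \<Rightarrow> 'b qchain \<Rightarrow> rat" where
  "pairing \<phi> c = (\<Sum>s\<in>Poly_Mapping.keys c. Poly_Mapping.lookup c s * \<phi> s)"

definition cobdry :: "'b qcochain \<Rightarrow> 'b qcochain" where
  "cobdry \<phi> s = pairing \<phi> (bdry (Poly_Mapping.single s 1))"

definition cocycle :: "'b topology \<Rightarrow> 'b set \<Rightarrow> 'b qcochain \<Rightarrow> bool" where
  "cocycle X A \<phi> \<longleftrightarrow> (\<forall>s\<in>simplices X. cobdry \<phi> s = 0) \<and> (\<forall>s\<in>simplices (subtopology X A). \<phi> s = 0)"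

definition cohomologous :: "'b topology \<Rightarrow> 'b set \<Rightarrow> 'b qcochain \<Rightarrow> 'b qcochain \<Rightarrow> bool" where
  "cohomologous X A \<phi> \<phi>' \<longleftrightarrow> (\<exists>\<psi>. (\<forall>s\<in>simplices (subtopology X A). \<psi> s = 0) \<and>
      (\<forall>s\<in>simplices X. \<phi> s - \<phi>' s = cobdry \<psi> s))"

definition pull_cochain :: "('b \<Rightarrow> 'c) \<Rightarrow> 'c qcochain \<Rightarrow> 'b qcochain" where
  "pull_cochain g \<phi> = (\<lambda>(p, f). \<phi> (p, simplex_map p g f))"

definition front_face :: "nat \<Rightarrow> 'b simplex \<Rightarrow> 'b simplex" where
  "front_face k = (\<lambda>(p, f). (k, restrict f (standard_simplex k)))"

definition back_face :: "nat \<Rightarrow> 'b simplex \<Rightarrow> 'b simplex" where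
  "back_face k = (\<lambda>(p, f).
     (p - k, restrict (\<lambda>y. f (\<lambda>i. if i < k then 0 else y (i - k))) (standard_simplex (p - k))))"

definition cup :: "'b qcochain \<Rightarrow> 'b qcochain \<Rightarrow> 'b qcochain" where
  "cup \<phi> \<psi> s = (\<Sum>k\<le>fst s. \<phi> (front_face k s) * \<psi> (back_face k s))"

definition cap :: "'b qcochain \<Rightarrow> 'b qchain \<Rightarrow> 'b qchain" where
  "cap \<phi> = qextend (\<lambda>s. \<Sum>k\<le>fst s. Poly_Mapping.single (back_face k s) (\<phi> (front_face k s)))"

definition unit_cochain :: "'b qcochain" where
  "unit_cochain s = (if fst s = 0 then 1 else 0)"

primrec cup_power :: "'b qcochain \<Rightarrow> nat \<Rightarrow> 'b qcochain" where
  "cup_power w 0 = unit_cochain"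
| "cup_power w (Suc n) = cup w (cup_power w n)"

primrec cup_prod :: "nat \<Rightarrow> (nat \<Rightarrow> 'b qcochain) \<Rightarrow> 'b qcochain" where
  "cup_prod 0 w = unit_cochain"
| "cup_prod (Suc n) w = cup (cup_prod n w) (w n)"

text \<open>
  The power series \<open>a\<close> evaluated at a cochain \<open>w\<close> of degree 2: on a simplex of dimension \<open>p\<close> the
  powers beyond the \<open>p\<close>-th vanish.
\<close>

definition fps_at :: "rat fps \<Rightarrow> 'b qcochain \<Rightarrow> 'b qcochain" where
  "fps_at a w s = (\<Sum>k\<le>fst s. fps_nth a k * cup_power w k s)"


section \<open>Vector bundles\<close>

text \<open>
  A vector bundle is given by its fibres, which are finite dimensional subspaces of some space of
  functions \<open>'k \<Rightarrow> complex\<close>, and by a set of local frames: \<open>(U, r, e)\<close> stands for the frame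
  \<open>e 0, \<dots>, e (r - 1)\<close> over \<open>U\<close>. The same notion serves for algebraic and for topological bundles: the
  predicates \<open>opn U\<close> and \<open>fn U f\<close> say which sets are open and which functions on \<open>U\<close> are
  admissible. The rank may vary from one connected component to another.
\<close>

record ('b, 'k) vb =
  fib :: "'b \<Rightarrow> ('k \<Rightarrow> complex) set"
  frames :: "('b set \<times> nat \<times> (nat \<Rightarrow> 'b \<Rightarrow> 'k \<Rightarrow> complex)) set"

definition vcomb :: "nat \<Rightarrow> (nat \<Rightarrow> complex) \<Rightarrow> (nat \<Rightarrow> 'k \<Rightarrow> complex) \<Rightarrow> 'k \<Rightarrow> complex" where
  "vcomb r c e = (\<lambda>k. \<Sum>i<r. c i * e i k)"

definition basis_of :: "('k \<Rightarrow> complex) set \<Rightarrow> nat \<Rightarrow> (nat \<Rightarrow> 'k \<Rightarrow> complex) \<Rightarrow> bool" where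
  "basis_of V r e \<longleftrightarrow> V = range (\<lambda>c. vcomb r c e) \<and>
     (\<forall>c. vcomb r c e = (\<lambda>k. 0) \<longrightarrow> (\<forall>i<r. c i = 0))"

definition vb_section ::
    "('b set \<Rightarrow> ('b \<Rightarrow> complex) \<Rightarrow> bool) \<Rightarrow> ('b, 'k) vb \<Rightarrow> 'b set \<Rightarrow> ('b \<Rightarrow> 'k \<Rightarrow> complex) \<Rightarrow> bool" where
  "vb_section fn E U s \<longleftrightarrow> (\<forall>x\<in>U. s x \<in> fib E x) \<and> (\<forall>(V, r, e)\<in>frames E. \<exists>c.
      (\<forall>i<r. fn (U \<inter> V) (c i)) \<and> (\<forall>x\<in>U \<inter> V. s x = vcomb r (\<lambda>i. c i x) (\<lambda>i. e i x)))"

definition vbundle ::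
    "('b set \<Rightarrow> bool) \<Rightarrow> ('b set \<Rightarrow> ('b \<Rightarrow> complex) \<Rightarrow> bool) \<Rightarrow> 'b set \<Rightarrow> ('b, 'k) vb \<Rightarrow> bool" where
  "vbundle opn fn B E \<longleftrightarrow> (\<Union>(U, r, e)\<in>frames E. U) = B \<and>
     (\<forall>(U, r, e)\<in>frames E. opn U \<and> (\<forall>x\<in>U. basis_of (fib E x) r (\<lambda>i. e i x)) \<and>
        (\<forall>i<r. vb_section fn E U (e i)))"

definition vb_map ::
    "('b set \<Rightarrow> bool) \<Rightarrow> ('b set \<Rightarrow> ('b \<Rightarrow> complex) \<Rightarrow> bool) \<Rightarrow> 'b set \<Rightarrow> ('b, 'k) vb \<Rightarrow> ('b, 'l) vb \<Rightarrow>
     ('b \<Rightarrow> ('k \<Rightarrow> complex) \<Rightarrow> 'l \<Rightarrow> complex) \<Rightarrow> bool" where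
  "vb_map opn fn B E F \<phi> \<longleftrightarrow>
     (\<forall>x\<in>B. \<phi> x \<in> fib E x \<rightarrow> fib F x \<and> (\<forall>v\<in>fib E x. \<forall>w\<in>fib E x. \<forall>a b.
        \<phi> x (\<lambda>k. a * v k + b * w k) = (\<lambda>k. a * \<phi> x v k + b * \<phi> x w k))) \<and>
     (\<forall>U s. opn U \<and> U \<subseteq> B \<and> vb_section fn E U s \<longrightarrow> vb_section fn F U (\<lambda>x. \<phi> x (s x)))"

definition vb_iso where
  "vb_iso opn fn B E F \<phi> \<longleftrightarrow> vb_map opn fn B E F \<phi> \<and> (\<forall>x\<in>B. bij_betw (\<phi> x) (fib E x) (fib F x))"

definition component :: "'i \<Rightarrow> ('i \<times> 'k \<Rightarrow> complex) \<Rightarrow> 'k \<Rightarrow> complex" where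
  "component i v = (\<lambda>k. v (i, k))"

text \<open>
  The direct sum of the bundles \<open>E i\<close> for \<open>i \<in> N\<close>, where all but finitely many of them have rank 0.
\<close>

definition vb_sum ::
    "('b set \<Rightarrow> bool) \<Rightarrow> ('b set \<Rightarrow> ('b \<Rightarrow> complex) \<Rightarrow> bool) \<Rightarrow> 'i set \<Rightarrow> ('i \<Rightarrow> ('b, 'k) vb) \<Rightarrow>
     ('b, 'i \<times> 'k) vb" where
  "vb_sum opn fn N E =
     (let fb = (\<lambda>x. {v. \<forall>i. if i \<in> N then component i v \<in> fib (E i) x else component i v = (\<lambda>k. 0)})
      in \<lparr>fib = fb,
          frames = {(U, r, e). opn U \<and> (\<forall>x\<in>U. basis_of (fb x) r (\<lambda>j. e j x)) \<and>
             (\<forall>j<r. \<forall>i\<in>N. vb_section fn (E i) U (\<lambda>x. component i (e j x)))}\<rparr>)"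

definition vb_pull :: "('s \<Rightarrow> 'b) \<Rightarrow> 's set \<Rightarrow> ('b, 'k) vb \<Rightarrow> ('s, 'k) vb" where
  "vb_pull f S E = \<lparr>fib = (\<lambda>s. fib E (f s)),
     frames = (\<lambda>(U, r, e). ({s \<in> S. f s \<in> U}, r, \<lambda>i s. e i (f s))) ` frames E\<rparr>"

subsection \<open>Algebraic bundles and locally free sheaves\<close>

abbreviation alg_vb :: "pt set \<Rightarrow> (pt, 'k) vb \<Rightarrow> bool" where
  "alg_vb M E \<equiv> vbundle (zopen M) (regular_on M) M E"

definition sheaf_of_sections :: "pt set \<Rightarrow> (pt, 'k) vb \<Rightarrow> (pt \<Rightarrow> 'k \<Rightarrow> complex) modsheaf" where
  "sheaf_of_sections M E = \<lparr>
     Sec = (\<lambda>U. \<lparr>carrier = {s \<in> extensional U. vb_section (regular_on M) E U s},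
        monoid.mult = undefined, one = undefined,
        zero = restrict (\<lambda>x k. 0) U, add = (\<lambda>s t. restrict (\<lambda>x k. s x k + t x k) U),
        smult = (\<lambda>f s. restrict (\<lambda>x k. f x * s x k) U)\<rparr>),
     Rst = (\<lambda>U V s. restrict s V)\<rparr>"

definition on_sections ::
    "(pt \<Rightarrow> ('k \<Rightarrow> complex) \<Rightarrow> 'l \<Rightarrow> complex) \<Rightarrow> pt set \<Rightarrow> (pt \<Rightarrow> 'k \<Rightarrow> complex) \<Rightarrow> pt \<Rightarrow> 'l \<Rightarrow> complex" where
  "on_sections \<phi> U s = restrict (\<lambda>x. \<phi> x (s x)) U"

text \<open>
  A finite locally free resolution of a sheaf \<open>G\<close> on \<open>M\<close>, with augmentation \<open>\<epsilon>\<close> from the sheaf of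
  \<open>E 0\<close> and with \<open>d i\<close> going from \<open>E i\<close> to \<open>E (i - 1)\<close>. Up to isomorphism, every locally free sheaf
  of finite rank is the sheaf of sections of a bundle with fibres of the given type.
\<close>

definition resolution ::
    "pt set \<Rightarrow> (nat \<Rightarrow> (pt, nat) vb) \<Rightarrow> (nat \<Rightarrow> pt \<Rightarrow> (nat \<Rightarrow> complex) \<Rightarrow> nat \<Rightarrow> complex) \<Rightarrow>
     (pt set \<Rightarrow> (pt \<Rightarrow> nat \<Rightarrow> complex) \<Rightarrow> 'a) \<Rightarrow> 'a modsheaf \<Rightarrow> bool" where
  "resolution M E d \<epsilon> G \<longleftrightarrow>
     (\<forall>i. alg_vb M (E i)) \<and> (\<exists>r. \<forall>i>r. \<forall>x\<in>M. fib (E i) x = {\<lambda>k. 0}) \<and>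
     d 0 = (\<lambda>x v k. 0) \<and> (\<forall>i. vb_map (zopen M) (regular_on M) M (E (Suc i)) (E i) (d (Suc i))) \<and>
     sheaf_hom M (sheaf_of_sections M (E 0)) G \<epsilon> \<and>
     (\<forall>i. sheaf_exact M (sheaf_of_sections M (E (Suc (Suc i)))) (on_sections (d (Suc (Suc i))))
        (sheaf_of_sections M (E (Suc i))) (on_sections (d (Suc i))) (sheaf_of_sections M (E i))) \<and>
     sheaf_exact M (sheaf_of_sections M (E 1)) (on_sections (d 1)) (sheaf_of_sections M (E 0)) \<epsilon> G \<and>
     sheaf_surj M (sheaf_of_sections M (E 0)) \<epsilon> G"


section \<open>Characteristic classes of topological bundles\<close>

definition cont_fn :: "'b topology \<Rightarrow> 'b set \<Rightarrow> ('b \<Rightarrow> complex) \<Rightarrow> bool" where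
  "cont_fn T U f \<longleftrightarrow> continuous_map (subtopology T U) euclidean f"

abbreviation top_vb :: "'b topology \<Rightarrow> ('b, 'k) vb \<Rightarrow> bool" where
  "top_vb T E \<equiv> vbundle (openin T) (cont_fn T) (topspace T) E"

definition line_bundle :: "'b topology \<Rightarrow> ('b, 'k) vb \<Rightarrow> bool" where
  "line_bundle T L \<longleftrightarrow> top_vb T L \<and> (\<forall>x\<in>topspace T. \<exists>e. basis_of (fib L x) 1 e)"

definition simplex_top :: "nat \<Rightarrow> (nat \<Rightarrow> real) topology" where
  "simplex_top p = subtopology (powertop_real UNIV) (standard_simplex p)"

definition vertex :: "nat \<Rightarrow> nat \<Rightarrow> real" where
  "vertex i = (\<lambda>j. if j = i then 1 else 0)"

text \<open>A continuous nowhere vanishing section of \<open>L\<close> along the singular simplex \<open>f\<close>.\<close>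

definition nonzero_lift ::
    "('b, 'k) vb \<Rightarrow> nat \<Rightarrow> ((nat \<Rightarrow> real) \<Rightarrow> 'b) \<Rightarrow> ((nat \<Rightarrow> real) \<Rightarrow> 'k \<Rightarrow> complex) \<Rightarrow> bool" where
  "nonzero_lift L p f g \<longleftrightarrow>
     vb_section (cont_fn (simplex_top p)) (vb_pull f (standard_simplex p) L) (standard_simplex p) g \<and>
     (\<forall>y\<in>standard_simplex p. g y \<noteq> (\<lambda>k. 0))"

text \<open>
  The first Chern class of a line bundle as the obstruction to a nowhere vanishing section. Choose
  nonzero vectors \<open>v\<close> over the points and nonzero sections \<open>s\<close> over the 1-simplices extending them.
  On a 2-simplex \<open>\<sigma>\<close> with nonzero section \<open>g\<close> we have
  \<open>s = exp (2 \<pi> \<i> \<theta>) g\<close> along each edge, and \<open>w \<sigma>\<close> is the winding number of \<open>s / g\<close>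
  along the boundary of \<open>\<sigma>\<close>. This makes the class of \<open>\<O>(1)\<close> on the projective line
  the positive generator.
\<close>

definition c1_cocycle :: "'b topology \<Rightarrow> ('b, 'k) vb \<Rightarrow> 'b qcochain \<Rightarrow> bool" where
  "c1_cocycle T L w \<longleftrightarrow> (\<forall>p f. p \<noteq> 2 \<longrightarrow> w (p, f) = 0) \<and>
    (\<exists>v s. (\<forall>x\<in>topspace T. v x \<in> fib L x - {\<lambda>k. 0}) \<and>
      (\<forall>f. singular_simplex 1 T f \<longrightarrow> nonzero_lift L 1 f (s f) \<and>
         (\<forall>i\<le>1. s f (vertex i) = v (f (vertex i)))) \<and>
      (\<forall>\<sigma>. singular_simplex 2 T \<sigma> \<longrightarrow> (\<exists>g \<theta>. nonzero_lift L 2 \<sigma> g \<and>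
         (\<forall>k\<le>2. cont_fn (simplex_top 1) (standard_simplex 1) (\<theta> k) \<and>
            (\<forall>y\<in>standard_simplex 1. s (singular_face 2 k \<sigma>) y =
               (\<lambda>l. exp (2 * of_real pi * \<i> * \<theta> k y) * g (simplical_face k y) l))) \<and>
         of_rat (w (2, \<sigma>)) =
           (\<theta> 2 (vertex 1) - \<theta> 2 (vertex 0)) + (\<theta> 0 (vertex 1) - \<theta> 0 (vertex 0))
           - (\<theta> 1 (vertex 1) - \<theta> 1 (vertex 0)))))"

text \<open>A decomposition of the pullback \<open>f\<^sup>* E\<close> to \<open>S\<close> into \<open>r\<close> line subbundles.\<close>

definition line_splitting ::
    "'s topology \<Rightarrow> 'b topology \<Rightarrow> ('s \<Rightarrow> 'b) \<Rightarrow> ('b, 'k) vb \<Rightarrow> nat \<Rightarrow> (nat \<Rightarrow> ('s, 'k) vb) \<Rightarrow> bool" where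
  "line_splitting S T f E r L \<longleftrightarrow> continuous_map S T f \<and>
     (\<forall>i<r. line_bundle S (L i) \<and>
        vb_map (openin S) (cont_fn S) (topspace S) (L i) (vb_pull f (topspace S) E) (\<lambda>s v. v)) \<and>
     (\<forall>s\<in>topspace S. \<exists>b. (\<forall>i<r. b i \<in> fib (L i) s) \<and> basis_of (fib E (f s)) r b)"

text \<open>
  The Chern character and the Todd class via the splitting principle: they are determined by
  their pullbacks along all maps over which the bundle splits into line bundles. The type of the
  test spaces is large enough for the bundle whose points over \<open>x\<close> are the
  decompositions of \<open>E\<^sub>x\<close> into lines; its projection splits \<open>E\<close> and is injective on cohomology.
\<close>

definition is_ch :: "'b topology \<Rightarrow> ('b, 'k) vb \<Rightarrow> 'b qcochain \<Rightarrow> bool" where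
  "is_ch T E a \<longleftrightarrow> cocycle T {} a \<and>
    (\<forall>(S :: ('b \<times> (nat \<Rightarrow> ('k \<Rightarrow> complex) set)) topology) f r L w.
       line_splitting S T f E r L \<and> (\<forall>i<r. c1_cocycle S (L i) (w i)) \<longrightarrow>
       cohomologous S {} (pull_cochain f a) (\<lambda>s. \<Sum>i<r. fps_at (fps_exp 1) (w i) s))"

definition is_td :: "'b topology \<Rightarrow> ('b, 'k) vb \<Rightarrow> 'b qcochain \<Rightarrow> bool" where
  "is_td T E a \<longleftrightarrow> cocycle T {} a \<and>
    (\<forall>(S :: ('b \<times> (nat \<Rightarrow> ('k \<Rightarrow> complex) set)) topology) f r L w.
       line_splitting S T f E r L \<and> (\<forall>i<r. c1_cocycle S (L i) (w i)) \<longrightarrow>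
       cohomologous S {} (pull_cochain f a)
         (cup_prod r (\<lambda>i. fps_at (fps_X / (1 - fps_exp (-1))) (w i))))"


section \<open>Topological K-theory and difference bundles\<close>

text \<open>A pair \<open>(E, F)\<close> stands for the formal difference \<open>[E] - [F]\<close>.\<close>

definition K_equiv ::
    "'b topology \<Rightarrow> ('b, 'k) vb \<times> ('b, 'k) vb \<Rightarrow> ('b, 'k) vb \<times> ('b, 'k) vb \<Rightarrow> bool" where
  "K_equiv T = (\<lambda>(E, F) (E', F'). \<exists>H \<phi>. top_vb T (H :: ('b, 'k) vb) \<and>
     vb_iso (openin T) (cont_fn T) (topspace T)
       (vb_sum (openin T) (cont_fn T) {0, 1, 2::nat} ((!) [E, F', H]))
       (vb_sum (openin T) (cont_fn T) {0, 1, 2::nat} ((!) [E', F, H])) \<phi>)"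

definition K_class :: "'b topology \<Rightarrow> ('b, 'k) vb \<Rightarrow> ('b, 'k) vb \<Rightarrow> (('b, 'k) vb \<times> ('b, 'k) vb) set" where
  "K_class T E F = {(E', F'). top_vb T E' \<and> top_vb T F' \<and> K_equiv T (E, F) (E', F')}"

definition is_ch_K :: "'b topology \<Rightarrow> (('b, 'k) vb \<times> ('b, 'k) vb) set \<Rightarrow> 'b qcochain \<Rightarrow> bool" where
  "is_ch_K T \<kappa> a \<longleftrightarrow> (\<exists>(E, F)\<in>\<kappa>. \<exists>b c. is_ch T E b \<and> is_ch T F c \<and> a = (\<lambda>s. b s - c s))"

text \<open>
  For \<open>A\<close> open in \<open>T\<close>, let \<open>D\<close> be two copies of \<open>T\<close> joined by a cylinder over \<open>A\<close>. The relative group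
  \<open>K\<^sup>0(T, A)\<close> is the kernel of the restriction from \<open>K\<^sup>0(D)\<close> to \<open>K\<^sup>0(T \<times> {1})\<close>.
\<close>

definition dbl :: "'b topology \<Rightarrow> 'b set \<Rightarrow> ('b \<times> real) topology" where
  "dbl T A = subtopology (prod_topology T euclideanreal)
     (topspace T \<times> {0} \<union> A \<times> {0..1} \<union> topspace T \<times> {1})"

definition K_rel :: "'b topology \<Rightarrow> 'b set \<Rightarrow> (('b \<times> real, 'k) vb \<times> ('b \<times> real, 'k) vb) set set" where
  "K_rel T A = {\<kappa>. \<exists>E F. top_vb (dbl T A) E \<and> top_vb (dbl T A) F \<and> \<kappa> = K_class (dbl T A) E F \<and>
     K_equiv T (vb_pull (\<lambda>x. (x, 1)) (topspace T) E, vb_pull (\<lambda>x. (x, 1)) (topspace T) F)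
       (\<lparr>fib = (\<lambda>x. {\<lambda>k. 0}), frames = {(topspace T, 0, \<lambda>i x k. 0)}\<rparr>,
        \<lparr>fib = (\<lambda>x. {\<lambda>k. 0}), frames = {(topspace T, 0, \<lambda>i x k. 0)}\<rparr>)}"

text \<open>\<open>E\<close> on the lower half of \<open>D\<close> and \<open>F\<close> on the upper half, glued over \<open>A\<close> by \<open>\<beta>\<close>.\<close>

definition glue ::
    "'b topology \<Rightarrow> 'b set \<Rightarrow> ('b, 'k) vb \<Rightarrow> ('b, 'k) vb \<Rightarrow> ('b \<Rightarrow> ('k \<Rightarrow> complex) \<Rightarrow> 'k \<Rightarrow> complex) \<Rightarrow>
     ('b \<times> real, 'k) vb" where
  "glue T A E F \<beta> = \<lparr>fib = (\<lambda>(x, t). if t \<le> 1/2 then fib E x else fib F x),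
     frames =
       (\<lambda>(U, r, e). ({(x, t) \<in> topspace (dbl T A). x \<in> U \<and> t < 1/2}, r, \<lambda>i (x, t). e i x)) ` frames E \<union>
       (\<lambda>(U, r, e). ({(x, t) \<in> topspace (dbl T A). x \<in> U \<and> t > 1/2}, r, \<lambda>i (x, t). e i x)) ` frames F \<union>
       (\<lambda>(U, r, e). ((U \<inter> A) \<times> {0..1}, r,
          \<lambda>i (x, t). if t \<le> 1/2 then e i x else \<beta> x (e i x))) ` frames E\<rparr>"

definition difference_bundle ::
    "'b topology \<Rightarrow> 'b set \<Rightarrow> ('b, 'k) vb \<Rightarrow> ('b, 'k) vb \<Rightarrow> ('b \<Rightarrow> ('k \<Rightarrow> complex) \<Rightarrow> 'k \<Rightarrow> complex) \<Rightarrow>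
     (('b \<times> real, 'k) vb \<times> ('b \<times> real, 'k) vb) set" where
  "difference_bundle T A E F \<beta> =
     K_class (dbl T A) (glue T A E F \<beta>) (vb_pull fst (topspace (dbl T A)) F)"

text \<open>
  The relative Chern character of an element of \<open>K\<^sup>0(T, A)\<close>, in \<open>H\<^sup>*(T, A)\<close>. With
  \<open>B = A \<times> [0,1] \<union> T \<times> {1}\<close> the map \<open>x \<mapsto> (x, 0)\<close> induces an isomorphism from \<open>H\<^sup>*(D, B)\<close> to
  \<open>H\<^sup>*(T, A)\<close>, and \<open>H\<^sup>*(D, B)\<close> injects into \<open>H\<^sup>*(D)\<close> since \<open>D\<close> retracts onto \<open>T \<times> {1}\<close>, which is a
  deformation retract of \<open>B\<close>.
\<close>

definition is_ch_rel ::
    "'b topology \<Rightarrow> 'b set \<Rightarrow> (('b \<times> real, 'k) vb \<times> ('b \<times> real, 'k) vb) set \<Rightarrow> 'b qcochain \<Rightarrow> bool" where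
  "is_ch_rel T A \<kappa> u \<longleftrightarrow> \<kappa> \<in> K_rel T A \<and> cocycle T A u \<and>
     (\<exists>a b. is_ch_K (dbl T A) \<kappa> a \<and> cocycle (dbl T A) (A \<times> {0..1} \<union> topspace T \<times> {1}) b \<and>
        cohomologous (dbl T A) {} b a \<and> cohomologous T A u (pull_cochain (\<lambda>x. (x, 0)) b))"


section \<open>Smooth varieties\<close>

definition derivation_at :: "pt set \<Rightarrow> pt \<Rightarrow> (pt set \<times> (pt \<Rightarrow> complex) \<Rightarrow> complex) \<Rightarrow> bool" where
  "derivation_at M p D \<longleftrightarrow>
     (\<forall>U f. \<not> (zopen M U \<and> p \<in> U \<and> f \<in> carrier (oring M U)) \<longrightarrow> D (U, f) = 0) \<and>
     (\<forall>U. zopen M U \<and> p \<in> U \<longrightarrow>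
        (\<forall>c. D (U, restrict (\<lambda>x. c) U) = 0) \<and>
        (\<forall>f\<in>carrier (oring M U).
           (\<forall>V. zopen M V \<and> p \<in> V \<and> V \<subseteq> U \<longrightarrow> D (V, restrict f V) = D (U, f)) \<and>
           (\<forall>g\<in>carrier (oring M U).
              D (U, f \<oplus>\<^bsub>oring M U\<^esub> g) = D (U, f) + D (U, g) \<and>
              D (U, f \<otimes>\<^bsub>oring M U\<^esub> g) = f p * D (U, g) + g p * D (U, f))))"

definition coord_frame ::
    "pt set \<Rightarrow> pt set \<Rightarrow> nat \<Rightarrow> (nat \<Rightarrow> pt \<Rightarrow> complex) \<Rightarrow>
     (nat \<Rightarrow> pt \<Rightarrow> pt set \<times> (pt \<Rightarrow> complex) \<Rightarrow> complex) \<Rightarrow> bool" where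
  "coord_frame M U d t e \<longleftrightarrow> zopen M U \<and> (\<forall>j<d. t j \<in> carrier (oring M U)) \<and>
     (\<forall>x\<in>U. basis_of {D. derivation_at M x D} d (\<lambda>i. e i x) \<and>
        (\<forall>i<d. \<forall>j<d. e i x (U, t j) = (if i = j then 1 else 0)))"

text \<open>
  The tangent bundle: its fibres are the Zariski tangent spaces, and its frames are the vector fields
  \<open>\<partial>/\<partial>t\<^sub>i\<close> for local coordinates \<open>t\<close>.
\<close>

definition tangent_bundle :: "pt set \<Rightarrow> (pt, pt set \<times> (pt \<Rightarrow> complex)) vb" where
  "tangent_bundle M = \<lparr>fib = (\<lambda>x. {D. derivation_at M x D}),
     frames = {(U, d, e). \<exists>t. coord_frame M U d t e}\<rparr>"

definition irreducible_variety :: "pt set \<Rightarrow> bool" where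
  "irreducible_variety C \<longleftrightarrow> variety C \<and> C \<noteq> {} \<and>
     (\<forall>A B. variety A \<and> variety B \<and> C \<subseteq> A \<union> B \<longrightarrow> C \<subseteq> A \<or> C \<subseteq> B)"

text \<open>The Krull dimension of the local ring of \<open>M\<close> at \<open>p\<close>.\<close>

definition local_dim :: "pt set \<Rightarrow> pt \<Rightarrow> nat" where
  "local_dim M p = Sup {k. \<exists>C. (\<forall>i\<le>k. irreducible_variety (C i) \<and> C i \<subseteq> M) \<and> p \<in> C 0 \<and>
     (\<forall>i<k. C i \<subset> C (Suc i))}"

definition smooth_variety :: "pt set \<Rightarrow> bool" where
  "smooth_variety M \<longleftrightarrow> variety M \<and>
     (\<forall>p\<in>M. \<exists>e. basis_of {D. derivation_at M p D} (local_dim M p) e)"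

text \<open>
  A small simplex around \<open>x\<close>, contained in a coordinate neighbourhood \<open>W\<close>. In the real coordinates
  \<open>Re t\<^sub>0, Im t\<^sub>0, Re t\<^sub>1, \<dots>\<close> it is affine with centre \<open>x\<close>, and the edges from its first vertex are
  positive multiples of \<open>(1, \<dots>, 1)\<close> plus the standard basis vectors, so it is positively oriented.
\<close>

definition positive_simplex :: "pt set \<Rightarrow> pt \<Rightarrow> nat \<Rightarrow> ((nat \<Rightarrow> real) \<Rightarrow> pt) \<Rightarrow> bool" where
  "positive_simplex M x d f \<longleftrightarrow> (\<exists>U t e W r. coord_frame M U d t e \<and> x \<in> W \<and> W \<subseteq> U \<and>
     openin (ctop M) W \<and> inj_on (\<lambda>y. map (\<lambda>j. t j y) [0..<d]) W \<and>
     singular_simplex (2 * d) (subtopology (ctop M) W) f \<and> r > 0 \<and>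
     (\<forall>y\<in>standard_simplex (2 * d). \<forall>j<d. t j (f y) =
        t j x + of_real r * Complex (y (2 * j + 1) - y 0) (y (2 * j + 2) - y 0)))"

definition fundamental_cycle :: "pt set \<Rightarrow> pt qchain \<Rightarrow> bool" where
  "fundamental_cycle M \<mu> \<longleftrightarrow> cycle (ctop M) \<mu> \<and>
     (\<forall>(p, f)\<in>Poly_Mapping.keys \<mu>. \<forall>y\<in>standard_simplex p. p = 2 * local_dim M (f y)) \<and>
     (\<forall>x\<in>M. \<exists>d f. positive_simplex M x d f \<and>
        homologous (ctop M) (M - {x}) \<mu> (Poly_Mapping.single (2 * d, f) 1))"

text \<open>
  Alexander-Lefschetz duality for \<open>j : Z \<rightarrow> M\<close>: the class of the cycle \<open>z\<close> in \<open>H\<^sub>*(Z)\<close> corresponds to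
  \<open>u\<close> in \<open>H\<^sup>*(M, M - j(Z))\<close> if in every neighbourhood \<open>W\<close> of \<open>j(Z)\<close> it agrees with the cap product of
  \<open>u\<close> and the fundamental class, the latter excised to \<open>H\<^sub>*(W, W - j(Z))\<close>. Since \<open>j(Z)\<close> is a
  neighbourhood retract this determines the class of \<open>z\<close>.
\<close>

definition alexander_dual ::
    "pt set \<Rightarrow> pt set \<Rightarrow> (pt \<Rightarrow> pt) \<Rightarrow> pt qcochain \<Rightarrow> pt qchain \<Rightarrow> bool" where
  "alexander_dual M Z j u z \<longleftrightarrow> cycle (ctop Z) z \<and> (\<exists>\<mu>. fundamental_cycle M \<mu> \<and>
     (\<forall>W. openin (ctop M) W \<and> j ` Z \<subseteq> W \<longrightarrow>
        (\<exists>c\<in>qchains (subtopology (ctop M) W). homologous (ctop M) (M - j ` Z) c \<mu> \<and>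
           homologous (subtopology (ctop M) W) {} (push_chain j z) (cap u c))))"


section \<open>The Baum-Fulton-MacPherson transformation and charges\<close>

definition E_even :: "pt set \<Rightarrow> (nat \<Rightarrow> (pt, nat) vb) \<Rightarrow> (pt, nat \<times> nat) vb" where
  "E_even M E = vb_sum (openin (ctop M)) (cont_fn (ctop M)) {i. even i} E"

definition E_odd :: "pt set \<Rightarrow> (nat \<Rightarrow> (pt, nat) vb) \<Rightarrow> (pt, nat \<times> nat) vb" where
  "E_odd M E = vb_sum (openin (ctop M)) (cont_fn (ctop M)) {i. odd i} E"

text \<open>
  Splittings of the resolution over \<open>A = M - Z\<close>, given by projections \<open>\<rho> i\<close> of \<open>E i\<close> onto the kernel of
  \<open>d i\<close>; the isomorphism \<open>E i \<simeq> ker (d i) \<oplus> ker (d (i - 1))\<close> sends \<open>e\<close> to \<open>(\<rho> i e, d i e)\<close>.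
\<close>

definition splittings ::
    "pt set \<Rightarrow> pt set \<Rightarrow> (nat \<Rightarrow> (pt, nat) vb) \<Rightarrow> (nat \<Rightarrow> pt \<Rightarrow> (nat \<Rightarrow> complex) \<Rightarrow> nat \<Rightarrow> complex) \<Rightarrow>
     (nat \<Rightarrow> pt \<Rightarrow> (nat \<Rightarrow> complex) \<Rightarrow> nat \<Rightarrow> complex) \<Rightarrow> bool" where
  "splittings M A E d \<rho> \<longleftrightarrow> (\<forall>i.
     vb_map (openin (ctop M)) (cont_fn (ctop M)) A (E i) (E i) (\<rho> i) \<and>
     (\<forall>x\<in>A. \<forall>v\<in>fib (E i) x. d i x (\<rho> i x v) = (\<lambda>k. 0) \<and> (d i x v = (\<lambda>k. 0) \<longrightarrow> \<rho> i x v = v)))"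

text \<open>
  The isomorphism \<open>\<beta>\<close> matches the summands \<open>ker (d i)\<close> of both sides.
\<close>

definition even_odd_iso ::
    "pt set \<Rightarrow> pt set \<Rightarrow> (nat \<Rightarrow> (pt, nat) vb) \<Rightarrow> (nat \<Rightarrow> pt \<Rightarrow> (nat \<Rightarrow> complex) \<Rightarrow> nat \<Rightarrow> complex) \<Rightarrow>
     (nat \<Rightarrow> pt \<Rightarrow> (nat \<Rightarrow> complex) \<Rightarrow> nat \<Rightarrow> complex) \<Rightarrow>
     (pt \<Rightarrow> (nat \<times> nat \<Rightarrow> complex) \<Rightarrow> nat \<times> nat \<Rightarrow> complex) \<Rightarrow> bool" where
  "even_odd_iso M A E d \<rho> \<beta> \<longleftrightarrow> (\<forall>x\<in>A. \<forall>v\<in>fib (E_even M E) x. \<beta> x v \<in> fib (E_odd M E) x \<and>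
     (\<forall>i. d (2 * i + 1) x (component (2 * i + 1) (\<beta> x v)) = \<rho> (2 * i) x (component (2 * i) v) \<and>
          \<rho> (2 * i + 1) x (component (2 * i + 1) (\<beta> x v)) = d (2 * i + 2) x (component (2 * i + 2) v)))"

text \<open>The choices entering the construction of \<open>\<tau>\<close> of a sheaf \<open>F\<close> on \<open>Z\<close>.\<close>

definition BFM_data where
  "BFM_data Z F M j E d \<epsilon> \<rho> \<beta> \<longleftrightarrow> smooth_variety M \<and> closed_embedding Z M j \<and>
     resolution M E d \<epsilon> (direct_image Z j F) \<and>
     splittings M (M - j ` Z) E d \<rho> \<and> even_odd_iso M (M - j ` Z) E d \<rho> \<beta>"

text \<open>\<open>z\<close> represents the localized Chern character of the complex \<open>E\<close>.\<close>

definition localized_ch ::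
    "pt set \<Rightarrow> pt set \<Rightarrow> (pt \<Rightarrow> pt) \<Rightarrow> (nat \<Rightarrow> (pt, nat) vb) \<Rightarrow>
     (pt \<Rightarrow> (nat \<times> nat \<Rightarrow> complex) \<Rightarrow> nat \<times> nat \<Rightarrow> complex) \<Rightarrow> pt qchain \<Rightarrow> bool" where
  "localized_ch M Z j E \<beta> z \<longleftrightarrow> (\<exists>u. is_ch_rel (ctop M) (M - j ` Z)
      (difference_bundle (ctop M) (M - j ` Z) (E_even M E) (E_odd M E) \<beta>) u \<and>
      alexander_dual M Z j u z)"

definition BFM_value where
  "BFM_value M Z j E \<beta> q \<longleftrightarrow> (\<exists>a z. is_td (ctop M) (tangent_bundle M) a \<and>
      localized_ch M Z j E \<beta> z \<and> q = hom_class (ctop Z) (cap (pull_cochain j a) z))"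

text \<open>
  The transformation \<open>\<tau> : K\<^sub>0 Z \<rightarrow> H\<^sub>*(Z; \<rat>)\<close> is additive, and for a coherent sheaf choices
  exist and each of them yields exactly one class, namely the value of \<open>\<tau>\<close>.
\<close>

definition BFM_transformation ::
    "(pt set \<Rightarrow> ('a modsheaf \<Rightarrow>\<^sub>0 int) set \<Rightarrow> pt qchain set) \<Rightarrow> bool" where
  "BFM_transformation \<tau> \<longleftrightarrow> (\<forall>Z. variety Z \<longrightarrow>
     (\<forall>\<kappa>\<in>K0 Z. \<tau> Z \<kappa> \<in> homology (ctop Z) \<and>
        (\<forall>\<kappa>'\<in>K0 Z. \<tau> Z (coset_add \<kappa> \<kappa>') = coset_add (\<tau> Z \<kappa>) (\<tau> Z \<kappa>'))) \<and>
     (\<forall>F. coherent Z F \<longrightarrow>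
        (\<exists>M j E d \<epsilon> \<rho> \<beta>. BFM_data Z F M j E d \<epsilon> \<rho> \<beta>) \<and>
        (\<forall>M j E d \<epsilon> \<rho> \<beta>. BFM_data Z F M j E d \<epsilon> \<rho> \<beta> \<longrightarrow>
           (\<forall>q. BFM_value M Z j E \<beta> q \<longleftrightarrow> q = \<tau> Z (K0_class Z (frag_of F))))))"

definition charge ::
    "(pt set \<Rightarrow> ('a modsheaf \<Rightarrow>\<^sub>0 int) set \<Rightarrow> pt qchain set) \<Rightarrow> pt set \<Rightarrow> 'a sheaf_complex \<Rightarrow> pt qchain set"
  where
  "charge \<tau> Z G = \<tau> Z (brane_class Z G)"

end

theory Submission
  imports Defs "HOL-Library.Function_Algebras"
begin

text \<open>
  Embed \<open>X\<close> into a smooth \<open>M\<close> by \<open>j\<close> and resolve the direct image of the sheaf on \<open>M\<close>. Extending by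
  zero from \<open>Y\<close> to \<open>X\<close> and then to \<open>M\<close> is the same as extending from \<open>Y\<close> to \<open>M\<close>, so one complex \<open>E\<close>
  computes both charges. It is exact over \<open>M - j(Y)\<close>, which contains \<open>M - j(X)\<close>; there it splits
  locally in the Zariski topology, and a partition of unity yields continuous splittings and an
  isomorphism \<open>\<beta>\<close> over all of \<open>M - j(Y)\<close>. As the choices do not matter, \<open>\<beta>\<close> may be used for \<open>Y\<close> and
  its restriction for \<open>X\<close>. The difference bundle of \<open>X\<close> is then the restriction of that of \<open>Y\<close>, and
  the same cocycle \<open>u\<close> represents both relative Chern characters. Cap products of \<open>u\<close> with the
  fundamental cycle excised to a neighbourhood of \<open>j(X)\<close> or of \<open>j(Y)\<close> are homologous because \<open>u\<close>
  vanishes off \<open>j(Y)\<close>, so a cycle on \<open>Y\<close> dual to \<open>u\<close> is dual to \<open>u\<close> on \<open>X\<close> as well.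
\<close>

section \<open>Zariski topology and regular functions\<close>

text \<open>The transformation is specified on coherent sheaves only, so nothing is known about
  \<open>\<tau>\<close> on \<open>X\<close> before the extension by zero is shown to be coherent.
  Its relations include all functions vanishing on \<open>Y\<close>; their finite generation is the
  reason for Hilbert's basis theorem, which also makes the covers behind the partitions of unity
  finite. Data for \<open>X\<close> carry an isomorphism over the complement of j(X), and nothing
  lets it extend to the larger complement of j(Y). Only the embedding and the resolution are kept;
  the splittings are built anew over the larger set. No Chern or Todd class and no dual cycle is
  ever constructed. By specification the value of \<open>\<tau>\<close> on \<open>Y\<close> is one
  of the values of the recipe, and its witnesses \<open>a\<close>, \<open>u\<close> and
  \<open>z\<close> are carried over to \<open>X\<close>. This direction is the easy one: cochains
  and bundles restrict to smaller sets, and chains on \<open>Y\<close> are chains on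
  \<open>X\<close>. The price is that bundles, frames and \<open>K_class\<close> must restrict in
  the exact form in which the definitions mention them.\<close>

definition proj_points :: "pt set" where
  "proj_points = pline ` coord_vecs"

lemma hpoly_scale:
  assumes "hpoly d f"
  shows "f (\<lambda>i. c * v i) = c ^ d * f v"
  using assms by induction (auto simp: algebra_simps power_add)

lemma proj_pointsE:
  assumes "p \<in> proj_points"
  obtains v where "v \<in> coord_vecs" "p = pline v" "v \<in> p"
  using assms unfolding proj_points_def pline_def
  by (auto, metis (mono_tags, lifting) mem_Collect_eq mult_1 zero_neq_one)

lemma proj_points_scale:
  assumes "p \<in> proj_points" "v \<in> p" "w \<in> p"
  shows "\<exists>c. c \<noteq> 0 \<and> w = (\<lambda>i. c * v i)"
proof -
  obtain u a b where "a \<noteq> 0" "b \<noteq> 0" "v = (\<lambda>i. a * u i)" "w = (\<lambda>i. b * u i)"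
    using assms unfolding proj_points_def pline_def by auto
  then show ?thesis
    by (intro exI[of _ "b / a"]) auto
qed

lemma proj_points_mem_coord_vecs:
  assumes "p \<in> proj_points" "v \<in> p"
  shows "v \<in> coord_vecs" and "pline v = p"
proof -
  obtain u a where u: "u \<in> coord_vecs" "p = pline u" "a \<noteq> 0" "v = (\<lambda>i. a * u i)"
    using assms unfolding proj_points_def pline_def by auto
  then show "v \<in> coord_vecs"
    unfolding coord_vecs_def by auto
  show "pline v = p"
  proof
    show "pline v \<subseteq> p"
      using u unfolding pline_def by (auto simp: mult.assoc[symmetric])
    show "p \<subseteq> pline v"
    proof
      fix w assume "w \<in> p"
      with u obtain c where "c \<noteq> 0" "w = (\<lambda>i. c * u i)"
        unfolding pline_def by auto
      then show "w \<in> pline v"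
        unfolding pline_def using u by (intro CollectI exI[of _ "c / a"]) auto
    qed
  qed
qed

lemma mem_pline: "v \<in> pline v"
  unfolding pline_def by (rule CollectI, rule exI[of _ 1]) auto

lemma proj_space_subset_points: "proj_space n \<subseteq> proj_points"
  unfolding proj_space_def proj_points_def by auto

lemma proj_space_mono: "m \<le> n \<Longrightarrow> proj_space m \<subseteq> proj_space n"
  unfolding proj_space_def by (intro image_mono) auto

lemma mem_proj_space_iff:
  assumes "p \<in> proj_points" "v \<in> p"
  shows "p \<in> proj_space n \<longleftrightarrow> (\<forall>i>n. v i = 0)"
proof
  assume "p \<in> proj_space n"
  then obtain u where "p = pline u" "\<forall>i>n. u i = 0"
    unfolding proj_space_def by auto
  with \<open>v \<in> p\<close> show "\<forall>i>n. v i = 0"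
    unfolding pline_def by auto
next
  assume "\<forall>i>n. v i = 0"
  with proj_points_mem_coord_vecs[OF assms] show "p \<in> proj_space n"
    unfolding proj_space_def by (auto intro!: image_eqI[of _ _ v])
qed

lemma hpoly_zero_iff:
  assumes "p \<in> proj_points" "v \<in> p" "w \<in> p" "hpoly d f"
  shows "f v = 0 \<longleftrightarrow> f w = 0"
  using proj_points_scale[OF assms(1-3)] hpoly_scale[OF assms(4)] by auto

lemma hpoly_quotient_eq:
  assumes "p \<in> proj_points" "v \<in> p" "w \<in> p" "hpoly d f" "hpoly d g"
  shows "f v / g v = f w / g w"
  using proj_points_scale[OF assms(1-3)] hpoly_scale[OF assms(4)] hpoly_scale[OF assms(5)] by auto

section \<open>Zero loci, their intersections and unions\<close>

lemma variety_subset_proj_space: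
  assumes "variety Z"
  obtains n where "Z \<subseteq> proj_space n"
  using assms unfolding variety_def by auto

lemma variety_subset_points: "variety Z \<Longrightarrow> Z \<subseteq> proj_points"
  using proj_space_subset_points by (meson order_trans variety_subset_proj_space)

text \<open>The empty zero locus of a family is all of \<open>proj_points\<close>, so only the bound by some
  \<open>proj_space n\<close> distinguishes a variety from an arbitrary zero locus.\<close>

lemma variety_iff_zero_locus:
  "variety Z \<longleftrightarrow> (\<exists>n. Z \<subseteq> proj_space n) \<and>
     (\<exists>P. (\<forall>f\<in>P. \<exists>d. hpoly d f) \<and> Z = {p \<in> proj_points. \<forall>f\<in>P. \<forall>v\<in>p. f v = 0})"
proof
  assume "variety Z"
  then obtain n P where P: "\<forall>f\<in>P. \<exists>d. hpoly d f"
      "Z = {p \<in> proj_space n. \<forall>f\<in>P. \<forall>v\<in>p. f v = 0}"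
    unfolding variety_def by blast
  \<comment> \<open>The coordinates beyond \<open>n\<close> cut out \<open>proj_space n\<close>
    among all points.\<close>
  let ?Q = "P \<union> (\<lambda>i v. v i) ` {n<..}"
  have Zeq: "Z = {p \<in> proj_points. \<forall>f\<in>?Q. \<forall>v\<in>p. f v = 0}"
  proof (intro Set.set_eqI)
    fix p
    show "p \<in> Z \<longleftrightarrow> p \<in> {p \<in> proj_points. \<forall>f\<in>?Q. \<forall>v\<in>p. f v = 0}"
    proof (cases "p \<in> proj_points")
      case True
      then obtain v where "v \<in> p" by (elim proj_pointsE)
      then have "p \<in> proj_space n \<longleftrightarrow> (\<forall>i>n. \<forall>v\<in>p. v i = 0)"
        using True mem_proj_space_iff by blast
      then show ?thesis
        using True P(2) by auto
    next
      case False
      then have "p \<notin> Z" using P(2) proj_space_subset_points[of n] by blast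
      then show ?thesis using False by simp
    qed
  qed
  have "\<forall>f\<in>?Q. \<exists>d. hpoly d f"
    using P(1) hpoly.coord by blast
  with Zeq P(2) show "(\<exists>n. Z \<subseteq> proj_space n) \<and>
     (\<exists>P. (\<forall>f\<in>P. \<exists>d. hpoly d f) \<and> Z = {p \<in> proj_points. \<forall>f\<in>P. \<forall>v\<in>p. f v = 0})"
    by blast
next
  assume "(\<exists>n. Z \<subseteq> proj_space n) \<and>
     (\<exists>P. (\<forall>f\<in>P. \<exists>d. hpoly d f) \<and> Z = {p \<in> proj_points. \<forall>f\<in>P. \<forall>v\<in>p. f v = 0})"
  then obtain n P where "Z \<subseteq> proj_space n" "\<forall>f\<in>P. \<exists>d. hpoly d f"
      "Z = {p \<in> proj_points. \<forall>f\<in>P. \<forall>v\<in>p. f v = 0}"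
    by blast
  moreover from this have "Z = {p \<in> proj_space n. \<forall>f\<in>P. \<forall>v\<in>p. f v = 0}"
    using proj_space_subset_points by blast
  ultimately show "variety Z"
    unfolding variety_def by blast
qed

lemma variety_zero_locusE:
  assumes "variety Z"
  obtains P where "\<forall>f\<in>P. \<exists>d. hpoly d f" "Z = {p \<in> proj_points. \<forall>f\<in>P. \<forall>v\<in>p. f v = 0}"
  using conjunct2[OF iffD1[OF variety_iff_zero_locus assms]] by (elim exE conjE)

lemma varietyI:
  assumes "Z \<subseteq> proj_space n" "\<And>f. f \<in> P \<Longrightarrow> \<exists>d. hpoly d f"
    "Z = {p \<in> proj_points. \<forall>f\<in>P. \<forall>v\<in>p. f v = 0}"
  shows "variety Z"
  by (rule iffD2[OF variety_iff_zero_locus], rule conjI, rule exI[of _ n], rule assms(1),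
      rule exI[of _ P], rule conjI, rule ballI, erule assms(2), rule assms(3))

text \<open>The equations of all members are collected. Any single member bounds the ambient
  projective space, which is what nonemptiness is for.\<close>

lemma variety_Inter:
  assumes "\<And>Z. Z \<in> \<Z> \<Longrightarrow> variety Z" "\<Z> \<noteq> {}"
  shows "variety (\<Inter>\<Z>)"
proof -
  have "\<forall>Z\<in>\<Z>. \<exists>P. (\<forall>f\<in>P. \<exists>d. hpoly d f) \<and> Z = {p \<in> proj_points. \<forall>f\<in>P. \<forall>v\<in>p. f v = 0}"
  proof
    fix Z assume "Z \<in> \<Z>"
    with assms(1) have "variety Z" by blast
    then show "\<exists>P. (\<forall>f\<in>P. \<exists>d. hpoly d f) \<and> Z = {p \<in> proj_points. \<forall>f\<in>P. \<forall>v\<in>p. f v = 0}"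
      by (rule variety_zero_locusE) (intro exI conjI)
  qed
  then obtain P where P: "\<forall>Z\<in>\<Z>. (\<forall>f\<in>P Z. \<exists>d. hpoly d f) \<and>
      Z = {p \<in> proj_points. \<forall>f\<in>P Z. \<forall>v\<in>p. f v = 0}"
    by (rule bchoice[THEN exE])
  then have P1: "\<exists>d. hpoly d f" if "Z \<in> \<Z>" "f \<in> P Z" for Z f
    using that by blast
  have P2: "p \<in> Z \<longleftrightarrow> p \<in> proj_points \<and> (\<forall>f\<in>P Z. \<forall>v\<in>p. f v = 0)" if "Z \<in> \<Z>" for Z p
    by (subst P[THEN bspec, OF that, THEN conjunct2]) (rule mem_Collect_eq)
  obtain Z0 where "Z0 \<in> \<Z>" using assms(2) by blast
  then obtain n where "Z0 \<subseteq> proj_space n"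
    using assms(1) by (metis variety_subset_proj_space)
  show ?thesis
  proof (rule varietyI)
    show "\<Inter>\<Z> \<subseteq> proj_space n"
      using \<open>Z0 \<in> \<Z>\<close> \<open>Z0 \<subseteq> proj_space n\<close> by blast
    show "\<exists>d. hpoly d f" if "f \<in> \<Union>(P ` \<Z>)" for f
      using that P1 by blast
    show "\<Inter>\<Z> = {p \<in> proj_points. \<forall>f\<in>\<Union>(P ` \<Z>). \<forall>v\<in>p. f v = 0}"
      using P2 \<open>Z0 \<in> \<Z>\<close> by auto
  qed
qed

lemma variety_Int: "variety Z \<Longrightarrow> variety W \<Longrightarrow> variety (Z \<inter> W)"
  using variety_Inter[of "{Z, W}"] by auto

lemma variety_Un:
  assumes "variety Z" "variety W"
  shows "variety (Z \<union> W)"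
proof -
  obtain P where P: "\<forall>f\<in>P. \<exists>d. hpoly d f" "Z = {p \<in> proj_points. \<forall>f\<in>P. \<forall>v\<in>p. f v = 0}"
    using assms(1) by (rule variety_zero_locusE)
  obtain Q where Q: "\<forall>f\<in>Q. \<exists>d. hpoly d f" "W = {p \<in> proj_points. \<forall>f\<in>Q. \<forall>v\<in>p. f v = 0}"
    using assms(2) by (rule variety_zero_locusE)
  obtain m n where "Z \<subseteq> proj_space m" "W \<subseteq> proj_space n"
    using assms by (metis variety_subset_proj_space)
  then have "Z \<union> W \<subseteq> proj_space (max m n)"
    using proj_space_mono[of m "max m n"] proj_space_mono[of n "max m n"] by auto
  moreover have "\<exists>d. hpoly d h" if "h \<in> {\<lambda>v. f v * g v |f g. f \<in> P \<and> g \<in> Q}" for h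
    using that P(1) Q(1) hpoly.mult by blast
  moreover have "Z \<union> W = {p \<in> proj_points. \<forall>h\<in>{\<lambda>v. f v * g v |f g. f \<in> P \<and> g \<in> Q}. \<forall>v\<in>p. h v = 0}"
  proof (intro Set.set_eqI iffI)
    fix p assume "p \<in> Z \<union> W"
    then show "p \<in> {p \<in> proj_points. \<forall>h\<in>{\<lambda>v. f v * g v |f g. f \<in> P \<and> g \<in> Q}. \<forall>v\<in>p. h v = 0}"
      using P(2) Q(2) by auto
  next
    fix p assume p: "p \<in> {p \<in> proj_points. \<forall>h\<in>{\<lambda>v. f v * g v |f g. f \<in> P \<and> g \<in> Q}. \<forall>v\<in>p. h v = 0}"
    show "p \<in> Z \<union> W"
    proof (rule ccontr)
      assume "p \<notin> Z \<union> W"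
      with p P(2) Q(2) obtain f v g w where "f \<in> P" "v \<in> p" "f v \<noteq> 0" "g \<in> Q" "w \<in> p" "g w \<noteq> 0"
        by auto
      \<comment> \<open>The two nonzero values are taken at different representatives of
        \<open>p\<close>; homogeneity moves the second one to \<open>v\<close>.\<close>
      moreover from this have "g v \<noteq> 0"
        using p Q(1) hpoly_zero_iff[of p v w _ g] by auto
      ultimately show False using p by (fastforce dest: spec[of _ "\<lambda>v. f v * g v"])
    qed
  qed
  ultimately show ?thesis
    by (rule varietyI)
qed

section \<open>Zariski open sets\<close>

lemma zopen_subset: "zopen Z U \<Longrightarrow> U \<subseteq> Z"
  by (simp add: zopen_def)

lemma zopen_Int:
  assumes "zopen Z U" "zopen Z V"
  shows "zopen Z (U \<inter> V)"
proof -
  have "Z - U \<inter> V = (Z - U) \<union> (Z - V)" by blast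
  then show ?thesis
    using assms variety_Un unfolding zopen_def by auto
qed

lemma zopen_empty: "variety Z \<Longrightarrow> zopen Z {}"
  by (simp add: zopen_def)

lemma zopen_Union:
  assumes "variety Z" "\<And>U. U \<in> \<U> \<Longrightarrow> zopen Z U"
  shows "zopen Z (\<Union>\<U>)"
proof (cases "\<U> = {}")
  case False
  then have "Z - \<Union>\<U> = \<Inter>((\<lambda>U. Z - U) ` \<U>)" by blast
  moreover have "variety (\<Inter>((\<lambda>U. Z - U) ` \<U>))"
    using False assms by (intro variety_Inter) (auto simp: zopen_def)
  ultimately show ?thesis
    using assms by (auto simp: zopen_def)
qed (use assms zopen_empty in auto)

lemma zopen_local:
  assumes "variety Z" "\<And>x. x \<in> U \<Longrightarrow> \<exists>V. zopen Z V \<and> x \<in> V \<and> V \<subseteq> U"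
  shows "zopen Z U"
proof -
  have "U = \<Union>{V. zopen Z V \<and> V \<subseteq> U}" using assms(2) by blast
  then show ?thesis using zopen_Union[OF assms(1)] by (metis (mono_tags, lifting) mem_Collect_eq)
qed

lemma zopen_restrict:
  assumes "variety Y" "Y \<subseteq> X" "zopen X U"
  shows "zopen Y (U \<inter> Y)"
proof -
  have "Y - U \<inter> Y = Y \<inter> (X - U)" using assms by blast
  then show ?thesis
    using assms variety_Int unfolding zopen_def by auto
qed

lemma zopen_diff: "variety Y \<Longrightarrow> Y \<subseteq> X \<Longrightarrow> zopen X (X - Y)"
  by (simp add: zopen_def double_diff)

lemma zopen_nonvanishing:
  assumes "variety Z" "hpoly d h"
  shows "zopen Z {p \<in> Z. \<forall>v\<in>p. h v \<noteq> 0}"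
proof -
  obtain P where P: "\<forall>f\<in>P. \<exists>d. hpoly d f" "Z = {p \<in> proj_points. \<forall>f\<in>P. \<forall>v\<in>p. f v = 0}"
    using assms(1) by (rule variety_zero_locusE)
  have *: "Z - {p \<in> Z. \<forall>v\<in>p. h v \<noteq> 0} = {p \<in> Z. \<forall>v\<in>p. h v = 0}"
  proof (intro Set.set_eqI)
    fix p
    have "(\<exists>v\<in>p. h v = 0) \<longleftrightarrow> (\<forall>v\<in>p. h v = 0)" if "p \<in> Z"
      using that variety_subset_points[OF assms(1)] hpoly_zero_iff[OF _ _ _ assms(2)]
      by (metis proj_pointsE subsetD)
    then show "p \<in> Z - {p \<in> Z. \<forall>v\<in>p. h v \<noteq> 0} \<longleftrightarrow> p \<in> {p \<in> Z. \<forall>v\<in>p. h v = 0}"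
      by auto
  qed
  have hP: "\<exists>d. hpoly d f" if "f \<in> insert h P" for f using that P(1) assms by auto
  moreover have "{p \<in> Z. \<forall>v\<in>p. h v = 0} = {p \<in> proj_points. \<forall>f\<in>insert h P. \<forall>v\<in>p. f v = 0}"
    using P(2) by auto
  moreover obtain n where "Z \<subseteq> proj_space n"
    using assms(1) by (rule variety_subset_proj_space)
  ultimately have "variety {p \<in> Z. \<forall>v\<in>p. h v = 0}"
    by (intro varietyI[of _ n "insert h P"]) auto
  with * show ?thesis by (simp add: zopen_def)
qed

text \<open>Principal open sets form a basis: one equation of the complement that is nonzero at
  \<open>x\<close> already separates \<open>x\<close> from it.\<close>

lemma zopen_principal_neighbourhood:
  assumes "zopen Z U" "x \<in> U" "x \<in> proj_points"
  obtains d h where "hpoly d h" "\<forall>p\<in>Z - U. \<forall>v\<in>p. h v = 0" "\<forall>v\<in>x. h v \<noteq> 0"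
proof -
  obtain P where P: "\<forall>f\<in>P. \<exists>d. hpoly d f" "Z - U = {p \<in> proj_points. \<forall>f\<in>P. \<forall>v\<in>p. f v = 0}"
    using assms(1) unfolding zopen_def by (elim conjE variety_zero_locusE)
  have "x \<notin> Z - U" using assms by auto
  with assms P(2) obtain f v where f: "f \<in> P" "v \<in> x" "f v \<noteq> 0" by auto
  then obtain d where d: "hpoly d f" using P by blast
  show thesis
  proof
    show "hpoly d f" by fact
    show "\<forall>p\<in>Z - U. \<forall>v\<in>p. f v = 0"
      using P(2) f(1) by simp
    show "\<forall>w\<in>x. f w \<noteq> 0"
      using hpoly_zero_iff[OF assms(3) _ f(2) d] f(3) by blast
  qed
qed

text \<open>The setting shared by algebraic and topological vector bundles.\<close>

locale fun_space =
  fixes opn :: "'b set \<Rightarrow> bool" and fn :: "'b set \<Rightarrow> ('b \<Rightarrow> complex) \<Rightarrow> bool"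
  assumes opn_Int: "opn U \<Longrightarrow> opn V \<Longrightarrow> opn (U \<inter> V)"
    and fn_mono: "fn U f \<Longrightarrow> opn V \<Longrightarrow> V \<subseteq> U \<Longrightarrow> fn V f"
    and fn_local: "(\<And>x. x \<in> U \<Longrightarrow> \<exists>V. opn V \<and> x \<in> V \<and> V \<subseteq> U \<and> fn V f) \<Longrightarrow> opn U \<Longrightarrow> fn U f"
    and fn_cong: "fn U f \<Longrightarrow> (\<And>x. x \<in> U \<Longrightarrow> f x = g x) \<Longrightarrow> fn U g"
    and fn_const: "opn U \<Longrightarrow> fn U (\<lambda>x. c)"
    and fn_add: "fn U f \<Longrightarrow> fn U g \<Longrightarrow> opn U \<Longrightarrow> fn U (\<lambda>x. f x + g x)"
    and fn_mult: "fn U f \<Longrightarrow> fn U g \<Longrightarrow> opn U \<Longrightarrow> fn U (\<lambda>x. f x * g x)"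
    and fn_inverse: "fn U f \<Longrightarrow> (\<And>x. x \<in> U \<Longrightarrow> f x \<noteq> 0) \<Longrightarrow> opn U \<Longrightarrow> fn U (\<lambda>x. inverse (f x))"
    and opn_nonzero: "fn U f \<Longrightarrow> opn U \<Longrightarrow> opn {x \<in> U. f x \<noteq> 0}"
begin

lemma fn_uminus: "fn U f \<Longrightarrow> opn U \<Longrightarrow> fn U (\<lambda>x. - f x)"
  using fn_mult[OF fn_const[of U "-1"], of f] by simp

lemma fn_diff: "fn U f \<Longrightarrow> fn U g \<Longrightarrow> opn U \<Longrightarrow> fn U (\<lambda>x. f x - g x)"
  using fn_add[OF _ fn_uminus, of U f g] by simp

lemma fn_sum:
  assumes "opn U" "\<And>i. i \<in> I \<Longrightarrow> fn U (f i)"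
  shows "fn U (\<lambda>x. \<Sum>i\<in>I. f i x)"
  using assms(2)
  by (induction I rule: infinite_finite_induct) (auto simp: fn_const fn_add assms(1))

lemma fn_divide:
  "fn U f \<Longrightarrow> fn U g \<Longrightarrow> (\<And>x. x \<in> U \<Longrightarrow> g x \<noteq> 0) \<Longrightarrow> opn U \<Longrightarrow> fn U (\<lambda>x. f x / g x)"
  by (simp add: divide_inverse fn_inverse fn_mult)

end

section \<open>Regular functions\<close>

lemma regular_onE:
  assumes "regular_on Z U f" "x \<in> U"
  obtains V d g h where "zopen Z V" "x \<in> V" "V \<subseteq> U" "hpoly d g" "hpoly d h"
    "\<forall>y\<in>V. \<forall>v\<in>y. h v \<noteq> 0 \<and> f y = g v / h v"
  using assms(1)[unfolded regular_on_def, THEN bspec, OF assms(2)] by (elim exE conjE)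

lemma regular_onI:
  assumes "\<And>x. x \<in> U \<Longrightarrow> \<exists>V d g h. zopen Z V \<and> x \<in> V \<and> V \<subseteq> U \<and> hpoly d g \<and> hpoly d h \<and>
      (\<forall>y\<in>V. \<forall>v\<in>y. h v \<noteq> 0 \<and> f y = g v / h v)"
  shows "regular_on Z U f"
  unfolding regular_on_def by (rule ballI) (rule assms)

lemma regular_onI_local:
  assumes "\<And>x. x \<in> U \<Longrightarrow> \<exists>V. zopen Z V \<and> x \<in> V \<and> V \<subseteq> U \<and> regular_on Z V f"
  shows "regular_on Z U f"
proof (rule regular_onI)
  fix x assume "x \<in> U"
  then obtain V where V: "x \<in> V" "V \<subseteq> U" "regular_on Z V f"
    using assms by blast
  obtain W d g h where W: "zopen Z W" "x \<in> W" "W \<subseteq> V" "hpoly d g" "hpoly d h"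
      "\<forall>y\<in>W. \<forall>v\<in>y. h v \<noteq> 0 \<and> f y = g v / h v"
    by (rule regular_onE[OF V(3,1)])
  then have "W \<subseteq> U" using V by blast
  with W show "\<exists>V d g h. zopen Z V \<and> x \<in> V \<and> V \<subseteq> U \<and> hpoly d g \<and> hpoly d h \<and>
      (\<forall>y\<in>V. \<forall>v\<in>y. h v \<noteq> 0 \<and> f y = g v / h v)"
    by blast
qed

lemma regular_on_mono:
  assumes "regular_on Z U f" "zopen Z V" "V \<subseteq> U"
  shows "regular_on Z V f"
proof (rule regular_onI)
  fix x assume "x \<in> V"
  then have "x \<in> U" using assms(3) by blast
  obtain W d g h where W: "zopen Z W" "x \<in> W" "W \<subseteq> U" "hpoly d g" "hpoly d h"
      "\<forall>y\<in>W. \<forall>v\<in>y. h v \<noteq> 0 \<and> f y = g v / h v"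
    by (rule regular_onE[OF assms(1) \<open>x \<in> U\<close>])
  show "\<exists>V' d g h. zopen Z V' \<and> x \<in> V' \<and> V' \<subseteq> V \<and> hpoly d g \<and> hpoly d h \<and>
      (\<forall>y\<in>V'. \<forall>v\<in>y. h v \<noteq> 0 \<and> f y = g v / h v)"
    by (intro exI[of _ "W \<inter> V"] exI[of _ d] exI[of _ g] exI[of _ h])
      (use \<open>x \<in> V\<close> zopen_Int[OF W(1) assms(2)] W in auto)
qed

lemma regular_on_cong:
  assumes "regular_on Z U f" "\<And>x. x \<in> U \<Longrightarrow> f x = g x"
  shows "regular_on Z U g"
proof (rule regular_onI)
  fix x assume x: "x \<in> U"
  obtain W d a h where W: "zopen Z W" "x \<in> W" "W \<subseteq> U" "hpoly d a" "hpoly d h"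
      "\<forall>y\<in>W. \<forall>v\<in>y. h v \<noteq> 0 \<and> f y = a v / h v"
    by (rule regular_onE[OF assms(1) x])
  moreover from this have "\<forall>y\<in>W. \<forall>v\<in>y. h v \<noteq> 0 \<and> g y = a v / h v"
    using assms(2) by (metis subsetD)
  ultimately show "\<exists>V d a h. zopen Z V \<and> x \<in> V \<and> V \<subseteq> U \<and> hpoly d a \<and> hpoly d h \<and>
      (\<forall>y\<in>V. \<forall>v\<in>y. h v \<noteq> 0 \<and> g y = a v / h v)"
    by blast
qed

lemma regular_on_quotient:
  assumes "variety Z" "zopen Z U" "hpoly d g" "hpoly d h"
    and "\<And>y v. y \<in> U \<Longrightarrow> v \<in> y \<Longrightarrow> h v \<noteq> 0 \<and> f y = g v / h v"
  shows "regular_on Z U f"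
  by (rule regular_onI, rule exI[of _ U], rule exI[of _ d], rule exI[of _ g], rule exI[of _ h])
    (use assms in auto)

text \<open>Sum and product share this proof. Over the common denominator, \<open>G\<close> is the
  numerator of the combined quotient; numerator and denominator then both have degree
  \<open>d + d'\<close>.\<close>

lemma regular_on_binop:
  assumes "regular_on Z U f" "regular_on Z U f'"
    and "\<And>d g h d' g' h'. hpoly d g \<Longrightarrow> hpoly d h \<Longrightarrow> hpoly d' g' \<Longrightarrow> hpoly d' h' \<Longrightarrow>
       hpoly (d + d') (\<lambda>v. G (g v) (h v) (g' v) (h' v))"
    and "\<And>a b c d. b \<noteq> 0 \<Longrightarrow> d \<noteq> 0 \<Longrightarrow> F (a / b) (c / d) = G a b c d / (b * d)"
  shows "regular_on Z U (\<lambda>x. F (f x) (f' x))"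
proof (rule regular_onI)
  fix x assume x: "x \<in> U"
  obtain W d g h where W: "zopen Z W" "x \<in> W" "W \<subseteq> U" "hpoly d g" "hpoly d h"
      "\<forall>y\<in>W. \<forall>v\<in>y. h v \<noteq> 0 \<and> f y = g v / h v"
    by (rule regular_onE[OF assms(1) x])
  obtain W' d' g' h' where W': "zopen Z W'" "x \<in> W'" "W' \<subseteq> U" "hpoly d' g'" "hpoly d' h'"
      "\<forall>y\<in>W'. \<forall>v\<in>y. h' v \<noteq> 0 \<and> f' y = g' v / h' v"
    by (rule regular_onE[OF assms(2) x])
  show "\<exists>V d g h. zopen Z V \<and> x \<in> V \<and> V \<subseteq> U \<and> hpoly d g \<and> hpoly d h \<and>
      (\<forall>y\<in>V. \<forall>v\<in>y. h v \<noteq> 0 \<and> F (f y) (f' y) = g v / h v)"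
  proof (intro exI conjI)
    show "zopen Z (W \<inter> W')" using W W' zopen_Int by blast
    show "hpoly (d + d') (\<lambda>v. G (g v) (h v) (g' v) (h' v))"
      using assms(3) W W' by blast
    show "hpoly (d + d') (\<lambda>v. h v * h' v)"
      using W W' hpoly.mult by blast
    show "\<forall>y\<in>W \<inter> W'. \<forall>v\<in>y. h v * h' v \<noteq> 0 \<and>
        F (f y) (f' y) = G (g v) (h v) (g' v) (h' v) / (h v * h' v)"
      using W(6) W'(6) by (metis IntD1 IntD2 assms(4) mult_eq_0_iff)
  qed (use W W' in auto)
qed

lemma regular_on_add:
  assumes "regular_on Z U f" "regular_on Z U f'"
  shows "regular_on Z U (\<lambda>x. f x + f' x)"
  by (rule regular_on_binop[OF assms, where G = "\<lambda>a b c d. a * d + b * c"])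
    (auto simp: field_simps intro: hpoly.intros)

lemma regular_on_mult:
  assumes "regular_on Z U f" "regular_on Z U f'"
  shows "regular_on Z U (\<lambda>x. f x * f' x)"
  by (rule regular_on_binop[OF assms, where G = "\<lambda>a b c d. a * c"]) (auto intro: hpoly.intros)

lemma regular_on_const:
  assumes "zopen Z U"
  shows "regular_on Z U (\<lambda>x. c)"
proof (rule regular_onI)
  fix x assume "x \<in> U"
  then show "\<exists>V d g h. zopen Z V \<and> x \<in> V \<and> V \<subseteq> U \<and> hpoly d g \<and> hpoly d h \<and>
      (\<forall>y\<in>V. \<forall>v\<in>y. h v \<noteq> 0 \<and> c = g v / h v)"
    using assms hpoly.const
    by (intro exI[of _ U] exI[of _ 0] exI[of _ "\<lambda>v. c"] exI[of _ "\<lambda>v. 1"]) auto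
qed

text \<open>Where \<open>f\<close> is \<open>g / h\<close>, its zeros are those of \<open>g\<close>,
  so the principal open set of \<open>g\<close> carries the inverse \<open>h / g\<close>.\<close>

lemma regular_on_nonzero_neighbourhood:
  assumes "variety Z" "regular_on Z U f" "x \<in> U" "f x \<noteq> 0"
  shows "\<exists>V. zopen Z V \<and> x \<in> V \<and> V \<subseteq> {y \<in> U. f y \<noteq> 0} \<and> regular_on Z V (\<lambda>y. inverse (f y))"
proof -
  obtain W d g h where W: "zopen Z W" "x \<in> W" "W \<subseteq> U" "hpoly d g" "hpoly d h"
      "\<forall>y\<in>W. \<forall>v\<in>y. h v \<noteq> 0 \<and> f y = g v / h v"
    by (rule regular_onE[OF assms(2,3)])
  let ?V = "W \<inter> {p \<in> Z. \<forall>v\<in>p. g v \<noteq> 0}"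
  have V: "zopen Z ?V"
    using zopen_Int[OF W(1) zopen_nonvanishing[OF assms(1) W(4)]] .
  have "x \<in> proj_points"
    using W zopen_subset variety_subset_points[OF assms(1)] by blast
  then obtain v where v: "v \<in> x" by (rule proj_pointsE)
  have "g w \<noteq> 0" if "w \<in> x" for w
    using W(2,6) assms(4) that by auto
  then have "x \<in> ?V" using W zopen_subset[OF W(1)] by auto
  moreover have "f y \<noteq> 0" if "y \<in> ?V" for y
  proof -
    have "y \<in> proj_points"
      using that variety_subset_points[OF assms(1)] by blast
    then obtain v where "v \<in> y" by (rule proj_pointsE)
    then show ?thesis using W(6) that by auto
  qed
  moreover have "regular_on Z ?V (\<lambda>y. inverse (f y))"
    by (rule regular_on_quotient[OF assms(1) V W(5,4)]) (use W(6) in auto)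
  ultimately show ?thesis using V W(3) by blast
qed

lemma zariski_fun_space:
  assumes "variety Z"
  shows "fun_space (zopen Z) (regular_on Z)"
proof
  show "regular_on Z U f \<Longrightarrow> (\<And>x. x \<in> U \<Longrightarrow> f x \<noteq> 0) \<Longrightarrow> zopen Z U \<Longrightarrow>
      regular_on Z U (\<lambda>x. inverse (f x))" for U f
    by (rule regular_onI_local) (use regular_on_nonzero_neighbourhood[OF assms] in fastforce)
  show "zopen Z {x \<in> U. f x \<noteq> 0}" if "regular_on Z U f" "zopen Z U" for U f
    using regular_on_nonzero_neighbourhood[OF assms that(1)]
    by (intro zopen_local[OF assms]) blast
qed (auto intro: zopen_Int regular_on_mono regular_on_cong regular_on_const regular_on_add
    regular_on_mult regular_onI_local)

lemma regular_on_restrict_variety: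
  assumes "variety Y" "Y \<subseteq> X" "regular_on X U f"
  shows "regular_on Y (U \<inter> Y) f"
proof (rule regular_onI)
  fix x assume "x \<in> U \<inter> Y"
  then have "x \<in> U" by blast
  obtain W d g h where W: "zopen X W" "x \<in> W" "W \<subseteq> U" "hpoly d g" "hpoly d h"
      "\<forall>y\<in>W. \<forall>v\<in>y. h v \<noteq> 0 \<and> f y = g v / h v"
    by (rule regular_onE[OF assms(3) \<open>x \<in> U\<close>])
  show "\<exists>V d g h. zopen Y V \<and> x \<in> V \<and> V \<subseteq> U \<inter> Y \<and> hpoly d g \<and> hpoly d h \<and>
      (\<forall>y\<in>V. \<forall>v\<in>y. h v \<noteq> 0 \<and> f y = g v / h v)"
    by (intro exI[of _ "W \<inter> Y"] exI[of _ d] exI[of _ g] exI[of _ h])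
      (use \<open>x \<in> U \<inter> Y\<close> zopen_restrict[OF assms(1,2) W(1)] W in auto)
qed

text \<open>A quotient of homogeneous polynomials that represents \<open>f\<close> near
  \<open>x\<close> makes sense off \<open>Y\<close> as well. The neighbourhood must avoid the zeros
  of \<open>h\<close> and the set \<open>Y - W\<close>, where the quotient need not agree with
  \<open>f\<close>.\<close>

lemma regular_on_extend:
  assumes "variety X" "variety Y" "Y \<subseteq> X" "regular_on Y U f" "x \<in> U"
  obtains V f' where "zopen X V" "x \<in> V" "V \<inter> Y \<subseteq> U" "regular_on X V f'"
    "\<And>y. y \<in> V \<inter> Y \<Longrightarrow> f' y = f y"
proof -
  obtain W d g h where W: "zopen Y W" "x \<in> W" "W \<subseteq> U" "hpoly d g" "hpoly d h"
      "\<forall>y\<in>W. \<forall>v\<in>y. h v \<noteq> 0 \<and> f y = g v / h v"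
    by (rule regular_onE[OF assms(4,5)])
  let ?V = "(X - (Y - W)) \<inter> {p \<in> X. \<forall>v\<in>p. h v \<noteq> 0}"
  \<comment> \<open>The representative is arbitrary: \<open>g\<close> and \<open>h\<close> have the
    same degree, so the quotient does not depend on it.\<close>
  let ?f = "\<lambda>y. let v = (SOME v. v \<in> y) in g v / h v"
  have "zopen X (X - (Y - W))"
    using W(1) assms(3) by (intro zopen_diff) (auto simp: zopen_def)
  then have V: "zopen X ?V"
    using zopen_Int zopen_nonvanishing[OF assms(1) W(5)] by blast
  have *: "?f y = g v / h v" if "y \<in> X" "v \<in> y" for y v
  proof -
    have "y \<in> proj_points" using that variety_subset_points[OF assms(1)] by blast
    then show ?thesis
      unfolding Let_def
      by (rule hpoly_quotient_eq[OF _ someI[of "\<lambda>v. v \<in> y", OF that(2)] that(2) W(4,5)])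
  qed
  show thesis
  proof
    show "zopen X ?V" by fact
    show "x \<in> ?V" using W zopen_subset[OF W(1)] assms(3) by auto
    show "?V \<inter> Y \<subseteq> U" using W(3) by blast
    show "regular_on X ?V ?f"
      by (rule regular_on_quotient[OF assms(1) V W(4,5)]) (use * in auto)
    show "?f y = f y" if "y \<in> ?V \<inter> Y" for y
    proof -
      have "y \<in> proj_points" using that variety_subset_points[OF assms(1)] by blast
      then obtain v where "v \<in> y" by (rule proj_pointsE)
      then have "f y = g v / h v" using W(6) that by blast
      moreover have "?f y = g v / h v" using *[of y v] \<open>v \<in> y\<close> that by blast
      ultimately show ?thesis by simp
    qed
  qed
qed

lemma oring_cring:
  assumes "zopen Z U" "variety Z"
  shows "cring (oring Z U)"
proof -
  interpret fun_space "zopen Z" "regular_on Z" by (rule zariski_fun_space) fact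
  have r: "regular_on Z U (restrict f U)" if "regular_on Z U f" for f
    by (rule regular_on_cong[OF that]) auto
  note [simp] = fn_add fn_mult fn_const fn_uminus assms
  show ?thesis
  proof (intro cringI abelian_groupI comm_monoidI)
    fix x assume x: "x \<in> carrier (oring Z U)"
    then show "\<exists>y\<in>carrier (oring Z U). y \<oplus>\<^bsub>oring Z U\<^esub> x = \<zero>\<^bsub>oring Z U\<^esub>"
      by (intro bexI[of _ "restrict (\<lambda>y. - x y) U"])
        (auto simp: oring_def fun_eq_iff intro!: r)
    show "\<zero>\<^bsub>oring Z U\<^esub> \<oplus>\<^bsub>oring Z U\<^esub> x = x" "\<one>\<^bsub>oring Z U\<^esub> \<otimes>\<^bsub>oring Z U\<^esub> x = x"
      using x by (auto simp: oring_def extensional_def fun_eq_iff)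
  qed (auto simp: oring_def restrict_def extensional_def algebra_simps cong: if_cong intro!: r[unfolded restrict_def])
qed

section \<open>Hilbert's basis theorem\<close>

text \<open>Rings are subsets of one ambient type here. This permits an induction that adjoins one
  coordinate function after another inside the ring of all functions.\<close>

inductive_set ideal_span :: "'a::comm_ring_1 set \<Rightarrow> 'a set \<Rightarrow> 'a set" for R S where
  zero: "0 \<in> ideal_span R S"
| step: "a \<in> ideal_span R S \<Longrightarrow> r \<in> R \<Longrightarrow> s \<in> S \<Longrightarrow> a + r * s \<in> ideal_span R S"

definition ring_closed :: "'a::comm_ring_1 set \<Rightarrow> bool" where
  "ring_closed R \<longleftrightarrow> 0 \<in> R \<and> 1 \<in> R \<and> (\<forall>a\<in>R. - a \<in> R) \<and> (\<forall>a\<in>R. \<forall>b\<in>R. a + b \<in> R \<and> a * b \<in> R)"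

text \<open>Stated for arbitrary subsets instead of ideals, and with the generators taken from
  \<open>S\<close> itself; finite covers by principal open sets need this form.\<close>

definition noetherian :: "'a::comm_ring_1 set \<Rightarrow> bool" where
  "noetherian R \<longleftrightarrow> (\<forall>S\<subseteq>R. \<exists>S0\<subseteq>S. finite S0 \<and> S \<subseteq> ideal_span R S0)"

lemma noetherianE:
  assumes "noetherian R" "S \<subseteq> R"
  obtains S0 where "S0 \<subseteq> S" "finite S0" "S \<subseteq> ideal_span R S0"
  using assms(1)[unfolded noetherian_def, rule_format, OF assms(2)] by (elim exE conjE)

inductive_set adjoin :: "'a::comm_ring_1 set \<Rightarrow> 'a \<Rightarrow> 'a set" for R x where
  base: "a \<in> R \<Longrightarrow> a \<in> adjoin R x"
| var: "x \<in> adjoin R x"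
| add: "a \<in> adjoin R x \<Longrightarrow> b \<in> adjoin R x \<Longrightarrow> a + b \<in> adjoin R x"
| mult: "a \<in> adjoin R x \<Longrightarrow> b \<in> adjoin R x \<Longrightarrow> a * b \<in> adjoin R x"

lemma ring_closed_adjoin:
  assumes "ring_closed R"
  shows "ring_closed (adjoin R x)"
proof -
  have m1: "- 1 \<in> adjoin R x"
    using assms by (auto simp: ring_closed_def intro: adjoin.base)
  have "- a \<in> adjoin R x" if "a \<in> adjoin R x" for a
    using adjoin.mult[OF m1 that] by simp
  then show ?thesis
    using assms unfolding ring_closed_def by (auto intro: adjoin.intros)
qed

lemma ideal_span_gen: "ring_closed R \<Longrightarrow> s \<in> S \<Longrightarrow> s \<in> ideal_span R S"
  using ideal_span.step[OF ideal_span.zero, of 1 R s S] by (simp add: ring_closed_def)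

lemma ideal_span_add:
  assumes "a \<in> ideal_span R S" "b \<in> ideal_span R S"
  shows "a + b \<in> ideal_span R S"
  using assms(2)
proof induction
  case (step b r s)
  then show ?case using ideal_span.step[of "a + b" R S r s] by (simp add: add.assoc)
qed (use assms(1) in simp)

lemma ideal_span_mult:
  assumes "ring_closed R" "r \<in> R" "a \<in> ideal_span R S"
  shows "r * a \<in> ideal_span R S"
  using assms(3)
proof induction
  case (step a r' s)
  then have "r * r' \<in> R" using assms by (simp add: ring_closed_def)
  then show ?case
    using ideal_span.step[OF step.IH, of "r * r'" s] step by (simp add: algebra_simps)
qed (simp add: ideal_span.zero)

lemma ideal_span_minus:
  assumes "ring_closed R" "a \<in> ideal_span R S" "b \<in> ideal_span R S"
  shows "a - b \<in> ideal_span R S"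
  using ideal_span_add[OF assms(2) ideal_span_mult[OF assms(1) _ assms(3), of "-1"]] assms(1)
  by (simp add: ring_closed_def)

lemma ideal_span_least:
  assumes "ring_closed R" "S \<subseteq> ideal_span R T"
  shows "ideal_span R S \<subseteq> ideal_span R T"
proof
  fix a assume "a \<in> ideal_span R S"
  then show "a \<in> ideal_span R T"
    by induction (use assms in \<open>auto intro!: ideal_span.zero ideal_span_add ideal_span_mult\<close>)
qed

lemma ideal_span_mono: "S \<subseteq> T \<Longrightarrow> ideal_span R S \<subseteq> ideal_span R T"
proof
  fix a assume "S \<subseteq> T" and a: "a \<in> ideal_span R S"
  show "a \<in> ideal_span R T"
    using a by induction (use \<open>S \<subseteq> T\<close> in \<open>auto intro: ideal_span.intros\<close>)
qed

text \<open>Every element of a span involves finitely many generators; these are collected over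
  \<open>F\<close>.\<close>

lemma ideal_span_finite_support:
  assumes "finite F" "F \<subseteq> ideal_span R S"
  obtains S0 where "S0 \<subseteq> S" "finite S0" "F \<subseteq> ideal_span R S0"
proof -
  have one: "\<exists>S0\<subseteq>S. finite S0 \<and> a \<in> ideal_span R S0" if "a \<in> ideal_span R S" for a
    using that
  proof induction
    case zero
    then show ?case by (intro exI[of _ "{}"]) (auto intro: ideal_span.zero)
  next
    case (step a r s)
    then obtain S0 where "S0 \<subseteq> S" "finite S0" "a \<in> ideal_span R S0" by blast
    moreover from this have "a \<in> ideal_span R (insert s S0)"
      using ideal_span_mono[of S0 "insert s S0" R] by blast
    ultimately show ?case
      using step by (intro exI[of _ "insert s S0"]) (auto intro: ideal_span.step)
  qed
  then have "\<forall>a\<in>F. \<exists>S0. S0 \<subseteq> S \<and> finite S0 \<and> a \<in> ideal_span R S0"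
    using assms(2) by blast
  then obtain g where g: "\<forall>a\<in>F. g a \<subseteq> S \<and> finite (g a) \<and> a \<in> ideal_span R (g a)"
    by (rule bchoice[THEN exE])
  show thesis
  proof
    show "\<Union>(g ` F) \<subseteq> S" "finite (\<Union>(g ` F))" using g assms(1) by auto
    show "F \<subseteq> ideal_span R (\<Union>(g ` F))"
      using g ideal_span_mono[of _ "\<Union>(g ` F)" R] by (meson UN_upper subsetD subsetI)
  qed
qed

lemma ideal_span_finite_sum:
  assumes "ring_closed R" "finite S" "a \<in> ideal_span R S"
  shows "\<exists>c. (\<forall>s. c s \<in> R) \<and> a = (\<Sum>s\<in>S. c s * s)"
  using assms(3)
proof induction
  case zero
  then show ?case
    using assms(1) by (intro exI[of _ "\<lambda>s. 0"]) (simp add: ring_closed_def)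
next
  case (step a r s)
  then obtain c where c: "\<forall>s. c s \<in> R" "a = (\<Sum>s\<in>S. c s * s)" by blast
  have "(\<Sum>t\<in>S. (c(s := c s + r)) t * t) = (\<Sum>t\<in>S. c t * t + (if t = s then r * s else 0))"
    by (rule sum.cong) (auto simp: algebra_simps)
  also have "\<dots> = a + r * s"
    using step assms(2) by (simp add: sum.distrib c)
  finally show ?case
    using c step assms(1) by (intro exI[of _ "c(s := c s + r)"]) (auto simp: ring_closed_def)
qed

text \<open>Elements that can be written as a polynomial in \<open>x\<close> of degree below
  \<open>d\<close>. As \<open>x\<close> is an element of the ring and not an indeterminate, such
  expressions need not be unique, and degrees are only upper bounds.\<close>

definition lower_terms :: "'a::comm_ring_1 set \<Rightarrow> 'a \<Rightarrow> nat \<Rightarrow> 'a set" where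
  "lower_terms R x d = {\<Sum>i<d. b i * x ^ i |b. \<forall>i. b i \<in> R}"

lemma lower_terms_add:
  assumes "ring_closed R" "a \<in> lower_terms R x d" "b \<in> lower_terms R x d"
  shows "a + b \<in> lower_terms R x d"
proof -
  obtain f g where "\<forall>i. f i \<in> R" "\<forall>i. g i \<in> R" "a = (\<Sum>i<d. f i * x ^ i)" "b = (\<Sum>i<d. g i * x ^ i)"
    using assms unfolding lower_terms_def by auto
  then show ?thesis
    using assms(1) unfolding lower_terms_def
    by (auto intro!: exI[of _ "\<lambda>i. f i + g i"] simp: ring_closed_def sum.distrib algebra_simps)
qed

lemma lower_terms_mult:
  assumes "ring_closed R" "r \<in> R" "a \<in> lower_terms R x d"
  shows "r * a \<in> lower_terms R x d"
proof -
  obtain f where "\<forall>i. f i \<in> R" "a = (\<Sum>i<d. f i * x ^ i)"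
    using assms unfolding lower_terms_def by auto
  then show ?thesis
    using assms(1,2) unfolding lower_terms_def
    by (auto intro!: exI[of _ "\<lambda>i. r * f i"] simp: ring_closed_def sum_distrib_left algebra_simps)
qed

lemma lower_terms_0 [simp]: "ring_closed R \<Longrightarrow> lower_terms R x 0 = {0}"
  unfolding lower_terms_def ring_closed_def by auto

text \<open>Splits off a coefficient of the top power; the inductions on the degree bound below all
  run through this equivalence.\<close>

lemma lower_terms_Suc:
  assumes "ring_closed R"
  shows "a \<in> lower_terms R x (Suc d) \<longleftrightarrow> (\<exists>c\<in>R. a - c * x ^ d \<in> lower_terms R x d)"
proof
  assume "a \<in> lower_terms R x (Suc d)"
  then obtain b where "\<forall>i. b i \<in> R" "a = (\<Sum>i<d. b i * x ^ i) + b d * x ^ d"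
    unfolding lower_terms_def by auto
  then show "\<exists>c\<in>R. a - c * x ^ d \<in> lower_terms R x d"
    unfolding lower_terms_def by (intro bexI[of _ "b d"] CollectI exI[of _ b]) auto
next
  assume "\<exists>c\<in>R. a - c * x ^ d \<in> lower_terms R x d"
  then obtain c f where "c \<in> R" "\<forall>i. f i \<in> R" "a = (\<Sum>i<d. f i * x ^ i) + c * x ^ d"
    unfolding lower_terms_def by (auto simp: algebra_simps)
  then show "a \<in> lower_terms R x (Suc d)"
    unfolding lower_terms_def by (auto intro!: exI[of _ "f(d := c)"])
qed

lemma lower_terms_minus:
  assumes "ring_closed R" "a \<in> lower_terms R x d" "b \<in> lower_terms R x d"
  shows "a - b \<in> lower_terms R x d"
  using lower_terms_add[OF assms(1,2) lower_terms_mult[OF assms(1) _ assms(3), of "-1"]] assms(1)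
  by (simp add: ring_closed_def)

lemma lower_terms_mono:
  assumes "ring_closed R" "d \<le> e"
  shows "lower_terms R x d \<subseteq> lower_terms R x e"
proof -
  have "lower_terms R x d \<subseteq> lower_terms R x (Suc d)" for d
    using assms(1) lower_terms_Suc[OF assms(1), of _ x d]
    by (auto intro!: bexI[of _ 0] simp: ring_closed_def)
  then show ?thesis using assms(2) by (rule lift_Suc_mono_le)
qed

lemma lower_terms_shift:
  assumes "ring_closed R" "a \<in> lower_terms R x d"
  shows "a * x ^ e \<in> lower_terms R x (d + e)"
proof -
  have *: "a * x \<in> lower_terms R x (Suc d)" if "a \<in> lower_terms R x d" for a d
    using that
  proof (induction d arbitrary: a)
    case 0
    then show ?case using assms(1) lower_terms_mono[OF assms(1), of 0 "Suc 0" x] by simp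
  next
    case (Suc d)
    then obtain c where c: "c \<in> R" "a - c * x ^ d \<in> lower_terms R x d"
      using lower_terms_Suc[OF assms(1)] by blast
    then have "(a - c * x ^ d) * x \<in> lower_terms R x (Suc d)" using Suc by blast
    then show ?case
      using c(1) by (subst lower_terms_Suc[OF assms(1)]) (auto intro!: bexI[of _ c] simp: algebra_simps)
  qed
  show ?thesis
  proof (induction e)
    case (Suc e)
    from *[OF this] show ?case by (simp add: algebra_simps)
  qed (use assms in simp)
qed

lemma adjoin_lower_terms:
  assumes "ring_closed R" "a \<in> adjoin R x"
  shows "\<exists>d. a \<in> lower_terms R x d"
  using assms(2)
proof induction
  case (base a)
  then have "a \<in> lower_terms R x (Suc 0)"
    using assms(1) by (subst lower_terms_Suc) (auto intro!: bexI[of _ a])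
  then show ?case by blast
next
  case var
  have "x \<in> lower_terms R x (Suc (Suc 0))"
    using assms(1) lower_terms_mono[OF assms(1), of 0 "Suc 0" x]
    by (subst lower_terms_Suc) (auto intro!: bexI[of _ 1] simp: ring_closed_def)
  then show ?case by blast
next
  case (add a b)
  then obtain d e where "a \<in> lower_terms R x d" "b \<in> lower_terms R x e" by blast
  then have "a + b \<in> lower_terms R x (max d e)"
    using lower_terms_mono[OF assms(1), of d "max d e" x] lower_terms_mono[OF assms(1), of e "max d e" x]
    by (intro lower_terms_add[OF assms(1)]) auto
  then show ?case by blast
next
  case (mult a b)
  then obtain d e where de: "a \<in> lower_terms R x d" "b \<in> lower_terms R x e" by blast
  have "a * b \<in> lower_terms R x (d + e)"
    using de(2)
  proof (induction e arbitrary: b)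
    case 0
    then show ?case using assms(1) lower_terms_mono[OF assms(1), of 0 d x] by simp
  next
    case (Suc e)
    then obtain c where c: "c \<in> R" "b - c * x ^ e \<in> lower_terms R x e"
      using lower_terms_Suc[OF assms(1)] by blast
    have "a * (b - c * x ^ e) \<in> lower_terms R x (Suc (d + e))"
      using Suc.IH[OF c(2)] lower_terms_mono[OF assms(1), of "d + e" "Suc (d + e)" x] by auto
    moreover have "(c * a) * x ^ e \<in> lower_terms R x (Suc (d + e))"
      using lower_terms_shift[OF assms(1) lower_terms_mult[OF assms(1) c(1) de(1)], of e]
        lower_terms_mono[OF assms(1), of "d + e" "Suc (d + e)" x] by auto
    ultimately have "a * (b - c * x ^ e) + (c * a) * x ^ e \<in> lower_terms R x (Suc (d + e))"
      by (rule lower_terms_add[OF assms(1)])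
    then show ?case by (simp add: algebra_simps)
  qed
  then show ?case by blast
qed

text \<open>The classical argument with leading coefficients. The sets \<open>L d\<close> of leading
  coefficients increase and are exhausted, up to spans, at some \<open>D\<close>; lifts of finitely
  many generators of \<open>L 0\<close>, ..., \<open>L D\<close> then generate the ideal, by
  cancelling leading terms.\<close>

lemma noetherian_adjoin:
  assumes R: "ring_closed R" and "noetherian R"
  shows "noetherian (adjoin R x)"
  unfolding noetherian_def
proof (intro allI impI)
  fix S assume S: "S \<subseteq> adjoin R x"
  define I where "I = ideal_span (adjoin R x) S"
  \<comment> \<open>Since degrees are not well defined, \<open>a\<close> counts as a leading
    coefficient of \<open>f\<close> in degree \<open>d\<close> as soon as subtracting
    \<open>a * x ^ d\<close> leaves lower terms; \<open>a = 0\<close> is allowed.\<close>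
  define L where "L d = {a \<in> R. \<exists>f\<in>I. f - a * x ^ d \<in> lower_terms R x d}" for d
  note R' = ring_closed_adjoin[OF R, of x]
  have pow: "x ^ e \<in> adjoin R x" for e
    using R' by (induction e) (auto simp: ring_closed_def intro: adjoin.intros)
  have L_mono: "L d \<subseteq> L e" if "d \<le> e" for d e
  proof
    fix a assume "a \<in> L d"
    then obtain f where f: "a \<in> R" "f \<in> I" "f - a * x ^ d \<in> lower_terms R x d"
      unfolding L_def by blast
    have "x ^ (e - d) * f \<in> I"
      unfolding I_def using f(2) pow R' by (intro ideal_span_mult) (auto simp: I_def)
    moreover have "(f - a * x ^ d) * x ^ (e - d) \<in> lower_terms R x e"
      using lower_terms_shift[OF R f(3), of "e - d"] that by simp
    moreover have "(f - a * x ^ d) * x ^ (e - d) = x ^ (e - d) * f - a * x ^ e"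
      using that by (simp add: algebra_simps power_add[symmetric])
    ultimately show "a \<in> L e" unfolding L_def using f(1) by (intro CollectI conjI bexI) auto
  qed
  have fin: "\<exists>T\<subseteq>L'. finite T \<and> L' \<subseteq> ideal_span R T" if "L' \<subseteq> R" for L'
    using assms(2) that unfolding noetherian_def by blast
  have L_sub: "L d \<subseteq> R" for d unfolding L_def by blast
  have "\<forall>d. \<exists>T. T \<subseteq> L d \<and> finite T \<and> L d \<subseteq> ideal_span R T"
    using fin[OF L_sub] by blast
  then obtain T where T: "\<And>d. T d \<subseteq> L d" "\<And>d. finite (T d)" "\<And>d. L d \<subseteq> ideal_span R (T d)"
    by metis
  \<comment> \<open>The union of all \<open>L d\<close> is finitely generated as well. Its finitely
    many generators lie in one \<open>L D\<close>, because the \<open>L d\<close> increase; this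
    fixes \<open>D\<close>.\<close>
  obtain U where U: "U \<subseteq> (\<Union>d. L d)" "finite U" "(\<Union>d. L d) \<subseteq> ideal_span R U"
    using fin[of "\<Union>d. L d"] L_sub by blast
  have "\<exists>D. U \<subseteq> L D"
    using U(2,1)
  proof (induction U rule: finite_induct)
    case (insert u U)
    then obtain D d where "U \<subseteq> L D" "u \<in> L d" by blast
    then have "insert u U \<subseteq> L (max D d)"
      using L_mono[of D "max D d"] L_mono[of d "max D d"] by auto
    then show ?case by blast
  qed simp
  then obtain D where D: "U \<subseteq> L D" by blast
  have L_stab: "L d \<subseteq> ideal_span R (T (min d D))" for d
  proof (cases "d \<le> D")
    case False
    have "L d \<subseteq> ideal_span R U" using U(3) by blast
    also have "\<dots> \<subseteq> ideal_span R (T D)"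
      using D T(3) by (intro ideal_span_least[OF R]) blast
    finally show ?thesis using False by simp
  qed (use T(3) in simp)
  have "\<forall>d. \<forall>t\<in>T d. \<exists>f. f \<in> I \<and> f - t * x ^ d \<in> lower_terms R x d"
    using T(1) unfolding L_def by blast
  then obtain lift where lift: "\<And>d t. t \<in> T d \<Longrightarrow> lift d t \<in> I \<and> lift d t - t * x ^ d \<in> lower_terms R x d"
    by metis
  define F where "F = (\<Union>d\<le>D. lift d ` T d)"
  have "finite F" unfolding F_def using T(2) by auto
  moreover have F_sub: "F \<subseteq> ideal_span (adjoin R x) S"
    unfolding F_def I_def[symmetric] using lift by auto
  \<comment> \<open>The members of \<open>F\<close> belong to the ideal but not necessarily to
    \<open>S\<close>; finitely many elements of \<open>S\<close> account for all of them.\<close>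
  ultimately obtain S0 where S0: "S0 \<subseteq> S" "finite S0" "F \<subseteq> ideal_span (adjoin R x) S0"
    by (rule ideal_span_finite_support)
  define J where "J = ideal_span (adjoin R x) F"
  have J_sub: "J \<subseteq> I"
    unfolding J_def I_def by (rule ideal_span_least[OF R' F_sub])
  have lead: "\<exists>g\<in>J. g - a * x ^ d \<in> lower_terms R x d" if "d \<le> D" "a \<in> ideal_span R (T d)" for d a
    using that(2)
  proof induction
    case zero
    show ?case
      using R lower_terms_mono[OF R, of 0 d x]
      by (intro bexI[of _ 0]) (auto simp: J_def ideal_span.zero)
  next
    case (step a r t)
    then obtain g where g: "g \<in> J" "g - a * x ^ d \<in> lower_terms R x d" by blast
    have "lift d t \<in> J"
      unfolding J_def using step that(1) by (intro ideal_span_gen[OF R']) (auto simp: F_def)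
    then have "g + r * lift d t \<in> J"
      unfolding J_def using g step.hyps
      by (intro ideal_span_add ideal_span_mult[OF R']) (auto simp: J_def intro: adjoin.base)
    moreover have "(g - a * x ^ d) + r * (lift d t - t * x ^ d) \<in> lower_terms R x d"
      using g lift step.hyps by (intro lower_terms_add[OF R] lower_terms_mult[OF R]) auto
    then have "g + r * lift d t - (a + r * t) * x ^ d \<in> lower_terms R x d"
      by (simp add: algebra_simps)
    ultimately show ?case by blast
  qed
  have IJ: "f \<in> J" if "f \<in> I" "f \<in> lower_terms R x d" for f d
    using that
  proof (induction d arbitrary: f)
    case 0
    then show ?case using R by (simp add: J_def ideal_span.zero)
  next
    case (Suc d)
    then obtain c where c: "c \<in> R" "f - c * x ^ d \<in> lower_terms R x d"
      using lower_terms_Suc[OF R] by blast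
    then have "c \<in> L d" unfolding L_def using Suc by blast
    then have "c \<in> ideal_span R (T (min d D))" using L_stab by blast
    then obtain g where g: "g \<in> J" "g - c * x ^ min d D \<in> lower_terms R x (min d D)"
      using lead[of "min d D" c] by auto
    \<comment> \<open>For \<open>d > D\<close> the leading coefficient is realised in degree
      \<open>D\<close> only, so \<open>g\<close> is shifted up to degree \<open>d\<close>.\<close>
    define g' where "g' = x ^ (d - min d D) * g"
    have g': "g' \<in> J"
      unfolding g'_def using g(1) pow R' by (auto simp: J_def intro: ideal_span_mult)
    have "(g - c * x ^ min d D) * x ^ (d - min d D) \<in> lower_terms R x d"
      using lower_terms_shift[OF R g(2), of "d - min d D"] by simp
    moreover have "(g - c * x ^ min d D) * x ^ (d - min d D) = g' - c * x ^ d"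
      unfolding g'_def by (simp add: algebra_simps power_add[symmetric])
    ultimately have "(f - c * x ^ d) - (g' - c * x ^ d) \<in> lower_terms R x d"
      using lower_terms_minus[OF R c(2)] by metis
    then have "f - g' \<in> lower_terms R x d" by simp
    moreover have "f - g' \<in> I"
      using Suc.prems g' J_sub unfolding I_def by (intro ideal_span_minus[OF R']) auto
    ultimately have "f - g' \<in> J" using Suc.IH[of "f - g'"] by simp
    then have "(f - g') + g' \<in> J"
      using g' unfolding J_def by (rule ideal_span_add)
    then show ?case by simp
  qed
  have "S \<subseteq> ideal_span (adjoin R x) S0"
  proof
    fix s assume s: "s \<in> S"
    then have "s \<in> I" unfolding I_def by (rule ideal_span_gen[OF R'])
    moreover obtain d where "s \<in> lower_terms R x d"
      using adjoin_lower_terms[OF R] s S by blast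
    ultimately have "s \<in> J" by (rule IJ)
    then show "s \<in> ideal_span (adjoin R x) S0"
      using ideal_span_least[OF R' S0(3)] unfolding J_def by blast
  qed
  with S0 show "\<exists>S0\<subseteq>S. finite S0 \<and> S \<subseteq> ideal_span (adjoin R x) S0" by blast
qed

text \<open>Polynomial functions of \<open>v 0\<close>, ..., \<open>v (n - 1)\<close>, so that
  \<open>proj_space n\<close> belongs to \<open>polyfuns (Suc n)\<close>. Working with functions
  instead of formal polynomials is possible because \<open>noetherian_adjoin\<close> asks nothing of
  the adjoined element.\<close>

primrec polyfuns :: "nat \<Rightarrow> ((nat \<Rightarrow> complex) \<Rightarrow> complex) set" where
  "polyfuns 0 = range (\<lambda>c v. c)"
| "polyfuns (Suc n) = adjoin (polyfuns n) (\<lambda>v. v n)"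

lemma ring_closed_polyfuns: "ring_closed (polyfuns n)"
proof (induction n)
  case 0
  show ?case
    by (auto simp: ring_closed_def zero_fun_def one_fun_def plus_fun_def times_fun_def fun_Compl_def)
qed (simp add: ring_closed_adjoin)

lemma noetherian_polyfuns: "noetherian (polyfuns n)"
proof (induction n)
  case 0
  show ?case
    unfolding noetherian_def
  proof (intro allI impI)
    fix S :: "((nat \<Rightarrow> complex) \<Rightarrow> complex) set"
    assume S: "S \<subseteq> polyfuns 0"
    show "\<exists>S0\<subseteq>S. finite S0 \<and> S \<subseteq> ideal_span (polyfuns 0) S0"
    proof (cases "S \<subseteq> {0}")
      case True
      then show ?thesis by (intro exI[of _ "{}"]) (auto intro: ideal_span.zero)
    next
      case False
      then obtain s where "s \<in> S" "s \<noteq> 0" by blast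
      then obtain a where a: "s = (\<lambda>v. a)" "a \<noteq> 0"
        using S by (auto simp: zero_fun_def)
      have "t \<in> ideal_span (polyfuns 0) {s}" if t: "t \<in> S" for t
      proof -
        obtain b where "t = (\<lambda>v. b)" using S t by auto
        then have "t = 0 + (\<lambda>v. b / a) * s"
          using a by (simp add: times_fun_def zero_fun_def plus_fun_def)
        then show ?thesis
          using ideal_span.step[OF ideal_span.zero, of "\<lambda>v. b / a" "polyfuns 0" s "{s}"] by simp
      qed
      then show ?thesis using \<open>s \<in> S\<close> by (intro exI[of _ "{s}"]) auto
    qed
  qed
next
  case (Suc n)
  then show ?case by (simp add: noetherian_adjoin ring_closed_polyfuns)
qed

lemma polyfuns_mono: "m \<le> n \<Longrightarrow> polyfuns m \<subseteq> polyfuns n"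
  by (rule lift_Suc_mono_le[of polyfuns]) (auto intro: adjoin.base)

text \<open>An \<open>hpoly\<close> may involve any number of variables. Truncation brings it into
  \<open>polyfuns (Suc n)\<close> and does not change its values at the homogeneous coordinates of
  points of \<open>proj_space n\<close>.\<close>

definition trunc_vec :: "nat \<Rightarrow> (nat \<Rightarrow> complex) \<Rightarrow> nat \<Rightarrow> complex" where
  "trunc_vec n v = (\<lambda>i. if i \<le> n then v i else 0)"

lemma hpoly_trunc_vec_polyfuns:
  assumes "hpoly d f"
  shows "(\<lambda>v. f (trunc_vec n v)) \<in> polyfuns (Suc n)"
  using assms
proof induction
  case (const c)
  then show ?case using polyfuns_mono[of 0 "Suc n"] by auto
next
  case (coord i)
  show ?case
  proof (cases "i \<le> n")
    case True
    then have "(\<lambda>v. v i) \<in> polyfuns (Suc n)"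
      using polyfuns_mono[of "Suc i" "Suc n"] adjoin.var[of "\<lambda>v. v i" "polyfuns i"] by auto
    then show ?thesis using True by (simp add: trunc_vec_def)
  next
    case False
    then show ?thesis
      using ring_closed_polyfuns[of "Suc n"] by (simp add: trunc_vec_def ring_closed_def zero_fun_def)
  qed
next
  case (add d f g)
  then show ?case
    using adjoin.add[of "\<lambda>v. f (trunc_vec n v)"] by (simp add: plus_fun_def)
next
  case (mult d f e g)
  then show ?case
    using adjoin.mult[of "\<lambda>v. f (trunc_vec n v)"] by (simp add: times_fun_def)
qed

section \<open>Coherence of the extension by zero\<close>

text \<open>The representative normalised to have \<open>i\<close>-th coordinate 1, that is, the
  standard affine chart. Where that coordinate vanishes, division by zero yields the zero
  vector.\<close>

definition chart :: "nat \<Rightarrow> pt \<Rightarrow> nat \<Rightarrow> complex" where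
  "chart i p = (let v = (SOME v. v \<in> p) in (\<lambda>k. v k / v i))"

lemma chart_eq:
  assumes "p \<in> proj_points" "v \<in> p"
  shows "chart i p = (\<lambda>k. v k / v i)"
proof -
  have "(SOME v. v \<in> p) \<in> p" by (rule someI[of "\<lambda>v. v \<in> p", OF assms(2)])
  then obtain c where "c \<noteq> 0" "(SOME v. v \<in> p) = (\<lambda>k. c * v k)"
    using proj_points_scale[OF assms] by blast
  then show ?thesis by (simp add: chart_def)
qed

lemma chart_mem:
  assumes "p \<in> proj_points" "v \<in> p" "v i \<noteq> 0"
  shows "chart i p \<in> p"
proof -
  have "(\<lambda>k. inverse (v i) * v k) \<in> pline v"
    unfolding pline_def using assms(3) by (intro CollectI exI[of _ "inverse (v i)"]) auto
  then show ?thesis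
    using proj_points_mem_coord_vecs(2)[OF assms(1,2)] by (simp add: chart_eq[OF assms(1,2)] field_simps)
qed

definition chart_domain :: "pt set \<Rightarrow> nat \<Rightarrow> pt set" where
  "chart_domain X i = {p \<in> X. \<forall>v\<in>p. v i \<noteq> 0}"

lemma chart_mem_domain:
  assumes "variety X" "p \<in> chart_domain X i"
  shows "chart i p \<in> p"
proof -
  have p: "p \<in> proj_points" using assms variety_subset_points by (auto simp: chart_domain_def)
  then obtain v where "v \<in> p" by (rule proj_pointsE)
  then show ?thesis using chart_mem[OF p] assms(2) by (simp add: chart_domain_def)
qed

lemma zopen_chart_domain: "variety X \<Longrightarrow> zopen X (chart_domain X i)"
  unfolding chart_domain_def by (rule zopen_nonvanishing[OF _ hpoly.coord])

lemma regular_polyfun_chart: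
  assumes "variety X" "G \<in> polyfuns n"
  shows "regular_on X (chart_domain X i) (\<lambda>p. G (chart i p))"
  using assms(2)
proof (induction n arbitrary: G)
  case 0
  then show ?case using regular_on_const[OF zopen_chart_domain[OF assms(1)]] by auto
next
  case (Suc n)
  have "G \<in> adjoin (polyfuns n) (\<lambda>v. v n)" using Suc by simp
  then show ?case
  proof induction
    case (base G)
    then show ?case by (rule Suc.IH)
  next
    case var
    have "chart i p n = v n / v i" if "p \<in> chart_domain X i" "v \<in> p" for p v
      using that variety_subset_points[OF assms(1)] chart_eq[of p v i] by (auto simp: chart_domain_def)
    then show ?case
      by (intro regular_on_quotient[OF assms(1) zopen_chart_domain[OF assms(1)] hpoly.coord hpoly.coord])
        (auto simp: chart_domain_def)
  next
    case (add G H)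
    then show ?case by (simp add: regular_on_add plus_fun_def)
  next
    case (mult G H)
    then show ?case by (simp add: regular_on_mult times_fun_def)
  qed
qed

text \<open>The ideal sheaf of \<open>Y\<close> in \<open>X\<close> is of finite type: on an affine
  chart, finitely many polynomials generate all those that vanish on \<open>Y\<close>. What remains
  is to pass from a local section of the sheaf, a quotient on a small open set, to a polynomial that
  vanishes on \<open>Y\<close> throughout the chart.\<close>

lemma ideal_sheaf_finite_type:
  assumes X: "variety X" and "variety Y" "Y \<subseteq> X" "x \<in> X"
  obtains V m f where "zopen X V" "x \<in> V" "\<forall>l<(m::nat). regular_on X V (f l)"
    "\<forall>l<m. \<forall>y\<in>V \<inter> Y. f l y = 0"
    "\<forall>W h y. zopen X W \<longrightarrow> W \<subseteq> V \<longrightarrow> regular_on X W h \<longrightarrow> (\<forall>y\<in>W \<inter> Y. h y = 0) \<longrightarrow> y \<in> W \<longrightarrow>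
       (\<exists>W' b. zopen X W' \<and> y \<in> W' \<and> W' \<subseteq> W \<and> (\<forall>l<m. regular_on X W' (b l)) \<and>
          (\<forall>z\<in>W'. h z = (\<Sum>l<m. b l z * f l z)))"
proof -
  interpret X: fun_space "zopen X" "regular_on X" by (rule zariski_fun_space[OF X])
  obtain n where n: "X \<subseteq> proj_space n" using X by (rule variety_subset_proj_space)
  have pts: "p \<in> proj_points" if "p \<in> X" for p using that variety_subset_points[OF X] by blast
  obtain v where v: "v \<in> coord_vecs" "v \<in> x"
    using pts[OF assms(4)] by (rule proj_pointsE)
  then obtain i where i: "v i \<noteq> 0" unfolding coord_vecs_def by blast
  define V where "V = chart_domain X i"
  have V: "zopen X V" unfolding V_def by (rule zopen_chart_domain[OF X])
  have xV: "x \<in> V"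
    unfolding V_def chart_domain_def
    using assms(4) hpoly_zero_iff[OF pts[OF assms(4)] v(2) _ hpoly.coord] i by blast
  have mem: "chart i p \<in> p" if "p \<in> V" for p
    using chart_mem_domain[OF X] that unfolding V_def .
  have trunc: "trunc_vec n (chart i p) = chart i p" if "p \<in> V" for p
  proof -
    have "p \<in> X" using that zopen_subset[OF V] by blast
    then have "\<forall>k>n. chart i p k = 0"
      using mem_proj_space_iff[OF pts mem[OF that]] n by blast
    then show ?thesis by (auto simp: trunc_vec_def fun_eq_iff)
  qed
  \<comment> \<open>The polynomials need not be homogeneous, since they are evaluated at the
    normalised representative only.\<close>
  define S where "S = {G \<in> polyfuns (Suc n). \<forall>p\<in>V \<inter> Y. G (chart i p) = 0}"
  have "S \<subseteq> polyfuns (Suc n)" unfolding S_def by (rule Collect_restrict)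
  then obtain S0 where S0: "S0 \<subseteq> S" "finite S0" "S \<subseteq> ideal_span (polyfuns (Suc n)) S0"
    by (rule noetherianE[OF noetherian_polyfuns])
  obtain g where g: "bij_betw g {..<card S0} S0"
    using ex_bij_betw_nat_finite[OF S0(2)] by (auto simp: atLeast0LessThan)
  have gS: "g l \<in> S" if "l < card S0" for l
    using g S0(1) that by (auto simp: bij_betw_def)
  show thesis
  proof
    show "zopen X V" "x \<in> V" by fact+
    show "\<forall>l<card S0. regular_on X V (\<lambda>p. g l (chart i p))"
      using gS regular_polyfun_chart[OF X, of _ "Suc n" i] by (auto simp: S_def V_def)
    show "\<forall>l<card S0. \<forall>p\<in>V \<inter> Y. g l (chart i p) = 0"
      using gS by (auto simp: S_def)
  next
    show "\<forall>W h y. zopen X W \<longrightarrow> W \<subseteq> V \<longrightarrow> regular_on X W h \<longrightarrow> (\<forall>y\<in>W \<inter> Y. h y = 0) \<longrightarrow> y \<in> W \<longrightarrow>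
       (\<exists>W' b. zopen X W' \<and> y \<in> W' \<and> W' \<subseteq> W \<and> (\<forall>l<card S0. regular_on X W' (b l)) \<and>
        (\<forall>z\<in>W'. h z = (\<Sum>l<card S0. b l z * g l (chart i z))))"
    proof (intro allI impI)
      fix W h y
      assume W: "zopen X W" "W \<subseteq> V" and h: "regular_on X W h" "\<forall>y\<in>W \<inter> Y. h y = 0" and y: "y \<in> W"
      obtain W1 d G H where W1: "zopen X W1" "y \<in> W1" "W1 \<subseteq> W" "hpoly d G" "hpoly d H"
          "\<forall>p\<in>W1. \<forall>v\<in>p. H v \<noteq> 0 \<and> h p = G v / H v"
        using h(1) y by (rule regular_onE)
      have "y \<in> proj_points" using y zopen_subset[OF W(1)] pts by blast
      \<comment> \<open>The numerator \<open>G\<close> is known to vanish only on the part of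
        \<open>Y\<close> inside \<open>W1\<close>. The factor \<open>Q\<close> vanishes on the rest,
        which brings \<open>QG\<close> into \<open>S\<close>; in the quotient by \<open>QH\<close>
        it cancels.\<close>
      obtain e Q where Q: "hpoly e Q" "\<forall>p\<in>X - W1. \<forall>v\<in>p. Q v = 0" "\<forall>v\<in>y. Q v \<noteq> 0"
        by (rule zopen_principal_neighbourhood[OF W1(1,2) \<open>y \<in> proj_points\<close>])
      define QG where "QG = (\<lambda>v. Q (trunc_vec n v) * G (trunc_vec n v))"
      define QH where "QH = (\<lambda>v. Q (trunc_vec n v) * H (trunc_vec n v))"
      have "QG \<in> polyfuns (Suc n)" "QH \<in> polyfuns (Suc n)"
        using hpoly_trunc_vec_polyfuns[OF hpoly.mult[OF Q(1) W1(4)], of n]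
          hpoly_trunc_vec_polyfuns[OF hpoly.mult[OF Q(1) W1(5)], of n]
        unfolding QG_def QH_def .
      have "QG (chart i p) = 0" if "p \<in> V \<inter> Y" for p
      proof (cases "p \<in> W1")
        case True
        then have "h p = G (chart i p) / H (chart i p)" "H (chart i p) \<noteq> 0" "h p = 0"
          using W1 h(2) mem that by blast+
        then show ?thesis using that trunc by (simp add: QG_def)
      next
        case False
        then show ?thesis
          using that Q(2) mem[of p] zopen_subset[OF V] trunc by (auto simp: QG_def)
      qed
      with \<open>QG \<in> _\<close> have "QG \<in> S" unfolding S_def by blast
      then obtain c where c: "\<forall>s. c s \<in> polyfuns (Suc n)" "QG = (\<Sum>s\<in>S0. c s * s)"
        using ideal_span_finite_sum[OF ring_closed_polyfuns S0(2)] S0(3) by blast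
      have QG_eq: "QG u = (\<Sum>l<card S0. c (g l) u * g l u)" for u
      proof -
        have "QG u = (\<Sum>s\<in>S0. c s u * s u)"
          unfolding c(2) by (induction S0 rule: infinite_finite_induct) auto
        also have "\<dots> = (\<Sum>l<card S0. c (g l) u * g l u)"
          by (rule sum.reindex_bij_betw[OF g, symmetric])
        finally show ?thesis .
      qed
      \<comment> \<open>Cancelling \<open>Q\<close> requires staying where it does not
        vanish.\<close>
      define W' where "W' = W1 \<inter> {p \<in> X. \<forall>v\<in>p. Q v \<noteq> 0}"
      have W': "zopen X W'"
        unfolding W'_def by (rule zopen_Int[OF W1(1) zopen_nonvanishing[OF X Q(1)]])
      have W'V: "W' \<subseteq> V" unfolding W'_def using W1(3) W(2) by blast
      have QH_nz: "QH (chart i p) \<noteq> 0" if "p \<in> W'" for p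
      proof -
        have "p \<in> V" using that W'V by blast
        then show ?thesis
          using that W1(6) mem[of p] trunc[of p] unfolding QH_def W'_def by auto
      qed
      define b where "b l p = c (g l) (chart i p) / QH (chart i p)" for l p
      have "regular_on X W' (b l)" for l
        unfolding b_def
      proof (rule X.fn_divide)
        show "regular_on X W' (\<lambda>p. c (g l) (chart i p))"
          using regular_polyfun_chart[OF X, of _ _ i] c(1) W' W'V unfolding V_def
          by (meson regular_on_mono)
        show "regular_on X W' (\<lambda>p. QH (chart i p))"
          using regular_polyfun_chart[OF X \<open>QH \<in> _\<close>, of i] W' W'V unfolding V_def
          by (rule regular_on_mono)
      qed (use W' QH_nz in auto)
      moreover have "h p = (\<Sum>l<card S0. b l p * g l (chart i p))" if "p \<in> W'" for p
      proof -
        have p: "p \<in> V" "p \<in> W1" using that W'V unfolding W'_def by blast+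
        have "h p = G (chart i p) / H (chart i p)" "Q (chart i p) \<noteq> 0"
          using W1(6) p mem[OF p(1)] that unfolding W'_def by auto
        then have "h p = QG (chart i p) / QH (chart i p)"
          unfolding QG_def QH_def trunc[OF p(1)] by simp
        then show ?thesis
          unfolding QG_eq b_def by (simp add: sum_divide_distrib)
      qed
      moreover have "y \<in> W'"
        unfolding W'_def using W1(2) Q(3) y zopen_subset[OF W(1)] by blast
      moreover have "W' \<subseteq> W" unfolding W'_def using W1(3) by blast
      ultimately show "\<exists>W' b. zopen X W' \<and> y \<in> W' \<and> W' \<subseteq> W \<and> (\<forall>l<card S0. regular_on X W' (b l)) \<and>
          (\<forall>z\<in>W'. h z = (\<Sum>l<card S0. b l z * g l (chart i z)))"
        using W' by blast
    qed
  qed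
qed

section \<open>Sheaves of modules and linear combinations of sections\<close>

lemma modsheaf_onD:
  assumes "modsheaf_on Z F"
  shows "zopen Z U \<Longrightarrow> module (oring Z U) (Sec F U)"
    and "zopen Z U \<Longrightarrow> zopen Z V \<Longrightarrow> V \<subseteq> U \<Longrightarrow> s \<in> carrier (Sec F U) \<Longrightarrow> Rst F U V s \<in> carrier (Sec F V)"
    and "zopen Z U \<Longrightarrow> zopen Z V \<Longrightarrow> V \<subseteq> U \<Longrightarrow> s \<in> carrier (Sec F U) \<Longrightarrow> t \<in> carrier (Sec F U) \<Longrightarrow>
       Rst F U V (s \<oplus>\<^bsub>Sec F U\<^esub> t) = Rst F U V s \<oplus>\<^bsub>Sec F V\<^esub> Rst F U V t"
    and "zopen Z U \<Longrightarrow> zopen Z V \<Longrightarrow> V \<subseteq> U \<Longrightarrow> f \<in> carrier (oring Z U) \<Longrightarrow> s \<in> carrier (Sec F U) \<Longrightarrow>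
       Rst F U V (f \<odot>\<^bsub>Sec F U\<^esub> s) = restrict f V \<odot>\<^bsub>Sec F V\<^esub> Rst F U V s"
    and "zopen Z U \<Longrightarrow> s \<in> carrier (Sec F U) \<Longrightarrow> Rst F U U s = s"
    and "zopen Z U \<Longrightarrow> zopen Z V \<Longrightarrow> zopen Z W \<Longrightarrow> W \<subseteq> V \<Longrightarrow> V \<subseteq> U \<Longrightarrow> s \<in> carrier (Sec F U) \<Longrightarrow>
       Rst F V W (Rst F U V s) = Rst F U W s"
    and "(\<And>V. V \<in> \<V> \<Longrightarrow> zopen Z V) \<Longrightarrow> (\<And>V. V \<in> \<V> \<Longrightarrow> \<sigma> V \<in> carrier (Sec F V)) \<Longrightarrow> zopen Z (\<Union>\<V>) \<Longrightarrow>
       (\<And>V W. V \<in> \<V> \<Longrightarrow> W \<in> \<V> \<Longrightarrow> Rst F V (V \<inter> W) (\<sigma> V) = Rst F W (V \<inter> W) (\<sigma> W)) \<Longrightarrow>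
       \<exists>!t. t \<in> carrier (Sec F (\<Union>\<V>)) \<and> (\<forall>V\<in>\<V>. Rst F (\<Union>\<V>) V t = \<sigma> V)"
proof -
  note A = assms[unfolded modsheaf_on_def]
  note A1 = A[THEN conjunct1] and A2 = A[THEN conjunct2, THEN conjunct1]
    and A3 = A[THEN conjunct2, THEN conjunct2, THEN conjunct1]
    and A4 = A[THEN conjunct2, THEN conjunct2, THEN conjunct2, THEN conjunct1]
    and A5 = A[THEN conjunct2, THEN conjunct2, THEN conjunct2, THEN conjunct2]
  show "zopen Z U \<Longrightarrow> module (oring Z U) (Sec F U)" using A1 by blast
  show "zopen Z U \<Longrightarrow> zopen Z V \<Longrightarrow> V \<subseteq> U \<Longrightarrow> s \<in> carrier (Sec F U) \<Longrightarrow> Rst F U V s \<in> carrier (Sec F V)"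
    using A2 by blast
  show "zopen Z U \<Longrightarrow> zopen Z V \<Longrightarrow> V \<subseteq> U \<Longrightarrow> s \<in> carrier (Sec F U) \<Longrightarrow> t \<in> carrier (Sec F U) \<Longrightarrow>
       Rst F U V (s \<oplus>\<^bsub>Sec F U\<^esub> t) = Rst F U V s \<oplus>\<^bsub>Sec F V\<^esub> Rst F U V t"
    using A2 by blast
  show "zopen Z U \<Longrightarrow> zopen Z V \<Longrightarrow> V \<subseteq> U \<Longrightarrow> f \<in> carrier (oring Z U) \<Longrightarrow> s \<in> carrier (Sec F U) \<Longrightarrow>
       Rst F U V (f \<odot>\<^bsub>Sec F U\<^esub> s) = restrict f V \<odot>\<^bsub>Sec F V\<^esub> Rst F U V s"
    using A2 by blast
  show "zopen Z U \<Longrightarrow> s \<in> carrier (Sec F U) \<Longrightarrow> Rst F U U s = s" using A3 by blast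
  show "zopen Z U \<Longrightarrow> zopen Z V \<Longrightarrow> zopen Z W \<Longrightarrow> W \<subseteq> V \<Longrightarrow> V \<subseteq> U \<Longrightarrow> s \<in> carrier (Sec F U) \<Longrightarrow>
       Rst F V W (Rst F U V s) = Rst F U W s"
    using A4 by blast
  show "(\<And>V. V \<in> \<V> \<Longrightarrow> zopen Z V) \<Longrightarrow> (\<And>V. V \<in> \<V> \<Longrightarrow> \<sigma> V \<in> carrier (Sec F V)) \<Longrightarrow> zopen Z (\<Union>\<V>) \<Longrightarrow>
       (\<And>V W. V \<in> \<V> \<Longrightarrow> W \<in> \<V> \<Longrightarrow> Rst F V (V \<inter> W) (\<sigma> V) = Rst F W (V \<inter> W) (\<sigma> W)) \<Longrightarrow>
       \<exists>!t. t \<in> carrier (Sec F (\<Union>\<V>)) \<and> (\<forall>V\<in>\<V>. Rst F (\<Union>\<V>) V t = \<sigma> V)"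
    by (rule A5[THEN spec, THEN spec, THEN mp]) blast
qed

lemma modsheaf_zero_closed: "modsheaf_on Z F \<Longrightarrow> zopen Z U \<Longrightarrow> \<zero>\<^bsub>Sec F U\<^esub> \<in> carrier (Sec F U)"
  using modsheaf_onD(1) abelian_groupE(2) module.axioms(2) by blast

text \<open>This is the gluing axiom for the empty family. It is the reason why an extension by zero
  has no sections off its support.\<close>

lemma modsheaf_empty:
  assumes "modsheaf_on Z F" "variety Z"
  shows "carrier (Sec F {}) = {\<zero>\<^bsub>Sec F {}\<^esub>}"
proof -
  note e = zopen_empty[OF assms(2)]
  have "\<exists>!t. t \<in> carrier (Sec F (\<Union>{})) \<and> (\<forall>V\<in>{}. Rst F (\<Union>{}) V t = undefined)"
    by (rule modsheaf_onD(7)[OF assms(1)]) (use e in auto)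
  then have "\<exists>!t. t \<in> carrier (Sec F {})" by simp
  then show ?thesis
    using modsheaf_zero_closed[OF assms(1) e] by blast
qed

lemma modsheaf_Rst_zero:
  assumes F: "modsheaf_on Z F" and U: "zopen Z U" "zopen Z V" "V \<subseteq> U"
  shows "Rst F U V \<zero>\<^bsub>Sec F U\<^esub> = \<zero>\<^bsub>Sec F V\<^esub>"
proof -
  interpret U: abelian_group "Sec F U" using modsheaf_onD(1)[OF F U(1)] by (rule module.axioms(2))
  interpret V: abelian_group "Sec F V" using modsheaf_onD(1)[OF F U(2)] by (rule module.axioms(2))
  have "Rst F U V \<zero>\<^bsub>Sec F U\<^esub> \<oplus>\<^bsub>Sec F V\<^esub> Rst F U V \<zero>\<^bsub>Sec F U\<^esub> = Rst F U V \<zero>\<^bsub>Sec F U\<^esub>"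
    using modsheaf_onD(3)[OF F U, of "\<zero>\<^bsub>Sec F U\<^esub>" "\<zero>\<^bsub>Sec F U\<^esub>"] by simp
  then show ?thesis
    using modsheaf_onD(2)[OF F U, of "\<zero>\<^bsub>Sec F U\<^esub>"] by (simp add: V.add.r_cancel_one)
qed

lemma oring_restrict:
  assumes "zopen Z V" "V \<subseteq> U" "f \<in> carrier (oring Z U)"
  shows "restrict f V \<in> carrier (oring Z V)"
  using assms regular_on_cong[OF regular_on_mono, of Z U f V "restrict f V"]
  by (auto simp: oring_def)

lemma lincomb_closed:
  assumes F: "modsheaf_on Z F" and U: "zopen Z U"
    and f: "\<And>i. i < n \<Longrightarrow> f i \<in> carrier (oring Z U)" and s: "\<And>i. i < n \<Longrightarrow> s i \<in> carrier (Sec F U)"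
  shows "lincomb F U n f s \<in> carrier (Sec F U)"
proof -
  interpret module "oring Z U" "Sec F U" using modsheaf_onD(1)[OF F U] .
  show ?thesis
    unfolding lincomb_def using f s by (intro M.finsum_closed) auto
qed

lemma lincomb_Suc:
  assumes F: "modsheaf_on Z F" and U: "zopen Z U"
    and f: "\<And>i. i < Suc n \<Longrightarrow> f i \<in> carrier (oring Z U)" and s: "\<And>i. i < Suc n \<Longrightarrow> s i \<in> carrier (Sec F U)"
  shows "lincomb F U (Suc n) f s = f n \<odot>\<^bsub>Sec F U\<^esub> s n \<oplus>\<^bsub>Sec F U\<^esub> lincomb F U n f s"
proof -
  interpret module "oring Z U" "Sec F U" using modsheaf_onD(1)[OF F U] .
  show ?thesis
    unfolding lincomb_def lessThan_Suc using f s by (intro M.finsum_insert) auto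
qed

lemma lincomb_Rst:
  assumes F: "modsheaf_on Z F" and U: "zopen Z U" "zopen Z V" "V \<subseteq> U"
    and "\<And>i. i < n \<Longrightarrow> f i \<in> carrier (oring Z U)" "\<And>i. i < n \<Longrightarrow> s i \<in> carrier (Sec F U)"
  shows "Rst F U V (lincomb F U n f s) = lincomb F V n (\<lambda>i. restrict (f i) V) (\<lambda>i. Rst F U V (s i))"
  using assms(5,6)
proof (induction n)
  case 0
  interpret U: abelian_group "Sec F U" using modsheaf_onD(1)[OF F U(1)] by (rule module.axioms(2))
  interpret V: abelian_group "Sec F V" using modsheaf_onD(1)[OF F U(2)] by (rule module.axioms(2))
  show ?case using modsheaf_Rst_zero[OF F U] by (simp add: lincomb_def)
next
  case (Suc n)
  interpret U: module "oring Z U" "Sec F U" using modsheaf_onD(1)[OF F U(1)] .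
  have "Rst F U V (lincomb F U (Suc n) f s) =
      Rst F U V (f n \<odot>\<^bsub>Sec F U\<^esub> s n \<oplus>\<^bsub>Sec F U\<^esub> lincomb F U n f s)"
    using lincomb_Suc[OF F U(1)] Suc.prems by simp
  also have "\<dots> = Rst F U V (f n \<odot>\<^bsub>Sec F U\<^esub> s n) \<oplus>\<^bsub>Sec F V\<^esub> Rst F U V (lincomb F U n f s)"
    using Suc.prems by (intro modsheaf_onD(3)[OF F U] lincomb_closed[OF F U(1)] U.smult_closed) auto
  also have "\<dots> = restrict (f n) V \<odot>\<^bsub>Sec F V\<^esub> Rst F U V (s n) \<oplus>\<^bsub>Sec F V\<^esub>
      lincomb F V n (\<lambda>i. restrict (f i) V) (\<lambda>i. Rst F U V (s i))"
    unfolding modsheaf_onD(4)[OF F U Suc.prems(1)[OF lessI] Suc.prems(2)[OF lessI]]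
    using Suc.IH[OF Suc.prems(1)[OF less_SucI] Suc.prems(2)[OF less_SucI]] by (simp only:)
  also have "\<dots> = lincomb F V (Suc n) (\<lambda>i. restrict (f i) V) (\<lambda>i. Rst F U V (s i))"
    by (rule lincomb_Suc[OF F U(2), symmetric])
      (rule oring_restrict[OF U(2,3) Suc.prems(1)] modsheaf_onD(2)[OF F U Suc.prems(2)], assumption)+
  finally show ?case .
qed

lemma lincomb_cong:
  assumes F: "modsheaf_on Z F" and U: "zopen Z U"
    and "\<And>i. i < n \<Longrightarrow> f i \<in> carrier (oring Z U)" "\<And>i. i < n \<Longrightarrow> s i \<in> carrier (Sec F U)"
    and "\<And>i. i < n \<Longrightarrow> f i = f' i" "\<And>i. i < n \<Longrightarrow> s i = s' i"
  shows "lincomb F U n f s = lincomb F U n f' s'"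
proof -
  interpret module "oring Z U" "Sec F U" using modsheaf_onD(1)[OF F U] .
  show ?thesis
    unfolding lincomb_def by (rule M.finsum_cong') (use assms in auto)
qed

lemma lincomb_zero:
  assumes F: "modsheaf_on Z F" and U: "zopen Z U"
    and "\<And>i. i < n \<Longrightarrow> f i = \<zero>\<^bsub>oring Z U\<^esub>" "\<And>i. i < n \<Longrightarrow> s i \<in> carrier (Sec F U)"
  shows "lincomb F U n f s = \<zero>\<^bsub>Sec F U\<^esub>"
proof -
  interpret module "oring Z U" "Sec F U" using modsheaf_onD(1)[OF F U] .
  have "lincomb F U n f s = finsum (Sec F U) (\<lambda>i. \<zero>\<^bsub>Sec F U\<^esub>) {..<n}"
    unfolding lincomb_def by (rule M.finsum_cong') (use assms(3,4) smult_l_null in auto)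
  then show ?thesis by simp
qed

section \<open>The extension by zero along a closed subvariety\<close>

lemma extend_by_zero_simps:
  "carrier (Sec (extend_by_zero Y F) U) = carrier (Sec F (U \<inter> Y))"
  "\<zero>\<^bsub>Sec (extend_by_zero Y F) U\<^esub> = \<zero>\<^bsub>Sec F (U \<inter> Y)\<^esub>"
  "s \<oplus>\<^bsub>Sec (extend_by_zero Y F) U\<^esub> t = s \<oplus>\<^bsub>Sec F (U \<inter> Y)\<^esub> t"
  "f \<odot>\<^bsub>Sec (extend_by_zero Y F) U\<^esub> s = restrict f (U \<inter> Y) \<odot>\<^bsub>Sec F (U \<inter> Y)\<^esub> s"
  "Rst (extend_by_zero Y F) U V = Rst F (U \<inter> Y) (V \<inter> Y)"
  "add_monoid (Sec (extend_by_zero Y F) U) = add_monoid (Sec F (U \<inter> Y))"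
proof -
  have "{x \<in> Y. x \<in> U} = U \<inter> Y" for U by auto
  then show "carrier (Sec (extend_by_zero Y F) U) = carrier (Sec F (U \<inter> Y))"
    "\<zero>\<^bsub>Sec (extend_by_zero Y F) U\<^esub> = \<zero>\<^bsub>Sec F (U \<inter> Y)\<^esub>"
    "s \<oplus>\<^bsub>Sec (extend_by_zero Y F) U\<^esub> t = s \<oplus>\<^bsub>Sec F (U \<inter> Y)\<^esub> t"
    "f \<odot>\<^bsub>Sec (extend_by_zero Y F) U\<^esub> s = restrict f (U \<inter> Y) \<odot>\<^bsub>Sec F (U \<inter> Y)\<^esub> s"
    "Rst (extend_by_zero Y F) U V = Rst F (U \<inter> Y) (V \<inter> Y)"
    "add_monoid (Sec (extend_by_zero Y F) U) = add_monoid (Sec F (U \<inter> Y))"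
    by (auto simp: extend_by_zero_def direct_image_def Let_def comp_def)
qed

text \<open>\<open>finsum\<close> depends on the module through its \<open>add_monoid\<close> only,
  which the extension shares with \<open>F\<close>; the scalars alone have to be restricted.\<close>

lemma lincomb_extend_by_zero:
  "lincomb (extend_by_zero Y F) U n f s = lincomb F (U \<inter> Y) n (\<lambda>i. restrict (f i) (U \<inter> Y)) s"
  unfolding lincomb_def finsum_def extend_by_zero_simps ..

lemma zopen_extend:
  assumes "variety X" "Y \<subseteq> X" "zopen Y V"
  shows "zopen X (X - (Y - V))" "(X - (Y - V)) \<inter> Y = V"
proof -
  have "X - (X - (Y - V)) = Y - V" using assms(2) by blast
  then show "zopen X (X - (Y - V))" using assms(3) by (simp add: zopen_def Diff_subset)
  show "(X - (Y - V)) \<inter> Y = V" using assms(2) zopen_subset[OF assms(3)] by blast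
qed

lemma oring_regular: "f \<in> carrier (oring Z U) \<Longrightarrow> regular_on Z U f"
  by (simp add: oring_def)

lemma regular_restrict_oring: "regular_on Z U f \<Longrightarrow> restrict f U \<in> carrier (oring Z U)"
  using regular_on_cong[of Z U f "restrict f U"] by (auto simp: oring_def)

text \<open>The pair \<open>(l, j)\<close> is coded as \<open>l * n + j\<close>. The code numbers
  the relations of the form "generator \<open>l\<close> of the ideal times basis vector
  \<open>j\<close>".\<close>

lemma sum_pairs_lessThan: "(\<Sum>l<r. \<Sum>j<(n::nat). G l j) = (\<Sum>q<r * n. G (q div n) (q mod n))"
  for G :: "nat \<Rightarrow> nat \<Rightarrow> 'c::comm_monoid_add"
proof (cases "n = 0")
  case False
  have "(\<Sum>q<r * n. G (q div n) (q mod n)) = (\<Sum>l<r. \<Sum>q\<in>{l * n..<l * n + n}. G (q div n) (q mod n))"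
    by (rule sum.nat_group[symmetric])
  also have "\<dots> = (\<Sum>l<r. \<Sum>j<n. G l j)"
  proof (rule sum.cong[OF refl])
    fix l
    have "(\<Sum>q\<in>{l * n..<l * n + n}. G (q div n) (q mod n)) =
        (\<Sum>j\<in>{0..<n}. G ((j + l * n) div n) ((j + l * n) mod n))"
      using sum.shift_bounds_nat_ivl[of "\<lambda>q. G (q div n) (q mod n)" 0 "l * n" n] by (simp add: add.commute)
    also have "\<dots> = (\<Sum>j<n. G l j)"
      using False by (intro sum.cong) auto
    finally show "(\<Sum>q\<in>{l * n..<l * n + n}. G (q div n) (q mod n)) = (\<Sum>j<n. G l j)" .
  qed
  finally show ?thesis ..
qed simp

lemma sum_lessThan_add: "(\<Sum>k<m + n. f k) = (\<Sum>k<m. f k) + (\<Sum>k<n. f (m + k))"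
  for f :: "nat \<Rightarrow> 'c::comm_monoid_add" and m n :: nat
  by (induction n) (simp_all add: add.assoc)

text \<open>Finitely many local choices can be made on one neighbourhood, the intersection, because
  \<open>P\<close> survives shrinking.\<close>

lemma finite_zopen_choice:
  assumes "zopen X W" "y \<in> W"
    and "\<And>i. i < (n::nat) \<Longrightarrow> \<exists>W' b. zopen X W' \<and> y \<in> W' \<and> W' \<subseteq> W \<and> P i W' b"
    and mono: "\<And>i W' W'' b. P i W' b \<Longrightarrow> zopen X W'' \<Longrightarrow> W'' \<subseteq> W' \<Longrightarrow> P i W'' b"
  shows "\<exists>W' b. zopen X W' \<and> y \<in> W' \<and> W' \<subseteq> W \<and> (\<forall>i<n. P i W' (b i))"
  using assms(3)
proof (induction n)
  case 0
  show ?case using assms(1,2) by (intro exI[of _ W]) auto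
next
  case (Suc n)
  obtain W1 b where W1: "zopen X W1" "y \<in> W1" "W1 \<subseteq> W" "\<forall>i<n. P i W1 (b i)"
  proof -
    have "\<exists>W' b. zopen X W' \<and> y \<in> W' \<and> W' \<subseteq> W \<and> (\<forall>i<n. P i W' (b i))"
      by (rule Suc.IH) (rule Suc.prems, simp)
    then show thesis by (elim exE conjE) (rule that)
  qed
  obtain W2 c where W2: "zopen X W2" "y \<in> W2" "W2 \<subseteq> W" "P n W2 c"
    using Suc.prems[OF lessI] by (elim exE conjE)
  have W12: "zopen X (W1 \<inter> W2)" by (rule zopen_Int[OF W1(1) W2(1)])
  have "P i (W1 \<inter> W2) ((b(n := c)) i)" if "i < Suc n" for i
  proof (cases "i = n")
    case True
    then show ?thesis using mono[OF W2(4) W12] by simp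
  next
    case False
    then show ?thesis using mono[of i W1 "b i" "W1 \<inter> W2"] W12 W1(4) that by simp
  qed
  then show ?case
    using W12 W1(2,3) W2(2) by (intro exI[of _ "W1 \<inter> W2"] exI[of _ "b(n := c)"]) auto
qed

context
  fixes X Y :: "pt set" and F :: "'a modsheaf"
  assumes X: "variety X" and Y: "variety Y" and YX: "Y \<subseteq> X" and F: "modsheaf_on Y F"
begin

lemma oring_restrict_variety:
  assumes "zopen X U" "f \<in> carrier (oring X U)"
  shows "restrict f (U \<inter> Y) \<in> carrier (oring Y (U \<inter> Y))"
  using assms regular_on_cong[OF regular_on_restrict_variety[OF Y YX, of U f], of "restrict f (U \<inter> Y)"]
  by (auto simp: oring_def)

lemma module_extend_by_zero:
  assumes U: "zopen X U"
  shows "module (oring X U) (Sec (extend_by_zero Y F) U)"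
proof -
  have UY: "zopen Y (U \<inter> Y)" by (rule zopen_restrict[OF Y YX U])
  interpret M: module "oring Y (U \<inter> Y)" "Sec F (U \<inter> Y)" by (rule modsheaf_onD(1)[OF F UY])
  note r = oring_restrict_variety[OF U]
  have r_add: "restrict (f \<oplus>\<^bsub>oring X U\<^esub> g) (U \<inter> Y) =
      restrict f (U \<inter> Y) \<oplus>\<^bsub>oring Y (U \<inter> Y)\<^esub> restrict g (U \<inter> Y)"
    and r_mult: "restrict (f \<otimes>\<^bsub>oring X U\<^esub> g) (U \<inter> Y) =
      restrict f (U \<inter> Y) \<otimes>\<^bsub>oring Y (U \<inter> Y)\<^esub> restrict g (U \<inter> Y)"
    and r_one: "restrict \<one>\<^bsub>oring X U\<^esub> (U \<inter> Y) = \<one>\<^bsub>oring Y (U \<inter> Y)\<^esub>" for f g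
    by (auto simp: oring_def fun_eq_iff)
  show ?thesis
  proof (rule moduleI)
    show "cring (oring X U)" by (rule oring_cring[OF U X])
    show "abelian_group (Sec (extend_by_zero Y F) U)"
      using M.M.abelian_group_axioms
      unfolding abelian_group_def abelian_monoid_def abelian_group_axioms_def extend_by_zero_simps .
  qed (auto simp: extend_by_zero_simps r_add r_mult r_one r M.smult_l_distr M.smult_r_distr M.smult_assoc1)
qed

lemma modsheaf_extend_by_zero: "modsheaf_on X (extend_by_zero Y F)"
proof -
  note r = zopen_restrict[OF Y YX]
  have glue: "\<exists>!t. t \<in> carrier (Sec F (\<Union>\<V> \<inter> Y)) \<and> (\<forall>V\<in>\<V>. Rst F (\<Union>\<V> \<inter> Y) (V \<inter> Y) t = s V)"
    if V: "\<And>V. V \<in> \<V> \<Longrightarrow> zopen X V" and s: "\<And>V. V \<in> \<V> \<Longrightarrow> s V \<in> carrier (Sec F (V \<inter> Y))"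
      and U: "zopen X (\<Union>\<V>)"
      and comp: "\<And>V W. V \<in> \<V> \<Longrightarrow> W \<in> \<V> \<Longrightarrow>
        Rst F (V \<inter> Y) (V \<inter> W \<inter> Y) (s V) = Rst F (W \<inter> Y) (V \<inter> W \<inter> Y) (s W)" for \<V> s
  proof -
    \<comment> \<open>Different members of the cover of \<open>X\<close> may have the same trace on
      \<open>Y\<close>. Their sections agree then, so a section can be attached to the trace, as the
      gluing axiom on \<open>Y\<close> requires.\<close>
    define \<sigma> where "\<sigma> A = s (SOME V. V \<in> \<V> \<and> V \<inter> Y = A)" for A
    have same: "s V = s W" if "V \<in> \<V>" "W \<in> \<V>" "V \<inter> Y = W \<inter> Y" for V W
    proof -
      have "V \<inter> W \<inter> Y = W \<inter> Y" using that(3) by blast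
      then have "Rst F (W \<inter> Y) (W \<inter> Y) (s V) = Rst F (W \<inter> Y) (W \<inter> Y) (s W)"
        using comp[OF that(1,2)] that(3) by simp
      moreover have "s V \<in> carrier (Sec F (W \<inter> Y))" "s W \<in> carrier (Sec F (W \<inter> Y))"
        using s[OF that(1)] s[OF that(2)] that(3) by simp_all
      ultimately show ?thesis
        using modsheaf_onD(5)[OF F r[OF V[OF that(2)]]] by simp
    qed
    have \<sigma>: "\<sigma> (V \<inter> Y) = s V" if "V \<in> \<V>" for V
    proof -
      have "(SOME W. W \<in> \<V> \<and> W \<inter> Y = V \<inter> Y) \<in> \<V> \<and> (SOME W. W \<in> \<V> \<and> W \<inter> Y = V \<inter> Y) \<inter> Y = V \<inter> Y"
        using that by (intro someI[of "\<lambda>W. W \<in> \<V> \<and> W \<inter> Y = V \<inter> Y"]) simp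
      then show ?thesis unfolding \<sigma>_def using same that by blast
    qed
    have un: "\<Union>((\<lambda>V. V \<inter> Y) ` \<V>) = \<Union>\<V> \<inter> Y" by blast
    have "\<exists>!t. t \<in> carrier (Sec F (\<Union>((\<lambda>V. V \<inter> Y) ` \<V>))) \<and>
        (\<forall>A\<in>(\<lambda>V. V \<inter> Y) ` \<V>. Rst F (\<Union>((\<lambda>V. V \<inter> Y) ` \<V>)) A t = \<sigma> A)"
    proof (rule modsheaf_onD(7)[OF F])
      show "zopen Y A" if "A \<in> (\<lambda>V. V \<inter> Y) ` \<V>" for A using that V r by auto
      show "\<sigma> A \<in> carrier (Sec F A)" if "A \<in> (\<lambda>V. V \<inter> Y) ` \<V>" for A using that s \<sigma> by auto
      show "zopen Y (\<Union>((\<lambda>V. V \<inter> Y) ` \<V>))" unfolding un by (rule r[OF U])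
      show "Rst F A (A \<inter> B) (\<sigma> A) = Rst F B (A \<inter> B) (\<sigma> B)"
        if AB: "A \<in> (\<lambda>V. V \<inter> Y) ` \<V>" "B \<in> (\<lambda>V. V \<inter> Y) ` \<V>" for A B
      proof -
        obtain V W where VW: "A = V \<inter> Y" "V \<in> \<V>" "B = W \<inter> Y" "W \<in> \<V>" using AB by blast
        then have "A \<inter> B = V \<inter> W \<inter> Y" by blast
        then show ?thesis using comp[OF VW(2,4)] \<sigma> VW by simp
      qed
    qed
    then show ?thesis unfolding un by (simp add: \<sigma>)
  qed
  show ?thesis
    unfolding modsheaf_on_def extend_by_zero_simps
  proof (intro conjI allI impI ballI Pi_I)
    fix U assume "zopen X U"
    then show "module (oring X U) (Sec (extend_by_zero Y F) U)" by (rule module_extend_by_zero)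
  next
    fix U V s assume "zopen X U \<and> zopen X V \<and> V \<subseteq> U" "s \<in> carrier (Sec F (U \<inter> Y))"
    then show "Rst F (U \<inter> Y) (V \<inter> Y) s \<in> carrier (Sec F (V \<inter> Y))"
      by (intro modsheaf_onD(2)[OF F] r) auto
  next
    fix U V s t assume "zopen X U \<and> zopen X V \<and> V \<subseteq> U" "s \<in> carrier (Sec F (U \<inter> Y))" "t \<in> carrier (Sec F (U \<inter> Y))"
    then show "Rst F (U \<inter> Y) (V \<inter> Y) (s \<oplus>\<^bsub>Sec F (U \<inter> Y)\<^esub> t) =
        Rst F (U \<inter> Y) (V \<inter> Y) s \<oplus>\<^bsub>Sec F (V \<inter> Y)\<^esub> Rst F (U \<inter> Y) (V \<inter> Y) t"
      by (intro modsheaf_onD(3)[OF F] r) auto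
  next
    fix U V f s
    assume a: "zopen X U \<and> zopen X V \<and> V \<subseteq> U" "f \<in> carrier (oring X U)" "s \<in> carrier (Sec F (U \<inter> Y))"
    then have "restrict (restrict f V) (V \<inter> Y) = restrict (restrict f (U \<inter> Y)) (V \<inter> Y)"
      by (auto simp: restrict_def fun_eq_iff)
    then show "Rst F (U \<inter> Y) (V \<inter> Y) (restrict f (U \<inter> Y) \<odot>\<^bsub>Sec F (U \<inter> Y)\<^esub> s) =
        restrict (restrict f V) (V \<inter> Y) \<odot>\<^bsub>Sec F (V \<inter> Y)\<^esub> Rst F (U \<inter> Y) (V \<inter> Y) s"
      using a by (simp only:) (intro modsheaf_onD(4)[OF F] r oring_restrict_variety, auto)
  next
    fix U s assume "zopen X U" "s \<in> carrier (Sec F (U \<inter> Y))"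
    then show "Rst F (U \<inter> Y) (U \<inter> Y) s = s" by (intro modsheaf_onD(5)[OF F] r)
  next
    fix U V W s assume "zopen X U \<and> zopen X V \<and> zopen X W \<and> W \<subseteq> V \<and> V \<subseteq> U" "s \<in> carrier (Sec F (U \<inter> Y))"
    then show "Rst F (V \<inter> Y) (W \<inter> Y) (Rst F (U \<inter> Y) (V \<inter> Y) s) = Rst F (U \<inter> Y) (W \<inter> Y) s"
      by (intro modsheaf_onD(6)[OF F] r) auto
  next
    fix \<V> s
    assume "(\<forall>V\<in>\<V>. zopen X V \<and> s V \<in> carrier (Sec F (V \<inter> Y))) \<and> zopen X (\<Union>\<V>) \<and>
      (\<forall>V\<in>\<V>. \<forall>W\<in>\<V>. Rst F (V \<inter> Y) (V \<inter> W \<inter> Y) (s V) = Rst F (W \<inter> Y) (V \<inter> W \<inter> Y) (s W))"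
    then show "\<exists>!t. t \<in> carrier (Sec F (\<Union>\<V> \<inter> Y)) \<and> (\<forall>V\<in>\<V>. Rst F (\<Union>\<V> \<inter> Y) (V \<inter> Y) t = s V)"
      by (intro glue) blast+
  qed
qed

lemma extend_regular_family:
  assumes "zopen Y U" "y \<in> U" "zopen X V" "y \<in> V" "finite I" "\<And>i. i \<in> I \<Longrightarrow> regular_on Y U (f i)"
  obtains W f' where "zopen X W" "y \<in> W" "W \<subseteq> V" "W \<inter> Y \<subseteq> U" "\<forall>i\<in>I. regular_on X W (f' i)"
    "\<forall>i\<in>I. \<forall>z\<in>W \<inter> Y. f' i z = f i z"
proof -
  have "\<exists>W f'. zopen X W \<and> y \<in> W \<and> W \<subseteq> V \<and> W \<inter> Y \<subseteq> U \<and> (\<forall>i\<in>I. regular_on X W (f' i)) \<and>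
      (\<forall>i\<in>I. \<forall>z\<in>W \<inter> Y. f' i z = f i z)"
    using assms(5,6)
  proof (induction I rule: finite_induct)
    case empty
    have "zopen X (V \<inter> (X - (Y - U)))"
      by (rule zopen_Int[OF assms(3) zopen_extend(1)[OF X YX assms(1)]])
    moreover have "y \<in> V \<inter> (X - (Y - U))"
      using assms(2,4) zopen_subset[OF assms(3)] by blast
    moreover have "V \<inter> (X - (Y - U)) \<inter> Y \<subseteq> U" by blast
    ultimately show ?case by blast
  next
    case (insert i I)
    then obtain W f' where W: "zopen X W" "y \<in> W" "W \<subseteq> V" "W \<inter> Y \<subseteq> U" "\<forall>i\<in>I. regular_on X W (f' i)"
        "\<forall>i\<in>I. \<forall>z\<in>W \<inter> Y. f' i z = f i z"
      by auto
    obtain W1 g where W1: "zopen X W1" "y \<in> W1" "W1 \<inter> Y \<subseteq> U" "regular_on X W1 g"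
        "\<And>z. z \<in> W1 \<inter> Y \<Longrightarrow> g z = f i z"
      using regular_on_extend[OF X Y YX, of U "f i" y] insert.prems assms(2) by (metis insertI1)
    have W2: "zopen X (W \<inter> W1)" by (rule zopen_Int[OF W(1) W1(1)])
    have "\<forall>k\<in>insert i I. regular_on X (W \<inter> W1) ((f'(i := g)) k)"
      using W(5) W1(4) regular_on_mono[OF _ W2] by auto
    moreover have "\<forall>k\<in>insert i I. \<forall>z\<in>W \<inter> W1 \<inter> Y. (f'(i := g)) k z = f k z"
      using W(6) W1(5) by auto
    moreover have "y \<in> W \<inter> W1" "W \<inter> W1 \<subseteq> V" "W \<inter> W1 \<inter> Y \<subseteq> U"
      using W(2,3,4) W1(2) by auto
    ultimately show ?case using W2 by (intro exI[of _ "W \<inter> W1"] exI[of _ "f'(i := g)"] conjI)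
  qed
  then show thesis by (elim exE conjE) (rule that)
qed

lemma section_off_support:
  assumes "s \<in> carrier (Sec F (U \<inter> Y))" "U \<inter> Y = {}"
  shows "s = \<zero>\<^bsub>Sec F (U \<inter> Y)\<^esub>"
  using assms modsheaf_empty[OF F Y] by simp

text \<open>Generators of \<open>F\<close> over \<open>U\<close> also serve over the open set of
  \<open>X\<close> with trace \<open>U\<close>: at points of \<open>Y\<close> the coefficients
  extend locally to \<open>X\<close>, and at other points all sections vanish after
  shrinking.\<close>

lemma finite_type_extend_by_zero:
  assumes "finite_type Y F"
  shows "finite_type X (extend_by_zero Y F)"
  unfolding finite_type_def extend_by_zero_simps lincomb_extend_by_zero
proof
  note r = zopen_restrict[OF Y YX]
  have XY: "zopen X (X - Y)" by (rule zopen_diff[OF Y YX])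
  fix x assume "x \<in> X"
  show "\<exists>U n s. zopen X U \<and> x \<in> U \<and> (\<forall>i<n. s i \<in> carrier (Sec F (U \<inter> Y))) \<and>
      (\<forall>V t. zopen X V \<and> V \<subseteq> U \<and> t \<in> carrier (Sec F (V \<inter> Y)) \<longrightarrow>
        (\<forall>y\<in>V. \<exists>W f. zopen X W \<and> y \<in> W \<and> W \<subseteq> V \<and> (\<forall>i<n. f i \<in> carrier (oring X W)) \<and>
           Rst F (V \<inter> Y) (W \<inter> Y) t =
           lincomb F (W \<inter> Y) n (\<lambda>i. restrict (f i) (W \<inter> Y)) (\<lambda>i. Rst F (U \<inter> Y) (W \<inter> Y) (s i))))"
    (is "\<exists>U n s. ?P U n s")
  proof (cases "x \<in> Y")
    case False
    \<comment> \<open>Off \<open>Y\<close> every section is zero, so an empty family of generators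
      is enough.\<close>
    have "?P (X - Y) 0 (\<lambda>i. undefined)"
    proof (intro conjI allI impI ballI)
      fix V t y assume V: "zopen X V \<and> V \<subseteq> X - Y \<and> t \<in> carrier (Sec F (V \<inter> Y))" and "y \<in> V"
      have "Rst F (V \<inter> Y) (V \<inter> Y) t = \<zero>\<^bsub>Sec F (V \<inter> Y)\<^esub>"
        using V r by (intro section_off_support modsheaf_onD(2)[OF F]) auto
      moreover have "lincomb F (V \<inter> Y) 0 (\<lambda>i. restrict (undefined i) (V \<inter> Y))
          (\<lambda>i. Rst F ((X - Y) \<inter> Y) (V \<inter> Y) undefined) = \<zero>\<^bsub>Sec F (V \<inter> Y)\<^esub>"
        using V r by (intro lincomb_zero[OF F]) auto
      ultimately show "\<exists>W f. zopen X W \<and> y \<in> W \<and> W \<subseteq> V \<and> (\<forall>i<0. f i \<in> carrier (oring X W)) \<and>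
          Rst F (V \<inter> Y) (W \<inter> Y) t = lincomb F (W \<inter> Y) 0 (\<lambda>i. restrict (f i) (W \<inter> Y))
            (\<lambda>i. Rst F ((X - Y) \<inter> Y) (W \<inter> Y) undefined)"
        using V \<open>y \<in> V\<close> by (intro exI[of _ V] exI[of _ undefined]) auto
    qed (use \<open>x \<in> X\<close> False XY in auto)
    then show ?thesis
      by (rule exI[of _ "X - Y", OF exI[of _ 0, OF exI[of _ "\<lambda>i. undefined"]]])
  next
    case True
    then obtain U n s where U: "zopen Y U" "x \<in> U" "\<forall>i<n. s i \<in> carrier (Sec F U)"
      and gen: "\<forall>V t. zopen Y V \<and> V \<subseteq> U \<and> t \<in> carrier (Sec F V) \<longrightarrow>
        (\<forall>y\<in>V. \<exists>W f. zopen Y W \<and> y \<in> W \<and> W \<subseteq> V \<and> (\<forall>i<n. f i \<in> carrier (oring Y W)) \<and>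
           Rst F V W t = lincomb F W n f (\<lambda>i. Rst F U W (s i)))"
      using assms[unfolded finite_type_def, THEN bspec, OF True] by (elim exE conjE)
    define U' where "U' = X - (Y - U)"
    have U': "zopen X U'" "U' \<inter> Y = U"
      using zopen_extend[OF X YX U(1)] by (simp_all add: U'_def)
    have "?P U' n s"
    proof (intro conjI allI impI ballI)
      show "x \<in> U'" using U(2) U'(2) by blast
      show "s i \<in> carrier (Sec F (U' \<inter> Y))" if "i < n" for i using U(3) U'(2) that by simp
      fix V t y assume V: "zopen X V \<and> V \<subseteq> U' \<and> t \<in> carrier (Sec F (V \<inter> Y))" and yV: "y \<in> V"
      have VY: "zopen Y (V \<inter> Y)" using V r by blast
      have VU: "V \<inter> Y \<subseteq> U" using V U'(2) by blast
      show "\<exists>W f. zopen X W \<and> y \<in> W \<and> W \<subseteq> V \<and> (\<forall>i<n. f i \<in> carrier (oring X W)) \<and>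
          Rst F (V \<inter> Y) (W \<inter> Y) t = lincomb F (W \<inter> Y) n (\<lambda>i. restrict (f i) (W \<inter> Y))
            (\<lambda>i. Rst F (U' \<inter> Y) (W \<inter> Y) (s i))"
      proof (cases "y \<in> Y")
        case False
        define W where "W = V \<inter> (X - Y)"
        have W: "zopen X W" "y \<in> W" "W \<subseteq> V" "W \<inter> Y = {}"
          using V yV False zopen_subset[of X V] zopen_Int[OF _ XY, of V] unfolding W_def by auto
        have WY: "zopen Y (W \<inter> Y)" by (rule r[OF W(1)])
        have f0: "restrict (\<lambda>x. 0) W \<in> carrier (oring X W)"
          by (rule regular_restrict_oring[OF regular_on_const[OF W(1)]])
        have "Rst F (V \<inter> Y) (W \<inter> Y) t = \<zero>\<^bsub>Sec F (W \<inter> Y)\<^esub>"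
          using V W(3) by (intro section_off_support[OF _ W(4)] modsheaf_onD(2)[OF F VY WY]) auto
        moreover have "lincomb F (W \<inter> Y) n (\<lambda>i. restrict (restrict (\<lambda>x. 0) W) (W \<inter> Y))
            (\<lambda>i. Rst F (U' \<inter> Y) (W \<inter> Y) (s i)) = \<zero>\<^bsub>Sec F (W \<inter> Y)\<^esub>"
          using U(1,3) U'(2) WY oring_restrict_variety[OF W(1) f0] W(4)
          by (intro section_off_support[OF _ W(4)] lincomb_closed[OF F WY] modsheaf_onD(2)[OF F _ WY])
            auto
        ultimately show ?thesis
          using W f0 by (intro exI[of _ W] exI[of _ "\<lambda>i. restrict (\<lambda>x. 0) W"]) auto
      next
        case True
        then have "y \<in> V \<inter> Y" using yV by blast
        then obtain W1 f where W1: "zopen Y W1" "y \<in> W1" "W1 \<subseteq> V \<inter> Y" "\<forall>i<n. f i \<in> carrier (oring Y W1)"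
            "Rst F (V \<inter> Y) W1 t = lincomb F W1 n f (\<lambda>i. Rst F U W1 (s i))"
          using gen[rule_format, of "V \<inter> Y" t y] VY VU V by blast
        have "zopen X V" using V by blast
        obtain W f' where W: "zopen X W" "y \<in> W" "W \<subseteq> V" "W \<inter> Y \<subseteq> W1"
            "\<forall>i\<in>{..<n}. regular_on X W (f' i)" "\<forall>i\<in>{..<n}. \<forall>z\<in>W \<inter> Y. f' i z = f i z"
          by (rule extend_regular_family[OF W1(1,2) \<open>zopen X V\<close> yV, of "{..<n}" f])
            (use W1(4) oring_regular in auto)
        have WY: "zopen Y (W \<inter> Y)" by (rule r[OF W(1)])
        have fW: "restrict (f' i) W \<in> carrier (oring X W)" if "i < n" for i
          using W(5) that by (auto intro: regular_restrict_oring)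
        have sW1: "Rst F U W1 (s i) \<in> carrier (Sec F W1)" if "i < n" for i
          using U W1(1,3) VU that by (intro modsheaf_onD(2)[OF F U(1) W1(1)]) auto
        have "Rst F (V \<inter> Y) (W \<inter> Y) t = Rst F W1 (W \<inter> Y) (Rst F (V \<inter> Y) W1 t)"
          using V by (intro modsheaf_onD(6)[OF F VY W1(1) WY W(4) W1(3), symmetric]) auto
        also have "\<dots> = lincomb F (W \<inter> Y) n (\<lambda>i. restrict (f i) (W \<inter> Y)) (\<lambda>i. Rst F W1 (W \<inter> Y) (Rst F U W1 (s i)))"
          unfolding W1(5) using W1(4) sW1 by (intro lincomb_Rst[OF F W1(1) WY W(4)]) auto
        also have "\<dots> = lincomb F (W \<inter> Y) n (\<lambda>i. restrict (restrict (f' i) W) (W \<inter> Y)) (\<lambda>i. Rst F (U' \<inter> Y) (W \<inter> Y) (s i))"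
        proof (rule lincomb_cong[OF F WY])
          fix i assume i: "i < n"
          show "restrict (f i) (W \<inter> Y) \<in> carrier (oring Y (W \<inter> Y))"
            using W1(4) i W(4) WY by (blast intro: oring_restrict)
          show "Rst F W1 (W \<inter> Y) (Rst F U W1 (s i)) \<in> carrier (Sec F (W \<inter> Y))"
            by (rule modsheaf_onD(2)[OF F W1(1) WY W(4) sW1[OF i]])
          show "restrict (f i) (W \<inter> Y) = restrict (restrict (f' i) W) (W \<inter> Y)"
            using W(6) i by (auto simp: fun_eq_iff)
          show "Rst F W1 (W \<inter> Y) (Rst F U W1 (s i)) = Rst F (U' \<inter> Y) (W \<inter> Y) (s i)"
            unfolding U'(2) using U(3) i W1(3) VU
            by (intro modsheaf_onD(6)[OF F U(1) W1(1) WY W(4)]) auto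
        qed
        finally show ?thesis
          using W fW by (intro exI[of _ W] exI[of _ "\<lambda>i. restrict (f' i) W"]) auto
      qed
    qed (use U' in auto)
    then show ?thesis by (rule exI[of _ U', OF exI[of _ n, OF exI[of _ s]]])
  qed
qed

text \<open>A tuple of functions is a relation over \<open>X\<close> exactly if its restriction to
  \<open>Y\<close> is one. Subtracting a combination of lifted relations leaves a tuple of functions
  that vanish on \<open>Y\<close>, and these are governed by the ideal sheaf.\<close>

lemma finite_type_relations_extend_by_zero:
  assumes rel: "finite_type_relations Y F"
  shows "finite_type_relations X (extend_by_zero Y F)"
  unfolding finite_type_relations_def extend_by_zero_simps lincomb_extend_by_zero
proof (intro allI impI ballI)
  note r = zopen_restrict[OF Y YX]
  have XY: "zopen X (X - Y)" by (rule zopen_diff[OF Y YX])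
  interpret X: fun_space "zopen X" "regular_on X" by (rule zariski_fun_space[OF X])
  fix U n s x
  assume U_s: "zopen X U \<and> (\<forall>i<(n::nat). s i \<in> carrier (Sec F (U \<inter> Y)))" and xU: "x \<in> U"
  then have U: "zopen X U" and s: "\<And>i. i < n \<Longrightarrow> s i \<in> carrier (Sec F (U \<inter> Y))" by blast+
  note UY = r[OF U]
  have "x \<in> X" using xU zopen_subset[OF U] by blast
  text \<open>Lifts to \<open>X\<close> of generators of the relations over \<open>Y\<close>; they vanish if \<open>x\<close> is not in \<open>Y\<close>.\<close>
  obtain V0 m g where V0: "zopen X V0" "x \<in> V0" "V0 \<subseteq> U"
    and g: "\<And>k i. k < (m::nat) \<Longrightarrow> i < n \<Longrightarrow> regular_on X V0 (g k i)"
    and g_rel: "\<And>k V. k < m \<Longrightarrow> zopen X V \<Longrightarrow> V \<subseteq> V0 \<Longrightarrow>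
        lincomb F (V \<inter> Y) n (\<lambda>i. restrict (g k i) (V \<inter> Y)) (\<lambda>i. Rst F (U \<inter> Y) (V \<inter> Y) (s i)) = \<zero>\<^bsub>Sec F (V \<inter> Y)\<^esub>"
    and g_gen: "\<And>W h y. zopen X W \<Longrightarrow> W \<subseteq> V0 \<Longrightarrow> (\<And>i. i < n \<Longrightarrow> h i \<in> carrier (oring X W)) \<Longrightarrow>
        lincomb F (W \<inter> Y) n (\<lambda>i. restrict (h i) (W \<inter> Y)) (\<lambda>i. Rst F (U \<inter> Y) (W \<inter> Y) (s i)) = \<zero>\<^bsub>Sec F (W \<inter> Y)\<^esub> \<Longrightarrow>
        y \<in> W \<Longrightarrow> \<exists>W' a. zopen X W' \<and> y \<in> W' \<and> W' \<subseteq> W \<and> (\<forall>k<m. regular_on X W' (a k)) \<and>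
          (\<forall>i<n. \<forall>z\<in>W' \<inter> Y. h i z = (\<Sum>k<m. a k z * g k i z))"
  proof (cases "x \<in> Y")
    case False
    define V0 where "V0 = U \<inter> (X - Y)"
    show thesis
    proof
      show "zopen X V0" unfolding V0_def by (rule zopen_Int[OF U XY])
      show "x \<in> V0" "V0 \<subseteq> U" unfolding V0_def using xU False \<open>x \<in> X\<close> by auto
      fix W and h :: "nat \<Rightarrow> pt \<Rightarrow> complex" and y assume "zopen X W" "W \<subseteq> V0" "y \<in> W"
      then show "\<exists>W' a. zopen X W' \<and> y \<in> W' \<and> W' \<subseteq> W \<and> (\<forall>k<(0::nat). regular_on X W' (a k)) \<and>
          (\<forall>i<n. \<forall>z\<in>W' \<inter> Y. h i z = (\<Sum>k<(0::nat). a k z * undefined k i z))"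
        unfolding V0_def by (intro exI[of _ W] exI[of _ undefined]) auto
    qed auto
  next
    case True
    then have "x \<in> U \<inter> Y" using xU by blast
    obtain VY m gY where VY: "zopen Y VY" "x \<in> VY" "VY \<subseteq> U \<inter> Y"
      and gY: "\<forall>k<m. (\<forall>i<n. gY k i \<in> carrier (oring Y VY)) \<and>
          lincomb F VY n (gY k) (\<lambda>i. Rst F (U \<inter> Y) VY (s i)) = \<zero>\<^bsub>Sec F VY\<^esub>"
      and gY_gen: "\<forall>W h. zopen Y W \<and> W \<subseteq> VY \<and> (\<forall>i<n. h i \<in> carrier (oring Y W)) \<and>
          lincomb F W n h (\<lambda>i. Rst F (U \<inter> Y) W (s i)) = \<zero>\<^bsub>Sec F W\<^esub> \<longrightarrow>
          (\<forall>y\<in>W. \<exists>W' a. zopen Y W' \<and> y \<in> W' \<and> W' \<subseteq> W \<and> (\<forall>k<(m::nat). a k \<in> carrier (oring Y W')) \<and>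
              (\<forall>i<n. \<forall>z\<in>W'. h i z = (\<Sum>k<m. a k z * gY k i z)))"
      using rel[unfolded finite_type_relations_def, rule_format, of "U \<inter> Y" n s, OF conjI, OF UY _ \<open>x \<in> U \<inter> Y\<close>] s
      by (elim meta_mp[elim_format] exE conjE) auto
    obtain V0 f' where V0: "zopen X V0" "x \<in> V0" "V0 \<subseteq> U" "V0 \<inter> Y \<subseteq> VY"
        "\<forall>p\<in>{..<m} \<times> {..<n}. regular_on X V0 (f' p)"
        "\<forall>p\<in>{..<m} \<times> {..<n}. \<forall>z\<in>V0 \<inter> Y. f' p z = (case p of (k, i) \<Rightarrow> gY k i) z"
      by (rule extend_regular_family[OF VY(1,2) U xU, of "{..<m} \<times> {..<n}" "\<lambda>(k, i). gY k i"])
        (use gY oring_regular in auto)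
    show thesis
    proof
      show "zopen X V0" "x \<in> V0" "V0 \<subseteq> U" by fact+
      show "regular_on X V0 ((\<lambda>k i. f' (k, i)) k i)" if "k < m" "i < n" for k i
        using V0(5) that by auto
    next
      fix k V assume k: "k < m" and V: "zopen X V" "V \<subseteq> V0"
      note VY' = r[OF V(1)]
      have sub: "V \<inter> Y \<subseteq> VY" using V(2) V0(4) by blast
      have gk: "\<And>i. i < n \<Longrightarrow> gY k i \<in> carrier (oring Y VY)" using gY k by blast
      have sV: "\<And>i. i < n \<Longrightarrow> Rst F (U \<inter> Y) VY (s i) \<in> carrier (Sec F VY)"
        by (rule modsheaf_onD(2)[OF F UY VY(1,3) s])
      have "lincomb F (V \<inter> Y) n (\<lambda>i. restrict (gY k i) (V \<inter> Y)) (\<lambda>i. Rst F VY (V \<inter> Y) (Rst F (U \<inter> Y) VY (s i))) =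
          \<zero>\<^bsub>Sec F (V \<inter> Y)\<^esub>"
        using lincomb_Rst[where n = n and f = "gY k" and s = "\<lambda>i. Rst F (U \<inter> Y) VY (s i)", OF F VY(1) VY' sub gk sV]
          modsheaf_Rst_zero[OF F VY(1) VY' sub] gY k by metis
      moreover have "lincomb F (V \<inter> Y) n (\<lambda>i. restrict (gY k i) (V \<inter> Y)) (\<lambda>i. Rst F VY (V \<inter> Y) (Rst F (U \<inter> Y) VY (s i))) =
          lincomb F (V \<inter> Y) n (\<lambda>i. restrict (f' (k, i)) (V \<inter> Y)) (\<lambda>i. Rst F (U \<inter> Y) (V \<inter> Y) (s i))"
      proof (rule lincomb_cong[OF F VY'])
        fix i assume i: "i < n"
        show "restrict (gY k i) (V \<inter> Y) \<in> carrier (oring Y (V \<inter> Y))"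
          by (rule oring_restrict[OF VY' sub gk[OF i]])
        show "Rst F VY (V \<inter> Y) (Rst F (U \<inter> Y) VY (s i)) \<in> carrier (Sec F (V \<inter> Y))"
          by (rule modsheaf_onD(2)[OF F VY(1) VY' sub sV[OF i]])
        show "restrict (gY k i) (V \<inter> Y) = restrict (f' (k, i)) (V \<inter> Y)"
          using V0(6) k i V(2) by (auto simp: fun_eq_iff)
        show "Rst F VY (V \<inter> Y) (Rst F (U \<inter> Y) VY (s i)) = Rst F (U \<inter> Y) (V \<inter> Y) (s i)"
          by (rule modsheaf_onD(6)[OF F UY VY(1) VY' sub VY(3) s[OF i]])
      qed
      ultimately show "lincomb F (V \<inter> Y) n (\<lambda>i. restrict ((\<lambda>k i. f' (k, i)) k i) (V \<inter> Y)) (\<lambda>i. Rst F (U \<inter> Y) (V \<inter> Y) (s i)) =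
          \<zero>\<^bsub>Sec F (V \<inter> Y)\<^esub>"
        by simp
    next
      fix W h y
      assume W: "zopen X W" "W \<subseteq> V0" and h: "\<And>i. i < n \<Longrightarrow> h i \<in> carrier (oring X W)"
        and h0: "lincomb F (W \<inter> Y) n (\<lambda>i. restrict (h i) (W \<inter> Y)) (\<lambda>i. Rst F (U \<inter> Y) (W \<inter> Y) (s i)) = \<zero>\<^bsub>Sec F (W \<inter> Y)\<^esub>"
        and y: "y \<in> W"
      show "\<exists>W' a. zopen X W' \<and> y \<in> W' \<and> W' \<subseteq> W \<and> (\<forall>k<m. regular_on X W' (a k)) \<and>
          (\<forall>i<n. \<forall>z\<in>W' \<inter> Y. h i z = (\<Sum>k<m. a k z * (\<lambda>k i. f' (k, i)) k i z))"
      proof (cases "y \<in> Y")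
        case False
        have W': "zopen X (W \<inter> (X - Y))" by (rule zopen_Int[OF W(1) XY])
        show ?thesis
          by (rule exI[of _ "W \<inter> (X - Y)"], rule exI[of _ "\<lambda>k x. 0"])
            (use W' regular_on_const[OF W', of 0] y False zopen_subset[OF W(1)] in auto)
      next
        case True
        have WY: "zopen Y (W \<inter> Y)" "W \<inter> Y \<subseteq> VY" using r[OF W(1)] W(2) V0(4) by auto
        have hY: "\<forall>i<n. restrict (h i) (W \<inter> Y) \<in> carrier (oring Y (W \<inter> Y))"
          using h oring_restrict_variety[OF W(1)] by blast
        have "y \<in> W \<inter> Y" using y True by blast
        obtain W1 a where W1: "zopen Y W1" "y \<in> W1" "W1 \<subseteq> W \<inter> Y" "\<forall>k<m. a k \<in> carrier (oring Y W1)"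
            "\<forall>i<n. \<forall>z\<in>W1. restrict (h i) (W \<inter> Y) z = (\<Sum>k<m. a k z * gY k i z)"
          using gY_gen[THEN spec, THEN spec, THEN mp, OF conjI[OF WY(1) conjI[OF WY(2) conjI[OF hY h0]]],
              THEN bspec, OF \<open>y \<in> W \<inter> Y\<close>] by (elim exE conjE)
        obtain W2 a' where W2: "zopen X W2" "y \<in> W2" "W2 \<subseteq> W" "W2 \<inter> Y \<subseteq> W1"
            "\<forall>k\<in>{..<m}. regular_on X W2 (a' k)" "\<forall>k\<in>{..<m}. \<forall>z\<in>W2 \<inter> Y. a' k z = a k z"
          by (rule extend_regular_family[OF W1(1,2) W(1) y, of "{..<m}" a]) (use W1(4) oring_regular in auto)
        have "h i z = (\<Sum>k<m. a' k z * f' (k, i) z)" if i: "i < n" and z: "z \<in> W2 \<inter> Y" for i z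
        proof -
          have "z \<in> W1" "z \<in> W \<inter> Y" "z \<in> V0 \<inter> Y" using z W2(3,4) W1(3) W(2) by blast+
          then have "h i z = (\<Sum>k<m. a k z * gY k i z)" using W1(5)[rule_format, OF i, of z] by simp
          also have "\<dots> = (\<Sum>k<m. a' k z * f' (k, i) z)"
            using W2(6) z V0(6) i \<open>z \<in> V0 \<inter> Y\<close> by (intro sum.cong) auto
          finally show ?thesis .
        qed
        moreover have "\<forall>k<m. regular_on X W2 (a' k)" using W2(5) by blast
        ultimately show ?thesis
          using W2(1,2,3) by (rule_tac exI[of _ W2], rule_tac exI[of _ a'], simp)
      qed
    qed
  qed
  obtain V1 q f where V1: "zopen X V1" "x \<in> V1" and f: "\<forall>l<(q::nat). regular_on X V1 (f l)"
      "\<forall>l<q. \<forall>y\<in>V1 \<inter> Y. f l y = 0"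
    and f_gen: "\<forall>W h y. zopen X W \<longrightarrow> W \<subseteq> V1 \<longrightarrow> regular_on X W h \<longrightarrow> (\<forall>y\<in>W \<inter> Y. h y = 0) \<longrightarrow> y \<in> W \<longrightarrow>
       (\<exists>W' b. zopen X W' \<and> y \<in> W' \<and> W' \<subseteq> W \<and> (\<forall>l<q. regular_on X W' (b l)) \<and>
          (\<forall>z\<in>W'. h z = (\<Sum>l<q. b l z * f l z)))"
    by (rule ideal_sheaf_finite_type[OF X Y YX \<open>x \<in> X\<close>])
  define V where "V = V0 \<inter> V1"
  have V: "zopen X V" "x \<in> V" "V \<subseteq> U" "V \<subseteq> V0" "V \<subseteq> V1"
    unfolding V_def using zopen_Int[OF V0(1) V1(1)] V0 V1 by auto
  text \<open>The relations over \<open>X\<close> are generated by the lifts together with the ideal of \<open>Y\<close> times the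
    basis vectors.\<close>
  define G where "G k i = (if k < m then g k i else if i = (k - m) mod n then f ((k - m) div n) else (\<lambda>x. 0))"
    for k i
  have G_reg: "regular_on X V (G k i)" if "k < m + q * n" "i < n" for k i
  proof -
    have "(k - m) div n < q" if "\<not> k < m"
      using that \<open>k < m + q * n\<close> by (intro less_mult_imp_div_less) auto
    then show ?thesis
      unfolding G_def using regular_on_mono[OF g[OF _ that(2)] V(1,4)] regular_on_mono[OF _ V(1,5)] f(1)
        regular_on_const[OF V(1)] by simp
  qed
  have G_rel: "lincomb F (V \<inter> Y) n (\<lambda>i. restrict (restrict (G k i) V) (V \<inter> Y)) (\<lambda>i. Rst F (U \<inter> Y) (V \<inter> Y) (s i)) =
      \<zero>\<^bsub>Sec F (V \<inter> Y)\<^esub>" if k: "k < m + q * n" for k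
  proof (cases "k < m")
    case True
    have "(\<lambda>i. restrict (restrict (G k i) V) (V \<inter> Y)) = (\<lambda>i. restrict (g k i) (V \<inter> Y))"
      using True by (auto simp: G_def fun_eq_iff)
    then show ?thesis using g_rel[OF True V(1,4)] by simp
  next
    case False
    then have l: "(k - m) div n < q" using k by (intro less_mult_imp_div_less) auto
    show ?thesis
    proof (rule lincomb_zero[OF F r[OF V(1)]])
      show "restrict (restrict (G k i) V) (V \<inter> Y) = \<zero>\<^bsub>oring Y (V \<inter> Y)\<^esub>" for i
        using False f(2) l V(5) by (auto simp: G_def oring_def fun_eq_iff)
      show "Rst F (U \<inter> Y) (V \<inter> Y) (s i) \<in> carrier (Sec F (V \<inter> Y))" if "i < n" for i
        using V(3) by (intro modsheaf_onD(2)[OF F UY r[OF V(1)] _ s[OF that]]) auto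
    qed
  qed
  have G_gen: "\<exists>W' a. zopen X W' \<and> y \<in> W' \<and> W' \<subseteq> W \<and> (\<forall>k<m + q * n. a k \<in> carrier (oring X W')) \<and>
      (\<forall>i<n. \<forall>z\<in>W'. h i z = (\<Sum>k<m + q * n. a k z * restrict (G k i) V z))"
    if W: "zopen X W" "W \<subseteq> V" and h: "\<And>i. i < n \<Longrightarrow> h i \<in> carrier (oring X W)"
      and h0: "lincomb F (W \<inter> Y) n (\<lambda>i. restrict (h i) (W \<inter> Y)) (\<lambda>i. Rst F (U \<inter> Y) (W \<inter> Y) (s i)) = \<zero>\<^bsub>Sec F (W \<inter> Y)\<^esub>"
      and y: "y \<in> W" for W h y
  proof -
    have "W \<subseteq> V0" using W(2) V(4) by blast
    obtain W2 a where W2: "zopen X W2" "y \<in> W2" "W2 \<subseteq> W" "\<forall>k<m. regular_on X W2 (a k)"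
        "\<forall>i<n. \<forall>z\<in>W2 \<inter> Y. h i z = (\<Sum>k<m. a k z * g k i z)"
    proof -
      have "\<exists>W' a. zopen X W' \<and> y \<in> W' \<and> W' \<subseteq> W \<and> (\<forall>k<m. regular_on X W' (a k)) \<and>
          (\<forall>i<n. \<forall>z\<in>W' \<inter> Y. h i z = (\<Sum>k<m. a k z * g k i z))"
        by (rule g_gen[OF W(1) \<open>W \<subseteq> V0\<close> _ h0 y]) (rule h)
      then show thesis by (elim exE conjE) (rule that)
    qed
    have W2V: "W2 \<subseteq> V1" "W2 \<subseteq> V0" using W2(3) W(2) V(4,5) by blast+
    \<comment> \<open>The remainder vanishes on \<open>Y\<close>; each of its components is locally
      a combination of the generators \<open>f l\<close> of the ideal.\<close>
    define h' where "h' i z = h i z - (\<Sum>k<m. a k z * g k i z)" for i z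
    have h'_reg: "regular_on X W2 (h' i)" if "i < n" for i
      unfolding h'_def
    proof (intro X.fn_diff X.fn_sum X.fn_mult W2(1))
      show "regular_on X W2 (h i)"
        by (rule regular_on_mono[OF oring_regular[OF h[OF that]] W2(1,3)])
      show "regular_on X W2 (a k)" "regular_on X W2 (g k i)" if "k \<in> {..<m}" for k
        using that W2(4) regular_on_mono[OF g[OF _ \<open>i < n\<close>] W2(1) W2V(2)] by auto
    qed
    have h'_gen: "\<exists>W' b. zopen X W' \<and> y \<in> W' \<and> W' \<subseteq> W2 \<and> ((\<forall>l<q. regular_on X W' (b l)) \<and>
        (\<forall>z\<in>W'. h' i z = (\<Sum>l<q. b l z * f l z)))" if "i < n" for i
      by (rule f_gen[rule_format, OF W2(1) W2V(1) h'_reg[OF that] _ W2(2)])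
        (use W2(5) that in \<open>auto simp: h'_def\<close>)
    have "\<exists>W' b. zopen X W' \<and> y \<in> W' \<and> W' \<subseteq> W2 \<and> (\<forall>i<n. (\<forall>l<q. regular_on X W' (b i l)) \<and>
        (\<forall>z\<in>W'. h' i z = (\<Sum>l<q. b i l z * f l z)))"
      by (rule finite_zopen_choice[OF W2(1,2) h'_gen]) (auto intro: regular_on_mono)
    then obtain W' b where W': "zopen X W'" "y \<in> W'" "W' \<subseteq> W2"
      and b: "\<And>i l. i < n \<Longrightarrow> l < q \<Longrightarrow> regular_on X W' (b i l)"
        "\<And>i z. i < n \<Longrightarrow> z \<in> W' \<Longrightarrow> h' i z = (\<Sum>l<q. b i l z * f l z)"
      by blast
    \<comment> \<open>The numbering is that of \<open>G\<close>: below \<open>m\<close> the lifted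
      relations, and at \<open>m + l * n + j\<close> the coefficient of \<open>f l\<close> in
      component \<open>j\<close>.\<close>
    define c where "c k = (if k < m then a k else b ((k - m) mod n) ((k - m) div n))" for k
    have c_reg: "restrict (c k) W' \<in> carrier (oring X W')" if "k < m + q * n" for k
    proof (rule regular_restrict_oring)
      show "regular_on X W' (c k)"
      proof (cases "k < m")
        case True
        then show ?thesis using W2(4) regular_on_mono[OF _ W'(1,3)] by (auto simp: c_def)
      next
        case False
        then have "k - m < q * n" using that by auto
        then have "(k - m) div n < q" "n > 0"
          by (auto intro: less_mult_imp_div_less gr0I)
        then show ?thesis using b(1) False by (auto simp: c_def)
      qed
    qed
    have "h i z = (\<Sum>k<m + q * n. restrict (c k) W' z * restrict (G k i) V z)" if i: "i < n" and z: "z \<in> W'" for i z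
    proof -
      have zV: "z \<in> V" using z W'(3) W2(3) W(2) by blast
      have "(\<Sum>l<q. b i l z * f l z) = (\<Sum>l<q. \<Sum>j<n. b j l z * (if i = j then f l z else 0))"
        using i by (intro sum.cong refl) (simp add: if_distrib cong: if_cong)
      also have "\<dots> = (\<Sum>p<q * n. b (p mod n) (p div n) z * (if i = p mod n then f (p div n) z else 0))"
        by (rule sum_pairs_lessThan)
      also have "\<dots> = (\<Sum>p<q * n. c (m + p) z * G (m + p) i z)"
        by (intro sum.cong refl) (auto simp: c_def G_def)
      finally have *: "h' i z = (\<Sum>p<q * n. c (m + p) z * G (m + p) i z)"
        using b(2)[OF i z] by simp
      have "h i z = (\<Sum>k<m. c k z * G k i z) + (\<Sum>p<q * n. c (m + p) z * G (m + p) i z)"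
        unfolding *[symmetric] h'_def by (simp add: c_def G_def)
      also have "\<dots> = (\<Sum>k<m + q * n. c k z * G k i z)"
        by (rule sum_lessThan_add[symmetric])
      finally show ?thesis using z zV by simp
    qed
    then show ?thesis
      using W' W2(3) c_reg by (intro exI[of _ W'] exI[of _ "\<lambda>k. restrict (c k) W'"]) auto
  qed
  have G_ring: "restrict (G k i) V \<in> carrier (oring X V)" if "k < m + q * n" "i < n" for k i
    by (rule regular_restrict_oring[OF G_reg[OF that]])
  show "\<exists>V m' g'. zopen X V \<and> x \<in> V \<and> V \<subseteq> U \<and>
      (\<forall>k<(m'::nat). (\<forall>i<n. g' k i \<in> carrier (oring X V)) \<and>
         lincomb F (V \<inter> Y) n (\<lambda>i. restrict (g' k i) (V \<inter> Y)) (\<lambda>i. Rst F (U \<inter> Y) (V \<inter> Y) (s i)) = \<zero>\<^bsub>Sec F (V \<inter> Y)\<^esub>) \<and>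
      (\<forall>W h. zopen X W \<and> W \<subseteq> V \<and> (\<forall>i<n. h i \<in> carrier (oring X W)) \<and>
         lincomb F (W \<inter> Y) n (\<lambda>i. restrict (h i) (W \<inter> Y)) (\<lambda>i. Rst F (U \<inter> Y) (W \<inter> Y) (s i)) = \<zero>\<^bsub>Sec F (W \<inter> Y)\<^esub> \<longrightarrow>
         (\<forall>y\<in>W. \<exists>W' a. zopen X W' \<and> y \<in> W' \<and> W' \<subseteq> W \<and> (\<forall>k<m'. a k \<in> carrier (oring X W')) \<and>
            (\<forall>i<n. \<forall>z\<in>W'. h i z = (\<Sum>k<m'. a k z * g' k i z))))"
    by (rule exI[of _ V], rule exI[of _ "m + q * n"], rule exI[of _ "\<lambda>k i. restrict (G k i) V"],
        intro conjI allI impI ballI V(1,2,3) G_ring G_rel G_gen) blast+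
qed

lemma coherent_extend_by_zero: "coherent Y F \<Longrightarrow> coherent X (extend_by_zero Y F)"
  unfolding coherent_def
  using modsheaf_extend_by_zero finite_type_extend_by_zero finite_type_relations_extend_by_zero by blast

end

text \<open>The image of \<open>Y\<close> is closed in that of \<open>X\<close> as the preimage of
  \<open>Y\<close> under the regular inverse of \<open>j\<close>. For regularity of the inverse on
  it, a function on \<open>Y\<close> is extended locally to \<open>X\<close>, pulled back there and
  restricted again.\<close>

lemma closed_embedding_restrict:
  assumes X: "variety X" and Y: "variety Y" and YX: "Y \<subseteq> X" and M: "variety M" and j: "closed_embedding X M j"
  shows "closed_embedding Y M j" and "variety (j ` Y)"
proof -
  have reg: "regular_map X M j" and inj: "inj_on j X" and im: "variety (j ` X)"
    and inv: "regular_map (j ` X) X (inv_into X j)"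
    using j unfolding closed_embedding_def by blast+
  have invD: "zopen (j ` X) {p \<in> j ` X. inv_into X j p \<in> U}"
      "regular_on X U f \<Longrightarrow> regular_on (j ` X) {p \<in> j ` X. inv_into X j p \<in> U} (f \<circ> inv_into X j)"
    if "zopen X U" for U f
    using inv that unfolding regular_map_def by blast+
  have jD: "zopen X {p \<in> X. j p \<in> U}"
      "regular_on M U f \<Longrightarrow> regular_on X {p \<in> X. j p \<in> U} (f \<circ> j)"
    if "zopen M U" for U f
    using reg that unfolding regular_map_def by blast+
  have inv_j: "inv_into X j (j y) = y" if "y \<in> X" for y
    using inv_into_f_f[OF inj that] .
  have jYX: "j ` Y \<subseteq> j ` X" using YX by blast
  have "{p \<in> j ` X. inv_into X j p \<in> X - Y} = j ` X - j ` Y"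
    using inv_j YX by auto
  then have "zopen (j ` X) (j ` X - j ` Y)"
    using invD(1)[OF zopen_diff[OF Y YX]] by simp
  moreover have "j ` X - (j ` X - j ` Y) = j ` Y" using jYX by blast
  ultimately show jY: "variety (j ` Y)" by (simp add: zopen_def)
  have inv_Y: "inv_into Y j p = inv_into X j p" if "p \<in> j ` Y" for p
    using that inv_j YX inv_into_f_f[OF inj_on_subset[OF inj YX]] by auto
  have "regular_map Y M j"
    unfolding regular_map_def
  proof (intro conjI allI impI)
    show "j \<in> Y \<rightarrow> M" using reg YX unfolding regular_map_def by blast
    fix U assume U: "zopen M U"
    have eq: "{p \<in> Y. j p \<in> U} = {p \<in> X. j p \<in> U} \<inter> Y" using YX by blast
    show "zopen Y {p \<in> Y. j p \<in> U}" unfolding eq by (rule zopen_restrict[OF Y YX jD(1)[OF U]])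
    show "regular_on Y {p \<in> Y. j p \<in> U} (f \<circ> j)" if "regular_on M U f" for f
      unfolding eq by (rule regular_on_restrict_variety[OF Y YX jD(2)[OF U that]])
  qed
  moreover have "regular_map (j ` Y) Y (inv_into Y j)"
    unfolding regular_map_def
  proof (intro conjI allI impI)
    show "inv_into Y j \<in> j ` Y \<rightarrow> Y" by (auto intro: inv_into_into)
    fix U assume U: "zopen Y U"
    note U' = zopen_extend[OF X YX U]
    have inv_mem: "inv_into X j p \<in> Y" if "p \<in> j ` Y" for p
      using that inv_j YX by auto
    have "{p \<in> j ` Y. inv_into Y j p \<in> U} = {p \<in> j ` X. inv_into X j p \<in> X - (Y - U)} \<inter> j ` Y"
    proof (rule Set.set_eqI)
      fix p
      show "p \<in> {p \<in> j ` Y. inv_into Y j p \<in> U} \<longleftrightarrow> p \<in> {p \<in> j ` X. inv_into X j p \<in> X - (Y - U)} \<inter> j ` Y"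
        using inv_mem[of p] inv_Y[of p] YX jYX zopen_subset[OF U] by (cases "p \<in> j ` Y") auto
    qed
    then show zU: "zopen (j ` Y) {p \<in> j ` Y. inv_into Y j p \<in> U}"
      using zopen_restrict[OF jY jYX invD(1)[OF U'(1)]] by simp
    fix f assume f: "regular_on Y U f"
    show "regular_on (j ` Y) {p \<in> j ` Y. inv_into Y j p \<in> U} (f \<circ> inv_into Y j)"
    proof (rule regular_onI_local)
      fix p assume p: "p \<in> {p \<in> j ` Y. inv_into Y j p \<in> U}"
      define x where "x = inv_into Y j p"
      have "x \<in> U" using p by (simp add: x_def)
      obtain V f' where V: "zopen X V" "x \<in> V" "V \<inter> Y \<subseteq> U" "regular_on X V f'"
          "\<And>y. y \<in> V \<inter> Y \<Longrightarrow> f' y = f y"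
        using regular_on_extend[OF X Y YX f \<open>x \<in> U\<close>] by metis
      let ?W = "{p \<in> j ` X. inv_into X j p \<in> V} \<inter> j ` Y"
      have W: "zopen (j ` Y) ?W" by (rule zopen_restrict[OF jY jYX invD(1)[OF V(1)]])
      have "regular_on (j ` Y) ?W (f' \<circ> inv_into X j)"
        by (rule regular_on_restrict_variety[OF jY jYX invD(2)[OF V(1,4)]])
      then have "regular_on (j ` Y) ?W (f \<circ> inv_into Y j)"
      proof (rule regular_on_cong)
        fix z assume z: "z \<in> ?W"
        then have "inv_into X j z \<in> V \<inter> Y" using inv_j YX by auto
        then show "(f' \<circ> inv_into X j) z = (f \<circ> inv_into Y j) z"
          using V(5) inv_Y z by simp
      qed
      moreover have "p \<in> ?W" using p V(2) inv_Y jYX by (auto simp: x_def)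
      moreover have "?W \<subseteq> {p \<in> j ` Y. inv_into Y j p \<in> U}"
      proof
        fix z assume z: "z \<in> ?W"
        then have "inv_into X j z \<in> V \<inter> Y" using inv_mem by blast
        then show "z \<in> {p \<in> j ` Y. inv_into Y j p \<in> U}"
          using V(3) inv_Y z by auto
      qed
      ultimately show "\<exists>V. zopen (j ` Y) V \<and> p \<in> V \<and> V \<subseteq> {p \<in> j ` Y. inv_into Y j p \<in> U} \<and>
          regular_on (j ` Y) V (f \<circ> inv_into Y j)"
        using W by (intro exI[of _ ?W] conjI)
    qed
  qed
  ultimately show "closed_embedding Y M j"
    unfolding closed_embedding_def using jY inj_on_subset[OF inj YX] by blast
qed

section \<open>Vector bundles\<close>

lemma vcomb_cong: "r = r' \<Longrightarrow> (\<And>i. i < r \<Longrightarrow> c i = c' i) \<Longrightarrow> (\<And>i. i < r \<Longrightarrow> e i = e' i) \<Longrightarrow> vcomb r c e = vcomb r' c' e'"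
  by (auto simp: vcomb_def)

lemma vcomb_diff: "vcomb r c e k - vcomb r c' e k = vcomb r (\<lambda>i. c i - c' i) e k"
  by (simp add: vcomb_def sum_subtractf algebra_simps)

lemma vcomb_vcomb: "vcomb m a (\<lambda>j. vcomb r (c j) e) = vcomb r (\<lambda>i. \<Sum>j<m. a j * c j i) e"
  unfolding vcomb_def
  by (auto simp: sum_distrib_left sum_distrib_right mult.assoc fun_eq_iff intro: sum.swap)

lemma vcomb_unit: "i < r \<Longrightarrow> vcomb r (\<lambda>l. if l = i then 1 else 0) e = e i"
  by (auto simp: vcomb_def fun_eq_iff if_distrib[of "\<lambda>x. x * _"] cong: if_cong)

lemma vcomb_zero [simp]: "vcomb r (\<lambda>i. 0) e = (\<lambda>k. 0)" "vcomb 0 c e = (\<lambda>k. 0)"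
  by (simp_all add: vcomb_def)

lemma basis_ofE:
  assumes "basis_of V r e" "v \<in> V"
  obtains c where "v = vcomb r c e"
  using assms unfolding basis_of_def by blast

lemma basis_of_vcomb: "basis_of V r e \<Longrightarrow> vcomb r c e \<in> V"
  unfolding basis_of_def by blast

lemma basis_of_unique:
  assumes "basis_of V r e" "vcomb r c e = vcomb r c' e" "i < r"
  shows "c i = c' i"
proof -
  have "vcomb r (\<lambda>i. c i - c' i) e = (\<lambda>k. 0)"
    using assms(2) vcomb_diff[of r c e _ c'] by (metis eq_iff_diff_eq_0)
  then show ?thesis
    using assms unfolding basis_of_def by fastforce
qed

lemma basis_of_mem: "basis_of V r e \<Longrightarrow> i < r \<Longrightarrow> e i \<in> V"
  using basis_of_vcomb[of V r e] vcomb_unit[of i r e] by metis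

lemma basis_of_closed:
  assumes "basis_of V r e" "\<And>j. j < m \<Longrightarrow> v j \<in> V"
  shows "vcomb m a v \<in> V"
proof -
  have "\<forall>j. \<exists>c. j < m \<longrightarrow> v j = vcomb r c e"
    using assms by (meson basis_ofE)
  then obtain c where "\<And>j. j < m \<Longrightarrow> v j = vcomb r (c j) e" by metis
  then have "vcomb m a v = vcomb m a (\<lambda>j. vcomb r (c j) e)"
    by (intro vcomb_cong) auto
  then show ?thesis
    using basis_of_vcomb[OF assms(1)] vcomb_vcomb[of m a r c e] by simp
qed

lemma basis_of_zero: "basis_of V r e \<Longrightarrow> (\<lambda>k. 0) \<in> V"
  using basis_of_vcomb[of V r e "\<lambda>i. 0"] by simp

lemma vcomb_two: "vcomb 2 (\<lambda>j. if j = 0 then a else b) (\<lambda>j. if j = 0 then v else w) = (\<lambda>k. a * v k + b * w k)"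
  by (simp add: vcomb_def numeral_2_eq_2)

lemma basis_of_lin: "basis_of V r e \<Longrightarrow> v \<in> V \<Longrightarrow> w \<in> V \<Longrightarrow> (\<lambda>k. a * v k + b * w k) \<in> V"
  using basis_of_closed[of V r e 2 "\<lambda>j. if j = 0 then v else w" "\<lambda>j. if j = 0 then a else b"]
  by (simp add: vcomb_two)

lemma linear_vcomb:
  assumes V: "basis_of V r e"
    and lin: "\<And>v w a b. v \<in> V \<Longrightarrow> w \<in> V \<Longrightarrow> \<phi> (\<lambda>k. a * v k + b * w k) = (\<lambda>k. a * \<phi> v k + b * \<phi> w k)"
    and v: "\<And>j. j < m \<Longrightarrow> v j \<in> V"
  shows "\<phi> (vcomb m a v) = vcomb m a (\<lambda>j. \<phi> (v j))"
  using v
proof (induction m)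
  case 0
  have "\<phi> (\<lambda>k. 0 * 0 + 0 * 0) = (\<lambda>k. 0 * \<phi> (\<lambda>k. 0) k + 0 * \<phi> (\<lambda>k. 0) k)"
    using basis_of_zero[OF V] by (intro lin)
  then show ?case by simp
next
  case (Suc m)
  have "vcomb (Suc m) a v = (\<lambda>k. 1 * vcomb m a v k + a m * v m k)"
    by (simp add: vcomb_def)
  then have "\<phi> (vcomb (Suc m) a v) = (\<lambda>k. 1 * \<phi> (vcomb m a v) k + a m * \<phi> (v m) k)"
    using Suc.prems basis_of_closed[OF V, of m v a] by (simp only:) (intro lin, auto)
  then show ?case
    using Suc by (simp add: vcomb_def)
qed

lemma vb_mapD:
  assumes "vb_map opn fn A E F \<phi>"
  shows "x \<in> A \<Longrightarrow> v \<in> fib E x \<Longrightarrow> \<phi> x v \<in> fib F x"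
    and "x \<in> A \<Longrightarrow> v \<in> fib E x \<Longrightarrow> w \<in> fib E x \<Longrightarrow>
       \<phi> x (\<lambda>k. a * v k + b * w k) = (\<lambda>k. a * \<phi> x v k + b * \<phi> x w k)"
    and "opn U \<Longrightarrow> U \<subseteq> A \<Longrightarrow> vb_section fn E U s \<Longrightarrow> vb_section fn F U (\<lambda>x. \<phi> x (s x))"
  using assms unfolding vb_map_def by blast+

lemma vb_map_subset:
  assumes "vb_map opn fn A E F \<phi>" "A' \<subseteq> A"
  shows "vb_map opn fn A' E F \<phi>"
  using assms unfolding vb_map_def by (meson order_trans subsetD)

lemma vb_map_comp:
  assumes "vb_map opn fn A E F \<phi>" "vb_map opn fn A F G \<psi>"
  shows "vb_map opn fn A E G (\<lambda>x v. \<psi> x (\<phi> x v))"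
  unfolding vb_map_def
  using vb_mapD[OF assms(1)] vb_mapD[OF assms(2)] by (simp add: Pi_iff)

section \<open>Sections, frames and maps of bundles\<close>

context fun_space
begin

lemma vbundle_frameE:
  assumes "vbundle opn fn B E" "x \<in> B"
  obtains V r e where "(V, r, e) \<in> frames E" "x \<in> V"
  using assms unfolding vbundle_def by fastforce

lemma vbundle_frameD:
  assumes "vbundle opn fn B E" "(V, r, e) \<in> frames E"
  shows "opn V" "V \<subseteq> B" "\<And>x. x \<in> V \<Longrightarrow> basis_of (fib E x) r (\<lambda>i. e i x)" "\<And>i. i < r \<Longrightarrow> vb_section fn E V (e i)"
  using assms unfolding vbundle_def by fastforce+

lemma vb_sectionE:
  assumes "vb_section fn E U s" "(V, r, e) \<in> frames E"
  obtains c where "\<forall>i<r. fn (U \<inter> V) (c i)" "\<forall>x\<in>U \<inter> V. s x = vcomb r (\<lambda>i. c i x) (\<lambda>i. e i x)"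
  using assms unfolding vb_section_def by fastforce

lemma vb_section_fib: "vb_section fn E U s \<Longrightarrow> x \<in> U \<Longrightarrow> s x \<in> fib E x"
  unfolding vb_section_def by blast

lemma vb_sectionI:
  assumes "\<And>x. x \<in> U \<Longrightarrow> s x \<in> fib E x"
    and "\<And>V r e. (V, r, e) \<in> frames E \<Longrightarrow> \<exists>c. (\<forall>i<r. fn (U \<inter> V) (c i)) \<and>
       (\<forall>x\<in>U \<inter> V. s x = vcomb r (\<lambda>i. c i x) (\<lambda>i. e i x))"
  shows "vb_section fn E U s"
  unfolding vb_section_def using assms by blast

lemma vb_section_vcomb:
  assumes E: "vbundle opn fn B E" and U: "opn U" "U \<subseteq> B"
    and s: "\<And>j. j < m \<Longrightarrow> vb_section fn E U (s j)" and a: "\<And>j. j < m \<Longrightarrow> fn U (a j)"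
  shows "vb_section fn E U (\<lambda>x. vcomb m (\<lambda>j. a j x) (\<lambda>j. s j x))"
proof (rule vb_sectionI)
  fix x assume "x \<in> U"
  then obtain V r e where "(V, r, e) \<in> frames E" "x \<in> V" using vbundle_frameE[OF E] U by blast
  then show "vcomb m (\<lambda>j. a j x) (\<lambda>j. s j x) \<in> fib E x"
    by (intro basis_of_closed[OF vbundle_frameD(3)[OF E]]) (auto intro: vb_section_fib[OF s] \<open>x \<in> U\<close>)
next
  fix V r e assume V: "(V, r, e) \<in> frames E"
  have UV: "opn (U \<inter> V)" using vbundle_frameD(1)[OF E V] U opn_Int by blast
  have "\<forall>j. \<exists>c. j < m \<longrightarrow> (\<forall>i<r. fn (U \<inter> V) (c i)) \<and> (\<forall>x\<in>U \<inter> V. s j x = vcomb r (\<lambda>i. c i x) (\<lambda>i. e i x))"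
    using vb_sectionE[OF s V] by metis
  then obtain c where c: "\<And>j i. j < m \<Longrightarrow> i < r \<Longrightarrow> fn (U \<inter> V) (c j i)"
      "\<And>j x. j < m \<Longrightarrow> x \<in> U \<inter> V \<Longrightarrow> s j x = vcomb r (\<lambda>i. c j i x) (\<lambda>i. e i x)"
    by metis
  have "fn (U \<inter> V) (\<lambda>x. \<Sum>j<m. a j x * c j i x)" if "i < r" for i
    using c(1) that a UV by (intro fn_sum fn_mult) (auto intro: fn_mono)
  moreover have "vcomb m (\<lambda>j. a j x) (\<lambda>j. s j x) = vcomb r (\<lambda>i. \<Sum>j<m. a j x * c j i x) (\<lambda>i. e i x)"
    if "x \<in> U \<inter> V" for x
  proof -
    have "vcomb m (\<lambda>j. a j x) (\<lambda>j. s j x) = vcomb m (\<lambda>j. a j x) (\<lambda>j. vcomb r (\<lambda>i. c j i x) (\<lambda>i. e i x))"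
      using c(2) that by (intro vcomb_cong) auto
    then show ?thesis by (simp only: vcomb_vcomb)
  qed
  ultimately show "\<exists>c. (\<forall>i<r. fn (U \<inter> V) (c i)) \<and>
      (\<forall>x\<in>U \<inter> V. vcomb m (\<lambda>j. a j x) (\<lambda>j. s j x) = vcomb r (\<lambda>i. c i x) (\<lambda>i. e i x))"
    by (intro exI[of _ "\<lambda>i x. \<Sum>j<m. a j x * c j i x"]) auto
qed

lemma vb_section_mono:
  assumes "vbundle opn fn B E" "vb_section fn E U s" "opn V" "V \<subseteq> U"
  shows "vb_section fn E V s"
proof (rule vb_sectionI)
  fix x assume "x \<in> V"
  then show "s x \<in> fib E x" using vb_section_fib[OF assms(2)] assms(4) by blast
next
  fix W r e assume W: "(W, r, e) \<in> frames E"
  obtain c where c: "\<forall>i<r. fn (U \<inter> W) (c i)" "\<forall>x\<in>U \<inter> W. s x = vcomb r (\<lambda>i. c i x) (\<lambda>i. e i x)"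
    by (rule vb_sectionE[OF assms(2) W])
  have "opn (V \<inter> W)" using assms(3) vbundle_frameD(1)[OF assms(1) W] opn_Int by blast
  then have "\<forall>i<r. fn (V \<inter> W) (c i)" using c(1) assms(4) fn_mono[of "U \<inter> W" _ "V \<inter> W"] by blast
  then show "\<exists>c. (\<forall>i<r. fn (V \<inter> W) (c i)) \<and> (\<forall>x\<in>V \<inter> W. s x = vcomb r (\<lambda>i. c i x) (\<lambda>i. e i x))"
    using c(2) assms(4) by blast
qed

lemma vb_section_cong:
  assumes "vb_section fn E U s" "\<And>x. x \<in> U \<Longrightarrow> s x = t x"
  shows "vb_section fn E U t"
proof (rule vb_sectionI)
  fix x assume "x \<in> U"
  then show "t x \<in> fib E x" using vb_section_fib[OF assms(1)] assms(2) by metis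
next
  fix W r e assume W: "(W, r, e) \<in> frames E"
  obtain c where c: "\<forall>i<r. fn (U \<inter> W) (c i)" "\<forall>x\<in>U \<inter> W. s x = vcomb r (\<lambda>i. c i x) (\<lambda>i. e i x)"
    by (rule vb_sectionE[OF assms(1) W])
  then show "\<exists>c. (\<forall>i<r. fn (U \<inter> W) (c i)) \<and> (\<forall>x\<in>U \<inter> W. t x = vcomb r (\<lambda>i. c i x) (\<lambda>i. e i x))"
    using assms(2) by (intro exI[of _ c]) (metis IntD1)
qed

text \<open>A section must have admissible coefficients in every frame. Coefficients in a frame are
  unique, so those found locally are restrictions of one global family.\<close>

lemma vb_section_local:
  assumes E: "vbundle opn fn B E" and U: "opn U"
    and loc: "\<And>x. x \<in> U \<Longrightarrow> \<exists>V. opn V \<and> x \<in> V \<and> V \<subseteq> U \<and> vb_section fn E V s"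
  shows "vb_section fn E U s"
proof (rule vb_sectionI)
  fix x assume "x \<in> U"
  then show "s x \<in> fib E x" using loc vb_section_fib by blast
next
  fix W r e assume W: "(W, r, e) \<in> frames E"
  note D = vbundle_frameD[OF E W]
  have UW: "opn (U \<inter> W)" using U D(1) opn_Int by blast
  have "\<forall>x. \<exists>c. x \<in> U \<inter> W \<longrightarrow> s x = vcomb r c (\<lambda>i. e i x)"
    using loc vb_section_fib D(3) by (meson IntD1 IntD2 basis_ofE)
  then obtain c where c: "\<And>x. x \<in> U \<inter> W \<Longrightarrow> s x = vcomb r (c x) (\<lambda>i. e i x)" by metis
  have "fn (U \<inter> W) (\<lambda>x. c x i)" if i: "i < r" for i
  proof (rule fn_local[OF _ UW])
    fix x assume x: "x \<in> U \<inter> W"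
    then obtain V where V: "opn V" "x \<in> V" "V \<subseteq> U" "vb_section fn E V s" using loc by blast
    obtain d where d: "\<forall>i<r. fn (V \<inter> W) (d i)" "\<forall>x\<in>V \<inter> W. s x = vcomb r (\<lambda>i. d i x) (\<lambda>i. e i x)"
      by (rule vb_sectionE[OF V(4) W])
    have "fn (V \<inter> W) (\<lambda>x. c x i)"
    proof (rule fn_cong[OF d(1)[rule_format, OF i]])
      fix y assume y: "y \<in> V \<inter> W"
      then have "vcomb r (\<lambda>i. d i y) (\<lambda>i. e i y) = vcomb r (c y) (\<lambda>i. e i y)"
        using c d(2) V(3) by (metis Int_iff subsetD)
      then show "d i y = c y i"
        using basis_of_unique[OF D(3)] y i by blast
    qed
    then show "\<exists>V. opn V \<and> x \<in> V \<and> V \<subseteq> U \<inter> W \<and> fn V (\<lambda>x. c x i)"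
      using V x opn_Int[OF V(1) D(1)] by (intro exI[of _ "V \<inter> W"]) auto
  qed
  then show "\<exists>c. (\<forall>i<r. fn (U \<inter> W) (c i)) \<and> (\<forall>x\<in>U \<inter> W. s x = vcomb r (\<lambda>i. c i x) (\<lambda>i. e i x))"
    using c by (intro exI[of _ "\<lambda>i x. c x i"]) auto
qed

text \<open>One frame near each point is enough, because the members of a frame are themselves
  sections and hence expand well in all other frames.\<close>

lemma vb_sectionI_frames:
  assumes E: "vbundle opn fn B E" and U: "opn U"
    and loc: "\<And>x. x \<in> U \<Longrightarrow> \<exists>V r e N c. (V, r, e) \<in> frames E \<and> opn N \<and> x \<in> N \<and> N \<subseteq> U \<inter> V \<and>
       (\<forall>i<r. fn N (c i)) \<and> (\<forall>y\<in>N. s y = vcomb r (\<lambda>i. c i y) (\<lambda>i. e i y))"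
  shows "vb_section fn E U s"
proof (rule vb_section_local[OF E U])
  fix x assume "x \<in> U"
  then obtain V r e N c where V: "(V, r, e) \<in> frames E" and N: "opn N" "x \<in> N" "N \<subseteq> U \<inter> V"
    and c: "\<forall>i<r. fn N (c i)" "\<forall>y\<in>N. s y = vcomb r (\<lambda>i. c i y) (\<lambda>i. e i y)"
    using loc by blast
  note D = vbundle_frameD[OF E V]
  have NV: "N \<subseteq> V" using N(3) by blast
  have "vb_section fn E N (\<lambda>y. vcomb r (\<lambda>i. c i y) (\<lambda>i. e i y))"
  proof (rule vb_section_vcomb[OF E N(1)])
    show "N \<subseteq> B" using NV D(2) by blast
    show "vb_section fn E N (e i)" if "i < r" for i
      by (rule vb_section_mono[OF E D(4)[OF that] N(1) NV])
  qed (use c in blast)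
  then have "vb_section fn E N s" by (rule vb_section_cong) (use c(2) in simp)
  then show "\<exists>V. opn V \<and> x \<in> V \<and> V \<subseteq> U \<and> vb_section fn E V s" using N by blast
qed

text \<open>Gaussian elimination. At each point some coefficient of the last unknown is nonzero, hence
  invertible in a neighbourhood.\<close>

lemma fn_linear_system:
  assumes "opn U" "\<And>i j. i < (N :: nat) \<Longrightarrow> j < r \<Longrightarrow> fn U (P i j)" "\<And>i. i < N \<Longrightarrow> fn U (q i)"
    and "\<And>x i. x \<in> U \<Longrightarrow> i < N \<Longrightarrow> (\<Sum>j<r. P i j x * c j x) = q i x"
    and "\<And>x d j. x \<in> U \<Longrightarrow> (\<And>i. i < N \<Longrightarrow> (\<Sum>j<r. P i j x * d j) = 0) \<Longrightarrow> j < r \<Longrightarrow> d j = (0 :: complex)"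
    and "j < (r :: nat)"
  shows "fn U (c j)"
  using assms
proof (induction r arbitrary: U P q j)
  case 0
  then show ?case by simp
next
  case (Suc r)
  show ?case
  proof (rule fn_local[OF _ Suc.prems(1)])
    fix x assume x: "x \<in> U"
    \<comment> \<open>Otherwise the last unit vector would be a nontrivial solution of the
      homogeneous system.\<close>
    have "\<exists>i0<N. P i0 r x \<noteq> 0"
    proof (rule ccontr)
      assume "\<not> ?thesis"
      then have "(\<Sum>j<Suc r. P i j x * (if j = r then 1 else 0)) = 0" if "i < N" for i
        using that by (simp add: if_distrib cong: if_cong)
      from Suc.prems(5)[of x "\<lambda>j. if j = r then 1 else 0" r, OF x this] show False by simp
    qed
    then obtain i0 where i0: "i0 < N" "P i0 r x \<noteq> 0" by blast
    define V where "V = {y \<in> U. P i0 r y \<noteq> 0}"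
    have V: "opn V" "x \<in> V" "V \<subseteq> U"
      unfolding V_def using opn_nonzero[OF Suc.prems(2)[OF i0(1)] Suc.prems(1)] i0 x by auto
    have nz: "P i0 r y \<noteq> 0" if "y \<in> V" for y using that by (simp add: V_def)
    have PV: "fn V (P i j)" if "i < N" "j < Suc r" for i j
      by (rule fn_mono[OF Suc.prems(2)[OF that] V(1,3)])
    have qV: "fn V (q i)" if "i < N" for i
      by (rule fn_mono[OF Suc.prems(3)[OF that] V(1,3)])
    define P' where "P' i j y = P i j y - P i r y * P i0 j y / P i0 r y" for i j y
    define q' where "q' i y = q i y - P i r y * q i0 y / P i0 r y" for i y
    have red: "(\<Sum>j<r. P' i j y * d j) = (\<Sum>j<r. P i j y * d j) - P i r y / P i0 r y * (\<Sum>j<r. P i0 j y * d j)" for i y d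
      unfolding P'_def sum_distrib_left sum_subtractf[symmetric] by (intro sum.cong) (auto simp: algebra_simps)
    have cj: "fn V (c j)" if "j < r" for j
    proof (rule Suc.IH[OF V(1) _ _ _ _ that, of P' q'])
      show "fn V (P' i j)" if "i < N" "j < r" for i j
        unfolding P'_def using that i0(1) V(1) nz by (intro fn_diff fn_divide fn_mult PV) auto
      show "fn V (q' i)" if "i < N" for i
        unfolding q'_def using that i0(1) V(1) nz by (intro fn_diff fn_divide fn_mult PV qV) auto
      show "(\<Sum>j<r. P' i j y * c j y) = q' i y" if "y \<in> V" "i < N" for y i
      proof -
        have "y \<in> U" using that V(3) by blast
        then show ?thesis
          unfolding red q'_def Suc.prems(4)[OF \<open>y \<in> U\<close> that(2), symmetric]
            Suc.prems(4)[OF \<open>y \<in> U\<close> i0(1), symmetric]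
          using nz[OF that(1)] by (simp add: field_simps)
      qed
      show "d j = 0" if y: "y \<in> V" and d: "\<And>i. i < N \<Longrightarrow> (\<Sum>j<r. P' i j y * d j) = 0" and j: "j < r" for y d j
      proof -
        \<comment> \<open>A solution of the reduced system extends to one of the full system; the
          pivot equation \<open>i0\<close> forces the value of the last unknown.\<close>
        define d' where "d' j = (if j = r then - (\<Sum>j<r. P i0 j y * d j) / P i0 r y else d j)" for j
        have "(\<Sum>j<Suc r. P i j y * d' j) = 0" if "i < N" for i
        proof -
          have "(\<Sum>j<Suc r. P i j y * d' j) = (\<Sum>j<r. P' i j y * d j)"
            unfolding red by (simp add: d'_def)
          then show ?thesis using d[OF that] by simp
        qed
        moreover have "y \<in> U" using y V(3) by blast
        ultimately have "d' j = 0" using Suc.prems(5)[of y d' j] j by auto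
        then show ?thesis using j by (simp add: d'_def)
      qed
    qed
    have "fn V (c j)" if "j = r"
    proof (rule fn_cong)
      show "fn V (\<lambda>y. (q i0 y - (\<Sum>j<r. P i0 j y * c j y)) / P i0 r y)"
        using V(1) i0(1) nz by (intro fn_divide fn_diff fn_sum fn_mult qV PV cj) auto
      fix y assume y: "y \<in> V"
      then have "y \<in> U" using V(3) by blast
      then show "(q i0 y - (\<Sum>j<r. P i0 j y * c j y)) / P i0 r y = c j y"
        using Suc.prems(4)[of y i0] i0(1) nz[OF y] that by (auto simp: field_simps)
    qed
    then have "fn V (c j)" using cj Suc.prems(6) less_Suc_eq by blast
    then show "\<exists>V. opn V \<and> x \<in> V \<and> V \<subseteq> U \<and> fn V (c j)" using V by blast
  qed
qed

text \<open>The coefficients \<open>c\<close> solve a linear system whose matrix \<open>P\<close>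
  has independent columns. Elimination shows that they are admissible without determinants and
  without comparing \<open>N\<close> and \<open>r\<close>.\<close>

lemma fn_change_of_frame:
  assumes U: "opn U"
    and e: "\<And>x. x \<in> U \<Longrightarrow> basis_of (fb x) r (\<lambda>j. e j x)" and f: "\<And>x. x \<in> U \<Longrightarrow> basis_of (fb x) N (\<lambda>i. f i x)"
    and P: "\<And>i j. i < N \<Longrightarrow> j < r \<Longrightarrow> fn U (P i j)"
      "\<And>x j. x \<in> U \<Longrightarrow> j < r \<Longrightarrow> e j x = vcomb N (\<lambda>i. P i j x) (\<lambda>i. f i x)"
    and q: "\<And>i. i < N \<Longrightarrow> fn U (q i)" "\<And>x. x \<in> U \<Longrightarrow> s x = vcomb N (\<lambda>i. q i x) (\<lambda>i. f i x)"
    and c: "\<And>x. x \<in> U \<Longrightarrow> s x = vcomb r (\<lambda>j. c j x) (\<lambda>j. e j x)"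
    and "j < r"
  shows "fn U (c j)"
proof (rule fn_linear_system[OF U P(1) q(1)])
  have eq: "vcomb r d (\<lambda>j. e j x) = vcomb N (\<lambda>i. \<Sum>j<r. d j * P i j x) (\<lambda>i. f i x)" if "x \<in> U" for x d
  proof -
    have "vcomb r d (\<lambda>j. e j x) = vcomb r d (\<lambda>j. vcomb N (\<lambda>i. P i j x) (\<lambda>i. f i x))"
      using P(2) that by (intro vcomb_cong) auto
    then show ?thesis by (simp only: vcomb_vcomb)
  qed
  show "(\<Sum>j<r. P i j x * c j x) = q i x" if "x \<in> U" "i < N" for x i
  proof -
    have "vcomb N (\<lambda>i. \<Sum>j<r. c j x * P i j x) (\<lambda>i. f i x) = vcomb N (\<lambda>i. q i x) (\<lambda>i. f i x)"
      using eq[OF that(1)] q(2) c that(1) by metis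
    from basis_of_unique[OF f[OF that(1)] this that(2)] show ?thesis by (simp add: mult.commute)
  qed
  show "d j = 0" if x: "x \<in> U" and d: "\<And>i. i < N \<Longrightarrow> (\<Sum>j<r. P i j x * d j) = 0" and "j < r" for x d j
  proof -
    have "vcomb r d (\<lambda>j. e j x) = vcomb N (\<lambda>i. 0) (\<lambda>i. f i x)"
      unfolding eq[OF x] using d by (intro vcomb_cong) (auto simp: mult.commute)
    then show ?thesis using e[OF x] \<open>j < r\<close> unfolding basis_of_def by simp
  qed
qed (use \<open>j < r\<close> in auto)

text \<open>By linearity, the images of the members of one frame near each point decide.\<close>

lemma vb_mapI_frames:
  assumes E: "vbundle opn fn B E" and F: "vbundle opn fn B F" and A: "A \<subseteq> B"
    and lin: "\<And>x v. x \<in> A \<Longrightarrow> v \<in> fib E x \<Longrightarrow> \<phi> x v \<in> fib F x"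
      "\<And>x v w a b. x \<in> A \<Longrightarrow> v \<in> fib E x \<Longrightarrow> w \<in> fib E x \<Longrightarrow>
       \<phi> x (\<lambda>k. a * v k + b * w k) = (\<lambda>k. a * \<phi> x v k + b * \<phi> x w k)"
    and loc: "\<And>x. x \<in> A \<Longrightarrow> \<exists>V r e N. (V, r, e) \<in> frames E \<and> opn N \<and> x \<in> N \<and> N \<subseteq> V \<and>
       (\<forall>i<r. vb_section fn F N (\<lambda>y. \<phi> y (e i y)))"
  shows "vb_map opn fn A E F \<phi>"
  unfolding vb_map_def
proof (intro conjI allI impI ballI Pi_I)
  fix U s assume U: "opn U \<and> U \<subseteq> A \<and> vb_section fn E U s"
  show "vb_section fn F U (\<lambda>x. \<phi> x (s x))"
  proof (rule vb_section_local[OF F])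
    fix x assume x: "x \<in> U"
    then obtain V r e N where V: "(V, r, e) \<in> frames E" and N: "opn N" "x \<in> N" "N \<subseteq> V"
      and \<phi>e: "\<forall>i<r. vb_section fn F N (\<lambda>y. \<phi> y (e i y))"
      using loc[of x] U by blast
    obtain c where c: "\<forall>i<r. fn (U \<inter> V) (c i)" "\<forall>x\<in>U \<inter> V. s x = vcomb r (\<lambda>i. c i x) (\<lambda>i. e i x)"
      using U V vb_sectionE by metis
    note D = vbundle_frameD[OF E V]
    have UN: "opn (U \<inter> N)" using U N(1) opn_Int by blast
    have "vb_section fn F (U \<inter> N) (\<lambda>y. vcomb r (\<lambda>i. c i y) (\<lambda>i. \<phi> y (e i y)))"
    proof (rule vb_section_vcomb[OF F UN])
      show "U \<inter> N \<subseteq> B" using U A by blast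
      show "vb_section fn F (U \<inter> N) (\<lambda>y. \<phi> y (e i y))" if "i < r" for i
        by (rule vb_section_mono[OF F \<phi>e[rule_format, OF that] UN]) blast
      show "fn (U \<inter> N) (c i)" if "i < r" for i
        using c(1) that N(3) fn_mono[OF _ UN, of "U \<inter> V" "c i"] by blast
    qed
    then have "vb_section fn F (U \<inter> N) (\<lambda>y. \<phi> y (s y))"
    proof (rule vb_section_cong)
      fix y assume y: "y \<in> U \<inter> N"
      then have yV: "y \<in> V" "y \<in> A" using N(3) U by blast+
      have "\<phi> y (s y) = \<phi> y (vcomb r (\<lambda>i. c i y) (\<lambda>i. e i y))" using c(2) y yV by auto
      also have "\<dots> = vcomb r (\<lambda>i. c i y) (\<lambda>i. \<phi> y (e i y))"
        by (rule linear_vcomb[OF D(3)[OF yV(1)] lin(2)[OF yV(2)]])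
          (use basis_of_mem[OF D(3)[OF yV(1)]] in auto)
      finally show "vcomb r (\<lambda>i. c i y) (\<lambda>i. \<phi> y (e i y)) = \<phi> y (s y)" ..
    qed
    then show "\<exists>V. opn V \<and> x \<in> V \<and> V \<subseteq> U \<and> vb_section fn F V (\<lambda>x. \<phi> x (s x))"
      using UN x N(2) by (intro exI[of _ "U \<inter> N"]) auto
  qed (use U in blast)
qed (use lin in auto)

lemma vb_map_frame_section:
  assumes E: "vbundle opn fn B E" and \<phi>: "vb_map opn fn A E F \<phi>" and V: "(V, r, e) \<in> frames E"
    and N: "opn N" "N \<subseteq> V" "N \<subseteq> A" and "i < r"
  shows "vb_section fn F N (\<lambda>y. \<phi> y (e i y))"
  using vb_mapD(3)[OF \<phi> N(1,3) vb_section_mono[OF E vbundle_frameD(4)[OF E V \<open>i < r\<close>] N(1,2)]] .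

lemma vb_map_lincomb:
  assumes E: "vbundle opn fn B E" and F: "vbundle opn fn B F" and A: "opn A" "A \<subseteq> B"
    and \<phi>: "\<And>j. j < m \<Longrightarrow> vb_map opn fn A E F (\<phi> j)" and a: "\<And>j. j < m \<Longrightarrow> fn A (a j)"
  shows "vb_map opn fn A E F (\<lambda>x v. vcomb m (\<lambda>j. a j x) (\<lambda>j. \<phi> j x v))"
  unfolding vb_map_def
proof (intro conjI allI impI ballI Pi_I)
  fix x v assume x: "x \<in> A" and v: "v \<in> fib E x"
  obtain V r e where V: "(V, r, e) \<in> frames F" "x \<in> V" using vbundle_frameE[OF F] x A by blast
  show "vcomb m (\<lambda>j. a j x) (\<lambda>j. \<phi> j x v) \<in> fib F x"
    by (rule basis_of_closed[OF vbundle_frameD(3)[OF F V]]) (use vb_mapD(1)[OF \<phi>] x v in auto)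
next
  fix x v w b c assume x: "x \<in> A" and v: "v \<in> fib E x" and w: "w \<in> fib E x"
  have "\<phi> j x (\<lambda>k. b * v k + c * w k) = (\<lambda>k. b * \<phi> j x v k + c * \<phi> j x w k)" if "j < m" for j
    by (rule vb_mapD(2)[OF \<phi>[OF that] x v w])
  then show "vcomb m (\<lambda>j. a j x) (\<lambda>j. \<phi> j x (\<lambda>k. b * v k + c * w k)) =
      (\<lambda>k. b * vcomb m (\<lambda>j. a j x) (\<lambda>j. \<phi> j x v) k + c * vcomb m (\<lambda>j. a j x) (\<lambda>j. \<phi> j x w) k)"
    unfolding vcomb_def by (auto simp: sum_distrib_left sum.distrib[symmetric] algebra_simps intro!: sum.cong)
next
  fix U s assume U: "opn U \<and> U \<subseteq> A \<and> vb_section fn E U s"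
  show "vb_section fn F U (\<lambda>x. vcomb m (\<lambda>j. a j x) (\<lambda>j. \<phi> j x (s x)))"
    by (rule vb_section_vcomb[OF F]) (use U A vb_mapD(3)[OF \<phi>] fn_mono[OF a] in auto)
qed

lemma vb_map_id: "vb_map opn fn A E E (\<lambda>x v. v)"
  unfolding vb_map_def by auto

lemma vb_map_lin2:
  assumes E: "vbundle opn fn B E" and F: "vbundle opn fn B F" and A: "opn A" "A \<subseteq> B"
    and \<phi>: "vb_map opn fn A E F \<phi>" "vb_map opn fn A E F \<psi>"
  shows "vb_map opn fn A E F (\<lambda>x v k. a * \<phi> x v k + b * \<psi> x v k)"
proof -
  have "vb_map opn fn A E F (\<lambda>x v. vcomb 2 (\<lambda>j. if j = 0 then a else b) (\<lambda>j. (if j = 0 then \<phi> else \<psi>) x v))"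
    by (rule vb_map_lincomb[OF E F A]) (use \<phi> fn_const[OF A(1)] in auto)
  moreover have "vcomb 2 (\<lambda>j. if j = 0 then a else b) (\<lambda>j. (if j = 0 then \<phi> else \<psi>) x v) = (\<lambda>k. a * \<phi> x v k + b * \<psi> x v k)"
    for x v
    by (simp add: vcomb_def numeral_2_eq_2)
  ultimately show ?thesis by simp
qed

section \<open>Direct sums of bundles\<close>

lemma component_vcomb: "component i (vcomb r c e) = vcomb r c (\<lambda>j. component i (e j))"
  by (simp add: component_def vcomb_def)

lemma fib_vb_sum:
  "fib (vb_sum opn fn N E) x = {v. \<forall>i. if i \<in> N then component i v \<in> fib (E i) x else component i v = (\<lambda>k. 0)}"
  by (simp add: vb_sum_def Let_def)

lemma frames_vb_sum:
  "(U, r, e) \<in> frames (vb_sum opn fn N E) \<longleftrightarrow> opn U \<and>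
     (\<forall>x\<in>U. basis_of (fib (vb_sum opn fn N E) x) r (\<lambda>j. e j x)) \<and>
     (\<forall>j<r. \<forall>i\<in>N. vb_section fn (E i) U (\<lambda>x. component i (e j x)))"
  by (simp add: vb_sum_def Let_def)

context
  fixes B :: "'b set" and N :: "'i set" and E :: "'i \<Rightarrow> ('b, 'k) vb" and N' :: "'i set"
  assumes B: "opn B" and E: "\<And>i. i \<in> N \<Longrightarrow> vbundle opn fn B (E i)"
    and N': "finite N'" "N' \<subseteq> N" "\<And>i x. i \<in> N - N' \<Longrightarrow> x \<in> B \<Longrightarrow> fib (E i) x = {\<lambda>k. 0}"
begin

text \<open>The frame is the concatenation of frames of the summands.\<close>

lemma vb_sum_frame:
  assumes "x \<in> B"
  obtains U r f where "x \<in> U" "U \<subseteq> B" "(U, r, f) \<in> frames (vb_sum opn fn N E)"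
    "\<forall>U' s. opn U' \<longrightarrow> U' \<subseteq> U \<longrightarrow> (\<forall>x\<in>U'. s x \<in> fib (vb_sum opn fn N E) x) \<longrightarrow>
      (\<forall>i\<in>N. vb_section fn (E i) U' (\<lambda>x. component i (s x))) \<longrightarrow>
      (\<exists>c. (\<forall>j<r. fn U' (c j)) \<and> (\<forall>x\<in>U'. s x = vcomb r (\<lambda>j. c j x) (\<lambda>j. f j x)))"
proof -
  let ?S = "vb_sum opn fn N E"
  have "\<forall>i\<in>N'. \<exists>F. F \<in> frames (E i) \<and> x \<in> fst F"
  proof
    fix i assume "i \<in> N'"
    then obtain V r e where "(V, r, e) \<in> frames (E i)" "x \<in> V"
      using vbundle_frameE[OF E assms] N'(2) by blast
    then show "\<exists>F. F \<in> frames (E i) \<and> x \<in> fst F" by (intro exI[of _ "(V, r, e)"]) simp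
  qed
  then obtain F where F: "\<forall>i\<in>N'. F i \<in> frames (E i) \<and> x \<in> fst (F i)"
    by (rule bchoice[THEN exE])
  define V where "V i = fst (F i)" for i
  define rk where "rk i = fst (snd (F i))" for i
  define e where "e i = snd (snd (F i))" for i
  have fr: "(V i, rk i, e i) \<in> frames (E i)" "x \<in> V i" if "i \<in> N'" for i
    using F that by (simp_all add: V_def rk_def e_def)
  have D: "opn (V i)" "V i \<subseteq> B" "\<And>y. y \<in> V i \<Longrightarrow> basis_of (fib (E i) y) (rk i) (\<lambda>l. e i l y)"
      "\<And>l. l < rk i \<Longrightarrow> vb_section fn (E i) (V i) (e i l)" if "i \<in> N'" for i
    using vbundle_frameD[OF E fr(1)] that N'(2) by blast+
  define U where "U = B \<inter> (\<Inter>i\<in>N'. V i)"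
  have "opn (B \<inter> (\<Inter>i\<in>I. V i))" if "finite I" "I \<subseteq> N'" for I
    using that
  proof (induction I rule: finite_induct)
    case (insert i I)
    then have "opn (V i \<inter> (B \<inter> (\<Inter>i\<in>I. V i)))" by (intro opn_Int[OF D(1)]) auto
    moreover have "V i \<inter> (B \<inter> (\<Inter>i\<in>I. V i)) = B \<inter> (\<Inter>i\<in>insert i I. V i)" by blast
    ultimately show ?case by simp
  qed (use B in simp)
  then have U: "opn U" unfolding U_def using N'(1) by blast
  have UV: "U \<subseteq> V i" if "i \<in> N'" for i unfolding U_def using that by blast
  have UB: "U \<subseteq> B" unfolding U_def by blast
  have xU: "x \<in> U" unfolding U_def using assms fr(2) by blast
  define J where "J = (SIGMA i:N'. {..<rk i})"
  have "finite J" unfolding J_def using N'(1) by blast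
  then obtain h where h: "bij_betw h {..<card J} J"
    using ex_bij_betw_nat_finite[of J] by (auto simp: atLeast0LessThan)
  define f where "f j y = (\<lambda>(i, k). if i = fst (h j) then e i (snd (h j)) y k else 0)" for j y
  have hJ: "h j \<in> J" if "j < card J" for j
    using h that by (auto simp: bij_betw_def)
  \<comment> \<open>With coefficients indexed by the pairs in \<open>J\<close>, a component of a
    combination is a combination in the frame of that summand. Spanning, independence and admissible
    coefficients are all read off from this.\<close>
  have comp: "component i (vcomb (card J) (\<lambda>j. d (h j)) (\<lambda>j. f j y)) =
      (if i \<in> N' then vcomb (rk i) (\<lambda>l. d (i, l)) (\<lambda>l. e i l y) else (\<lambda>k. 0))" for d i y
  proof
    fix k
    have "component i (vcomb (card J) (\<lambda>j. d (h j)) (\<lambda>j. f j y)) k =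
        (\<Sum>j<card J. d (h j) * (if i = fst (h j) then e i (snd (h j)) y k else 0))"
      by (simp add: component_def vcomb_def f_def)
    also have "\<dots> = (\<Sum>p\<in>J. d p * (if i = fst p then e i (snd p) y k else 0))"
      by (rule sum.reindex_bij_betw[OF h, of "\<lambda>p. d p * (if i = fst p then e i (snd p) y k else 0)"])
    also have "\<dots> = (\<Sum>i'\<in>N'. \<Sum>l<rk i'. d (i', l) * (if i = i' then e i l y k else 0))"
      unfolding J_def using N'(1) by (subst sum.Sigma) (auto simp: case_prod_beta)
    also have "\<dots> = (\<Sum>i'\<in>N'. if i = i' then \<Sum>l<rk i. d (i, l) * e i l y k else 0)"
      by (intro sum.cong refl) auto
    also have "\<dots> = (if i \<in> N' then vcomb (rk i) (\<lambda>l. d (i, l)) (\<lambda>l. e i l y) else (\<lambda>k. 0)) k"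
      using N'(1) by (simp add: vcomb_def)
    finally show "component i (vcomb (card J) (\<lambda>j. d (h j)) (\<lambda>j. f j y)) k =
        (if i \<in> N' then vcomb (rk i) (\<lambda>l. d (i, l)) (\<lambda>l. e i l y) else (\<lambda>k. 0)) k" .
  qed
  obtain h' where h': "\<And>j. j < card J \<Longrightarrow> h' (h j) = j"
    using h bij_betw_imp_inj_on[OF h] inv_into_f_f by (metis lessThan_iff)
  have comp': "component i (vcomb (card J) c (\<lambda>j. f j y)) =
      (if i \<in> N' then vcomb (rk i) (\<lambda>l. c (h' (i, l))) (\<lambda>l. e i l y) else (\<lambda>k. 0))" for c i y
  proof -
    have "vcomb (card J) c (\<lambda>j. f j y) = vcomb (card J) (\<lambda>j. (\<lambda>p. c (h' p)) (h j)) (\<lambda>j. f j y)"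
      by (intro vcomb_cong) (auto simp: h')
    then show ?thesis using comp[of i "\<lambda>p. c (h' p)" y] by simp
  qed
  have comp_eq: "v = w" if "\<And>i. component i v = component i w" for v w :: "'i \<times> 'k \<Rightarrow> complex"
  proof
    fix p :: "'i \<times> 'k"
    obtain i k where "p = (i, k)" by (cases p)
    then show "v p = w p" using fun_cong[OF that[of i], of k] by (simp add: component_def)
  qed
  have S_comp: "component i v = (\<lambda>k. 0)" if "v \<in> fib ?S y" "y \<in> B" "i \<notin> N'" for v y i
  proof (cases "i \<in> N")
    case True
    then have "component i v \<in> fib (E i) y" using that(1) unfolding fib_vb_sum by (auto dest: spec[of _ i])
    then show ?thesis using N'(3) True that by blast
  next
    case False
    then show ?thesis using that(1) unfolding fib_vb_sum by (auto dest: spec[of _ i])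
  qed
  have basis: "basis_of (fib ?S y) (card J) (\<lambda>j. f j y)" if y: "y \<in> U" for y
    unfolding basis_of_def
  proof (intro conjI allI impI)
    show "fib ?S y = range (\<lambda>c. vcomb (card J) c (\<lambda>j. f j y))"
    proof
      show "range (\<lambda>c. vcomb (card J) c (\<lambda>j. f j y)) \<subseteq> fib ?S y"
      proof clarify
        fix c
        have "(\<lambda>k. 0) \<in> fib (E i) y" if "i \<in> N - N'" for i
          using N'(3)[OF that] y UB by blast
        moreover have "vcomb (rk i) d (\<lambda>l. e i l y) \<in> fib (E i) y" if "i \<in> N'" for i d
          using basis_of_vcomb[OF D(3)[OF that]] UV[OF that] y by blast
        ultimately show "vcomb (card J) c (\<lambda>j. f j y) \<in> fib ?S y"
          unfolding fib_vb_sum using N'(2) by (auto simp: comp')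
      qed
      show "fib ?S y \<subseteq> range (\<lambda>c. vcomb (card J) c (\<lambda>j. f j y))"
      proof
        fix v assume v: "v \<in> fib ?S y"
        have "\<forall>i\<in>N'. \<exists>c. component i v = vcomb (rk i) c (\<lambda>l. e i l y)"
        proof
          fix i assume i: "i \<in> N'"
          then have "component i v \<in> fib (E i) y" using v N'(2) unfolding fib_vb_sum by (auto dest: spec[of _ i])
          moreover have "basis_of (fib (E i) y) (rk i) (\<lambda>l. e i l y)" using D(3)[OF i] UV[OF i] y by blast
          ultimately show "\<exists>c. component i v = vcomb (rk i) c (\<lambda>l. e i l y)" by (metis basis_ofE)
        qed
        then obtain c where c: "\<forall>i\<in>N'. component i v = vcomb (rk i) (c i) (\<lambda>l. e i l y)"
          by (rule bchoice[THEN exE])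
        have "v = vcomb (card J) (\<lambda>j. (\<lambda>(i, l). c i l) (h j)) (\<lambda>j. f j y)"
          using c S_comp[OF v] y UB by (intro comp_eq) (auto simp: comp)
        then show "v \<in> range (\<lambda>c. vcomb (card J) c (\<lambda>j. f j y))" by blast
      qed
    qed
    fix c j assume z: "vcomb (card J) c (\<lambda>j. f j y) = (\<lambda>k. 0)" and j: "j < card J"
    obtain i l where il: "h j = (i, l)" "i \<in> N'" "l < rk i"
      using hJ[OF j] unfolding J_def by (cases "h j") auto
    have "component i (vcomb (card J) c (\<lambda>j. f j y)) = (\<lambda>k. 0)"
      unfolding z by (simp add: component_def)
    then have "vcomb (rk i) (\<lambda>l. c (h' (i, l))) (\<lambda>l. e i l y) = (\<lambda>k. 0)"
      using il(2) by (simp add: comp')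
    moreover have "basis_of (fib (E i) y) (rk i) (\<lambda>l. e i l y)" using D(3)[OF il(2)] UV[OF il(2)] y by blast
    ultimately have "c (h' (i, l)) = 0" using il(3) unfolding basis_of_def by blast
    then show "c j = 0" using h'[OF j] il(1) by simp
  qed
  have sec: "vb_section fn (E i) U (\<lambda>y. component i (f j y))" if "j < card J" "i \<in> N" for i j
  proof -
    have eq: "component i (f j y) = (if i = fst (h j) then e i (snd (h j)) y else (\<lambda>k. 0))" for y
      by (auto simp: component_def f_def)
    show ?thesis
    proof (cases "i = fst (h j)")
      case True
      then have "i \<in> N'" "snd (h j) < rk i" using hJ[OF that(1)] unfolding J_def by auto
      then show ?thesis
        unfolding eq using True vb_section_mono[OF E[OF that(2)] D(4) U UV] by simp
    next
      case False
      have "vb_section fn (E i) U (\<lambda>x. vcomb 0 (\<lambda>j. undefined) (\<lambda>j. undefined))"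
        by (rule vb_section_vcomb[OF E[OF that(2)] U UB]) auto
      then show ?thesis unfolding eq using False by simp
    qed
  qed
  show thesis
  proof (rule that[OF xU UB])
    show "(U, card J, f) \<in> frames ?S"
      unfolding frames_vb_sum using U basis sec by blast
    show "\<forall>U' s. opn U' \<longrightarrow> U' \<subseteq> U \<longrightarrow> (\<forall>x\<in>U'. s x \<in> fib ?S x) \<longrightarrow>
      (\<forall>i\<in>N. vb_section fn (E i) U' (\<lambda>x. component i (s x))) \<longrightarrow>
      (\<exists>c. (\<forall>j<card J. fn U' (c j)) \<and> (\<forall>x\<in>U'. s x = vcomb (card J) (\<lambda>j. c j x) (\<lambda>j. f j x)))"
    proof (intro allI impI)
      fix U' s
      assume U': "opn U'" "U' \<subseteq> U" and s: "\<forall>x\<in>U'. s x \<in> fib ?S x"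
        and cs: "\<forall>i\<in>N. vb_section fn (E i) U' (\<lambda>x. component i (s x))"
      have "\<forall>i\<in>N'. \<exists>c. (\<forall>l<rk i. fn U' (c l)) \<and> (\<forall>y\<in>U'. component i (s y) = vcomb (rk i) (\<lambda>l. c l y) (\<lambda>l. e i l y))"
      proof
        fix i assume i: "i \<in> N'"
        obtain c where "\<forall>l<rk i. fn (U' \<inter> V i) (c l)"
            "\<forall>y\<in>U' \<inter> V i. component i (s y) = vcomb (rk i) (\<lambda>l. c l y) (\<lambda>l. e i l y)"
          using vb_sectionE[OF cs[rule_format] fr(1)[OF i]] i N'(2) by blast
        moreover have "U' \<inter> V i = U'" using U'(2) UV[OF i] by blast
        ultimately show "\<exists>c. (\<forall>l<rk i. fn U' (c l)) \<and> (\<forall>y\<in>U'. component i (s y) = vcomb (rk i) (\<lambda>l. c l y) (\<lambda>l. e i l y))"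
          by (intro exI[of _ c]) simp
      qed
      then obtain c where c: "\<forall>i\<in>N'. (\<forall>l<rk i. fn U' (c i l)) \<and>
          (\<forall>y\<in>U'. component i (s y) = vcomb (rk i) (\<lambda>l. c i l y) (\<lambda>l. e i l y))"
        by (rule bchoice[THEN exE])
      have "s y = vcomb (card J) (\<lambda>j. (\<lambda>(i, l). c i l y) (h j)) (\<lambda>j. f j y)" if y: "y \<in> U'" for y
        using c S_comp[of "s y" y] s y U'(2) UB by (intro comp_eq) (auto simp: comp)
      moreover have "fn U' (\<lambda>y. (\<lambda>(i, l). c i l y) (h j))" if j: "j < card J" for j
        using hJ[OF j] c unfolding J_def by (cases "h j") auto
      ultimately show "\<exists>c. (\<forall>j<card J. fn U' (c j)) \<and> (\<forall>x\<in>U'. s x = vcomb (card J) (\<lambda>j. c j x) (\<lambda>j. f j x))"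
        by (intro exI[of _ "\<lambda>j y. (\<lambda>(i, l). c i l y) (h j)"]) auto
    qed
  qed
qed

text \<open>\<open>vb_sum\<close> accepts every pointwise basis with admissible components as a
  frame, not only concatenated ones. Coefficients in an arbitrary frame are obtained by a change of
  frame from a concatenated one.\<close>

lemma vb_sum_coefficients:
  assumes V: "(V, r, e) \<in> frames (vb_sum opn fn N E)" and "V \<subseteq> B"
    and U: "opn U" "U \<subseteq> B" and s: "\<And>x. x \<in> U \<Longrightarrow> s x \<in> fib (vb_sum opn fn N E) x"
    and cs: "\<And>i. i \<in> N \<Longrightarrow> vb_section fn (E i) U (\<lambda>x. component i (s x))"
    and c: "\<And>x. x \<in> U \<inter> V \<Longrightarrow> s x = vcomb r (\<lambda>j. c j x) (\<lambda>j. e j x)" and j: "j < r"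
  shows "fn (U \<inter> V) (c j)"
proof -
  let ?S = "vb_sum opn fn N E"
  have opV: "opn V" and bV: "\<And>x. x \<in> V \<Longrightarrow> basis_of (fib ?S x) r (\<lambda>j. e j x)"
    and ce: "\<And>j i. j < r \<Longrightarrow> i \<in> N \<Longrightarrow> vb_section fn (E i) V (\<lambda>x. component i (e j x))"
    using V unfolding frames_vb_sum by blast+
  have UV: "opn (U \<inter> V)" by (rule opn_Int[OF U(1) opV])
  show ?thesis
  proof (rule fn_local[OF _ UV])
    fix x assume x: "x \<in> U \<inter> V"
    then have "x \<in> B" using U by blast
    then obtain W R f where W: "x \<in> W" "W \<subseteq> B" "(W, R, f) \<in> frames ?S"
      and co: "\<forall>U' s. opn U' \<longrightarrow> U' \<subseteq> W \<longrightarrow> (\<forall>x\<in>U'. s x \<in> fib ?S x) \<longrightarrow>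
        (\<forall>i\<in>N. vb_section fn (E i) U' (\<lambda>x. component i (s x))) \<longrightarrow>
        (\<exists>c. (\<forall>j<R. fn U' (c j)) \<and> (\<forall>x\<in>U'. s x = vcomb R (\<lambda>j. c j x) (\<lambda>j. f j x)))"
      by (rule vb_sum_frame)
    have bW: "opn W" "\<And>x. x \<in> W \<Longrightarrow> basis_of (fib ?S x) R (\<lambda>j. f j x)"
      using W(3) unfolding frames_vb_sum by blast+
    let ?U = "U \<inter> V \<inter> W"
    have opU: "opn ?U" by (rule opn_Int[OF UV bW(1)])
    have "\<exists>P. (\<forall>i<R. fn ?U (P i)) \<and> (\<forall>x\<in>?U. e l x = vcomb R (\<lambda>i. P i x) (\<lambda>i. f i x))" if l: "l < r" for l
    proof (rule co[rule_format, OF opU])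
      show "e l x \<in> fib ?S x" if "x \<in> ?U" for x
        using basis_of_mem[OF bV l] that by blast
      show "vb_section fn (E i) ?U (\<lambda>x. component i (e l x))" if "i \<in> N" for i
        by (rule vb_section_mono[OF E[OF that] ce[OF l that] opU]) blast
    qed blast
    then have "\<forall>l\<in>{..<r}. \<exists>P. (\<forall>i<R. fn ?U (P i)) \<and> (\<forall>x\<in>?U. e l x = vcomb R (\<lambda>i. P i x) (\<lambda>i. f i x))"
      by blast
    then obtain P where P: "\<forall>l\<in>{..<r}. (\<forall>i<R. fn ?U (P l i)) \<and> (\<forall>x\<in>?U. e l x = vcomb R (\<lambda>i. P l i x) (\<lambda>i. f i x))"
      by (rule bchoice[THEN exE])
    have "\<exists>q. (\<forall>i<R. fn ?U (q i)) \<and> (\<forall>x\<in>?U. s x = vcomb R (\<lambda>i. q i x) (\<lambda>i. f i x))"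
    proof (rule co[rule_format, OF opU])
      show "s x \<in> fib ?S x" if "x \<in> ?U" for x using s that by blast
      show "vb_section fn (E i) ?U (\<lambda>x. component i (s x))" if "i \<in> N" for i
        by (rule vb_section_mono[OF E[OF that] cs[OF that] opU]) blast
    qed blast
    then obtain q where q: "\<forall>i<R. fn ?U (q i)" "\<forall>x\<in>?U. s x = vcomb R (\<lambda>i. q i x) (\<lambda>i. f i x)"
      by (elim exE conjE)
    have "fn ?U (c j)"
    proof (rule fn_change_of_frame[OF opU, where fb = "fib ?S" and e = e and f = f and P = "\<lambda>i j. P j i" and q = q and s = s])
      show "basis_of (fib ?S x) r (\<lambda>j. e j x)" "basis_of (fib ?S x) R (\<lambda>j. f j x)" if "x \<in> ?U" for x
        using bV bW(2) that by blast+
      show "s x = vcomb r (\<lambda>j. c j x) (\<lambda>j. e j x)" if "x \<in> ?U" for x using c that by blast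
    qed (use P q j in blast)+
    then show "\<exists>W. opn W \<and> x \<in> W \<and> W \<subseteq> U \<inter> V \<and> fn W (c j)"
      using opU x W(1) by blast
  qed
qed

lemma vb_sum_sectionI:
  assumes sub: "\<And>V. opn V \<Longrightarrow> V \<subseteq> B"
    and U: "opn U" and s: "\<And>x. x \<in> U \<Longrightarrow> s x \<in> fib (vb_sum opn fn N E) x"
    and cs: "\<And>i. i \<in> N \<Longrightarrow> vb_section fn (E i) U (\<lambda>x. component i (s x))"
  shows "vb_section fn (vb_sum opn fn N E) U s"
proof (rule vb_sectionI[OF s])
  fix V r e assume V: "(V, r, e) \<in> frames (vb_sum opn fn N E)"
  then have opV: "opn V" and bV: "\<forall>x\<in>V. basis_of (fib (vb_sum opn fn N E) x) r (\<lambda>j. e j x)"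
    unfolding frames_vb_sum by blast+
  have "\<forall>x\<in>U \<inter> V. \<exists>c. s x = vcomb r c (\<lambda>j. e j x)"
    using s bV by (meson IntD1 IntD2 basis_ofE)
  then obtain c where c: "\<forall>x\<in>U \<inter> V. s x = vcomb r (c x) (\<lambda>j. e j x)"
    by (rule bchoice[THEN exE])
  have "fn (U \<inter> V) (\<lambda>x. c x j)" if "j < r" for j
    by (rule vb_sum_coefficients[OF V sub[OF opV] U sub[OF U] s cs, where c = "\<lambda>j x. c x j"])
      (use c that in auto)
  then show "\<exists>c. (\<forall>j<r. fn (U \<inter> V) (c j)) \<and> (\<forall>x\<in>U \<inter> V. s x = vcomb r (\<lambda>j. c j x) (\<lambda>j. e j x))"
    using c by (intro exI[of _ "\<lambda>j x. c x j"]) auto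
qed

lemma vbundle_vb_sum:
  assumes sub: "\<And>V. opn V \<Longrightarrow> V \<subseteq> B"
  shows "vbundle opn fn B (vb_sum opn fn N E)"
proof -
  let ?S = "vb_sum opn fn N E"
  have fr: "opn V" "V \<subseteq> B" "\<And>x. x \<in> V \<Longrightarrow> basis_of (fib ?S x) r (\<lambda>j. e j x)"
      "\<And>j. j < r \<Longrightarrow> vb_section fn ?S V (e j)" if V: "(V, r, e) \<in> frames ?S" for V r e
  proof -
    show *: "opn V" "\<And>x. x \<in> V \<Longrightarrow> basis_of (fib ?S x) r (\<lambda>j. e j x)" using V unfolding frames_vb_sum by blast+
    then show "V \<subseteq> B" using sub by blast
    show "vb_section fn ?S V (e j)" if "j < r" for j
      by (rule vb_sum_sectionI[OF sub *(1)])
        (use V that basis_of_mem[OF *(2)] in \<open>auto simp: frames_vb_sum\<close>)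
  qed
  have "B \<subseteq> (\<Union>(U, r, e)\<in>frames ?S. U)"
  proof
    fix x assume "x \<in> B"
    then obtain U r f where "x \<in> U" "(U, r, f) \<in> frames ?S" using vb_sum_frame by metis
    then show "x \<in> (\<Union>(U, r, e)\<in>frames ?S. U)" by blast
  qed
  then show ?thesis
    unfolding vbundle_def using fr by fast
qed

lemma vb_section_component:
  assumes sub: "\<And>V. opn V \<Longrightarrow> V \<subseteq> B" and U: "opn U" and s: "vb_section fn (vb_sum opn fn N E) U s" and i: "i \<in> N"
  shows "vb_section fn (E i) U (\<lambda>x. component i (s x))"
proof (rule vb_section_local[OF E[OF i] U])
  let ?S = "vb_sum opn fn N E"
  fix x assume x: "x \<in> U"
  then have "x \<in> B" using sub U by blast
  then obtain W r e where W: "x \<in> W" "(W, r, e) \<in> frames ?S" using vb_sum_frame by metis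
  obtain c where c: "\<forall>j<r. fn (U \<inter> W) (c j)" "\<forall>x\<in>U \<inter> W. s x = vcomb r (\<lambda>j. c j x) (\<lambda>j. e j x)"
    by (rule vb_sectionE[OF s W(2)])
  have W': "opn W" "\<And>j. j < r \<Longrightarrow> vb_section fn (E i) W (\<lambda>x. component i (e j x))"
    using W(2) i unfolding frames_vb_sum by blast+
  have UW: "opn (U \<inter> W)" by (rule opn_Int[OF U W'(1)])
  have "vb_section fn (E i) (U \<inter> W) (\<lambda>x. vcomb r (\<lambda>j. c j x) (\<lambda>j. component i (e j x)))"
    by (rule vb_section_vcomb[OF E[OF i] UW sub[OF UW]])
      (use c(1) vb_section_mono[OF E[OF i] W'(2) UW] in auto)
  then have "vb_section fn (E i) (U \<inter> W) (\<lambda>x. component i (s x))"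
    by (rule vb_section_cong) (use c(2) in \<open>simp add: component_vcomb\<close>)
  then show "\<exists>V. opn V \<and> x \<in> V \<and> V \<subseteq> U \<and> vb_section fn (E i) V (\<lambda>x. component i (s x))"
    using UW x W(1) by (intro exI[of _ "U \<inter> W"]) auto
qed

end

end

section \<open>Topological bundles and difference bundles\<close>

lemma cont_fn_mono: "cont_fn T U f \<Longrightarrow> V \<subseteq> U \<Longrightarrow> cont_fn T V f"
  unfolding cont_fn_def by (rule continuous_map_from_subtopology_mono)

lemma cont_fn_cong:
  assumes "cont_fn T U f" "\<And>x. x \<in> U \<Longrightarrow> f x = g x"
  shows "cont_fn T U g"
  using assms(1) unfolding cont_fn_def by (rule continuous_map_eq) (use assms(2) in auto)

lemma cont_fn_openin:
  assumes "openin T U"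
  shows "cont_fn T U f \<longleftrightarrow> (\<forall>C. open C \<longrightarrow> openin T {x \<in> U. f x \<in> C})"
proof -
  have "U \<subseteq> topspace T" using assms by (rule openin_subset)
  then have *: "{x \<in> topspace (subtopology T U). f x \<in> C} = {x \<in> U. f x \<in> C}" for C by auto
  show ?thesis
    unfolding cont_fn_def continuous_map_def * using assms by (auto simp: openin_open_subtopology)
qed

lemma cont_fn_mult:
  assumes "cont_fn T U f" "cont_fn T U g"
  shows "cont_fn T U (\<lambda>x. f x * g x)"
proof -
  have "continuous_map (subtopology T U) (prod_topology euclidean euclidean) (\<lambda>x. (f x, g x))"
    unfolding continuous_map_pairwise using assms by (simp add: cont_fn_def o_def)
  moreover have "continuous_map (prod_topology euclidean euclidean) euclidean (\<lambda>p. fst p * snd p :: complex)"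
    by (simp add: continuous_on_fst continuous_on_snd continuous_on_mult)
  ultimately show ?thesis
    unfolding cont_fn_def by (rule continuous_map_compose[unfolded o_def, THEN continuous_map_eq]) simp
qed

lemma cont_fn_compose_continuous:
  assumes "cont_fn T U f" "f \<in> U \<rightarrow> S" "continuous_on S g"
  shows "cont_fn T U (\<lambda>x. g (f x))"
proof -
  have "continuous_map (subtopology T U) (top_of_set S) f"
    using assms(1,2) by (auto simp: cont_fn_def continuous_map_in_subtopology)
  moreover have "continuous_map (top_of_set S) euclidean g"
    using assms(3) by simp
  ultimately show ?thesis
    unfolding cont_fn_def by (rule continuous_map_compose[unfolded o_def, THEN continuous_map_eq]) simp
qed

lemma topological_fun_space: "fun_space (openin T) (cont_fn T)"
proof
  show "cont_fn T U f" if loc: "\<And>x. x \<in> U \<Longrightarrow> \<exists>V. openin T V \<and> x \<in> V \<and> V \<subseteq> U \<and> cont_fn T V f" and U: "openin T U"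
    for U f
    unfolding cont_fn_openin[OF U]
  proof (intro allI impI)
    fix C :: "complex set" assume C: "open C"
    show "openin T {x \<in> U. f x \<in> C}"
    proof (subst openin_subopen, intro ballI)
      fix x assume x: "x \<in> {x \<in> U. f x \<in> C}"
      then obtain V where V: "openin T V" "x \<in> V" "V \<subseteq> U" "cont_fn T V f" using loc by blast
      then have "openin T {x \<in> V. f x \<in> C}" using C by (simp add: cont_fn_openin)
      then show "\<exists>W. openin T W \<and> x \<in> W \<and> W \<subseteq> {x \<in> U. f x \<in> C}"
        using x V by (intro exI[of _ "{x \<in> V. f x \<in> C}"]) auto
    qed
  qed
  show "openin T {x \<in> U. f x \<noteq> 0}" if "cont_fn T U f" "openin T U" for U f
  proof -
    have "openin T {x \<in> U. f x \<in> - {0}}"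
      using that cont_fn_openin[OF that(2), of f] open_Compl[of "{0 :: complex}"] by blast
    then show ?thesis by simp
  qed
  show "cont_fn T U (\<lambda>x. inverse (f x))" if "cont_fn T U f" "\<And>x. x \<in> U \<Longrightarrow> f x \<noteq> 0" for U f
    by (rule cont_fn_compose_continuous[OF that(1), of "- {0}"])
      (use that(2) in \<open>auto intro!: continuous_intros\<close>)
qed (auto simp: cont_fn_mult intro: cont_fn_mono cont_fn_cong, auto simp: cont_fn_def intro: continuous_map_add)

lemma cont_fn_pull:
  assumes "cont_fn T U c" "continuous_map T' T f" "U' \<subseteq> topspace T'" "f ` U' \<subseteq> U"
  shows "cont_fn T' U' (\<lambda>x. c (f x))"
proof -
  have "continuous_map (subtopology T' U') (subtopology T U) f"
    using assms by (intro continuous_map_into_subtopology continuous_map_from_subtopology) auto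
  then show ?thesis
    using continuous_map_compose[OF _ assms(1)[unfolded cont_fn_def]] unfolding cont_fn_def
    by (simp add: o_def)
qed

section \<open>Pullbacks of bundles\<close>

lemma fib_vb_pull [simp]: "fib (vb_pull f S E) x = fib E (f x)"
  by (simp add: vb_pull_def)

lemma frames_vb_pull:
  "frames (vb_pull f S E) = (\<lambda>(U, r, e). ({s \<in> S. f s \<in> U}, r, \<lambda>i s. e i (f s))) ` frames E"
  by (simp add: vb_pull_def)

lemma vb_section_pull:
  assumes s: "vb_section (cont_fn T) E U s" and f: "continuous_map T' T f" and U': "U' \<subseteq> topspace T'" "f ` U' \<subseteq> U"
  shows "vb_section (cont_fn T') (vb_pull f (topspace T') E) U' (\<lambda>x. s (f x))"
  unfolding vb_section_def
proof (intro conjI ballI)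
  show "s (f x) \<in> fib (vb_pull f (topspace T') E) x" if "x \<in> U'" for x
    using s U' that unfolding vb_section_def by auto
  fix F assume "F \<in> frames (vb_pull f (topspace T') E)"
  then obtain V r e where V: "(V, r, e) \<in> frames E" and F: "F = ({s \<in> topspace T'. f s \<in> V}, r, \<lambda>i s. e i (f s))"
    unfolding frames_vb_pull by auto
  obtain c where c: "\<forall>i<r. cont_fn T (U \<inter> V) (c i)" "\<forall>x\<in>U \<inter> V. s x = vcomb r (\<lambda>i. c i x) (\<lambda>i. e i x)"
    using s V unfolding vb_section_def by fastforce
  have "\<forall>i<r. cont_fn T' (U' \<inter> {s \<in> topspace T'. f s \<in> V}) (\<lambda>x. c i (f x))"
    using c(1) U' by (auto intro!: cont_fn_pull[OF _ f])
  moreover have "\<forall>x\<in>U' \<inter> {s \<in> topspace T'. f s \<in> V}. s (f x) = vcomb r (\<lambda>i. c i (f x)) (\<lambda>i. e i (f x))"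
    using c(2) U' by auto
  ultimately show "case F of (V, r, e) \<Rightarrow> \<exists>c. (\<forall>i<r. cont_fn T' (U' \<inter> V) (c i)) \<and>
      (\<forall>x\<in>U' \<inter> V. s (f x) = vcomb r (\<lambda>i. c i x) (\<lambda>i. e i x))"
    unfolding F prod.case by (intro exI[of _ "\<lambda>i x. c i (f x)"]) simp
qed

lemma top_vb_pull:
  assumes E: "top_vb T E" and f: "continuous_map T' T f"
  shows "top_vb T' (vb_pull f (topspace T') E)"
proof -
  interpret T: fun_space "openin T" "cont_fn T" by (rule topological_fun_space)
  have fT: "f x \<in> topspace T" if "x \<in> topspace T'" for x
    using continuous_map_image_subset_topspace[OF f] that by blast
  have "topspace T' \<subseteq> (\<Union>(U, r, e)\<in>frames (vb_pull f (topspace T') E). U)"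
  proof
    fix x assume x: "x \<in> topspace T'"
    obtain V r e where "(V, r, e) \<in> frames E" "f x \<in> V"
      by (rule T.vbundle_frameE[OF E fT[OF x]])
    then show "x \<in> (\<Union>(U, r, e)\<in>frames (vb_pull f (topspace T') E). U)"
      using x unfolding frames_vb_pull by force
  qed
  moreover have "openin T' V' \<and> V' \<subseteq> topspace T' \<and> (\<forall>x\<in>V'. basis_of (fib (vb_pull f (topspace T') E) x) r (\<lambda>i. e' i x)) \<and>
      (\<forall>i<r. vb_section (cont_fn T') (vb_pull f (topspace T') E) V' (e' i))"
    if "(V', r, e') \<in> frames (vb_pull f (topspace T') E)" for V' r e'
  proof -
    from that obtain V e where V: "(V, r, e) \<in> frames E" and
      eq: "V' = {s \<in> topspace T'. f s \<in> V}" "e' = (\<lambda>i s. e i (f s))"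
      unfolding frames_vb_pull by auto
    note D = T.vbundle_frameD[OF E V]
    have "openin T' V'" unfolding eq by (rule openin_continuous_map_preimage[OF f D(1)])
    moreover have "vb_section (cont_fn T') (vb_pull f (topspace T') E) V' (e' i)" if "i < r" for i
      unfolding eq by (rule vb_section_pull[OF D(4)[OF that] f]) auto
    ultimately show ?thesis using D(3) unfolding eq by auto
  qed
  ultimately show ?thesis
    unfolding vbundle_def by (intro conjI) fast+
qed

context fun_space
begin

lemma vbundleI:
  assumes "(\<Union>(U, r, e)\<in>frames E. U) = B"
    and "\<And>V r e. (V, r, e) \<in> frames E \<Longrightarrow> opn V"
    and b: "\<And>V r e x. (V, r, e) \<in> frames E \<Longrightarrow> x \<in> V \<Longrightarrow> basis_of (fib E x) r (\<lambda>i. e i x)"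
    and c: "\<And>V r e V' r' e' i. (V, r, e) \<in> frames E \<Longrightarrow> (V', r', e') \<in> frames E \<Longrightarrow> i < r \<Longrightarrow>
       \<exists>c. (\<forall>j<r'. fn (V \<inter> V') (c j)) \<and> (\<forall>x\<in>V \<inter> V'. e i x = vcomb r' (\<lambda>j. c j x) (\<lambda>j. e' j x))"
  shows "vbundle opn fn B E"
proof -
  have "vb_section fn E V (e i)" if V: "(V, r, e) \<in> frames E" "i < r" for V r e i
    by (rule vb_sectionI) (use c[OF V(1) _ V(2)] basis_of_mem[OF b[OF V(1)] V(2)] in auto)
  then show ?thesis
    unfolding vbundle_def using assms(1,2,3) by fast
qed

text \<open>Restricting a bundle usually produces a different set of frames than building it on the
  smaller space. The sections nevertheless agree if the frames of one bundle are parts of frames of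
  the other.\<close>

lemma vb_section_subframes:
  assumes E: "vbundle opn fn B E" and F: "vbundle opn fn B F" and fib: "\<And>x. fib E x = fib F x"
    and sub: "\<And>V r e. (V, r, e) \<in> frames E \<Longrightarrow> \<exists>V' e'. (V', r, e') \<in> frames F \<and> V \<subseteq> V' \<and> (\<forall>i<r. \<forall>x\<in>V. e i x = e' i x)"
    and U: "opn U" "U \<subseteq> B"
  shows "vb_section fn E U s \<longleftrightarrow> vb_section fn F U s"
proof
  assume s: "vb_section fn E U s"
  show "vb_section fn F U s"
  proof (rule vb_sectionI_frames[OF F U(1)])
    fix x assume x: "x \<in> U"
    obtain V r e where V: "(V, r, e) \<in> frames E" "x \<in> V" using vbundle_frameE[OF E] x U by blast
    obtain V' e' where V': "(V', r, e') \<in> frames F" "V \<subseteq> V'" "\<forall>i<r. \<forall>x\<in>V. e i x = e' i x"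
      using sub[OF V(1)] by blast
    obtain c where c: "\<forall>i<r. fn (U \<inter> V) (c i)" "\<forall>x\<in>U \<inter> V. s x = vcomb r (\<lambda>i. c i x) (\<lambda>i. e i x)"
      by (rule vb_sectionE[OF s V(1)])
    have "s y = vcomb r (\<lambda>i. c i y) (\<lambda>i. e' i y)" if "y \<in> U \<inter> V" for y
      using c(2)[rule_format, OF that] V'(3) that by (simp only:) (intro vcomb_cong, auto)
    moreover have "opn (U \<inter> V)" using U(1) vbundle_frameD(1)[OF E V(1)] opn_Int by blast
    ultimately show "\<exists>V r e N c. (V, r, e) \<in> frames F \<and> opn N \<and> x \<in> N \<and> N \<subseteq> U \<inter> V \<and>
       (\<forall>i<r. fn N (c i)) \<and> (\<forall>y\<in>N. s y = vcomb r (\<lambda>i. c i y) (\<lambda>i. e i y))"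
      using V'(1,2) c(1) x V(2)
      by (intro exI[of _ V'] exI[of _ r] exI[of _ e'] exI[of _ "U \<inter> V"] exI[of _ c]) auto
  qed
next
  assume s: "vb_section fn F U s"
  show "vb_section fn E U s"
  proof (rule vb_sectionI_frames[OF E U(1)])
    fix x assume x: "x \<in> U"
    obtain V r e where V: "(V, r, e) \<in> frames E" "x \<in> V" using vbundle_frameE[OF E] x U by blast
    obtain V' e' where V': "(V', r, e') \<in> frames F" "V \<subseteq> V'" "\<forall>i<r. \<forall>x\<in>V. e i x = e' i x"
      using sub[OF V(1)] by blast
    obtain c where c: "\<forall>i<r. fn (U \<inter> V') (c i)" "\<forall>x\<in>U \<inter> V'. s x = vcomb r (\<lambda>i. c i x) (\<lambda>i. e' i x)"
      by (rule vb_sectionE[OF s V'(1)])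
    have "s y = vcomb r (\<lambda>i. c i y) (\<lambda>i. e i y)" if "y \<in> U \<inter> V" for y
    proof -
      have "s y = vcomb r (\<lambda>i. c i y) (\<lambda>i. e' i y)" using c(2) that V'(2) by blast
      also have "\<dots> = vcomb r (\<lambda>i. c i y) (\<lambda>i. e i y)" using V'(3) that by (intro vcomb_cong) auto
      finally show ?thesis .
    qed
    moreover have UV: "opn (U \<inter> V)" using U(1) vbundle_frameD(1)[OF E V(1)] opn_Int by blast
    moreover have "\<forall>i<r. fn (U \<inter> V) (c i)"
      using c(1) fn_mono[OF _ UV, of "U \<inter> V'"] V'(2) by blast
    ultimately show "\<exists>V r e N c. (V, r, e) \<in> frames E \<and> opn N \<and> x \<in> N \<and> N \<subseteq> U \<inter> V \<and>
       (\<forall>i<r. fn N (c i)) \<and> (\<forall>y\<in>N. s y = vcomb r (\<lambda>i. c i y) (\<lambda>i. e i y))"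
      using V x by (intro exI[of _ V] exI[of _ r] exI[of _ e] exI[of _ "U \<inter> V"] exI[of _ c]) auto
  qed
qed

text \<open>A sum uses its summands only through fibres and sections. Summands with different sets
  of frames can therefore be exchanged by an equality instead of an isomorphism.\<close>

lemma vb_sum_cong:
  assumes "\<And>i x. i \<in> N \<Longrightarrow> fib (E i) x = fib (F i) x"
    and "\<And>i U s. i \<in> N \<Longrightarrow> opn U \<Longrightarrow> vb_section fn (E i) U s \<longleftrightarrow> vb_section fn (F i) U s"
  shows "vb_sum opn fn N E = vb_sum opn fn N F"
proof -
  have fb: "{v. \<forall>i. if i \<in> N then component i v \<in> fib (E i) x else component i v = (\<lambda>k. 0)} =
      {v. \<forall>i. if i \<in> N then component i v \<in> fib (F i) x else component i v = (\<lambda>k. 0)}" for x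
    using assms(1) by (intro Collect_cong all_cong1) auto
  have fr: "{(U, r, e). opn U \<and> P U r e \<and> (\<forall>j<(r::nat). \<forall>i\<in>N. vb_section fn (E i) U (\<lambda>x. component i (e j x)))} =
      {(U, r, e). opn U \<and> P U r e \<and> (\<forall>j<r. \<forall>i\<in>N. vb_section fn (F i) U (\<lambda>x. component i (e j x)))}" for P
    using assms(2) by (intro Collect_cong) (auto simp: case_prod_beta)
  show ?thesis
    unfolding vb_sum_def Let_def fb fr ..
qed

end

text \<open>\<open>K_equiv\<close> asks for isomorphisms between sums of bundles. The pullback of a
  sum has fewer frames than the sum of the pullbacks, so the isomorphism is transported directly to
  the latter and tested on pulled back frames.\<close>

lemma vb_iso_sum_pull:
  assumes f: "continuous_map T' T f" and N: "finite N"
    and E: "\<And>i. i \<in> N \<Longrightarrow> top_vb T (E i)" and F: "\<And>i. i \<in> N \<Longrightarrow> top_vb T (F i)"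
    and \<phi>: "vb_iso (openin T) (cont_fn T) (topspace T)
      (vb_sum (openin T) (cont_fn T) N E) (vb_sum (openin T) (cont_fn T) N F) \<phi>"
  shows "vb_iso (openin T') (cont_fn T') (topspace T')
      (vb_sum (openin T') (cont_fn T') N (\<lambda>i. vb_pull f (topspace T') (E i)))
      (vb_sum (openin T') (cont_fn T') N (\<lambda>i. vb_pull f (topspace T') (F i))) (\<lambda>x. \<phi> (f x))"
proof -
  interpret T: fun_space "openin T" "cont_fn T" by (rule topological_fun_space)
  interpret T': fun_space "openin T'" "cont_fn T'" by (rule topological_fun_space)
  let ?E = "vb_sum (openin T) (cont_fn T) N E" and ?F = "vb_sum (openin T) (cont_fn T) N F"
  let ?E' = "vb_sum (openin T') (cont_fn T') N (\<lambda>i. vb_pull f (topspace T') (E i))"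
  let ?F' = "vb_sum (openin T') (cont_fn T') N (\<lambda>i. vb_pull f (topspace T') (F i))"
  have fT: "f x \<in> topspace T" if "x \<in> topspace T'" for x
    using continuous_map_image_subset_topspace[OF f] that by blast
  have fibE: "fib ?E' x = fib ?E (f x)" and fibF: "fib ?F' x = fib ?F (f x)" for x
    by (simp_all add: T.fib_vb_sum T'.fib_vb_sum)
  have \<phi>map: "vb_map (openin T) (cont_fn T) (topspace T) ?E ?F \<phi>"
    and \<phi>bij: "\<And>x. x \<in> topspace T \<Longrightarrow> bij_betw (\<phi> x) (fib ?E x) (fib ?F x)"
    using \<phi> unfolding vb_iso_def by blast+
  have sub: "V \<subseteq> topspace T" if "openin T V" for V using that by (rule openin_subset)
  have sub': "V \<subseteq> topspace T'" if "openin T' V" for V using that by (rule openin_subset)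
  note E' = top_vb_pull[OF E f] and F' = top_vb_pull[OF F f]
  note topE = T.vbundle_vb_sum[OF openin_topspace E N subset_refl _ sub]
  note topE' = T'.vbundle_vb_sum[OF openin_topspace E' N subset_refl _ sub']
    and topF' = T'.vbundle_vb_sum[OF openin_topspace F' N subset_refl _ sub']
  have "vb_map (openin T') (cont_fn T') (topspace T') ?E' ?F' (\<lambda>x. \<phi> (f x))"
  proof (rule T'.vb_mapI_frames[OF topE' topF' subset_refl])
    show "\<phi> (f x) v \<in> fib ?F' x" if "x \<in> topspace T'" "v \<in> fib ?E' x" for x v
      using vb_mapD(1)[OF \<phi>map fT[OF that(1)]] that(2) fibE fibF by simp
    show "\<phi> (f x) (\<lambda>k. a * v k + b * w k) = (\<lambda>k. a * \<phi> (f x) v k + b * \<phi> (f x) w k)"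
      if "x \<in> topspace T'" "v \<in> fib ?E' x" "w \<in> fib ?E' x" for x v w a b
      using vb_mapD(2)[OF \<phi>map fT[OF that(1)]] that(2,3) unfolding fibE by blast
    fix x assume x: "x \<in> topspace T'"
    obtain V r e where V: "(V, r, e) \<in> frames ?E" "f x \<in> V"
      by (rule T.vbundle_frameE[OF topE fT[OF x]]) auto
    let ?V = "{y \<in> topspace T'. f y \<in> V}"
    have Vop: "openin T V" and bas: "\<And>x. x \<in> V \<Longrightarrow> basis_of (fib ?E x) r (\<lambda>j. e j x)"
      and es: "\<And>j i. j < r \<Longrightarrow> i \<in> N \<Longrightarrow> vb_section (cont_fn T) (E i) V (\<lambda>x. component i (e j x))"
      using V(1) unfolding T.frames_vb_sum by blast+
    have V': "openin T' ?V" by (rule openin_continuous_map_preimage[OF f Vop])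
    have "(?V, r, \<lambda>j y. e j (f y)) \<in> frames ?E'"
      unfolding T'.frames_vb_sum fibE
      using V' bas vb_section_pull[OF es f, of _ _ ?V] by auto
    moreover have "vb_section (cont_fn T') ?F' ?V (\<lambda>y. \<phi> (f y) (e j (f y)))" if j: "j < r" for j
    proof (rule T'.vb_sum_sectionI[OF openin_topspace F' N subset_refl _ sub' V'])
      have s: "vb_section (cont_fn T) ?F V (\<lambda>y. \<phi> y (e j y))"
        by (rule T.vb_map_frame_section[OF topE \<phi>map V(1) Vop subset_refl sub[OF Vop] j]) auto
      show "\<phi> (f y) (e j (f y)) \<in> fib ?F' y" if "y \<in> ?V" for y
        using T.vb_section_fib[OF s] that unfolding fibF by blast
      show "vb_section (cont_fn T') (vb_pull f (topspace T') (F i)) ?V (\<lambda>x. component i (\<phi> (f x) (e j (f x))))"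
        if "i \<in> N" for i
        using vb_section_pull[OF T.vb_section_component[OF openin_topspace F N subset_refl _ sub Vop s that] f, of ?V] by auto
    qed auto
    ultimately show "\<exists>V r e M. (V, r, e) \<in> frames ?E' \<and> openin T' M \<and> x \<in> M \<and> M \<subseteq> V \<and>
        (\<forall>i<r. vb_section (cont_fn T') ?F' M (\<lambda>y. \<phi> (f y) (e i y)))"
      using V' x V(2) by (intro exI[of _ ?V] exI[of _ r] exI[of _ "\<lambda>j y. e j (f y)"]) auto
  qed auto
  then show ?thesis
    unfolding vb_iso_def fibE fibF using \<phi>bij fT by blast
qed

section \<open>The double of a pair and bundles glued over it\<close>

lemma topspace_dbl:
  assumes "A \<subseteq> topspace T"
  shows "topspace (dbl T A) = topspace T \<times> {0} \<union> A \<times> {0..1} \<union> topspace T \<times> {1}"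
  using assms by (auto simp: dbl_def)

lemma dbl_subtopology:
  assumes "A' \<subseteq> A"
  shows "dbl T A' = subtopology (dbl T A) (topspace T \<times> {0} \<union> A' \<times> {0..1} \<union> topspace T \<times> {1})"
proof -
  have "(topspace T \<times> {0} \<union> A \<times> {0..1} \<union> topspace T \<times> {1}) \<inter> (topspace T \<times> {0} \<union> A' \<times> {0..1} \<union> topspace T \<times> {1}) =
      topspace T \<times> {0} \<union> A' \<times> {0..1} \<union> topspace T \<times> {1 :: real}"
    using assms by auto
  then show ?thesis by (simp add: dbl_def subtopology_subtopology)
qed

lemma continuous_map_fst_dbl: "continuous_map (dbl T A) T fst"
  unfolding dbl_def by (intro continuous_map_from_subtopology continuous_map_fst)

lemma continuous_map_top_dbl: "continuous_map T (dbl T A) (\<lambda>x. (x, 1))"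
  unfolding dbl_def by (intro continuous_map_into_subtopology) (auto simp: continuous_map_pairwise o_def)

lemma openin_dbl:
  assumes "openin T U" "open I" "A \<subseteq> topspace T"
  shows "openin (dbl T A) {p \<in> topspace (dbl T A). fst p \<in> U \<and> snd p \<in> I}"
proof -
  have "openin (prod_topology T euclideanreal) (U \<times> I)"
    using assms by (simp add: openin_prod_Times_iff)
  then have "openin (dbl T A) ((U \<times> I) \<inter> (topspace T \<times> {0} \<union> A \<times> {0..1} \<union> topspace T \<times> {1}))"
    unfolding dbl_def openin_subtopology by blast
  moreover have "(U \<times> I) \<inter> (topspace T \<times> {0} \<union> A \<times> {0..1} \<union> topspace T \<times> {1}) =
      {p \<in> topspace (dbl T A). fst p \<in> U \<and> snd p \<in> I}"
    unfolding topspace_dbl[OF assms(3)] by auto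
  ultimately show ?thesis by simp
qed

lemma basis_of_image:
  assumes V: "basis_of V r e" and bij: "bij_betw \<phi> V W"
    and lin: "\<And>v w a b. v \<in> V \<Longrightarrow> w \<in> V \<Longrightarrow> \<phi> (\<lambda>k. a * v k + b * w k) = (\<lambda>k. a * \<phi> v k + b * \<phi> w k)"
  shows "basis_of W r (\<lambda>i. \<phi> (e i))"
proof -
  have \<phi>: "\<phi> (vcomb r c e) = vcomb r c (\<lambda>i. \<phi> (e i))" for c
    by (rule linear_vcomb[OF V lin]) (use basis_of_mem[OF V] in auto)
  have "W = \<phi> ` V" using bij by (simp add: bij_betw_def)
  also have "\<dots> = range (\<lambda>c. vcomb r c (\<lambda>i. \<phi> (e i)))"
    using V unfolding basis_of_def by (auto simp: \<phi>[symmetric])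
  finally have 1: "W = range (\<lambda>c. vcomb r c (\<lambda>i. \<phi> (e i)))" .
  have 2: "c i = 0" if "vcomb r c (\<lambda>i. \<phi> (e i)) = (\<lambda>k. 0)" "i < r" for c i
  proof -
    have "\<phi> (\<lambda>k. 0) = (\<lambda>k. 0)" using \<phi>[of "\<lambda>i. 0"] by simp
    then have "\<phi> (vcomb r c e) = \<phi> (\<lambda>k. 0)" using that(1) \<phi> by simp
    then have "vcomb r c e = (\<lambda>k. 0)"
      using bij basis_of_vcomb[OF V] basis_of_zero[OF V] unfolding bij_betw_def inj_on_def by blast
    then show ?thesis using V that(2) unfolding basis_of_def by blast
  qed
  show ?thesis unfolding basis_of_def using 1 2 by blast
qed

text \<open>The trivial condition \<open>snd p \<in> UNIV\<close> gives the three kinds of frames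
  the common shape that \<open>openin_dbl\<close> handles.\<close>

lemma frames_glue:
  assumes A: "openin T A"
  shows "frames (glue T A E F \<beta>) =
     (\<lambda>(U, r, f). ({p \<in> topspace (dbl T A). fst p \<in> U \<and> snd p < 1/2}, r, \<lambda>i p. f i (fst p))) ` frames E \<union>
     (\<lambda>(U, r, f). ({p \<in> topspace (dbl T A). fst p \<in> U \<and> snd p > 1/2}, r, \<lambda>i p. f i (fst p))) ` frames F \<union>
     (\<lambda>(U, r, f). ({p \<in> topspace (dbl T A). fst p \<in> U \<inter> A \<and> snd p \<in> UNIV}, r,
        \<lambda>i p. if snd p \<le> 1/2 then f i (fst p) else \<beta> (fst p) (f i (fst p)))) ` frames E"
proof -
  have "(U \<inter> A) \<times> {0..1} = {p \<in> topspace (dbl T A). fst p \<in> U \<inter> A \<and> snd p \<in> UNIV}" for U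
    using openin_subset[OF A] by (auto simp: topspace_dbl[OF openin_subset[OF A]])
  then show ?thesis
    unfolding glue_def vb.simps by (simp add: case_prod_beta')
qed

lemma glue_framesE:
  assumes A: "openin T A" and "(V, r, e) \<in> frames (glue T A E F \<beta>)"
  obtains (lower) U f where "(U, r, f) \<in> frames E" "V = {p \<in> topspace (dbl T A). fst p \<in> U \<and> snd p < 1/2}"
      "e = (\<lambda>i p. f i (fst p))"
  | (upper) U f where "(U, r, f) \<in> frames F" "V = {p \<in> topspace (dbl T A). fst p \<in> U \<and> snd p > 1/2}"
      "e = (\<lambda>i p. f i (fst p))"
  | (middle) U f where "(U, r, f) \<in> frames E" "V = {p \<in> topspace (dbl T A). fst p \<in> U \<inter> A \<and> snd p \<in> UNIV}"
      "e = (\<lambda>i p. if snd p \<le> 1/2 then f i (fst p) else \<beta> (fst p) (f i (fst p)))"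
  using assms(2) unfolding frames_glue[OF A]
proof (elim UnE imageE)
  fix Z assume Z: "(V, r, e) = (case Z of (U, r, f) \<Rightarrow>
      ({p \<in> topspace (dbl T A). fst p \<in> U \<and> snd p < 1/2}, r, \<lambda>i p. f i (fst p)))" "Z \<in> frames E"
  obtain U r' f where "Z = (U, r', f)" by (cases Z)
  with Z show thesis by (intro lower[of U f]) (auto simp only: prod.case prod.inject)
next
  fix Z assume Z: "(V, r, e) = (case Z of (U, r, f) \<Rightarrow>
      ({p \<in> topspace (dbl T A). fst p \<in> U \<and> snd p > 1/2}, r, \<lambda>i p. f i (fst p)))" "Z \<in> frames F"
  obtain U r' f where "Z = (U, r', f)" by (cases Z)
  with Z show thesis by (intro upper[of U f]) (auto simp only: prod.case prod.inject)
next
  fix Z assume Z: "(V, r, e) = (case Z of (U, r, f) \<Rightarrow>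
      ({p \<in> topspace (dbl T A). fst p \<in> U \<inter> A \<and> snd p \<in> UNIV}, r,
        \<lambda>i p. if snd p \<le> 1/2 then f i (fst p) else \<beta> (fst p) (f i (fst p))))" "Z \<in> frames E"
  obtain U r' f where "Z = (U, r', f)" by (cases Z)
  with Z show thesis by (intro middle[of U f]) (auto simp only: prod.case prod.inject)
qed

lemma glue_frames:
  assumes A: "openin T A"
  shows "(U, r, f) \<in> frames E \<Longrightarrow>
     ({p \<in> topspace (dbl T A). fst p \<in> U \<and> snd p < 1/2}, r, \<lambda>i p. f i (fst p)) \<in> frames (glue T A E F \<beta>)"
  "(U, r, f) \<in> frames F \<Longrightarrow>
     ({p \<in> topspace (dbl T A). fst p \<in> U \<and> snd p > 1/2}, r, \<lambda>i p. f i (fst p)) \<in> frames (glue T A E F \<beta>)"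
  "(U, r, f) \<in> frames E \<Longrightarrow>
     ({p \<in> topspace (dbl T A). fst p \<in> U \<inter> A \<and> snd p \<in> UNIV}, r,
       \<lambda>i p. if snd p \<le> 1/2 then f i (fst p) else \<beta> (fst p) (f i (fst p))) \<in> frames (glue T A E F \<beta>)"
  unfolding frames_glue[OF A]
  by (rule UnI1, rule UnI1, rule image_eqI[of _ _ "(U, r, f)"], simp only: prod.case, assumption,
      rule UnI1, rule UnI2, rule image_eqI[of _ _ "(U, r, f)"], simp only: prod.case, assumption,
      rule UnI2, rule image_eqI[of _ _ "(U, r, f)"], simp only: prod.case, assumption)

lemma fib_glue: "fib (glue T A E F \<beta>) p = (if snd p \<le> 1/2 then fib E (fst p) else fib F (fst p))"
  by (simp add: glue_def case_prod_beta)

context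
  fixes T :: "'b topology" and A :: "'b set" and E F :: "('b, 'k) vb" and \<beta> :: "'b \<Rightarrow> ('k \<Rightarrow> complex) \<Rightarrow> 'k \<Rightarrow> complex"
  assumes E: "top_vb T E" and F: "top_vb T F" and A: "openin T A"
    and \<beta>: "vb_map (openin T) (cont_fn T) A E F \<beta>" "\<And>x. x \<in> A \<Longrightarrow> bij_betw (\<beta> x) (fib E x) (fib F x)"
begin

interpretation T: fun_space "openin T" "cont_fn T" by (rule topological_fun_space)

lemma A_sub: "A \<subseteq> topspace T" using A by (rule openin_subset)

lemma image_frame_basis:
  assumes "(U, r, f) \<in> frames E" "x \<in> U \<inter> A"
  shows "basis_of (fib F x) r (\<lambda>i. \<beta> x (f i x))"
proof -
  have "x \<in> U" "x \<in> A" using assms(2) by auto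
  then show ?thesis
    using basis_of_image[OF T.vbundle_frameD(3)[OF E assms(1)] \<beta>(2)] vb_mapD(2)[OF \<beta>(1)] by blast
qed

lemma frame_change_E:
  assumes "(U, r, f) \<in> frames E" "(U', r', f') \<in> frames E" "i < r"
  shows "\<exists>c. (\<forall>j<r'. cont_fn T (U \<inter> U') (c j)) \<and> (\<forall>x\<in>U \<inter> U'. f i x = vcomb r' (\<lambda>j. c j x) (\<lambda>j. f' j x))"
  using T.vb_sectionE[OF T.vbundle_frameD(4)[OF E assms(1,3)] assms(2)] by metis

text \<open>The fibres jump at height 1/2, which does no harm since continuity is measured by
  coefficients in frames. Lower and upper frames do not meet, and most other transitions come from
  transitions of \<open>E\<close> or \<open>F\<close> pulled back along \<open>fst\<close>.
  Expanding an upper frame in a middle one is the exception: it amounts to inverting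
  \<beta>.\<close>

lemma top_vb_glue: "top_vb (dbl T A) (glue T A E F \<beta>)"
proof -
  let ?D = "dbl T A" and ?G = "glue T A E F \<beta>"
  interpret D: fun_space "openin ?D" "cont_fn ?D" by (rule topological_fun_space)
  note topD = topspace_dbl[OF A_sub]
  have lift: "\<exists>c. (\<forall>j<r'. cont_fn ?D V (c j)) \<and> (\<forall>p\<in>V. a p = vcomb r' (\<lambda>j. c j p) (\<lambda>j. b j p))"
    if c: "\<exists>c. (\<forall>j<r'. cont_fn T W (c j)) \<and> (\<forall>x\<in>W. a0 x = vcomb r' (\<lambda>j. c j x) (\<lambda>j. b0 j x))"
      and V: "V \<subseteq> topspace ?D" "fst ` V \<subseteq> W"
      and ab: "\<And>p c. p \<in> V \<Longrightarrow> a0 (fst p) = vcomb r' c (\<lambda>j. b0 j (fst p)) \<Longrightarrow> a p = vcomb r' c (\<lambda>j. b j p)"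
    for r' V W a b and a0 :: "'b \<Rightarrow> 'k \<Rightarrow> complex" and b0
  proof -
    from c obtain c where c: "\<forall>j<r'. cont_fn T W (c j)" "\<forall>x\<in>W. a0 x = vcomb r' (\<lambda>j. c j x) (\<lambda>j. b0 j x)"
      by (elim exE conjE)
    have "\<forall>j<r'. cont_fn ?D V (\<lambda>p. c j (fst p))"
      using c(1) by (auto intro: cont_fn_pull[OF _ continuous_map_fst_dbl V])
    moreover have "\<forall>p\<in>V. a p = vcomb r' (\<lambda>j. c j (fst p)) (\<lambda>j. b j p)"
      using c(2) V(2) ab by blast
    ultimately show ?thesis by (intro exI[of _ "\<lambda>j p. c j (fst p)"]) simp
  qed
  have chE: "\<exists>c. (\<forall>j<r'. cont_fn ?D V (c j)) \<and> (\<forall>p\<in>V. a p = vcomb r' (\<lambda>j. c j p) (\<lambda>j. b j p))"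
    if "(U, r, f) \<in> frames E" "(U', r', f') \<in> frames E" "i < r" "V \<subseteq> topspace ?D" "fst ` V \<subseteq> U \<inter> U'"
      "\<And>p c. p \<in> V \<Longrightarrow> f i (fst p) = vcomb r' c (\<lambda>j. f' j (fst p)) \<Longrightarrow> a p = vcomb r' c (\<lambda>j. b j p)"
    for U r f U' r' f' i V a b
    by (rule lift[OF frame_change_E[OF that(1,2,3)] that(4,5,6)])
  show ?thesis
  proof (rule D.vbundleI)
    show "openin ?D V" if "(V, r, e) \<in> frames ?G" for V r e
      using A that
    proof (cases rule: glue_framesE)
      case (lower U f)
      then show ?thesis
        using openin_dbl[OF T.vbundle_frameD(1)[OF E lower(1)], of "{..<1/2}"] A_sub by simp
    next
      case (upper U f)
      then show ?thesis
        using openin_dbl[OF T.vbundle_frameD(1)[OF F upper(1)], of "{1/2<..}"] A_sub by simp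
    next
      case (middle U f)
      then show ?thesis
        using openin_dbl[OF T.opn_Int[OF T.vbundle_frameD(1)[OF E middle(1)] A], of UNIV] A_sub by simp
    qed
    then have "(\<Union>(U, r, e)\<in>frames ?G. U) \<subseteq> topspace ?D"
      using openin_subset by fastforce
    moreover have "p \<in> (\<Union>(U, r, e)\<in>frames ?G. U)" if p: "p \<in> topspace ?D" for p
    proof -
      have "fst p \<in> topspace T" using p A_sub unfolding topD by auto
      then obtain U r f U' r' f' where fr: "(U, r, f) \<in> frames E" "fst p \<in> U" "(U', r', f') \<in> frames F" "fst p \<in> U'"
        using T.vbundle_frameE[OF E] T.vbundle_frameE[OF F] by metis
      consider "snd p < 1/2" | "snd p > 1/2" | "fst p \<in> A" using p unfolding topD by force
      then show ?thesis
      proof cases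
        case 1
        then show ?thesis using glue_frames(1)[OF A fr(1)] p fr(2) by blast
      next
        case 2
        then show ?thesis using glue_frames(2)[OF A fr(3)] p fr(4) by blast
      next
        case 3
        then show ?thesis using glue_frames(3)[OF A fr(1)] p fr(2) by blast
      qed
    qed
    ultimately show "(\<Union>(U, r, e)\<in>frames ?G. U) = topspace ?D" by blast
    show "basis_of (fib ?G p) r (\<lambda>i. e i p)" if "(V, r, e) \<in> frames ?G" "p \<in> V" for V r e p
      using A that(1)
    proof (cases rule: glue_framesE)
      case (lower U f)
      then show ?thesis using T.vbundle_frameD(3)[OF E lower(1)] that(2) by (simp add: fib_glue)
    next
      case (upper U f)
      then show ?thesis using T.vbundle_frameD(3)[OF F upper(1)] that(2) by (simp add: fib_glue)
    next
      case (middle U f)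
      then show ?thesis
        using T.vbundle_frameD(3)[OF E middle(1), of "fst p"] image_frame_basis[OF middle(1), of "fst p"] that(2)
        by (simp add: fib_glue)
    qed
    fix V r e V' r' e' i
    assume fr: "(V, r, e) \<in> frames ?G" and fr': "(V', r', e') \<in> frames ?G" and i: "i < r"
    show "\<exists>c. (\<forall>j<r'. cont_fn ?D (V \<inter> V') (c j)) \<and> (\<forall>p\<in>V \<inter> V'. e i p = vcomb r' (\<lambda>j. c j p) (\<lambda>j. e' j p))"
      using A fr
    proof (cases rule: glue_framesE)
      case lower: (lower U f)
      show ?thesis
        using A fr'
      proof (cases rule: glue_framesE)
        case (lower U' f')
        show ?thesis
          by (rule chE[OF \<open>(U, r, f) \<in> frames E\<close> lower(1) i]) (use lower(2,3) \<open>V = _\<close> \<open>e = _\<close> in auto)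
      next
        case (upper U' f')
        then have "V \<inter> V' = {}" using lower(2) by auto
        then show ?thesis by (intro exI[of _ "\<lambda>j p. 0"]) (auto intro: D.fn_const)
      next
        case (middle U' f')
        show ?thesis
          by (rule chE[OF lower(1) middle(1) i]) (use lower(2,3) middle(2,3) in auto)
      qed
    next
      case upper: (upper U f)
      show ?thesis
        using A fr'
      proof (cases rule: glue_framesE)
        case (lower U' f')
        then have "V \<inter> V' = {}" using upper(2) by auto
        then show ?thesis by (intro exI[of _ "\<lambda>j p. 0"]) (auto intro: D.fn_const)
      next
        case (upper U' f')
        have "\<exists>c. (\<forall>j<r'. cont_fn T (U \<inter> U') (c j)) \<and> (\<forall>x\<in>U \<inter> U'. f i x = vcomb r' (\<lambda>j. c j x) (\<lambda>j. f' j x))"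
          using T.vb_sectionE[OF T.vbundle_frameD(4)[OF F \<open>(U, r, f) \<in> frames F\<close> i] upper(1)] by metis
        then show ?thesis
          by (rule lift) (use upper(2,3) \<open>V = _\<close> \<open>e = _\<close> in auto)
      next
        case (middle U' f')
        note DF = T.vbundle_frameD[OF F upper(1)]
        let ?W = "U \<inter> (U' \<inter> A)"
        have W: "openin T ?W" "?W \<subseteq> U'" "?W \<subseteq> A"
          using T.opn_Int[OF DF(1) T.opn_Int[OF T.vbundle_frameD(1)[OF E middle(1)] A]] by auto
        have "\<exists>P. (\<forall>k<r. cont_fn T ?W (P k)) \<and> (\<forall>x\<in>?W. \<beta> x (f' j x) = vcomb r (\<lambda>k. P k x) (\<lambda>k. f k x))"
          if j: "j < r'" for j
        proof -
          have s: "vb_section (cont_fn T) F ?W (\<lambda>x. \<beta> x (f' j x))"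
            by (rule T.vb_map_frame_section[OF E \<beta>(1) middle(1) W j])
          have "?W \<inter> U = ?W" by blast
          then show ?thesis by (rule subst) (rule T.vb_sectionE[OF s upper(1)], intro exI conjI)
        qed
        then have "\<forall>j\<in>{..<r'}. \<exists>P. (\<forall>k<r. cont_fn T ?W (P k)) \<and>
            (\<forall>x\<in>?W. \<beta> x (f' j x) = vcomb r (\<lambda>k. P k x) (\<lambda>k. f k x))"
          by blast
        then obtain P where P: "\<forall>j\<in>{..<r'}. (\<forall>k<r. cont_fn T ?W (P j k)) \<and>
            (\<forall>x\<in>?W. \<beta> x (f' j x) = vcomb r (\<lambda>k. P j k x) (\<lambda>k. f k x))"
          by (rule bchoice[THEN exE])
        have bF: "basis_of (fib F x) r' (\<lambda>j. \<beta> x (f' j x))" if "x \<in> ?W" for x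
          using image_frame_basis[OF middle(1)] that by blast
        have "\<forall>x\<in>?W. \<exists>c. f i x = vcomb r' c (\<lambda>j. \<beta> x (f' j x))"
        proof
          fix x assume x: "x \<in> ?W"
          then have "f i x \<in> fib F x" using basis_of_mem[OF DF(3) i] by blast
          then show "\<exists>c. f i x = vcomb r' c (\<lambda>j. \<beta> x (f' j x))" using basis_ofE[OF bF[OF x]] by metis
        qed
        then obtain c where c: "\<forall>x\<in>?W. f i x = vcomb r' (c x) (\<lambda>j. \<beta> x (f' j x))"
          by (rule bchoice[THEN exE])
        \<comment> \<open>These are the entries of the inverse matrix of \<beta> in the two frames.
          Their continuity comes from the change of frame, so the inverse of \<beta> need not be
          known to be a bundle map.\<close>
        have "cont_fn T ?W (\<lambda>x. c x j)" if j: "j < r'" for j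
        proof (rule T.fn_change_of_frame[OF W(1), where fb = "fib F" and e = "\<lambda>j x. \<beta> x (f' j x)" and f = f
                and P = "\<lambda>i j. P j i" and q = "\<lambda>k x. if k = i then 1 else 0" and s = "f i" and r = r' and N = r])
          show "basis_of (fib F x) r (\<lambda>i. f i x)" if "x \<in> ?W" for x using DF(3) that by blast
          show "cont_fn T ?W (\<lambda>x. if k = i then 1 else 0)" for k using T.fn_const[OF W(1)] by simp
          show "f i x = vcomb r (\<lambda>k. if k = i then 1 else 0) (\<lambda>k. f k x)" for x
            using vcomb_unit[OF i, of "\<lambda>k. f k x"] by simp
        qed (use P bF c j in auto)
        then have "\<exists>c. (\<forall>j<r'. cont_fn T ?W (c j)) \<and> (\<forall>x\<in>?W. f i x = vcomb r' (\<lambda>j. c j x) (\<lambda>j. \<beta> x (f' j x)))"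
          using c by (intro exI[of _ "\<lambda>j x. c x j"]) auto
        then show ?thesis
          by (rule lift) (use upper(2,3) middle(2,3) in auto)
      qed
    next
      case middle: (middle U f)
      show ?thesis
        using A fr'
      proof (cases rule: glue_framesE)
        case (lower U' f')
        show ?thesis
          by (rule chE[OF middle(1) lower(1) i]) (use lower(2,3) middle(2,3) in auto)
      next
        case (upper U' f')
        note DF = T.vbundle_frameD[OF F upper(1)]
        let ?W = "(U \<inter> A) \<inter> U'"
        have W: "openin T (U \<inter> A)" "U \<inter> A \<subseteq> U" "U \<inter> A \<subseteq> A"
          using T.opn_Int[OF T.vbundle_frameD(1)[OF E middle(1)] A] by auto
        have "\<exists>c. (\<forall>k<r'. cont_fn T ?W (c k)) \<and> (\<forall>x\<in>?W. \<beta> x (f i x) = vcomb r' (\<lambda>k. c k x) (\<lambda>k. f' k x))"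
          by (rule T.vb_sectionE[OF T.vb_map_frame_section[OF E \<beta>(1) middle(1) W i] upper(1)]) (intro exI conjI)
        then show ?thesis
          by (rule lift) (use upper(2,3) middle(2,3) in auto)
      next
        case (middle U' f')
        show ?thesis
        proof (rule chE[OF \<open>(U, r, f) \<in> frames E\<close> middle(1) i])
          fix p c assume p: "p \<in> V \<inter> V'" and eq: "f i (fst p) = vcomb r' c (\<lambda>j. f' j (fst p))"
          have pp: "fst p \<in> U'" "fst p \<in> A" using p middle(2) by auto
          have "\<beta> (fst p) (f i (fst p)) = vcomb r' c (\<lambda>j. \<beta> (fst p) (f' j (fst p)))"
            unfolding eq
            by (rule linear_vcomb[OF T.vbundle_frameD(3)[OF E middle(1) pp(1)] vb_mapD(2)[OF \<beta>(1) pp(2)]])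
              (use basis_of_mem[OF T.vbundle_frameD(3)[OF E middle(1) pp(1)]] in auto)
          then show "e i p = vcomb r' c (\<lambda>j. e' j p)"
            using eq unfolding \<open>e = _\<close> middle(3) by simp
        qed (use middle(2) \<open>V = _\<close> in auto)
      qed
    qed
  qed
qed

end

definition zero_vb :: "'b topology \<Rightarrow> ('b, 'k) vb" where
  "zero_vb T = \<lparr>fib = (\<lambda>x. {\<lambda>k. 0}), frames = {(topspace T, 0, \<lambda>i x k. 0)}\<rparr>"

lemma top_vb_zero: "top_vb T (zero_vb T)"
proof -
  interpret fun_space "openin T" "cont_fn T" by (rule topological_fun_space)
  show ?thesis
    by (rule vbundleI) (auto simp: zero_vb_def basis_of_def vcomb_def)
qed

lemma three_bundles:
  "i \<in> {0, 1, 2::nat} \<Longrightarrow> P (E :: 'e) \<Longrightarrow> P F \<Longrightarrow> P H \<Longrightarrow> P ([E, F, H] ! i)"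
  by auto

lemma all_three: "(\<forall>i. if i \<in> {0, 1, 2::nat} then P i else Q i) \<longleftrightarrow> P 0 \<and> P 1 \<and> P 2 \<and> (\<forall>i>2. Q i)"
proof (intro iffI conjI allI impI)
  assume r: "P 0 \<and> P 1 \<and> P 2 \<and> (\<forall>i>2. Q i)"
  fix i :: nat
  consider "i = 0" | "i = 1" | "i = 2" | "i > 2" by linarith
  then show "if i \<in> {0, 1, 2} then P i else Q i" by cases (use r in auto)
next
  assume l: "\<forall>i. if i \<in> {0, 1, 2::nat} then P i else Q i"
  show "P 0" "P 1" "P 2" using l[rule_format, of 0] l[rule_format, of 1] l[rule_format, of 2] by auto
  show "Q i" if "i > 2" for i using l[rule_format, of i] that by auto
qed

text \<open>Height 1 lies in the upper half, where the glued bundle is \<open>F\<close>; hence both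
  members of the pair restrict to copies of \<open>F\<close> there and their difference is zero. The
  stabilising summand in \<open>K_equiv\<close> can be taken zero.\<close>

lemma K_rel_difference_bundle:
  fixes T :: "'b topology" and E F :: "('b, 'k) vb"
  assumes E: "top_vb T E" and F: "top_vb T F" and A: "openin T A"
    and \<beta>: "vb_map (openin T) (cont_fn T) A E F \<beta>" "\<And>x. x \<in> A \<Longrightarrow> bij_betw (\<beta> x) (fib E x) (fib F x)"
  shows "difference_bundle T A E F \<beta> \<in> K_rel T A"
proof -
  interpret T: fun_space "openin T" "cont_fn T" by (rule topological_fun_space)
  let ?D = "dbl T A"
  let ?G = "glue T A E F \<beta>" and ?P = "vb_pull fst (topspace (dbl T A)) F"
  let ?j = "\<lambda>x. (x, 1 :: real)"
  let ?G1 = "vb_pull ?j (topspace T) ?G" and ?P1 = "vb_pull ?j (topspace T) ?P"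
  have G: "top_vb ?D ?G" by (rule top_vb_glue[OF E F A \<beta>])
  have P: "top_vb ?D ?P" by (rule top_vb_pull[OF F continuous_map_fst_dbl])
  have G1: "top_vb T ?G1" by (rule top_vb_pull[OF G continuous_map_top_dbl])
  have P1: "top_vb T ?P1" by (rule top_vb_pull[OF P continuous_map_top_dbl])
  note D = topspace_dbl[OF openin_subset[OF A]]
  have fibG: "fib ?G1 x = fib F x" for x by (simp add: fib_glue)
  have fibP: "fib ?P1 x = fib F x" for x by simp
  \<comment> \<open>The two copies of \<open>F\<close> differ in their frames: the glued bundle also
    contributes restricted middle frames. Only the upper frames are needed for the
    comparison.\<close>
  have subF: "\<exists>V' e'. (V', r, e') \<in> frames ?G1 \<and> V \<subseteq> V' \<and> (\<forall>i<r. \<forall>x\<in>V. e i x = e' i x)"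
    if "(V, r, e) \<in> frames ?P1" for V r e
  proof -
    from that obtain U f where U: "(U, r, f) \<in> frames F" and V: "V = {s \<in> topspace T. (s, 1) \<in> {p \<in> topspace ?D. fst p \<in> U}}"
      and e: "e = (\<lambda>i s. f i (fst (s, 1 :: real)))"
      unfolding frames_vb_pull by (auto simp only: prod.case prod.inject elim!: imageE)
    have "({s \<in> topspace T. (s, 1) \<in> {p \<in> topspace ?D. fst p \<in> U \<and> snd p > 1/2}}, r, \<lambda>i s. f i (fst (s, 1 :: real))) \<in> frames ?G1"
      unfolding frames_vb_pull[of ?j]
      by (rule image_eqI[OF _ glue_frames(2)[OF A U]]) (simp only: prod.case)
    then show ?thesis unfolding V e by (intro exI conjI) (assumption, auto)
  qed
  have sec: "vb_section (cont_fn T) ?P1 U s \<longleftrightarrow> vb_section (cont_fn T) ?G1 U s" if "openin T U" for U s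
    by (rule T.vb_section_subframes[OF P1 G1 _ subF that openin_subset[OF that]]) (simp add: fib_glue)
  let ?Z = "zero_vb T :: ('b, 'k) vb"
  have Z: "top_vb T ?Z" by (rule top_vb_zero)
  let ?L = "vb_sum (openin T) (cont_fn T) {0, 1, 2::nat} ((!) [?G1, ?Z, ?Z])"
  let ?R = "vb_sum (openin T) (cont_fn T) {0, 1, 2::nat} ((!) [?Z, ?P1, ?Z])"
  \<comment> \<open>Moves summand 0 of the left side into slot 1 of the right side; the remaining
    summands have zero fibres.\<close>
  define \<phi> :: "'b \<Rightarrow> (nat \<times> 'k \<Rightarrow> complex) \<Rightarrow> nat \<times> 'k \<Rightarrow> complex"
    where "\<phi> x v = (\<lambda>(i, k). if i = 1 then v (0, k) else 0)" for x v
  have comp: "component i (\<phi> x v) = (if i = 1 then component 0 v else (\<lambda>k. 0))" for i x v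
    by (auto simp: component_def \<phi>_def fun_eq_iff)
  have fibL: "v \<in> fib ?L x \<longleftrightarrow> component 0 v \<in> fib F x \<and> (\<forall>i. i \<noteq> 0 \<longrightarrow> component i v = (\<lambda>k. 0))"
    and fibR: "v \<in> fib ?R x \<longleftrightarrow> component 1 v \<in> fib F x \<and> (\<forall>i. i \<noteq> 1 \<longrightarrow> component i v = (\<lambda>k. 0))" for v x
  proof -
    have "(\<forall>i. i \<noteq> 0 \<longrightarrow> P i) \<longleftrightarrow> P 1 \<and> P 2 \<and> (\<forall>i>2. P i)"
      "(\<forall>i. i \<noteq> 1 \<longrightarrow> P i) \<longleftrightarrow> P 0 \<and> P 2 \<and> (\<forall>i>2. P i)" for P :: "nat \<Rightarrow> bool"
    proof -
      have "(\<forall>i. i \<noteq> 0 \<longrightarrow> P i) \<longleftrightarrow> (\<forall>i. if i \<in> {0, 1, 2} then i \<noteq> 0 \<longrightarrow> P i else P i)"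
        "(\<forall>i. i \<noteq> 1 \<longrightarrow> P i) \<longleftrightarrow> (\<forall>i. if i \<in> {0, 1, 2} then i \<noteq> 1 \<longrightarrow> P i else P i)"
        by (intro all_cong1; simp)+
      then show "(\<forall>i. i \<noteq> 0 \<longrightarrow> P i) \<longleftrightarrow> P 1 \<and> P 2 \<and> (\<forall>i>2. P i)"
        "(\<forall>i. i \<noteq> 1 \<longrightarrow> P i) \<longleftrightarrow> P 0 \<and> P 2 \<and> (\<forall>i>2. P i)"
        unfolding all_three by simp_all
    qed
    then show "v \<in> fib ?L x \<longleftrightarrow> component 0 v \<in> fib F x \<and> (\<forall>i. i \<noteq> 0 \<longrightarrow> component i v = (\<lambda>k. 0))"
      "v \<in> fib ?R x \<longleftrightarrow> component 1 v \<in> fib F x \<and> (\<forall>i. i \<noteq> 1 \<longrightarrow> component i v = (\<lambda>k. 0))"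
      unfolding T.fib_vb_sum all_three mem_Collect_eq by (auto simp: fib_glue zero_vb_def)
  qed
  have comp_eq: "v = w" if "\<And>i. component i v = component i w" for v w :: "nat \<times> 'k \<Rightarrow> complex"
  proof
    fix p :: "nat \<times> 'k"
    obtain i k where "p = (i, k)" by (cases p)
    then show "v p = w p" using fun_cong[OF that[of i], of k] by (simp add: component_def)
  qed
  have bij: "bij_betw (\<phi> x) (fib ?L x) (fib ?R x)" for x
  proof (rule bij_betw_byWitness[where f' = "\<lambda>v. \<lambda>(i, k). if i = 0 then v (1, k) else 0"])
    show "\<forall>v\<in>fib ?L x. (\<lambda>(i, k). if i = 0 then \<phi> x v (1, k) else 0) = v"
    proof (intro ballI comp_eq)
      fix v i assume "v \<in> fib ?L x"
      then have "i \<noteq> 0 \<Longrightarrow> component i v = (\<lambda>k. 0)" using fibL by blast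
      then show "component i (\<lambda>(i, k). if i = 0 then \<phi> x v (1, k) else 0) = component i v"
        by (cases "i = 0") (auto simp: component_def \<phi>_def fun_eq_iff)
    qed
    show "\<forall>v\<in>fib ?R x. \<phi> x (\<lambda>(i, k). if i = 0 then v (1, k) else 0) = v"
    proof (intro ballI comp_eq)
      fix v i assume "v \<in> fib ?R x"
      then have "i \<noteq> 1 \<Longrightarrow> component i v = (\<lambda>k. 0)" using fibR by blast
      then show "component i (\<phi> x (\<lambda>(i, k). if i = 0 then v (1, k) else 0)) = component i v"
        by (cases "i = 1") (auto simp: component_def \<phi>_def fun_eq_iff)
    qed
    show "\<phi> x ` fib ?L x \<subseteq> fib ?R x"
    proof (rule image_subsetI)
      fix v assume "v \<in> fib ?L x"
      then show "\<phi> x v \<in> fib ?R x" unfolding fibL fibR comp by simp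
    qed
    show "(\<lambda>v. \<lambda>(i, k). if i = 0 then v (1, k) else 0) ` fib ?R x \<subseteq> fib ?L x"
    proof (rule image_subsetI)
      fix v assume "v \<in> fib ?R x"
      then show "(\<lambda>(i, k). if i = 0 then v (1, k) else 0) \<in> fib ?L x"
        unfolding fibL fibR by (simp add: component_def)
    qed
  qed
  have topL: "top_vb T ([?G1, ?Z, ?Z] ! i)" if "i \<in> {0, 1, 2}" for i
    by (rule three_bundles[OF that]) (fact G1 Z)+
  have topR: "top_vb T ([?Z, ?P1, ?Z] ! i)" if "i \<in> {0, 1, 2}" for i
    by (rule three_bundles[OF that]) (fact P1 Z)+
  have map: "vb_map (openin T) (cont_fn T) (topspace T) ?L ?R \<phi>"
    unfolding vb_map_def
  proof (intro conjI ballI allI impI Pi_I)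
    show "\<phi> x v \<in> fib ?R x" if "v \<in> fib ?L x" for x v
      using that unfolding fibL fibR comp by simp
    show "\<phi> x (\<lambda>k. a * v k + b * w k) = (\<lambda>k. a * \<phi> x v k + b * \<phi> x w k)" for x v w a b
      by (auto simp: \<phi>_def fun_eq_iff)
    fix U s assume U: "openin T U \<and> U \<subseteq> topspace T \<and> vb_section (cont_fn T) ?L U s"
    then have opU: "openin T U" and s: "vb_section (cont_fn T) ?L U s" by blast+
    show "vb_section (cont_fn T) ?R U (\<lambda>x. \<phi> x (s x))"
    proof (rule T.vb_sum_sectionI[OF openin_topspace topR _ subset_refl _ openin_subset opU])
      show "\<phi> x (s x) \<in> fib ?R x" if "x \<in> U" for x
        using T.vb_section_fib[OF s that] unfolding fibL fibR comp by simp
      have c0: "vb_section (cont_fn T) ([?G1, ?Z, ?Z] ! 0) U (\<lambda>x. component 0 (s x))"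
        by (rule T.vb_section_component[OF openin_topspace topL _ subset_refl _ openin_subset opU s]) auto
      have z: "vb_section (cont_fn T) ?Z U (\<lambda>x. vcomb 0 (\<lambda>j. undefined) (\<lambda>j. undefined))"
        by (rule T.vb_section_vcomb[OF Z opU openin_subset[OF opU]]) auto
      show "vb_section (cont_fn T) ([?Z, ?P1, ?Z] ! i) U (\<lambda>x. component i (\<phi> x (s x)))" if "i \<in> {0, 1, 2}" for i
        using c0 z that sec[OF opU] by (auto simp: comp)
    qed auto
  qed
  have "K_equiv T (?G1, ?P1) (?Z, ?Z)"
    unfolding K_equiv_def prod.case using Z map bij by (intro exI conjI) (auto simp: vb_iso_def)
  then show ?thesis
    unfolding K_rel_def difference_bundle_def zero_vb_def using G P by blast
qed

text \<open>The ends at heights 0 and 1 over \<open>A - A'\<close> remain in the smaller double. A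
  middle frame for \<open>A'\<close> omits them while the restricted middle frame for
  \<open>A\<close> contains them, hence an inclusion and not an equality.\<close>

lemma glue_restrict_subframe:
  assumes A: "openin T A" and A': "openin T A'" "A' \<subseteq> A"
    and V: "(V, r, e) \<in> frames (glue T A' E F \<beta>)"
  shows "\<exists>V' e'. (V', r, e') \<in> frames (vb_pull (\<lambda>x. x) (topspace (dbl T A')) (glue T A E F \<beta>)) \<and> V \<subseteq> V' \<and>
    (\<forall>i<r. \<forall>x\<in>V. e i x = e' i x)"
proof -
  have sub: "topspace (dbl T A') \<subseteq> topspace (dbl T A)"
    using A'(2) topspace_dbl[OF openin_subset[OF A]] topspace_dbl[OF openin_subset[OF A'(1)]] by auto
  have *: "({s \<in> topspace (dbl T A'). s \<in> W}, r, e) \<in> frames (vb_pull (\<lambda>x. x) (topspace (dbl T A')) (glue T A E F \<beta>))"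
    if "(W, r, e) \<in> frames (glue T A E F \<beta>)" for W e
    unfolding frames_vb_pull by (rule image_eqI[OF _ that]) simp
  show ?thesis
    using A'(1) V
  proof (cases rule: glue_framesE)
    case (lower U f)
    show ?thesis using *[OF glue_frames(1)[OF A lower(1), where F = F and \<beta> = \<beta>]] lower(2,3) sub by (intro exI conjI) auto
  next
    case (upper U f)
    show ?thesis using *[OF glue_frames(2)[OF A upper(1), where E = E and \<beta> = \<beta>]] upper(2,3) sub by (intro exI conjI) auto
  next
    case (middle U f)
    show ?thesis using *[OF glue_frames(3)[OF A middle(1), where F = F and \<beta> = \<beta>]] middle(2,3) sub A'(2) by (intro exI conjI) auto
  qed
qed

text \<open>\<open>is_ch_K\<close> may use any representative of the class, so an arbitrary one has
  to be restricted. The isomorphism that puts it into the class is pulled back, and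
  \<open>vb_sum_cong\<close> exchanges the restricted glued bundle for the one glued over
  \<open>A'\<close>.\<close>

lemma K_class_restrict:
  fixes T :: "'b topology" and E F :: "('b, 'k) vb"
  assumes E: "top_vb T E" and F: "top_vb T F" and A: "openin T A" and A': "openin T A'" "A' \<subseteq> A"
    and \<beta>: "vb_map (openin T) (cont_fn T) A E F \<beta>" "\<And>x. x \<in> A \<Longrightarrow> bij_betw (\<beta> x) (fib E x) (fib F x)"
    and EF: "(E1, F1) \<in> difference_bundle T A E F \<beta>"
  defines "res \<equiv> vb_pull (\<lambda>x. x) (topspace (dbl T A'))"
  shows "(res E1, res F1) \<in> difference_bundle T A' E F \<beta>"
proof -
  let ?D = "dbl T A" and ?D' = "dbl T A'"
  interpret D': fun_space "openin ?D'" "cont_fn ?D'" by (rule topological_fun_space)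
  have \<beta>': "vb_map (openin T) (cont_fn T) A' E F \<beta>" "\<And>x. x \<in> A' \<Longrightarrow> bij_betw (\<beta> x) (fib E x) (fib F x)"
    using vb_map_subset[OF \<beta>(1) A'(2)] \<beta>(2) A'(2) by auto
  have id: "continuous_map ?D' ?D (\<lambda>x. x)"
    unfolding dbl_subtopology[OF A'(2)] by (intro continuous_map_from_subtopology) simp
  let ?G = "glue T A E F \<beta>" and ?G' = "glue T A' E F \<beta>"
  let ?P = "vb_pull fst (topspace ?D) F" and ?P' = "vb_pull fst (topspace ?D') F"
  have G: "top_vb ?D ?G" by (rule top_vb_glue[OF E F A \<beta>])
  have G': "top_vb ?D' ?G'" by (rule top_vb_glue[OF E F A'(1) \<beta>'])
  have P: "top_vb ?D ?P" by (rule top_vb_pull[OF F continuous_map_fst_dbl])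
  have resG: "top_vb ?D' (res ?G)" unfolding res_def by (rule top_vb_pull[OF G id])
  have sub: "topspace ?D' \<subseteq> topspace ?D"
    using continuous_map_image_subset_topspace[OF id] by auto
  \<comment> \<open>Here restriction yields the very same record; only the glued bundle has other
    frames.\<close>
  have resP: "res ?P = ?P'"
    unfolding res_def vb_pull_def using sub
    by (auto simp: image_image case_prod_beta intro!: image_cong)
  have secG: "vb_section (cont_fn ?D') ?G' U s \<longleftrightarrow> vb_section (cont_fn ?D') (res ?G) U s"
    if "openin ?D' U" for U s
    by (rule D'.vb_section_subframes[OF G' resG _ _ that openin_subset[OF that]])
      (use glue_restrict_subframe[OF A A'] in \<open>auto simp: res_def fib_glue\<close>)
  obtain H \<phi> where E1: "top_vb ?D E1" and F1: "top_vb ?D F1" and H: "top_vb ?D H"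
    and iso: "vb_iso (openin ?D) (cont_fn ?D) (topspace ?D)
       (vb_sum (openin ?D) (cont_fn ?D) {0, 1, 2::nat} ((!) [?G, F1, H]))
       (vb_sum (openin ?D) (cont_fn ?D) {0, 1, 2::nat} ((!) [E1, ?P, H])) \<phi>"
    using EF unfolding difference_bundle_def K_class_def K_equiv_def by auto
  have top1: "top_vb ?D ([?G, F1, H] ! i)" if "i \<in> {0, 1, 2}" for i
    by (rule three_bundles[OF that]) (fact G F1 H)+
  have top2: "top_vb ?D ([E1, ?P, H] ! i)" if "i \<in> {0, 1, 2}" for i
    by (rule three_bundles[OF that]) (fact P E1 H)+
  have iso': "vb_iso (openin ?D') (cont_fn ?D') (topspace ?D')
      (vb_sum (openin ?D') (cont_fn ?D') {0, 1, 2} (\<lambda>i. res ([?G, F1, H] ! i)))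
      (vb_sum (openin ?D') (cont_fn ?D') {0, 1, 2} (\<lambda>i. res ([E1, ?P, H] ! i))) \<phi>"
    unfolding res_def by (rule vb_iso_sum_pull[OF id _ top1 top2 iso]) simp
  have eq1: "vb_sum (openin ?D') (cont_fn ?D') {0, 1, 2} (\<lambda>i. res ([?G, F1, H] ! i)) =
      vb_sum (openin ?D') (cont_fn ?D') {0, 1, 2} ((!) [?G', res F1, res H])"
  proof (rule D'.vb_sum_cong)
    fix i x assume "i \<in> {0, 1, 2::nat}"
    then show "fib (res ([?G, F1, H] ! i)) x = fib ([?G', res F1, res H] ! i) x"
      by (auto simp: res_def fib_glue)
  next
    fix i U s assume "i \<in> {0, 1, 2::nat}" "openin ?D' U"
    then show "vb_section (cont_fn ?D') (res ([?G, F1, H] ! i)) U s \<longleftrightarrow>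
        vb_section (cont_fn ?D') ([?G', res F1, res H] ! i) U s"
      using secG by auto
  qed
  have eq2: "vb_sum (openin ?D') (cont_fn ?D') {0, 1, 2} (\<lambda>i. res ([E1, ?P, H] ! i)) =
      vb_sum (openin ?D') (cont_fn ?D') {0, 1, 2} ((!) [res E1, ?P', res H])"
    by (rule D'.vb_sum_cong) (auto simp: resP)
  have "top_vb ?D' (res E1)" "top_vb ?D' (res F1)" "top_vb ?D' (res H)"
    unfolding res_def using E1 F1 H by (auto intro: top_vb_pull[OF _ id])
  then show ?thesis
    using iso' unfolding eq1 eq2 difference_bundle_def K_class_def K_equiv_def by auto
qed

section \<open>Restriction of cocycles and Chern characters\<close>

lemma simplices_subtopology:
  "(p, f) \<in> simplices (subtopology X S) \<longleftrightarrow> (p, f) \<in> simplices X \<and> f ` standard_simplex p \<subseteq> S"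
  by (auto simp: simplices_def singular_simplex_subtopology)

lemma simplices_subtopology_mono: "A \<subseteq> B \<Longrightarrow> simplices (subtopology X A) \<subseteq> simplices (subtopology X B)"
  unfolding simplices_def by (auto intro: singular_simplex_mono)

lemma simplices_subtopology_subset: "simplices (subtopology X A) \<subseteq> simplices X"
  by (auto simp: simplices_subtopology)

lemma vb_pull_restrict:
  assumes "f ` S \<subseteq> W"
  shows "vb_pull f S (vb_pull (\<lambda>x. x) W E) = vb_pull f S E"
proof -
  have "{s \<in> S. f s \<in> {x \<in> W. x \<in> U}} = {s \<in> S. f s \<in> U}" for U using assms by auto
  then show ?thesis by (simp add: vb_pull_def image_image case_prod_beta)
qed

lemma cocycle_subtopology:
  assumes "cocycle T A a" "subtopology T S = T'" "A' \<subseteq> A"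
  shows "cocycle T' A' a"
proof -
  have "simplices (subtopology T' A') \<subseteq> simplices (subtopology T A)"
    unfolding assms(2)[symmetric] subtopology_subtopology using assms(3) by (intro simplices_subtopology_mono) auto
  then show ?thesis
    using assms(1) simplices_subtopology_subset[of T S] unfolding cocycle_def assms(2) by blast
qed

lemma cohomologous_subtopology:
  assumes "cohomologous T A a b" "subtopology T S = T'" "A' \<subseteq> A"
  shows "cohomologous T' A' a b"
proof -
  have "simplices (subtopology T' A') \<subseteq> simplices (subtopology T A)"
    unfolding assms(2)[symmetric] subtopology_subtopology using assms(3) by (intro simplices_subtopology_mono) auto
  moreover have "simplices T' \<subseteq> simplices T" using simplices_subtopology_subset[of T S] unfolding assms(2) .
  moreover obtain \<psi> where "\<forall>s\<in>simplices (subtopology T A). \<psi> s = 0" "\<forall>s\<in>simplices T. a s - b s = cobdry \<psi> s"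
    using assms(1) unfolding cohomologous_def by blast
  ultimately show ?thesis unfolding cohomologous_def by (intro exI[of _ \<psi>]) blast
qed

text \<open>The characterisation quantifies over maps into the base along which the bundle splits. A
  map into the subspace is also a map into the whole space with the same pulled back bundle, so no
  splitting space has to be constructed.\<close>

lemma is_ch_restrict:
  fixes T :: "'b topology" and E :: "('b, 'k) vb"
  assumes "is_ch T E a" and T': "T' = subtopology T S"
  shows "is_ch T' (vb_pull (\<lambda>x. x) (topspace T') E) a"
  unfolding is_ch_def
proof (intro conjI allI impI)
  show "cocycle T' {} a"
    using assms(1) cocycle_subtopology[OF _ T'[symmetric] subset_refl] unfolding is_ch_def by blast
  fix S' :: "('b \<times> (nat \<Rightarrow> ('k \<Rightarrow> complex) set)) topology" and f r L w
  assume *: "line_splitting S' T' f (vb_pull (\<lambda>x. x) (topspace T') E) r L \<and> (\<forall>i<r. c1_cocycle S' (L i) (w i))"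
  then have f: "continuous_map S' T' f" unfolding line_splitting_def by blast
  then have "f ` topspace S' \<subseteq> topspace T'" by (rule continuous_map_image_subset_topspace)
  then have "line_splitting S' T f E r L"
    using * continuous_map_into_fulltopology[OF f[unfolded T']]
    unfolding line_splitting_def by (simp add: vb_pull_restrict)
  then show "cohomologous S' {} (pull_cochain f a) (\<lambda>s. \<Sum>i<r. fps_at (fps_exp 1) (w i) s)"
    using assms(1) * unfolding is_ch_def by blast
qed

text \<open>The same cochains serve for \<open>A'\<close>. Conditions on cochains concern simplices,
  and the smaller double and the smaller subset have fewer of them.\<close>

lemma is_ch_rel_restrict:
  fixes T :: "'b topology" and E F :: "('b, 'k) vb"
  assumes E: "top_vb T E" and F: "top_vb T F" and A: "openin T A" and A': "openin T A'" "A' \<subseteq> A"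
    and \<beta>: "vb_map (openin T) (cont_fn T) A E F \<beta>" "\<And>x. x \<in> A \<Longrightarrow> bij_betw (\<beta> x) (fib E x) (fib F x)"
    and u: "is_ch_rel T A (difference_bundle T A E F \<beta>) u"
  shows "is_ch_rel T A' (difference_bundle T A' E F \<beta>) u"
proof -
  let ?D = "dbl T A" and ?D' = "dbl T A'"
  note D' = dbl_subtopology[OF A'(2), of T]
  have \<beta>': "vb_map (openin T) (cont_fn T) A' E F \<beta>" "\<And>x. x \<in> A' \<Longrightarrow> bij_betw (\<beta> x) (fib E x) (fib F x)"
    using vb_map_subset[OF \<beta>(1) A'(2)] \<beta>(2) A'(2) by auto
  obtain a b where ch: "is_ch_K ?D (difference_bundle T A E F \<beta>) a"
    and b: "cocycle ?D (A \<times> {0..1} \<union> topspace T \<times> {1}) b" "cohomologous ?D {} b a"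
      "cohomologous T A u (pull_cochain (\<lambda>x. (x, 0)) b)" and cu: "cocycle T A u"
    using u unfolding is_ch_rel_def by blast
  obtain E1 F1 b1 c1 where EF: "(E1, F1) \<in> difference_bundle T A E F \<beta>" and
    ch1: "is_ch ?D E1 b1" "is_ch ?D F1 c1" and a: "a = (\<lambda>s. b1 s - c1 s)"
    using ch unfolding is_ch_K_def by blast
  have "is_ch_K ?D' (difference_bundle T A' E F \<beta>) a"
    unfolding is_ch_K_def
    using K_class_restrict[OF E F A A' \<beta> EF] is_ch_restrict[OF ch1(1) D'] is_ch_restrict[OF ch1(2) D'] a by blast
  moreover have "cocycle ?D' (A' \<times> {0..1} \<union> topspace T \<times> {1}) b"
    using A'(2) by (intro cocycle_subtopology[OF b(1) D'[symmetric]]) auto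
  moreover have "cohomologous ?D' {} b a"
    by (rule cohomologous_subtopology[OF b(2) D'[symmetric] subset_refl])
  moreover have "cohomologous T A' u (pull_cochain (\<lambda>x. (x, 0)) b)" "cocycle T A' u"
    using cohomologous_subtopology[OF b(3) subtopology_topspace A'(2)]
      cocycle_subtopology[OF cu subtopology_topspace A'(2)] by blast+
  ultimately show ?thesis
    unfolding is_ch_rel_def using K_rel_difference_bundle[OF E F A'(1) \<beta>'] by blast
qed

section \<open>The classical topology\<close>

lemma continuous_on_hpoly: "hpoly d f \<Longrightarrow> continuous_on S f"
proof (induction rule: hpoly.induct)
  case (coord i)
  show ?case by (intro continuous_on_subset[OF continuous_on_product_coordinates]) simp
qed (intro continuous_intros; assumption)+

lemma topspace_cp_top: "topspace cp_top = proj_points"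
proof -
  have "{v \<in> coord_vecs. pline v \<in> pline ` coord_vecs} = coord_vecs" by auto
  then have "openin cp_top (pline ` coord_vecs)"
    unfolding openin_cp_top by simp
  then show ?thesis
    unfolding proj_points_def topspace_def using openin_cp_top by blast
qed

lemma topspace_ctop: "variety Z \<Longrightarrow> topspace (ctop Z) = Z"
  using variety_subset_points by (auto simp: ctop_def topspace_cp_top)

text \<open>A set of vectors that is invariant under scaling is the full preimage of the set of
  lines contained in it.\<close>

lemma openin_cp_top_saturated:
  assumes W: "openin (top_of_set coord_vecs) W" and sat: "\<And>v c. v \<in> W \<Longrightarrow> c \<noteq> 0 \<Longrightarrow> (\<lambda>i. c * v i) \<in> W"
  shows "openin cp_top {p \<in> proj_points. p \<subseteq> W}"
proof -
  have "W \<subseteq> coord_vecs" using openin_imp_subset[OF W] .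
  have "{v \<in> coord_vecs. pline v \<in> {p \<in> proj_points. p \<subseteq> W}} = W"
  proof (intro Set.set_eqI iffI)
    fix v assume "v \<in> {v \<in> coord_vecs. pline v \<in> {p \<in> proj_points. p \<subseteq> W}}"
    then show "v \<in> W" using mem_pline by blast
  next
    fix v assume v: "v \<in> W"
    then have "v \<in> coord_vecs" using \<open>W \<subseteq> coord_vecs\<close> by blast
    moreover have "pline v \<subseteq> W" using sat[OF v] by (auto simp: pline_def)
    ultimately show "v \<in> {v \<in> coord_vecs. pline v \<in> {p \<in> proj_points. p \<subseteq> W}}"
      by (auto simp: proj_points_def)
  qed
  then show ?thesis
    unfolding openin_cp_top using W by (auto simp: proj_points_def)
qed

lemma openin_nonvanishing: "hpoly d f \<Longrightarrow> openin (top_of_set coord_vecs) {v \<in> coord_vecs. f v \<noteq> 0}"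
  using continuous_openin_preimage_gen[OF continuous_on_hpoly[of d f coord_vecs], of "- {0}"]
  by (simp add: vimage_def Int_def open_Compl)

lemma zopen_imp_openin:
  assumes Z: "variety Z" and "zopen Z U"
  shows "openin (ctop Z) U"
proof (subst openin_subopen, intro ballI)
  fix x assume x: "x \<in> U"
  then have pt: "x \<in> proj_points"
    using variety_subset_points[OF Z] zopen_subset[OF assms(2)] by blast
  obtain d f where f: "hpoly d f" "\<forall>p\<in>Z - U. \<forall>v\<in>p. f v = 0" "\<forall>v\<in>x. f v \<noteq> 0"
    by (rule zopen_principal_neighbourhood[OF assms(2) x pt])
  let ?W = "{v \<in> coord_vecs. f v \<noteq> 0}"
  have op: "openin cp_top {p \<in> proj_points. p \<subseteq> ?W}"
    by (rule openin_cp_top_saturated[OF openin_nonvanishing[OF f(1)]])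
      (auto simp: hpoly_scale[OF f(1)] coord_vecs_def)
  let ?V = "{p \<in> proj_points. p \<subseteq> ?W} \<inter> Z"
  have "openin (ctop Z) ?V" unfolding ctop_def using op by (auto simp: openin_subtopology)
  moreover have "x \<in> ?V"
    using pt f(3) proj_points_mem_coord_vecs(1)[OF pt] x zopen_subset[OF assms(2)] by auto
  moreover have "?V \<subseteq> U"
  proof
    fix p assume p: "p \<in> ?V"
    then obtain v where "v \<in> p" using proj_pointsE by blast
    then show "p \<in> U" using p f(2) by auto
  qed
  ultimately show "\<exists>V. openin (ctop Z) V \<and> x \<in> V \<and> V \<subseteq> U" by blast
qed

text \<open>Continuity descends along the quotient map from vectors to lines: for a function of
  degree 0 the preimages of open sets are invariant under scaling.\<close>

lemma cont_fn_homogeneous: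
  assumes g: "continuous_on W g" and W: "openin (top_of_set coord_vecs) W"
    and sat: "\<And>v c. v \<in> W \<Longrightarrow> c \<noteq> 0 \<Longrightarrow> (\<lambda>i. c * v i) \<in> W \<and> g (\<lambda>i. c * v i) = g v"
    and V: "\<And>p v. p \<in> V \<Longrightarrow> v \<in> p \<Longrightarrow> v \<in> W \<and> f p = g v" and Z: "variety Z"
  shows "cont_fn (ctop Z) V f"
  unfolding cont_fn_def continuous_map_def
proof (intro conjI allI impI)
  show "f \<in> topspace (subtopology (ctop Z) V) \<rightarrow> topspace euclidean" by simp
  fix C :: "complex set" assume "openin euclidean C"
  then have C: "open C" by simp
  let ?W = "{v \<in> W. g v \<in> C}"
  have "openin (top_of_set W) ?W"
    using continuous_openin_preimage_gen[OF g C] by (simp add: vimage_def Int_def)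
  then have "openin (top_of_set coord_vecs) ?W" using W openin_trans by blast
  then have "openin cp_top {p \<in> proj_points. p \<subseteq> ?W}"
    by (rule openin_cp_top_saturated) (use sat in auto)
  moreover have "{x \<in> topspace (subtopology (ctop Z) V). f x \<in> C} = {p \<in> proj_points. p \<subseteq> ?W} \<inter> (Z \<inter> V)"
  proof (intro Set.set_eqI iffI)
    fix p assume p: "p \<in> {x \<in> topspace (subtopology (ctop Z) V). f x \<in> C}"
    then have "p \<in> Z" "p \<in> V" "f p \<in> C" using topspace_ctop[OF Z] by auto
    moreover have "p \<in> proj_points" using \<open>p \<in> Z\<close> variety_subset_points[OF Z] by blast
    ultimately show "p \<in> {p \<in> proj_points. p \<subseteq> ?W} \<inter> (Z \<inter> V)" using V by force
  next
    fix p assume p: "p \<in> {p \<in> proj_points. p \<subseteq> ?W} \<inter> (Z \<inter> V)"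
    then obtain v where "v \<in> p" using proj_pointsE by blast
    then have "f p \<in> C" using p V by force
    then show "p \<in> {x \<in> topspace (subtopology (ctop Z) V). f x \<in> C}" using p topspace_ctop[OF Z] by auto
  qed
  ultimately show "openin (subtopology (ctop Z) V) {x \<in> topspace (subtopology (ctop Z) V). f x \<in> C}"
    unfolding ctop_def subtopology_subtopology by (auto simp: openin_subtopology)
qed

lemma regular_imp_cont_fn:
  assumes Z: "variety Z" and U: "zopen Z U" and f: "regular_on Z U f"
  shows "cont_fn (ctop Z) U f"
proof -
  interpret fun_space "openin (ctop Z)" "cont_fn (ctop Z)" by (rule topological_fun_space)
  show ?thesis
  proof (rule fn_local[OF _ zopen_imp_openin[OF Z U]])
    fix x assume x: "x \<in> U"
    obtain V d g h where V: "zopen Z V" "x \<in> V" "V \<subseteq> U" "hpoly d g" "hpoly d h"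
        "\<forall>y\<in>V. \<forall>v\<in>y. h v \<noteq> 0 \<and> f y = g v / h v"
      by (rule regular_onE[OF f x])
    have "cont_fn (ctop Z) V f"
    proof (rule cont_fn_homogeneous[OF _ openin_nonvanishing[OF V(5)] _ _ Z])
      show "continuous_on {v \<in> coord_vecs. h v \<noteq> 0} (\<lambda>v. g v / h v)"
        by (intro continuous_on_divide continuous_on_hpoly[OF V(4)] continuous_on_hpoly[OF V(5)]) auto
      show "(\<lambda>i. c * v i) \<in> {v \<in> coord_vecs. h v \<noteq> 0} \<and> g (\<lambda>i. c * v i) / h (\<lambda>i. c * v i) = g v / h v"
        if "v \<in> {v \<in> coord_vecs. h v \<noteq> 0}" "c \<noteq> 0" for v c
        using that by (auto simp: hpoly_scale[OF V(4)] hpoly_scale[OF V(5)] coord_vecs_def)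
      show "v \<in> {v \<in> coord_vecs. h v \<noteq> 0} \<and> f p = g v / h v" if "p \<in> V" "v \<in> p" for p v
        using that V(6) zopen_subset[OF V(1)] variety_subset_points[OF Z] proj_points_mem_coord_vecs(1)
        by blast
    qed
    then show "\<exists>V. openin (ctop Z) V \<and> x \<in> V \<and> V \<subseteq> U \<and> cont_fn (ctop Z) V f"
      using V zopen_imp_openin[OF Z V(1)] by blast
  qed
qed

lemma vb_section_regular_imp_cont:
  assumes M: "variety M" and E: "alg_vb M E" and U: "zopen M U" and s: "vb_section (regular_on M) E U s"
  shows "vb_section (cont_fn (ctop M)) E U s"
proof -
  interpret Z: fun_space "zopen M" "regular_on M" by (rule zariski_fun_space[OF M])
  interpret C: fun_space "openin (ctop M)" "cont_fn (ctop M)" by (rule topological_fun_space)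
  show ?thesis
  proof (rule C.vb_sectionI)
    show "s x \<in> fib E x" if "x \<in> U" for x by (rule Z.vb_section_fib[OF s that])
    fix V r e assume V: "(V, r, e) \<in> frames E"
    obtain c where c: "\<forall>i<r. regular_on M (U \<inter> V) (c i)" "\<forall>x\<in>U \<inter> V. s x = vcomb r (\<lambda>i. c i x) (\<lambda>i. e i x)"
      by (rule Z.vb_sectionE[OF s V])
    have "zopen M (U \<inter> V)" by (rule zopen_Int[OF U Z.vbundle_frameD(1)[OF E V]])
    then show "\<exists>c. (\<forall>i<r. cont_fn (ctop M) (U \<inter> V) (c i)) \<and> (\<forall>x\<in>U \<inter> V. s x = vcomb r (\<lambda>i. c i x) (\<lambda>i. e i x))"
      using c regular_imp_cont_fn[OF M] by (intro exI[of _ c]) auto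
  qed
qed

lemma alg_vb_imp_top_vb:
  assumes M: "variety M" and E: "alg_vb M E"
  shows "top_vb (ctop M) E"
proof -
  interpret Z: fun_space "zopen M" "regular_on M" by (rule zariski_fun_space[OF M])
  have "openin (ctop M) V \<and> (\<forall>x\<in>V. basis_of (fib E x) r (\<lambda>i. e i x)) \<and> (\<forall>i<r. vb_section (cont_fn (ctop M)) E V (e i))"
    if "(V, r, e) \<in> frames E" for V r e
    using Z.vbundle_frameD[OF E that] zopen_imp_openin[OF M] vb_section_regular_imp_cont[OF M E] by blast
  then have "\<forall>(V, r, e)\<in>frames E. openin (ctop M) V \<and> (\<forall>x\<in>V. basis_of (fib E x) r (\<lambda>i. e i x)) \<and>
      (\<forall>i<r. vb_section (cont_fn (ctop M)) E V (e i))"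
    by blast
  moreover have "(\<Union>(U, r, e)\<in>frames E. U) = topspace (ctop M)"
    using E topspace_ctop[OF M] unfolding vbundle_def by blast
  ultimately show ?thesis unfolding vbundle_def by blast
qed

text \<open>An algebraic map is only known to preserve algebraic sections. Continuous sections are
  reached by expanding them in algebraic frames, whose images are algebraic and hence
  continuous.\<close>

lemma alg_map_imp_top_map:
  assumes M: "variety M" and E: "alg_vb M E" and F: "alg_vb M F" and A: "zopen M A"
    and \<phi>: "vb_map (zopen M) (regular_on M) A E F \<phi>"
  shows "vb_map (openin (ctop M)) (cont_fn (ctop M)) A E F \<phi>"
proof -
  interpret Z: fun_space "zopen M" "regular_on M" by (rule zariski_fun_space[OF M])
  interpret C: fun_space "openin (ctop M)" "cont_fn (ctop M)" by (rule topological_fun_space)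
  show ?thesis
  proof (rule C.vb_mapI_frames[OF alg_vb_imp_top_vb[OF M E] alg_vb_imp_top_vb[OF M F]])
    show "A \<subseteq> topspace (ctop M)" using zopen_subset[OF A] topspace_ctop[OF M] by simp
    fix x assume x: "x \<in> A"
    then have "x \<in> M" using zopen_subset[OF A] by blast
    then obtain V r e where V: "(V, r, e) \<in> frames E" "x \<in> V" by (rule Z.vbundle_frameE[OF E])
    have VA: "zopen M (V \<inter> A)" by (rule zopen_Int[OF Z.vbundle_frameD(1)[OF E V(1)] A])
    have "vb_section (cont_fn (ctop M)) F (V \<inter> A) (\<lambda>y. \<phi> y (e i y))" if "i < r" for i
      by (rule vb_section_regular_imp_cont[OF M F VA Z.vb_map_frame_section[OF E \<phi> V(1) VA _ _ that]]) auto
    then show "\<exists>V r e N. (V, r, e) \<in> frames E \<and> openin (ctop M) N \<and> x \<in> N \<and> N \<subseteq> V \<and>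
        (\<forall>i<r. vb_section (cont_fn (ctop M)) F N (\<lambda>y. \<phi> y (e i y)))"
      using V x zopen_imp_openin[OF M VA]
      by (intro exI[of _ V] exI[of _ r] exI[of _ e] exI[of _ "V \<inter> A"]) auto
  qed (use vb_mapD[OF \<phi>] in auto)
qed

section \<open>Partitions of unity subordinate to Zariski open covers\<close>

lemma ideal_span_vanishing: "p \<in> ideal_span R S \<Longrightarrow> (\<And>s. s \<in> S \<Longrightarrow> s v = 0) \<Longrightarrow> p v = (0 :: complex)"
  by (induction rule: ideal_span.induct) auto

text \<open>Quasi-compactness by way of ideals: finitely many of the \<open>Q x\<close> generate all
  of them. At a point \<open>y\<close> where these vanished, \<open>Q y\<close> would vanish
  too.\<close>

lemma finite_principal_cover:
  assumes M: "variety M" and A: "A \<subseteq> M"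
    and Q: "\<And>x. x \<in> A \<Longrightarrow> hpoly (d x) (Q x) \<and> (\<forall>v\<in>x. Q x v \<noteq> 0)"
  obtains F where "finite F" "F \<subseteq> A" "\<forall>y\<in>A. \<exists>x\<in>F. \<forall>v\<in>y. Q x v \<noteq> 0"
proof -
  obtain n where n: "M \<subseteq> proj_space n" using M by (rule variety_subset_proj_space)
  define T where "T x v = Q x (trunc_vec n v)" for x v
  have pts: "y \<in> proj_points" if "y \<in> A" for y using that A variety_subset_points[OF M] by blast
  have T: "T x v = Q x v" if "y \<in> A" "v \<in> y" for x y v
  proof -
    have "\<forall>i>n. v i = 0" using mem_proj_space_iff[OF pts[OF that(1)] that(2)] n A that(1) by blast
    then have "trunc_vec n v = v" by (auto simp: trunc_vec_def fun_eq_iff)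
    then show ?thesis by (simp add: T_def)
  qed
  \<comment> \<open>Truncation puts all the \<open>Q x\<close> into one noetherian ring.\<close>
  have "T ` A \<subseteq> polyfuns (Suc n)"
    unfolding T_def[abs_def] using hpoly_trunc_vec_polyfuns Q by blast
  then obtain S0 where S0: "S0 \<subseteq> T ` A" "finite S0" "T ` A \<subseteq> ideal_span (polyfuns (Suc n)) S0"
    by (rule noetherianE[OF noetherian_polyfuns])
  obtain F where F: "F \<subseteq> A" "finite F" "S0 = T ` F"
    using finite_subset_image[OF S0(2,1)] by blast
  show thesis
  proof (rule that[OF F(2,1)], intro ballI)
    fix y assume y: "y \<in> A"
    obtain v where v: "v \<in> y" using pts[OF y] by (rule proj_pointsE)
    have "\<exists>x\<in>F. Q x v \<noteq> 0"
    proof (rule ccontr)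
      assume "\<not> ?thesis"
      then have z: "s v = 0" if "s \<in> S0" for s using that unfolding F(3) by (auto simp: T[OF y v])
      have "T y \<in> ideal_span (polyfuns (Suc n)) S0" using S0(3) y by blast
      then have "T y v = 0" by (rule ideal_span_vanishing) (rule z)
      then show False using T[OF y v] Q[OF y] v by simp
    qed
    then obtain x where x: "x \<in> F" "Q x v \<noteq> 0" by blast
    have "\<forall>w\<in>y. Q x w \<noteq> 0"
    proof
      fix w assume w: "w \<in> y"
      have "hpoly (d x) (Q x)" using Q x(1) F(1) by blast
      then show "Q x w \<noteq> 0" using hpoly_zero_iff[OF pts[OF y] v w] x(2) by blast
    qed
    then show "\<exists>x\<in>F. \<forall>v\<in>y. Q x v \<noteq> 0" using x(1) by blast
  qed
qed

text \<open>The absolute value of \<open>Q\<close>, divided by the \<open>d\<close>-th power of a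
  norm of the coordinate vector, has degree 0 and the same zeros as \<open>Q\<close>.\<close>

lemma cutoff_function:
  assumes M: "variety M" and Q: "hpoly d Q"
  obtains l where "cont_fn (ctop M) M (\<lambda>p. of_real (l p))" "\<forall>p. 0 \<le> l p"
    "\<forall>p\<in>M. \<forall>v\<in>p. l p = 0 \<longleftrightarrow> Q v = 0"
proof -
  obtain n where n: "M \<subseteq> proj_space n" using M by (rule variety_subset_proj_space)
  define N where "N v = (\<Sum>i\<le>n. norm (v i :: complex))" for v
  define g where "g v = norm (Q v) / N v ^ d" for v
  define l where "l p = g (SOME v. v \<in> p)" for p
  have N_scale: "N (\<lambda>i. c * v i) = norm c * N v" for c v
    by (simp add: N_def norm_mult sum_distrib_left)
  have g_scale: "g (\<lambda>i. c * v i) = g v" if "c \<noteq> 0" for c v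
    using that by (simp add: g_def N_scale hpoly_scale[OF Q] norm_mult norm_power power_mult_distrib)
  have pts: "p \<in> proj_points" if "p \<in> M" for p using that variety_subset_points[OF M] by blast
  have l_eq: "l p = g v" if p: "p \<in> M" and v: "v \<in> p" for p v
  proof -
    have "(SOME v. v \<in> p) \<in> p" by (rule someI[of "\<lambda>v. v \<in> p", OF v])
    then obtain c where "c \<noteq> 0" "(SOME v. v \<in> p) = (\<lambda>i. c * v i)"
      using proj_points_scale[OF pts[OF p] v] by blast
    then show ?thesis by (simp add: l_def g_scale)
  qed
  let ?W = "{v \<in> coord_vecs. N v \<noteq> 0}"
  have contN: "continuous_on S N" for S
    unfolding N_def
    by (intro continuous_intros continuous_on_subset[OF continuous_on_product_coordinates]) simp
  have N_nz: "N v \<noteq> 0" if p: "p \<in> M" and v: "v \<in> p" for p v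
  proof -
    have "\<forall>i>n. v i = 0" using mem_proj_space_iff[OF pts[OF p] v] n p by blast
    moreover obtain i where "v i \<noteq> 0"
      using proj_points_mem_coord_vecs(1)[OF pts[OF p] v] unfolding coord_vecs_def by blast
    ultimately have "i \<le> n" "0 < norm (v i)" by (auto simp: not_less[symmetric])
    then have "norm (v i) \<le> N v" unfolding N_def by (intro member_le_sum) auto
    then show ?thesis using \<open>0 < norm (v i)\<close> by linarith
  qed
  show thesis
  proof
    show "cont_fn (ctop M) M (\<lambda>p. of_real (l p))"
    proof (rule cont_fn_homogeneous[OF _ _ _ _ M])
      show "continuous_on ?W (\<lambda>v. of_real (g v) :: complex)"
        unfolding g_def
        by (intro continuous_intros continuous_on_hpoly[OF Q] contN) auto
      show "openin (top_of_set coord_vecs) ?W"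
        using continuous_openin_preimage_gen[OF contN[of coord_vecs], of "- {0}"]
        by (simp add: vimage_def Int_def open_Compl)
      show "(\<lambda>i. c * v i) \<in> ?W \<and> complex_of_real (g (\<lambda>i. c * v i)) = of_real (g v)"
        if "v \<in> ?W" "c \<noteq> 0" for v c
        using that by (auto simp: N_scale g_scale coord_vecs_def)
      show "v \<in> ?W \<and> complex_of_real (l p) = of_real (g v)" if "p \<in> M" "v \<in> p" for p v
        using N_nz[OF that] l_eq[OF that] proj_points_mem_coord_vecs(1)[OF pts[OF that(1)] that(2)] by simp
    qed
    show "\<forall>p. 0 \<le> l p" by (simp add: l_def g_def N_def sum_nonneg)
    show "\<forall>p\<in>M. \<forall>v\<in>p. l p = 0 \<longleftrightarrow> Q v = 0"
      using l_eq N_nz by (auto simp: g_def)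
  qed
qed

text \<open>Normalised cutoff functions add up to 1 and vanish off the sets of the cover, but
  possibly not near the points outside. Extending local bundle maps by zero needs the latter, so the
  functions are cut at a positive threshold and normalised again.\<close>

lemma zariski_partition_of_unity:
  assumes M: "variety M" and A: "zopen M A"
    and cover: "\<And>x. x \<in> A \<Longrightarrow> \<exists>U. zopen M U \<and> x \<in> U \<and> U \<subseteq> A \<and> P U"
  obtains m U \<phi> where "\<forall>k<(m::nat). zopen M (U k) \<and> U k \<subseteq> A \<and> P (U k)"
    "\<forall>k<m. cont_fn (ctop M) A (\<phi> k)" "\<forall>x\<in>A. (\<Sum>k<m. \<phi> k x) = 1"
    "\<forall>k<m. \<forall>x\<in>A - U k. \<exists>N. openin (ctop M) N \<and> x \<in> N \<and> N \<subseteq> A \<and> (\<forall>y\<in>N. \<phi> k y = 0)"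
proof -
  interpret C: fun_space "openin (ctop M)" "cont_fn (ctop M)" by (rule topological_fun_space)
  have AM: "A \<subseteq> M" by (rule zopen_subset[OF A])
  have Aop: "openin (ctop M) A" by (rule zopen_imp_openin[OF M A])
  have "\<forall>x\<in>A. \<exists>U. zopen M U \<and> x \<in> U \<and> U \<subseteq> A \<and> P U" using cover by blast
  then obtain U' where U': "\<forall>x\<in>A. zopen M (U' x) \<and> x \<in> U' x \<and> U' x \<subseteq> A \<and> P (U' x)"
    by (rule bchoice[THEN exE])
  have "\<forall>x\<in>A. \<exists>Q. hpoly (fst Q) (snd Q) \<and> (\<forall>p\<in>M - U' x. \<forall>v\<in>p. snd Q v = 0) \<and> (\<forall>v\<in>x. snd Q v \<noteq> 0)"
  proof
    fix x assume x: "x \<in> A"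
    have "x \<in> proj_points" using x AM variety_subset_points[OF M] by blast
    then obtain d Q where "hpoly d Q" "\<forall>p\<in>M - U' x. \<forall>v\<in>p. Q v = 0" "\<forall>v\<in>x. Q v \<noteq> 0"
      using zopen_principal_neighbourhood[of M "U' x" x] U' x by metis
    then show "\<exists>Q. hpoly (fst Q) (snd Q) \<and> (\<forall>p\<in>M - U' x. \<forall>v\<in>p. snd Q v = 0) \<and> (\<forall>v\<in>x. snd Q v \<noteq> 0)"
      by (intro exI[of _ "(d, Q)"]) simp
  qed
  then obtain Q where Q: "\<forall>x\<in>A. hpoly (fst (Q x)) (snd (Q x)) \<and> (\<forall>p\<in>M - U' x. \<forall>v\<in>p. snd (Q x) v = 0) \<and>
      (\<forall>v\<in>x. snd (Q x) v \<noteq> 0)"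
    by (rule bchoice[THEN exE])
  obtain F where F: "finite F" "F \<subseteq> A" "\<forall>y\<in>A. \<exists>x\<in>F. \<forall>v\<in>y. snd (Q x) v \<noteq> 0"
    by (rule finite_principal_cover[OF M AM, of "\<lambda>x. fst (Q x)" "\<lambda>x. snd (Q x)"]) (use Q in auto)
  have "\<forall>x\<in>F. \<exists>l. cont_fn (ctop M) M (\<lambda>p. of_real (l p)) \<and> (\<forall>p. 0 \<le> l p) \<and>
      (\<forall>p\<in>M. \<forall>v\<in>p. l p = 0 \<longleftrightarrow> snd (Q x) v = 0)"
  proof
    fix x assume "x \<in> F"
    then have "hpoly (fst (Q x)) (snd (Q x))" using Q F(2) by blast
    then obtain l where "cont_fn (ctop M) M (\<lambda>p. of_real (l p))" "\<forall>p. 0 \<le> l p"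
        "\<forall>p\<in>M. \<forall>v\<in>p. l p = 0 \<longleftrightarrow> snd (Q x) v = 0"
      by (rule cutoff_function[OF M])
    then show "\<exists>l. cont_fn (ctop M) M (\<lambda>p. of_real (l p)) \<and> (\<forall>p. 0 \<le> l p) \<and>
      (\<forall>p\<in>M. \<forall>v\<in>p. l p = 0 \<longleftrightarrow> snd (Q x) v = 0)" by blast
  qed
  then obtain l where l: "\<forall>x\<in>F. cont_fn (ctop M) M (\<lambda>p. of_real (l x p)) \<and> (\<forall>p. 0 \<le> l x p) \<and>
      (\<forall>p\<in>M. \<forall>v\<in>p. l x p = 0 \<longleftrightarrow> snd (Q x) v = 0)"
    by (rule bchoice[THEN exE])
  define m where "m = card F"
  obtain h where h: "bij_betw h {..<m} F"
    using ex_bij_betw_nat_finite[OF F(1)] unfolding m_def by (auto simp: atLeast0LessThan)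
  have hF: "h k \<in> F" if "k < m" for k using h that by (auto simp: bij_betw_def)
  define L where "L p = (\<Sum>k<m. l (h k) p)" for p
  define \<mu> where "\<mu> k p = l (h k) p / L p" for k p
  \<comment> \<open>The threshold is half the average \<open>1 / m\<close> of the \<mu>: some \<mu>
    exceeds it at every point, which keeps the sum positive, while near a zero of
    \<open>\<mu> k\<close> the function stays below it.\<close>
  define \<psi> where "\<psi> k p = max 0 (\<mu> k p - 1 / (2 * real m))" for k p
  define S where "S p = (\<Sum>k<m. \<psi> k p)" for p
  have Lpos: "L p > 0" if p: "p \<in> A" for p
  proof -
    obtain x where x: "x \<in> F" "\<forall>v\<in>p. snd (Q x) v \<noteq> 0" using F(3) p by blast
    obtain k where k: "k < m" "h k = x" using h x(1) unfolding bij_betw_def by blast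
    have "p \<in> proj_points" using p AM variety_subset_points[OF M] by blast
    then obtain v where "v \<in> p" by (rule proj_pointsE)
    then have "l x p \<noteq> 0" using l x p AM by blast
    moreover have "0 \<le> l x p" using l x(1) by blast
    ultimately have "0 < l (h k) p" using k by simp
    then show ?thesis
      unfolding L_def using k(1) l hF by (intro sum_pos2[of _ k]) auto
  qed
  have \<mu>sum: "(\<Sum>k<m. \<mu> k p) = 1" if "p \<in> A" for p
    using Lpos[OF that] by (simp add: \<mu>_def L_def sum_divide_distrib[symmetric])
  have Spos: "S p > 0" if p: "p \<in> A" for p
  proof -
    have m: "m > 0" using \<mu>sum[OF p] by (cases m) auto
    have "\<exists>k<m. \<mu> k p > 1 / (2 * real m)"
    proof (rule ccontr)
      assume "\<not> ?thesis"
      then have "(\<Sum>k<m. \<mu> k p) \<le> (\<Sum>k<m. 1 / (2 * real m))" by (intro sum_mono) (meson lessThan_iff not_le_imp_less)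
      then show False using \<mu>sum[OF p] m by simp
    qed
    then obtain k where "k < m" "\<psi> k p > 0" by (auto simp: \<psi>_def)
    then show ?thesis unfolding S_def by (intro sum_pos2[of _ k]) (auto simp: \<psi>_def)
  qed
  have cl: "cont_fn (ctop M) A (\<lambda>p. of_real (l (h k) p))" if "k < m" for k
    using l hF[OF that] cont_fn_mono[OF _ AM] by blast
  have cL: "cont_fn (ctop M) A (\<lambda>p. of_real (L p))"
    unfolding L_def of_real_sum using cl Aop by (intro C.fn_sum) auto
  have c\<mu>: "cont_fn (ctop M) A (\<lambda>p. of_real (\<mu> k p))" if "k < m" for k
    unfolding \<mu>_def of_real_divide using cl[OF that] cL Lpos Aop by (intro C.fn_divide) force+
  have c\<psi>: "cont_fn (ctop M) A (\<lambda>p. of_real (\<psi> k p))" if "k < m" for k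
  proof -
    have "cont_fn (ctop M) A (\<lambda>p. (\<lambda>z. of_real (max 0 (Re z - 1 / (2 * real m)))) (of_real (\<mu> k p)))"
      by (rule cont_fn_compose_continuous[OF c\<mu>[OF that], of UNIV]) (auto intro!: continuous_intros)
    then show ?thesis by (simp add: \<psi>_def)
  qed
  have cS: "cont_fn (ctop M) A (\<lambda>p. of_real (S p))"
    unfolding S_def of_real_sum using c\<psi> Aop by (intro C.fn_sum) auto
  show thesis
  proof (rule that)
    show "\<forall>k<m. zopen M (U' (h k)) \<and> U' (h k) \<subseteq> A \<and> P (U' (h k))"
      using U' hF F(2) by blast
    show "\<forall>k<m. cont_fn (ctop M) A (\<lambda>p. of_real (\<psi> k p) / of_real (S p))"
    proof (intro allI impI C.fn_divide c\<psi> cS Aop)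
      show "of_real (S p) \<noteq> (0 :: complex)" if "p \<in> A" for p using Spos[OF that] by simp
    qed
    show "\<forall>p\<in>A. (\<Sum>k<m. of_real (\<psi> k p) / of_real (S p)) = (1 :: complex)"
    proof
      fix p assume "p \<in> A"
      then have "of_real (S p) \<noteq> (0 :: complex)" using Spos by fastforce
      moreover have "(\<Sum>k<m. complex_of_real (\<psi> k p)) = of_real (S p)" by (simp add: S_def)
      ultimately show "(\<Sum>k<m. of_real (\<psi> k p) / of_real (S p)) = (1 :: complex)"
        by (simp add: sum_divide_distrib[symmetric])
    qed
    show "\<forall>k<m. \<forall>x\<in>A - U' (h k). \<exists>N. openin (ctop M) N \<and> x \<in> N \<and> N \<subseteq> A \<and>
        (\<forall>y\<in>N. of_real (\<psi> k y) / of_real (S y) = (0 :: complex))"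
    proof (intro allI impI ballI)
      fix k x assume k: "k < m" and x: "x \<in> A - U' (h k)"
      have m: "m > 0" using k by simp
      let ?N = "{y \<in> A. complex_of_real (\<mu> k y) \<in> {z. Re z < 1 / (2 * real m)}}"
      have "open {z. Re z < 1 / (2 * real m)}" by (intro open_Collect_less continuous_intros)
      then have "openin (ctop M) ?N" using c\<mu>[OF k] unfolding cont_fn_openin[OF Aop] by blast
      moreover have "\<mu> k x = 0"
      proof -
        have "x \<in> M - U' (h k)" "x \<in> proj_points" using x AM variety_subset_points[OF M] by blast+
        then obtain v where "v \<in> x" using proj_pointsE by blast
        then have "snd (Q (h k)) v = 0" using Q hF[OF k] F(2) \<open>x \<in> M - U' (h k)\<close> by blast
        then have "l (h k) x = 0" using l hF[OF k] \<open>v \<in> x\<close> \<open>x \<in> M - U' (h k)\<close> by blast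
        then show ?thesis by (simp add: \<mu>_def)
      qed
      then have "x \<in> ?N" using x m by simp
      moreover have "\<forall>y\<in>?N. of_real (\<psi> k y) / of_real (S y) = (0 :: complex)"
        by (auto simp: \<psi>_def max_def)
      ultimately show "\<exists>N. openin (ctop M) N \<and> x \<in> N \<and> N \<subseteq> A \<and>
          (\<forall>y\<in>N. of_real (\<psi> k y) / of_real (S y) = (0 :: complex))"
        by (intro exI[of _ ?N] conjI) auto
    qed
  qed
qed

section \<open>Splittings of an exact complex of bundles\<close>

lemma (in fun_space) vbundle_zero_mem:
  assumes "vbundle opn fn B E" "x \<in> B"
  shows "(\<lambda>k. 0) \<in> fib E x"
proof -
  obtain V r e where "(V, r, e) \<in> frames E" "x \<in> V" using assms by (rule vbundle_frameE)
  then show ?thesis using basis_of_zero vbundle_frameD(3)[OF assms(1)] by blast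
qed

lemma (in fun_space) vbundle_lin_mem:
  assumes "vbundle opn fn B E" "x \<in> B" "v \<in> fib E x" "w \<in> fib E x"
  shows "(\<lambda>k. a * v k + b * w k) \<in> fib E x"
proof -
  obtain V r e where "(V, r, e) \<in> frames E" "x \<in> V" using assms(1,2) by (rule vbundle_frameE)
  then show ?thesis using basis_of_lin vbundle_frameD(3)[OF assms(1)] assms(3,4) by blast
qed

lemma vb_map_diff:
  assumes "vb_map opn fn A E F \<phi>" "x \<in> A" "v \<in> fib E x" "w \<in> fib E x"
  shows "\<phi> x (\<lambda>k. v k - w k) = (\<lambda>k. \<phi> x v k - \<phi> x w k)"
  using vb_mapD(2)[OF assms, of 1 "-1"] by simp

lemma vb_map_add:
  assumes "vb_map opn fn A E F \<phi>" "x \<in> A" "v \<in> fib E x" "w \<in> fib E x"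
  shows "\<phi> x (\<lambda>k. v k + w k) = (\<lambda>k. \<phi> x v k + \<phi> x w k)"
  using vb_mapD(2)[OF assms, of 1 1] by simp

lemma vb_map_zero:
  assumes "vb_map opn fn A E F \<phi>" "x \<in> A" "v \<in> fib E x"
  shows "\<phi> x (\<lambda>k. 0) = (\<lambda>k. 0)"
  using vb_mapD(2)[OF assms assms(3), of 0 0] by simp

text \<open>The data of a resolution of a sheaf that vanishes on \<open>A\<close>. As
  \<open>d 0 = 0\<close>, the assumption \<open>exact\<close> for \<open>i = 0\<close> says that
  \<open>d 1\<close> is surjective over \<open>A\<close>.\<close>

context
  fixes M A :: "pt set" and E :: "nat \<Rightarrow> (pt, nat) vb" and d :: "nat \<Rightarrow> pt \<Rightarrow> (nat \<Rightarrow> complex) \<Rightarrow> nat \<Rightarrow> complex"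
  assumes M: "variety M" and A: "zopen M A" and E: "\<And>i. alg_vb M (E i)"
    and dmap: "\<And>i. vb_map (zopen M) (regular_on M) M (E (Suc i)) (E i) (d (Suc i))"
    and d0: "d 0 = (\<lambda>x v k. 0)"
    and dd: "\<And>i x v. x \<in> M \<Longrightarrow> v \<in> fib (E (Suc i)) x \<Longrightarrow> d i x (d (Suc i) x v) = (\<lambda>k. 0)"
    and exact: "\<And>i U t x. zopen M U \<Longrightarrow> U \<subseteq> A \<Longrightarrow> vb_section (regular_on M) (E i) U t \<Longrightarrow>
       (\<And>y. y \<in> U \<Longrightarrow> d i y (t y) = (\<lambda>k. 0)) \<Longrightarrow> x \<in> U \<Longrightarrow>
       \<exists>V u. zopen M V \<and> x \<in> V \<and> V \<subseteq> U \<and> vb_section (regular_on M) (E (Suc i)) V u \<and>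
         (\<forall>y\<in>V. d (Suc i) y (u y) = t y)"
    and fin: "\<exists>r. \<forall>i>r. \<forall>x\<in>M. fib (E i) x = {\<lambda>k. 0}"
begin

interpretation Z: fun_space "zopen M" "regular_on M" by (rule zariski_fun_space[OF M])
interpretation C: fun_space "openin (ctop M)" "cont_fn (ctop M)" by (rule topological_fun_space)

lemma A_subset: "A \<subseteq> M" by (rule zopen_subset[OF A])

lemma A_open: "openin (ctop M) A" by (rule zopen_imp_openin[OF M A])

lemma top_E: "top_vb (ctop M) (E i)" by (rule alg_vb_imp_top_vb[OF M E])

text \<open>A frame is projected into the kernel of \<open>d i\<close>, its members are lifted along
  \<open>d (Suc i)\<close> by exactness, and the lifts are extended linearly. On the kernel the
  projection is the identity, so there the result is a right inverse.\<close>

lemma local_section_from_projection: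
  assumes U: "zopen M U" "U \<subseteq> A" and x: "x \<in> U"
    and \<rho>: "vb_map (zopen M) (regular_on M) U (E i) (E i) \<rho>"
    and d\<rho>: "\<And>y v. y \<in> U \<Longrightarrow> v \<in> fib (E i) y \<Longrightarrow> d i y (\<rho> y v) = (\<lambda>k. 0)"
    and \<rho>id: "\<And>y v. y \<in> U \<Longrightarrow> v \<in> fib (E i) y \<Longrightarrow> d i y v = (\<lambda>k. 0) \<Longrightarrow> \<rho> y v = v"
  shows "\<exists>W s. zopen M W \<and> x \<in> W \<and> W \<subseteq> U \<and> vb_map (zopen M) (regular_on M) W (E i) (E (Suc i)) s \<and>
    (\<forall>y\<in>W. \<forall>v\<in>fib (E i) y. d i y v = (\<lambda>k. 0) \<longrightarrow> d (Suc i) y (s y v) = v)"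
proof -
  have "x \<in> M" using x U(2) A_subset by blast
  then obtain V r e where V: "(V, r, e) \<in> frames (E i)" "x \<in> V" by (rule Z.vbundle_frameE[OF E])
  note D = Z.vbundle_frameD[OF E V(1)]
  define W where "W = V \<inter> U"
  have W: "zopen M W" "x \<in> W" "W \<subseteq> A" "W \<subseteq> U" "W \<subseteq> V"
    unfolding W_def using zopen_Int[OF D(1) U(1)] V(2) x U(2) by auto
  have "\<exists>W' u. zopen M W' \<and> x \<in> W' \<and> W' \<subseteq> W \<and> (vb_section (regular_on M) (E (Suc i)) W' u \<and>
      (\<forall>y\<in>W'. d (Suc i) y (u y) = \<rho> y (e l y)))" if l: "l < r" for l
  proof (rule exact[OF W(1,3) _ _ W(2)])
    show "vb_section (regular_on M) (E i) W (\<lambda>y. \<rho> y (e l y))"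
      by (rule Z.vb_map_frame_section[OF E \<rho> V(1) W(1,5,4) l])
    show "d i y (\<rho> y (e l y)) = (\<lambda>k. 0)" if "y \<in> W" for y
      using d\<rho>[of y "e l y"] basis_of_mem[OF D(3) l] that W(4,5) by blast
  qed
  then have "\<exists>W' u. zopen M W' \<and> x \<in> W' \<and> W' \<subseteq> W \<and> (\<forall>l<r. vb_section (regular_on M) (E (Suc i)) W' (u l) \<and>
      (\<forall>y\<in>W'. d (Suc i) y (u l y) = \<rho> y (e l y)))"
    by (rule finite_zopen_choice[OF W(1,2)]) (use Z.vb_section_mono[OF E] in blast)+
  then obtain W' u where W': "zopen M W'" "x \<in> W'" "W' \<subseteq> W"
    and u: "\<forall>l<r. vb_section (regular_on M) (E (Suc i)) W' (u l) \<and> (\<forall>y\<in>W'. d (Suc i) y (u l y) = \<rho> y (e l y))"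
    by (elim exE conjE)
  have W'V: "W' \<subseteq> V" "W' \<subseteq> U" "W' \<subseteq> M" using W'(3) W(3,4,5) A_subset by auto
  have bas: "basis_of (fib (E i) y) r (\<lambda>l. e l y)" if "y \<in> W'" for y using D(3) that W'V(1) by blast
  \<comment> \<open>Coordinates in the frame; they are unique over \<open>W'\<close>, which makes
    \<open>s\<close> linear there.\<close>
  define coef where "coef y v = (SOME c. v = vcomb r c (\<lambda>l. e l y))" for y v
  define s where "s y v = vcomb r (coef y v) (\<lambda>l. u l y)" for y v
  have coef: "v = vcomb r (coef y v) (\<lambda>l. e l y)" if y: "y \<in> W'" and v: "v \<in> fib (E i) y" for y v
  proof -
    obtain c where "v = vcomb r c (\<lambda>l. e l y)" by (rule basis_ofE[OF bas[OF y] v])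
    then show ?thesis unfolding coef_def by (rule someI[of "\<lambda>c. v = vcomb r c (\<lambda>l. e l y)"])
  qed
  have s_eq: "s y (vcomb r c (\<lambda>l. e l y)) = vcomb r c (\<lambda>l. u l y)" if y: "y \<in> W'" for y c
    unfolding s_def
    using basis_of_unique[OF bas[OF y]] coef[OF y basis_of_vcomb[OF bas[OF y]]]
    by (intro vcomb_cong) (metis, auto)
  have "vb_map (zopen M) (regular_on M) W' (E i) (E (Suc i)) s"
  proof (rule Z.vb_mapI_frames[OF E E W'V(3)])
    show "s y v \<in> fib (E (Suc i)) y" if y: "y \<in> W'" and v: "v \<in> fib (E i) y" for y v
    proof -
      have "y \<in> M" using y W'V(3) by blast
      then obtain V2 r2 e2 where V2: "(V2, r2, e2) \<in> frames (E (Suc i))" "y \<in> V2" by (rule Z.vbundle_frameE[OF E])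
      show ?thesis
        unfolding s_def
      proof (rule basis_of_closed[OF Z.vbundle_frameD(3)[OF E V2]])
        fix l assume "l < r"
        then have "vb_section (regular_on M) (E (Suc i)) W' (u l)" using u by blast
        then show "u l y \<in> fib (E (Suc i)) y" using y by (rule Z.vb_section_fib)
      qed
    qed
    show "s y (\<lambda>k. a * v k + b * w k) = (\<lambda>k. a * s y v k + b * s y w k)"
      if y: "y \<in> W'" and v: "v \<in> fib (E i) y" and w: "w \<in> fib (E i) y" for y v w a b
    proof -
      have "(\<lambda>k. a * v k + b * w k) = vcomb r (\<lambda>l. a * coef y v l + b * coef y w l) (\<lambda>l. e l y)"
        using coef[OF y v] coef[OF y w]
        by (auto simp: vcomb_def fun_eq_iff sum_distrib_left sum.distrib algebra_simps)
      then have "s y (\<lambda>k. a * v k + b * w k) = vcomb r (\<lambda>l. a * coef y v l + b * coef y w l) (\<lambda>l. u l y)"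
        using s_eq[OF y] by simp
      then show ?thesis
        by (auto simp: s_def vcomb_def fun_eq_iff sum_distrib_left sum.distrib algebra_simps)
    qed
    fix y assume y: "y \<in> W'"
    have "vb_section (regular_on M) (E (Suc i)) W' (\<lambda>z. s z (e l z))" if l: "l < r" for l
    proof (rule Z.vb_section_cong)
      show "vb_section (regular_on M) (E (Suc i)) W' (u l)" using u l by blast
      show "u l z = s z (e l z)" if "z \<in> W'" for z
        using s_eq[OF that, of "\<lambda>k. if k = l then 1 else 0"] by (simp add: vcomb_unit[OF l])
    qed
    then show "\<exists>V r e N. (V, r, e) \<in> frames (E i) \<and> zopen M N \<and> y \<in> N \<and> N \<subseteq> V \<and>
       (\<forall>l<r. vb_section (regular_on M) (E (Suc i)) N (\<lambda>z. s z (e l z)))"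
      using V(1) W'(1) y W'V(1) by blast
  qed
  moreover have "d (Suc i) y (s y v) = v" if y: "y \<in> W'" and v: "v \<in> fib (E i) y" and dv: "d i y v = (\<lambda>k. 0)" for y v
  proof -
    have yU: "y \<in> U" and yM: "y \<in> M" using y W'V by blast+
    obtain V2 r2 e2 where V2: "(V2, r2, e2) \<in> frames (E (Suc i))" "y \<in> V2" by (rule Z.vbundle_frameE[OF E yM])
    have "d (Suc i) y (s y v) = vcomb r (coef y v) (\<lambda>l. d (Suc i) y (u l y))"
      unfolding s_def
      by (rule linear_vcomb[OF Z.vbundle_frameD(3)[OF E V2] vb_mapD(2)[OF dmap yM]])
        (use u y in \<open>auto intro: Z.vb_section_fib[of _ W']\<close>)
    also have "\<dots> = vcomb r (coef y v) (\<lambda>l. \<rho> y (e l y))"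
      using u y by (intro vcomb_cong) auto
    also have "\<dots> = \<rho> y (vcomb r (coef y v) (\<lambda>l. e l y))"
      by (rule linear_vcomb[OF bas[OF y] vb_mapD(2)[OF \<rho> yU], symmetric])
        (use basis_of_mem[OF bas[OF y]] in auto)
    also have "\<dots> = v" using coef[OF y v] \<rho>id[OF yU v dv] by simp
    finally show ?thesis .
  qed
  ultimately show ?thesis
    using W' W(4) by (intro exI[of _ W'] exI[of _ s]) auto
qed

text \<open>Induction along the complex. A right inverse \<open>s\<close> in one degree yields the
  projection \<open>v - s (d v)\<close> onto the kernel in the next degree, and from it a right
  inverse there; in degree 0 the identity is a projection because \<open>d 0 = 0\<close>.\<close>

lemma local_right_inverse:
  assumes "x \<in> A"
  shows "\<exists>W s. zopen M W \<and> x \<in> W \<and> W \<subseteq> A \<and> vb_map (zopen M) (regular_on M) W (E i) (E (Suc i)) s \<and>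
    (\<forall>y\<in>W. \<forall>v\<in>fib (E i) y. d i y v = (\<lambda>k. 0) \<longrightarrow> d (Suc i) y (s y v) = v)"
proof (induction i)
  case 0
  show ?case
    by (rule local_section_from_projection[OF A subset_refl assms Z.vb_map_id]) (auto simp: d0)
next
  case (Suc i)
  then obtain U s where U: "zopen M U" "x \<in> U" "U \<subseteq> A"
    and s: "vb_map (zopen M) (regular_on M) U (E i) (E (Suc i)) s"
    and ds: "\<forall>y\<in>U. \<forall>v\<in>fib (E i) y. d i y v = (\<lambda>k. 0) \<longrightarrow> d (Suc i) y (s y v) = v"
    by (elim exE conjE)
  have UM: "U \<subseteq> M" using U(3) A_subset by blast
  \<comment> \<open>The explicit coefficients 1 and -1 match the form of
    \<open>vb_map_lin2\<close>.\<close>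
  define \<rho> where "\<rho> y v = (\<lambda>k. 1 * v k + (-1) * s y (d (Suc i) y v) k)" for y v
  have sd: "vb_map (zopen M) (regular_on M) U (E (Suc i)) (E (Suc i)) (\<lambda>y v. s y (d (Suc i) y v))"
    by (rule vb_map_comp[OF vb_map_subset[OF dmap UM] s])
  have \<rho>: "vb_map (zopen M) (regular_on M) U (E (Suc i)) (E (Suc i)) \<rho>"
    unfolding \<rho>_def[abs_def] by (rule Z.vb_map_lin2[OF E E U(1) UM Z.vb_map_id sd])
  have "\<exists>W s. zopen M W \<and> x \<in> W \<and> W \<subseteq> U \<and> vb_map (zopen M) (regular_on M) W (E (Suc i)) (E (Suc (Suc i))) s \<and>
    (\<forall>y\<in>W. \<forall>v\<in>fib (E (Suc i)) y. d (Suc i) y v = (\<lambda>k. 0) \<longrightarrow> d (Suc (Suc i)) y (s y v) = v)"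
  proof (rule local_section_from_projection[OF U(1,3,2) \<rho>])
    fix y v assume y: "y \<in> U" and v: "v \<in> fib (E (Suc i)) y"
    have yM: "y \<in> M" using y UM by blast
    have dv: "d (Suc i) y v \<in> fib (E i) y" by (rule vb_mapD(1)[OF dmap yM v])
    have "d (Suc i) y (\<rho> y v) = (\<lambda>k. 1 * d (Suc i) y v k + (-1) * d (Suc i) y (s y (d (Suc i) y v)) k)"
      unfolding \<rho>_def by (rule vb_mapD(2)[OF dmap yM v vb_mapD(1)[OF sd y v]])
    then show "d (Suc i) y (\<rho> y v) = (\<lambda>k. 0)" using ds y dv dd[OF yM v] by simp
    assume "d (Suc i) y v = (\<lambda>k. 0)"
    then show "\<rho> y v = v" unfolding \<rho>_def
      using vb_map_zero[OF s y dv] by simp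
  qed
  then show ?case using U(3) by blast
qed

text \<open>The defining condition is affine in the right inverse, so combining local ones with
  weights that add up to 1 gives another. This is where algebraic maps give way to continuous
  ones.\<close>

lemma global_right_inverse:
  "\<exists>\<sigma>. vb_map (openin (ctop M)) (cont_fn (ctop M)) A (E i) (E (Suc i)) \<sigma> \<and>
    (\<forall>y\<in>A. \<forall>v\<in>fib (E i) y. d i y v = (\<lambda>k. 0) \<longrightarrow> d (Suc i) y (\<sigma> y v) = v)"
proof -
  let ?P = "\<lambda>W. \<exists>s. vb_map (zopen M) (regular_on M) W (E i) (E (Suc i)) s \<and>
    (\<forall>y\<in>W. \<forall>v\<in>fib (E i) y. d i y v = (\<lambda>k. 0) \<longrightarrow> d (Suc i) y (s y v) = v)"
  have "\<exists>W. zopen M W \<and> x \<in> W \<and> W \<subseteq> A \<and> ?P W" if "x \<in> A" for x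
    using local_right_inverse[OF that, of i] by blast
  then obtain m U \<phi> where U: "\<forall>k<(m::nat). zopen M (U k) \<and> U k \<subseteq> A \<and> ?P (U k)"
    and \<phi>: "\<forall>k<m. cont_fn (ctop M) A (\<phi> k)" "\<forall>x\<in>A. (\<Sum>k<m. \<phi> k x) = 1"
    and supp: "\<forall>k<m. \<forall>x\<in>A - U k. \<exists>N. openin (ctop M) N \<and> x \<in> N \<and> N \<subseteq> A \<and> (\<forall>y\<in>N. \<phi> k y = 0)"
    by (rule zariski_partition_of_unity[OF M A])
  have "\<forall>k\<in>{..<m}. ?P (U k)" using U by blast
  then obtain s where s: "\<forall>k\<in>{..<m}. vb_map (zopen M) (regular_on M) (U k) (E i) (E (Suc i)) (s k) \<and>
    (\<forall>y\<in>U k. \<forall>v\<in>fib (E i) y. d i y v = (\<lambda>k. 0) \<longrightarrow> d (Suc i) y (s k y v) = v)"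
    by (rule bchoice[THEN exE])
  have sC: "vb_map (openin (ctop M)) (cont_fn (ctop M)) (U k) (E i) (E (Suc i)) (s k)" if "k < m" for k
    using U s that by (intro alg_map_imp_top_map[OF M E E]) auto
  have \<phi>0: "\<phi> k y = 0" if "k < m" "y \<in> A" "y \<notin> U k" for k y
    using supp that by blast
  define \<sigma> where "\<sigma> y v = vcomb m (\<lambda>k. \<phi> k y) (\<lambda>k. if y \<in> U k then s k y v else (\<lambda>l. 0))" for y v
  have AC: "A \<subseteq> topspace (ctop M)" using A_subset topspace_ctop[OF M] by simp
  have zero: "(\<lambda>l. 0) \<in> fib (E (Suc i)) y" if "y \<in> A" for y
    using Z.vbundle_zero_mem[OF E] that A_subset by blast
  have sfib: "(if y \<in> U k then s k y v else (\<lambda>l. 0)) \<in> fib (E (Suc i)) y"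
    if "k < m" "y \<in> A" "v \<in> fib (E i) y" for k y v
    using vb_mapD(1)[OF sC[OF that(1)] _ that(3)] zero[OF that(2)] by simp
  have "vb_map (openin (ctop M)) (cont_fn (ctop M)) A (E i) (E (Suc i)) \<sigma>"
  proof (rule C.vb_mapI_frames[OF top_E top_E AC])
    show "\<sigma> y v \<in> fib (E (Suc i)) y" if y: "y \<in> A" and v: "v \<in> fib (E i) y" for y v
    proof -
      have "y \<in> M" using y A_subset by blast
      then obtain V2 r2 e2 where V2: "(V2, r2, e2) \<in> frames (E (Suc i))" "y \<in> V2" by (rule Z.vbundle_frameE[OF E])
      show ?thesis
        unfolding \<sigma>_def by (rule basis_of_closed[OF Z.vbundle_frameD(3)[OF E V2] sfib[OF _ y v]])
    qed
    show "\<sigma> y (\<lambda>k. a * v k + b * w k) = (\<lambda>k. a * \<sigma> y v k + b * \<sigma> y w k)"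
      if y: "y \<in> A" and v: "v \<in> fib (E i) y" and w: "w \<in> fib (E i) y" for y v w a b
    proof -
      have "(if y \<in> U k then s k y (\<lambda>k. a * v k + b * w k) else (\<lambda>l. 0)) =
          (\<lambda>l. a * (if y \<in> U k then s k y v else (\<lambda>l. 0)) l + b * (if y \<in> U k then s k y w else (\<lambda>l. 0)) l)"
        if "k < m" for k
        using vb_mapD(2)[OF sC[OF that] _ v w] by simp
      then have "\<sigma> y (\<lambda>k. a * v k + b * w k) = vcomb m (\<lambda>k. \<phi> k y)
          (\<lambda>k l. a * (if y \<in> U k then s k y v else (\<lambda>l. 0)) l + b * (if y \<in> U k then s k y w else (\<lambda>l. 0)) l)"
        unfolding \<sigma>_def by (intro vcomb_cong) auto
      also have "\<dots> = (\<lambda>k. a * \<sigma> y v k + b * \<sigma> y w k)"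
        by (simp only: \<sigma>_def vcomb_def fun_eq_iff sum_distrib_left sum.distrib[symmetric])
          (simp add: algebra_simps)
      finally show ?thesis .
    qed
    fix x assume x: "x \<in> A"
    then have "x \<in> M" using A_subset by blast
    then obtain V r e where V: "(V, r, e) \<in> frames (E i)" "x \<in> V" by (rule Z.vbundle_frameE[OF E])
    note D = C.vbundle_frameD[OF top_E V(1)]
    \<comment> \<open>Around \<open>x\<close> every term is either defined on a whole neighbourhood
      or multiplied by zero on one.\<close>
    have "\<forall>k\<in>{..<m}. \<exists>N. openin (ctop M) N \<and> x \<in> N \<and> N \<subseteq> A \<and> (if x \<in> U k then N \<subseteq> U k else \<forall>y\<in>N. \<phi> k y = 0)"
    proof
      fix k assume k: "k \<in> {..<m}"
      show "\<exists>N. openin (ctop M) N \<and> x \<in> N \<and> N \<subseteq> A \<and> (if x \<in> U k then N \<subseteq> U k else \<forall>y\<in>N. \<phi> k y = 0)"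
      proof (cases "x \<in> U k")
        case True
        then show ?thesis using U k zopen_imp_openin[OF M] by (intro exI[of _ "U k"]) auto
      next
        case False
        then show ?thesis using supp k x by auto
      qed
    qed
    then obtain N where N: "\<forall>k\<in>{..<m}. openin (ctop M) (N k) \<and> x \<in> N k \<and> N k \<subseteq> A \<and>
        (if x \<in> U k then N k \<subseteq> U k else \<forall>y\<in>N k. \<phi> k y = 0)"
      by (rule bchoice[THEN exE])
    have "openin (ctop M) (V \<inter> A \<inter> (\<Inter>k<n. N k))" if "n \<le> m" for n
      using that
    proof (induction n)
      case 0
      then show ?case using C.opn_Int[OF D(1) A_open] by simp
    next
      case (Suc n)
      then have "openin (ctop M) (V \<inter> A \<inter> (\<Inter>k<n. N k))" "openin (ctop M) (N n)" using N by auto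
      then have "openin (ctop M) (V \<inter> A \<inter> (\<Inter>k<n. N k) \<inter> N n)" by (rule C.opn_Int)
      moreover have "V \<inter> A \<inter> (\<Inter>k<n. N k) \<inter> N n = V \<inter> A \<inter> (\<Inter>k<Suc n. N k)"
        by (auto simp: less_Suc_eq)
      ultimately show ?case by simp
    qed
    then have N0: "openin (ctop M) (V \<inter> A \<inter> (\<Inter>k<m. N k))" by blast
    define N' where "N' = V \<inter> A \<inter> (\<Inter>k<m. N k)"
    have N': "openin (ctop M) N'" "x \<in> N'" "N' \<subseteq> V" "N' \<subseteq> A" "N' \<subseteq> topspace (ctop M)"
      using N0 V(2) x N AC unfolding N'_def by auto
    have N'N: "N' \<subseteq> N k" if "k < m" for k using that unfolding N'_def by blast
    have "vb_section (cont_fn (ctop M)) (E (Suc i)) N' (\<lambda>y. \<sigma> y (e l y))" if l: "l < r" for l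
    proof -
      \<comment> \<open>The case distinction is on the fixed point \<open>x\<close> and not on
        \<open>y\<close>; each \<open>t k\<close> is therefore a section over all of
        \<open>N'\<close>. Where it differs from the original term, the weight is zero.\<close>
      define t where "t k = (if x \<in> U k then (\<lambda>y. s k y (e l y)) else (\<lambda>y. vcomb 0 (\<lambda>j. undefined) (\<lambda>j. undefined)))" for k
      have "vb_section (cont_fn (ctop M)) (E (Suc i)) N' (\<lambda>y. vcomb m (\<lambda>k. \<phi> k y) (\<lambda>k. t k y))"
      proof (rule C.vb_section_vcomb[OF top_E N'(1,5)])
        show "cont_fn (ctop M) N' (\<phi> k)" if "k < m" for k using \<phi>(1) that cont_fn_mono[OF _ N'(4)] by blast
        show "vb_section (cont_fn (ctop M)) (E (Suc i)) N' (t k)" if k: "k < m" for k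
        proof (cases "x \<in> U k")
          case True
          then have "N' \<subseteq> U k" using N k N'N[OF k] by fastforce
          then show ?thesis
            using True C.vb_map_frame_section[OF top_E sC[OF k] V(1) N'(1,3) _ l] by (simp add: t_def)
        next
          case False
          have "vb_section (cont_fn (ctop M)) (E (Suc i)) N' (\<lambda>y. vcomb 0 (\<lambda>j. undefined) (\<lambda>j. undefined))"
            by (rule C.vb_section_vcomb[OF top_E N'(1,5)]) auto
          then show ?thesis using False by (simp add: t_def)
        qed
      qed
      then show ?thesis
      proof (rule C.vb_section_cong)
        fix y assume y: "y \<in> N'"
        have yA: "y \<in> A" using y N'(4) by blast
        have "\<phi> k y * t k y p = \<phi> k y * (if y \<in> U k then s k y (e l y) else (\<lambda>l. 0)) p" if k: "k < m" for k p
        proof (cases "x \<in> U k")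
          case True
          then have "y \<in> U k" using N k N'N[OF k] y by fastforce
          then show ?thesis using True by (simp add: t_def)
        next
          case False
          then have "\<phi> k y = 0" using N k N'N[OF k] y by fastforce
          then show ?thesis by simp
        qed
        then show "vcomb m (\<lambda>k. \<phi> k y) (\<lambda>k. t k y) = \<sigma> y (e l y)"
          unfolding \<sigma>_def vcomb_def by (intro ext sum.cong) auto
      qed
    qed
    then show "\<exists>V r e N. (V, r, e) \<in> frames (E i) \<and> openin (ctop M) N \<and> x \<in> N \<and> N \<subseteq> V \<and>
       (\<forall>l<r. vb_section (cont_fn (ctop M)) (E (Suc i)) N (\<lambda>y. \<sigma> y (e l y)))"
      using V(1) N'(1,2,3) by blast
  qed
  moreover have "d (Suc i) y (\<sigma> y v) = v" if y: "y \<in> A" and v: "v \<in> fib (E i) y" and dv: "d i y v = (\<lambda>k. 0)" for y v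
  proof -
    have yM: "y \<in> M" using y A_subset by blast
    obtain V2 r2 e2 where V2: "(V2, r2, e2) \<in> frames (E (Suc i))" "y \<in> V2" by (rule Z.vbundle_frameE[OF E yM])
    have "d (Suc i) y (\<sigma> y v) = vcomb m (\<lambda>k. \<phi> k y) (\<lambda>k. d (Suc i) y (if y \<in> U k then s k y v else (\<lambda>l. 0)))"
      unfolding \<sigma>_def
      by (rule linear_vcomb[OF Z.vbundle_frameD(3)[OF E V2] vb_mapD(2)[OF dmap yM]]) (use sfib y v in auto)
    also have "\<dots> = (\<lambda>p. \<Sum>k<m. \<phi> k y * v p)"
      unfolding vcomb_def
    proof (intro ext sum.cong refl)
      fix p k assume k: "k \<in> {..<m}"
      show "\<phi> k y * d (Suc i) y (if y \<in> U k then s k y v else (\<lambda>l. 0)) p = \<phi> k y * v p"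
        using s k v dv \<phi>0[of k y] y by (cases "y \<in> U k") auto
    qed
    also have "\<dots> = v" using \<phi>(2) y by (simp add: sum_distrib_right[symmetric])
    finally show ?thesis .
  qed
  ultimately show ?thesis by blast
qed

text \<open>The maps \<open>\<sigma> \<rho>\<close> form a contracting homotopy of the complex over
  \<open>A\<close>. Adding it to the differential gives an operator that exchanges even and odd
  degrees and squares to the identity.\<close>

lemma even_odd_splitting:
  "top_vb (ctop M) (E_even M E)" "top_vb (ctop M) (E_odd M E)"
  "\<exists>\<rho> \<beta>. splittings M A E d \<rho> \<and> even_odd_iso M A E d \<rho> \<beta> \<and>
     vb_map (openin (ctop M)) (cont_fn (ctop M)) A (E_even M E) (E_odd M E) \<beta> \<and>
     (\<forall>x\<in>A. bij_betw (\<beta> x) (fib (E_even M E) x) (fib (E_odd M E) x))"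
proof -
  obtain r where r: "\<forall>i>r. \<forall>x\<in>M. fib (E i) x = {\<lambda>k. 0}" using fin by blast
  have tsM: "topspace (ctop M) = M" by (rule topspace_ctop[OF M])
  have sub: "V \<subseteq> topspace (ctop M)" if "openin (ctop M) V" for V using that by (rule openin_subset)
  have finN: "finite {i \<in> N. i \<le> r}" for N by simp
  \<comment> \<open>The sums run over infinitely many indices; those above \<open>r\<close> have
    zero fibres and do not enter the frames.\<close>
  have zero: "fib (E i) x = {\<lambda>k. 0}" if "i \<in> N - {i \<in> N. i \<le> r}" "x \<in> topspace (ctop M)" for i x N
    using that r tsM by auto
  show "top_vb (ctop M) (E_even M E)"
    unfolding E_even_def
    by (rule C.vbundle_vb_sum[OF openin_topspace top_E finN[of "{i. even i}"] _ zero sub]) auto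
  show "top_vb (ctop M) (E_odd M E)"
    unfolding E_odd_def
    by (rule C.vbundle_vb_sum[OF openin_topspace top_E finN[of "{i. odd i}"] _ zero sub]) auto
  have "\<forall>i. \<exists>\<sigma>. vb_map (openin (ctop M)) (cont_fn (ctop M)) A (E i) (E (Suc i)) \<sigma> \<and>
    (\<forall>y\<in>A. \<forall>v\<in>fib (E i) y. d i y v = (\<lambda>k. 0) \<longrightarrow> d (Suc i) y (\<sigma> y v) = v)"
    using global_right_inverse by blast
  then obtain \<sigma> where \<sigma>: "\<forall>i. vb_map (openin (ctop M)) (cont_fn (ctop M)) A (E i) (E (Suc i)) (\<sigma> i) \<and>
    (\<forall>y\<in>A. \<forall>v\<in>fib (E i) y. d i y v = (\<lambda>k. 0) \<longrightarrow> d (Suc i) y (\<sigma> i y v) = v)"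
    by (rule choice[THEN exE])
  have \<sigma>map: "vb_map (openin (ctop M)) (cont_fn (ctop M)) A (E i) (E (Suc i)) (\<sigma> i)"
    and d\<sigma>: "\<And>y v. y \<in> A \<Longrightarrow> v \<in> fib (E i) y \<Longrightarrow> d i y v = (\<lambda>k. 0) \<Longrightarrow> d (Suc i) y (\<sigma> i y v) = v" for i
    using \<sigma> by blast+
  have dtop: "vb_map (openin (ctop M)) (cont_fn (ctop M)) A (E (Suc i)) (E i) (d (Suc i))" for i
    using alg_map_imp_top_map[OF M E E A vb_map_subset[OF dmap A_subset]] .
  have ddA: "d i x (d (Suc i) x v) = (\<lambda>k. 0)" if "x \<in> A" "v \<in> fib (E (Suc i)) x" for i x v
    using dd that A_subset by blast
  have AC: "A \<subseteq> topspace (ctop M)" using A_subset tsM by simp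
  have zmem: "(\<lambda>k. 0) \<in> fib (E i) x" if "x \<in> A" for i x
    using Z.vbundle_zero_mem[OF E] that A_subset by blast
  \<comment> \<open>The projection \<open>v - \<sigma> (d v)\<close> onto the kernel; in degree 0
    the kernel is everything.\<close>
  define \<rho> where "\<rho> i x v = (case i of 0 \<Rightarrow> v | Suc j \<Rightarrow> (\<lambda>k. v k - \<sigma> j x (d (Suc j) x v) k))" for i x v
  have \<rho>0: "\<rho> 0 x v = v" and \<rho>Suc: "\<rho> (Suc j) x v = (\<lambda>k. v k - \<sigma> j x (d (Suc j) x v) k)" for j x v
    by (simp_all add: \<rho>_def)
  have \<sigma>d: "vb_map (openin (ctop M)) (cont_fn (ctop M)) A (E (Suc j)) (E (Suc j)) (\<lambda>x v. \<sigma> j x (d (Suc j) x v))" for j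
    by (rule vb_map_comp[OF dtop \<sigma>map])
  have \<rho>map: "vb_map (openin (ctop M)) (cont_fn (ctop M)) A (E i) (E i) (\<rho> i)" for i
  proof (cases i)
    case 0
    then show ?thesis using C.vb_map_id[of A "E 0"] by (simp add: \<rho>_def[abs_def])
  next
    case (Suc j)
    show ?thesis
      unfolding Suc using C.vb_map_lin2[OF top_E top_E A_open AC C.vb_map_id \<sigma>d[of j], of 1 "-1"]
      by (simp add: \<rho>_def[abs_def])
  qed
  have d\<rho>: "d i x (\<rho> i x v) = (\<lambda>k. 0)" if x: "x \<in> A" and v: "v \<in> fib (E i) x" for i x v
  proof (cases i)
    case 0
    then show ?thesis by (simp add: d0)
  next
    case (Suc j)
    have v': "v \<in> fib (E (Suc j)) x" using v Suc by simp
    have dv: "d (Suc j) x v \<in> fib (E j) x" by (rule vb_mapD(1)[OF dtop x v'])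
    show ?thesis
      unfolding Suc \<rho>Suc vb_map_diff[OF dtop x v' vb_mapD(1)[OF \<sigma>d x v']]
      using d\<sigma>[OF x dv ddA[OF x v']] by simp
  qed
  have \<rho>id: "\<rho> i x v = v" if x: "x \<in> A" and v: "v \<in> fib (E i) x" and dv: "d i x v = (\<lambda>k. 0)" for i x v
    using vb_map_zero[OF \<sigma>map x zmem[OF x]] dv by (cases i) (auto simp: \<rho>0 \<rho>Suc)
  have split: "splittings M A E d \<rho>"
    unfolding splittings_def using \<rho>map d\<rho> \<rho>id by blast
  text \<open>The two components of \<open>\<beta>\<close> and of its inverse are given by the same formula, an involution on
    the sum of all \<open>E i\<close> that exchanges the parities.\<close>
  define h where "h k x v = (case k of 0 \<Rightarrow> (\<lambda>l. 0) | Suc j \<Rightarrow> \<sigma> j x (\<rho> j x (component j v)))" for k x and v :: "nat \<times> nat \<Rightarrow> complex"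
  have h0: "h 0 x v = (\<lambda>l. 0)" and hSuc: "h (Suc j) x v = \<sigma> j x (\<rho> j x (component j v))" for j x v
    by (simp_all add: h_def)
  define \<tau> where "\<tau> x v = (\<lambda>(k, l). h k x v l + d (Suc k) x (component (Suc k) v) l)"
    for x and v :: "nat \<times> nat \<Rightarrow> complex"
  have comp\<tau>: "component k (\<tau> x v) = (\<lambda>l. h k x v l + d (Suc k) x (component (Suc k) v) l)" for k x v
    by (simp add: component_def \<tau>_def)
  have hfib: "h k x v \<in> fib (E k) x" if "x \<in> A" "\<And>k. component k v \<in> fib (E k) x" for k x v
    using vb_mapD(1)[OF \<sigma>map that(1) vb_mapD(1)[OF \<rho>map that]] zmem[OF that(1)]
    by (cases k) (auto simp: h0 hSuc)
  have dfib: "d (Suc k) x (component (Suc k) v) \<in> fib (E k) x" if "x \<in> A" "\<And>k. component k v \<in> fib (E k) x" for k x v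
    by (rule vb_mapD(1)[OF dtop that])
  have addfib: "(\<lambda>l. v l + w l) \<in> fib (E k) x" if "x \<in> A" "v \<in> fib (E k) x" "w \<in> fib (E k) x" for k x v w
    using Z.vbundle_lin_mem[OF E _ that(2,3), of 1 1] that(1) A_subset by auto
  have \<tau>fib: "component k (\<tau> x v) \<in> fib (E k) x" if "x \<in> A" "\<And>k. component k v \<in> fib (E k) x" for k x v
    unfolding comp\<tau> by (intro addfib hfib dfib that)
  have dh: "d k x (h k x v) = (case k of 0 \<Rightarrow> (\<lambda>l. 0) | Suc j \<Rightarrow> \<rho> j x (component j v))"
    if "x \<in> A" "\<And>k. component k v \<in> fib (E k) x" for k x v
    using d\<sigma>[OF that(1) vb_mapD(1)[OF \<rho>map that] d\<rho>[OF that]] by (cases k) (auto simp: d0 hSuc)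
  \<comment> \<open>This and \<open>\<rho>\<tau>\<close> contain the two equations of
    \<open>even_odd_iso\<close>. They exchange the two summands of each \<open>E i\<close>, so
    applying \<open>\<tau>\<close> twice recovers every component.\<close>
  have d\<tau>: "d (Suc k) x (component (Suc k) (\<tau> x v)) = \<rho> k x (component k v)"
    if x: "x \<in> A" and v: "\<And>k. component k v \<in> fib (E k) x" for k x v
    unfolding comp\<tau> vb_map_add[OF dtop x hfib[OF x v] dfib[OF x v]] dh[OF x v] ddA[OF x v] by simp
  have \<rho>\<tau>: "\<rho> k x (component k (\<tau> x v)) = d (Suc k) x (component (Suc k) v)"
    if x: "x \<in> A" and v: "\<And>k. component k v \<in> fib (E k) x" for k x v
  proof (cases k)
    case 0
    then show ?thesis by (simp add: \<rho>0 comp\<tau> h0)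
  next
    case (Suc j)
    have "\<rho> (Suc j) x (component (Suc j) (\<tau> x v)) =
        (\<lambda>l. component (Suc j) (\<tau> x v) l - \<sigma> j x (\<rho> j x (component j v)) l)"
      unfolding \<rho>Suc d\<tau>[OF x v] ..
    then show ?thesis unfolding Suc comp\<tau> hSuc by simp
  qed
  have \<sigma>d\<rho>: "(\<lambda>l. \<sigma> j x (d (Suc j) x v) l + \<rho> (Suc j) x v l) = v" for j x v
    by (simp add: \<rho>Suc)
  have \<tau>\<tau>: "\<tau> x (\<tau> x v) = v" if x: "x \<in> A" and v: "\<And>k. component k v \<in> fib (E k) x" for x v
  proof -
    have "component k (\<tau> x (\<tau> x v)) = component k v" for k
    proof (cases k)
      case 0
      then show ?thesis unfolding comp\<tau>[of _ _ "\<tau> x v"] d\<tau>[OF x v] by (simp add: h0 \<rho>0)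
    next
      case (Suc j)
      show ?thesis
        unfolding Suc comp\<tau>[of _ _ "\<tau> x v"] d\<tau>[OF x v] hSuc \<rho>\<tau>[OF x v] by (rule \<sigma>d\<rho>)
    qed
    then show ?thesis
      by (metis (no_types, lifting) component_def ext surj_pair)
  qed
  have even_fib: "component k v \<in> fib (E k) x" if "x \<in> A" "v \<in> fib (E_even M E) x" for k x v
    using that(2)[unfolded E_even_def C.fib_vb_sum mem_Collect_eq, rule_format, of k] zmem[OF that(1)]
    by (cases "even k") auto
  have odd_fib: "component k v \<in> fib (E k) x" if "x \<in> A" "v \<in> fib (E_odd M E) x" for k x v
    using that(2)[unfolded E_odd_def C.fib_vb_sum mem_Collect_eq, rule_format, of k] zmem[OF that(1)]
    by (cases "odd k") auto
  have \<rho>z: "\<rho> j x (\<lambda>l. 0) = (\<lambda>l. 0)" and \<sigma>z: "\<sigma> j x (\<lambda>l. 0) = (\<lambda>l. 0)" and dz: "d (Suc j) x (\<lambda>l. 0) = (\<lambda>l. 0)"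
    if "x \<in> A" for j x
    using vb_map_zero[OF \<rho>map that zmem[OF that]] vb_map_zero[OF \<sigma>map that zmem[OF that]]
      vb_map_zero[OF dtop that zmem[OF that]] by blast+
  have to_odd: "\<tau> x v \<in> fib (E_odd M E) x" if x: "x \<in> A" and v: "v \<in> fib (E_even M E) x" for x v
    unfolding E_odd_def C.fib_vb_sum mem_Collect_eq
  proof
    fix k
    have z: "component j v = (\<lambda>l. 0)" if "odd j" for j
      using v[unfolded E_even_def C.fib_vb_sum mem_Collect_eq, rule_format, of j] that by simp
    have "component k (\<tau> x v) = (\<lambda>l. 0)" if "even k"
      using that z \<rho>z[OF x] \<sigma>z[OF x] dz[OF x] unfolding comp\<tau> by (cases k) (auto simp: h0 hSuc)
    then show "if odd k then component k (\<tau> x v) \<in> fib (E k) x else component k (\<tau> x v) = (\<lambda>k. 0)"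
      using \<tau>fib[OF x even_fib[OF x v]] by auto
  qed
  have to_even: "\<tau> x v \<in> fib (E_even M E) x" if x: "x \<in> A" and v: "v \<in> fib (E_odd M E) x" for x v
    unfolding E_even_def C.fib_vb_sum mem_Collect_eq
  proof
    fix k
    have z: "component j v = (\<lambda>l. 0)" if "even j" for j
      using v[unfolded E_odd_def C.fib_vb_sum mem_Collect_eq, rule_format, of j] that by simp
    have "component k (\<tau> x v) = (\<lambda>l. 0)" if "odd k"
      using that z \<rho>z[OF x] \<sigma>z[OF x] dz[OF x] unfolding comp\<tau> by (cases k) (auto simp: h0 hSuc)
    then show "if even k then component k (\<tau> x v) \<in> fib (E k) x else component k (\<tau> x v) = (\<lambda>k. 0)"
      using \<tau>fib[OF x odd_fib[OF x v]] by auto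
  qed
  have bij: "bij_betw (\<tau> x) (fib (E_even M E) x) (fib (E_odd M E) x)" if x: "x \<in> A" for x
    by (rule bij_betw_byWitness[where f' = "\<tau> x"])
      (use \<tau>\<tau>[OF x] even_fib[OF x] odd_fib[OF x] to_odd[OF x] to_even[OF x] in auto)
  have iso: "even_odd_iso M A E d \<rho> \<tau>"
    unfolding even_odd_iso_def
    using to_odd d\<tau>[OF _ even_fib] \<rho>\<tau>[OF _ even_fib] by simp
  have lin: "\<tau> x (\<lambda>k. a * v k + b * w k) = (\<lambda>k. a * \<tau> x v k + b * \<tau> x w k)"
    if x: "x \<in> A" and v: "\<And>k. component k v \<in> fib (E k) x" and w: "\<And>k. component k w \<in> fib (E k) x" for x v w a b
  proof -
    have c: "component k (\<lambda>p. a * v p + b * w p) = (\<lambda>l. a * component k v l + b * component k w l)" for k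
      by (simp add: component_def)
    have "h k x (\<lambda>p. a * v p + b * w p) = (\<lambda>l. a * h k x v l + b * h k x w l)" for k
      using vb_mapD(2)[OF vb_map_comp[OF \<rho>map \<sigma>map] x v w] by (cases k) (auto simp: h0 hSuc c)
    moreover have "d (Suc k) x (component (Suc k) (\<lambda>p. a * v p + b * w p)) =
        (\<lambda>l. a * d (Suc k) x (component (Suc k) v) l + b * d (Suc k) x (component (Suc k) w) l)" for k
      unfolding c by (rule vb_mapD(2)[OF dtop x v w])
    ultimately show ?thesis
      by (auto simp: \<tau>_def fun_eq_iff algebra_simps)
  qed
  have "vb_map (openin (ctop M)) (cont_fn (ctop M)) A (E_even M E) (E_odd M E) \<tau>"
    unfolding vb_map_def
  proof (intro conjI ballI allI impI Pi_I)
    show "\<tau> x v \<in> fib (E_odd M E) x" if "x \<in> A" "v \<in> fib (E_even M E) x" for x v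
      by (rule to_odd[OF that])
    show "\<tau> x (\<lambda>k. a * v k + b * w k) = (\<lambda>k. a * \<tau> x v k + b * \<tau> x w k)"
      if x: "x \<in> A" and "v \<in> fib (E_even M E) x" "w \<in> fib (E_even M E) x" for x v w a b
      by (rule lin[OF x even_fib[OF x that(2)] even_fib[OF x that(3)]])
    fix U s assume U: "openin (ctop M) U \<and> U \<subseteq> A \<and> vb_section (cont_fn (ctop M)) (E_even M E) U s"
    then have opU: "openin (ctop M) U" and UA: "U \<subseteq> A" and s: "vb_section (cont_fn (ctop M)) (E_even M E) U s"
      by blast+
    have sfib: "s x \<in> fib (E_even M E) x" if "x \<in> U" for x by (rule C.vb_section_fib[OF s that])
    have zsec: "vb_section (cont_fn (ctop M)) (E k) U (\<lambda>x l. 0)" for k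
      using C.vb_section_vcomb[OF top_E opU openin_subset[OF opU], of 0 k] by simp
    have cs: "vb_section (cont_fn (ctop M)) (E k) U (\<lambda>x. component k (s x))" for k
    proof (cases "even k")
      case True
      then show ?thesis
        by (intro C.vb_section_component[OF openin_topspace top_E finN[of "{i. even i}"] _ zero sub opU s[unfolded E_even_def]]) auto
    next
      case False
      then have "component k (s x) = (\<lambda>l. 0)" if "x \<in> U" for x
        using sfib[OF that, unfolded E_even_def C.fib_vb_sum mem_Collect_eq, rule_format, of k] by simp
      then show ?thesis by (intro C.vb_section_cong[OF zsec]) simp
    qed
    have hs: "vb_section (cont_fn (ctop M)) (E k) U (\<lambda>x. h k x (s x))" for k
    proof (cases k)
      case 0
      then show ?thesis using zsec by (simp add: h0)
    next
      case (Suc j)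
      show ?thesis
        unfolding Suc hSuc
        by (rule vb_mapD(3)[OF vb_map_comp[OF \<rho>map \<sigma>map] opU UA cs])
    qed
    have ds: "vb_section (cont_fn (ctop M)) (E k) U (\<lambda>x. d (Suc k) x (component (Suc k) (s x)))" for k
      by (rule vb_mapD(3)[OF dtop opU UA cs])
    have \<tau>s: "vb_section (cont_fn (ctop M)) (E k) U (\<lambda>x. component k (\<tau> x (s x)))" for k
    proof -
      have "vb_section (cont_fn (ctop M)) (E k) U (\<lambda>x. vcomb 2 (\<lambda>j. 1)
          (\<lambda>j. (if j = 0 then (\<lambda>x. h k x (s x)) else (\<lambda>x. d (Suc k) x (component (Suc k) (s x)))) x))"
        by (rule C.vb_section_vcomb[OF top_E opU openin_subset[OF opU]]) (use hs ds C.fn_const[OF opU] in auto)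
      then show ?thesis
        unfolding comp\<tau> by (simp add: vcomb_def numeral_2_eq_2)
    qed
    have "vb_section (cont_fn (ctop M)) (vb_sum (openin (ctop M)) (cont_fn (ctop M)) {i. odd i} E) U (\<lambda>x. \<tau> x (s x))"
      by (rule C.vb_sum_sectionI[OF openin_topspace top_E finN[of "{i. odd i}"] _ zero sub opU _ \<tau>s])
        (use to_odd[OF _ sfib] UA in \<open>auto simp: E_odd_def\<close>)
    then show "vb_section (cont_fn (ctop M)) (E_odd M E) U (\<lambda>x. \<tau> x (s x))" by (simp add: E_odd_def)
  qed
  then show "\<exists>\<rho> \<beta>. splittings M A E d \<rho> \<and> even_odd_iso M A E d \<rho> \<beta> \<and>
     vb_map (openin (ctop M)) (cont_fn (ctop M)) A (E_even M E) (E_odd M E) \<beta> \<and>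
     (\<forall>x\<in>A. bij_betw (\<beta> x) (fib (E_even M E) x) (fib (E_odd M E) x))"
    using split iso bij by blast
qed

end

section \<open>Rational chains\<close>

lemma lookup_scale: "Poly_Mapping.lookup (Poly_Mapping.map ((*) r) c) s = r * Poly_Mapping.lookup (c :: 'a \<Rightarrow>\<^sub>0 rat) s"
  by (simp add: Poly_Mapping.map.rep_eq when_def)

lemma scale_one [simp]: "Poly_Mapping.map ((*) 1) c = (c :: 'a \<Rightarrow>\<^sub>0 rat)"
  by (rule poly_mapping_eqI) (simp add: lookup_scale)

lemma scale_single [simp]: "Poly_Mapping.map ((*) r) (Poly_Mapping.single s q) = Poly_Mapping.single s (r * q :: rat)"
  by (rule poly_mapping_eqI) (simp add: lookup_scale lookup_single when_def)

lemma scale_zero [simp]: "Poly_Mapping.map ((*) r) 0 = (0 :: 'a \<Rightarrow>\<^sub>0 rat)"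
  by (rule poly_mapping_eqI) (simp add: lookup_scale)

lemma scale_sum: "Poly_Mapping.map ((*) r) (\<Sum>i\<in>I. c i) = (\<Sum>i\<in>I. Poly_Mapping.map ((*) r) (c i :: 'a \<Rightarrow>\<^sub>0 rat))"
  by (rule poly_mapping_eqI) (simp add: lookup_scale lookup_sum sum_distrib_left)

lemma lookup_qextend_superset:
  assumes "finite S" "Poly_Mapping.keys c \<subseteq> S"
  shows "Poly_Mapping.lookup (qextend g c) t = (\<Sum>s\<in>S. Poly_Mapping.lookup c s * Poly_Mapping.lookup (g s) t)"
  unfolding qextend_def lookup_sum lookup_scale
  using assms by (intro sum.mono_neutral_left) (auto simp: in_keys_iff)

lemma lookup_qextend:
  "Poly_Mapping.lookup (qextend g c) t = (\<Sum>s\<in>Poly_Mapping.keys c. Poly_Mapping.lookup c s * Poly_Mapping.lookup (g s) t)"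
  by (rule lookup_qextend_superset) auto

lemma qextend_zero [simp]: "qextend g 0 = 0"
  by (simp add: qextend_def)

lemma qextend_add: "qextend g (a + b) = qextend g a + qextend g b"
proof (rule poly_mapping_eqI)
  fix t
  let ?S = "Poly_Mapping.keys a \<union> Poly_Mapping.keys b"
  have "Poly_Mapping.keys (a + b) \<subseteq> ?S" by (rule Poly_Mapping.keys_add)
  then show "Poly_Mapping.lookup (qextend g (a + b)) t = Poly_Mapping.lookup (qextend g a + qextend g b) t"
    by (simp add: lookup_add lookup_qextend_superset[of ?S] sum.distrib algebra_simps)
qed

lemma qextend_diff: "qextend g (a - b) = qextend g a - qextend g b"
  using qextend_add[of g "a - b" b] by (simp add: algebra_simps)

lemma qextend_sum: "qextend g (\<Sum>i\<in>I. c i) = (\<Sum>i\<in>I. qextend g (c i))"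
  by (induction I rule: infinite_finite_induct) (simp_all add: qextend_add)

lemma qextend_scale: "qextend g (Poly_Mapping.map ((*) r) c) = Poly_Mapping.map ((*) r) (qextend g c)"
proof (rule poly_mapping_eqI)
  fix t
  have "Poly_Mapping.keys (Poly_Mapping.map ((*) r) c) \<subseteq> Poly_Mapping.keys c"
    by (auto simp: in_keys_iff lookup_scale)
  then show "Poly_Mapping.lookup (qextend g (Poly_Mapping.map ((*) r) c)) t =
      Poly_Mapping.lookup (Poly_Mapping.map ((*) r) (qextend g c)) t"
    by (simp add: lookup_scale lookup_qextend_superset[of "Poly_Mapping.keys c"] sum_distrib_left mult.assoc)
qed

lemma qextend_single: "qextend g (Poly_Mapping.single s r) = Poly_Mapping.map ((*) r) (g s)"
  by (rule poly_mapping_eqI) (simp add: lookup_scale lookup_qextend_superset[of "{s}"])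

text \<open>Allows identities between linear operators on chains to be checked on single
  simplices.\<close>

lemma qextend_qextend: "qextend f (qextend g c) = qextend (\<lambda>s. qextend f (g s)) c"
  unfolding qextend_def[of g] qextend_def[of "\<lambda>s. qextend f (g s)"] by (simp add: qextend_sum qextend_scale)

lemma qextend_cong: "(\<And>s. s \<in> Poly_Mapping.keys c \<Longrightarrow> f s = g s) \<Longrightarrow> qextend f c = qextend g c"
  by (simp add: qextend_def)

lemma qextend_fun_add: "qextend (\<lambda>s. f s + g s) c = qextend f c + qextend g c"
  by (rule poly_mapping_eqI) (simp add: lookup_qextend lookup_add sum.distrib algebra_simps)

lemma qextend_fun_diff: "qextend (\<lambda>s. f s - g s) c = qextend f c - qextend g c"
  by (rule poly_mapping_eqI) (simp add: lookup_qextend lookup_minus sum_subtractf algebra_simps)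

lemma qextend_fun_zero [simp]: "qextend (\<lambda>s. 0) c = 0"
  by (rule poly_mapping_eqI) (simp add: lookup_qextend)

lemma qextend_id: "qextend (\<lambda>s. Poly_Mapping.single s 1) c = c"
proof (rule poly_mapping_eqI)
  fix t
  have "Poly_Mapping.lookup (qextend (\<lambda>s. Poly_Mapping.single s 1) c) t =
      (\<Sum>s\<in>Poly_Mapping.keys c. if s = t then Poly_Mapping.lookup c s else 0)"
    unfolding lookup_qextend lookup_single when_def by (intro sum.cong) auto
  then show "Poly_Mapping.lookup (qextend (\<lambda>s. Poly_Mapping.single s 1) c) t = Poly_Mapping.lookup c t"
    by (simp add: in_keys_iff)
qed

lemma keys_qextend: "Poly_Mapping.keys (qextend g c) \<subseteq> (\<Union>s\<in>Poly_Mapping.keys c. Poly_Mapping.keys (g s))"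
proof
  fix t assume t: "t \<in> Poly_Mapping.keys (qextend g c)"
  show "t \<in> (\<Union>s\<in>Poly_Mapping.keys c. Poly_Mapping.keys (g s))"
  proof (rule ccontr)
    assume "t \<notin> (\<Union>s\<in>Poly_Mapping.keys c. Poly_Mapping.keys (g s))"
    then have "Poly_Mapping.lookup (qextend g c) t = 0"
      unfolding lookup_qextend by (intro sum.neutral) (auto simp: in_keys_iff)
    then show False using t by (simp add: in_keys_iff)
  qed
qed

section \<open>Chains in subspaces and the boundary operator\<close>

lemma qchains_zero [simp]: "0 \<in> qchains X"
  by (simp add: qchains_def)

lemma qchains_add: "a \<in> qchains X \<Longrightarrow> b \<in> qchains X \<Longrightarrow> a + b \<in> qchains X"
  using Poly_Mapping.keys_add[of a b] by (auto simp: qchains_def)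

lemma qchains_diff: "a \<in> qchains X \<Longrightarrow> b \<in> qchains X \<Longrightarrow> a - b \<in> qchains X"
  using keys_diff[of a b] by (auto simp: qchains_def)

lemma qchains_sum: "(\<And>i. i \<in> I \<Longrightarrow> c i \<in> qchains X) \<Longrightarrow> (\<Sum>i\<in>I. c i) \<in> qchains X"
  by (induction I rule: infinite_finite_induct) (auto intro: qchains_add)

lemma qchains_single: "s \<in> simplices X \<Longrightarrow> Poly_Mapping.single s r \<in> qchains X"
  by (simp add: qchains_def)

lemma qchains_qextend:
  assumes "c \<in> qchains X" "\<And>s. s \<in> simplices X \<Longrightarrow> g s \<in> qchains Y"
  shows "qextend g c \<in> qchains Y"
  using keys_qextend[of g c] assms unfolding qchains_def by blast

lemma qchains_subtopology: "qchains (subtopology X S) \<subseteq> qchains X"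
  using simplices_subtopology_subset[of X S] unfolding qchains_def by blast

lemma qchains_subtopology_mono: "S \<subseteq> S' \<Longrightarrow> qchains (subtopology X S) \<subseteq> qchains (subtopology X S')"
  using simplices_subtopology_mono[of S S' X] unfolding qchains_def by blast

lemma qchains_subtopology_Int:
  assumes "c \<in> qchains (subtopology X S)" "c \<in> qchains (subtopology X S')"
  shows "c \<in> qchains (subtopology X (S \<inter> S'))"
proof -
  have "simplices (subtopology X S) \<inter> simplices (subtopology X S') \<subseteq> simplices (subtopology X (S \<inter> S'))"
  proof
    fix s assume s: "s \<in> simplices (subtopology X S) \<inter> simplices (subtopology X S')"
    obtain p f where "s = (p, f)" by (cases s)
    then show "s \<in> simplices (subtopology X (S \<inter> S'))" using s by (auto simp: simplices_subtopology)
  qed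
  then show ?thesis using assms unfolding qchains_def by blast
qed

lemma bdry_add: "bdry (a + b) = bdry a + bdry b" and bdry_diff: "bdry (a - b) = bdry a - bdry b"
  and bdry_zero [simp]: "bdry 0 = 0"
  by (simp_all add: bdry_def qextend_add qextend_diff)

lemma bdry_single:
  "bdry (Poly_Mapping.single (p, f) r) =
     (if p = 0 then 0 else \<Sum>k\<le>p. Poly_Mapping.single (p - 1, singular_face p k f) ((-1) ^ k * r))"
  by (simp add: bdry_def qextend_single scale_sum mult.commute)

lemma bdry_qchains: "c \<in> qchains X \<Longrightarrow> bdry c \<in> qchains X"
  unfolding bdry_def
proof (erule qchains_qextend)
  fix s assume "s \<in> simplices X"
  then obtain p f where s: "s = (p, f)" "singular_simplex p X f" by (auto simp: simplices_def)
  have "Poly_Mapping.single (p - 1, singular_face p k f) ((-1) ^ k) \<in> qchains X" if "p \<noteq> 0" "k \<le> p" for k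
    using singular_simplex_singular_face[OF s(2), of k] that by (intro qchains_single) (auto simp: simplices_def)
  then show "(case s of (p, f) \<Rightarrow> if p = 0 then 0 else \<Sum>k\<le>p. Poly_Mapping.single (p - 1, singular_face p k f) ((-1) ^ k)) \<in> qchains X"
    unfolding s(1) by (auto intro: qchains_sum)
qed

text \<open>The passage from integral chains of a fixed dimension to rational chains of mixed
  dimension. Facts on boundaries and subdivision are transferred through it.\<close>

definition rat_chain :: "nat \<Rightarrow> 'b chain \<Rightarrow> 'b qchain" where
  "rat_chain p c = (\<Sum>f\<in>Poly_Mapping.keys c. Poly_Mapping.single (p, f) (of_int (Poly_Mapping.lookup c f)))"

lemma lookup_rat_chain:
  "Poly_Mapping.lookup (rat_chain p c) (q, f) = (if q = p then of_int (Poly_Mapping.lookup c f) else 0)"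
proof -
  have "Poly_Mapping.lookup (rat_chain p c) (q, f) =
      (\<Sum>g\<in>Poly_Mapping.keys c. if g = f then (if q = p then of_int (Poly_Mapping.lookup c f) else 0) else 0)"
    unfolding rat_chain_def lookup_sum lookup_single when_def by (intro sum.cong) auto
  then show ?thesis by (auto simp: in_keys_iff)
qed

lemma rat_chain_eqI: "(\<And>q f. Poly_Mapping.lookup a (q, f) = Poly_Mapping.lookup b (q, f)) \<Longrightarrow> a = b"
  by (rule poly_mapping_eqI) (metis surj_pair)

lemma rat_chain_diff: "rat_chain p (a - b) = rat_chain p a - rat_chain p b"
  by (rule rat_chain_eqI) (simp add: lookup_rat_chain lookup_minus)

lemma rat_chain_add: "rat_chain p (a + b) = rat_chain p a + rat_chain p b"
  by (rule rat_chain_eqI) (simp add: lookup_rat_chain lookup_add)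

lemma rat_chain_zero [simp]: "rat_chain p 0 = 0"
  by (simp add: rat_chain_def)

lemma rat_chain_sum: "rat_chain p (\<Sum>i\<in>I. c i) = (\<Sum>i\<in>I. rat_chain p (c i))"
  by (induction I rule: infinite_finite_induct) (simp_all add: rat_chain_add)

lemma rat_chain_cmul_of: "rat_chain p (frag_cmul k (frag_of f)) = Poly_Mapping.single (p, f) (of_int k)"
  by (rule rat_chain_eqI) (auto simp: lookup_rat_chain lookup_single when_def)

lemma rat_chain_of: "rat_chain p (frag_of f) = Poly_Mapping.single (p, f) 1"
  using rat_chain_cmul_of[of p 1 f] by simp

lemma rat_chain_qchains: "singular_chain p X c \<Longrightarrow> rat_chain p c \<in> qchains X"
  unfolding rat_chain_def
  by (intro qchains_sum qchains_single) (auto simp: simplices_def singular_chain_def)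

lemma keys_rat_chain: "s \<in> Poly_Mapping.keys (rat_chain p c) \<Longrightarrow> \<exists>f. s = (p, f) \<and> f \<in> Poly_Mapping.keys c"
  by (cases s) (auto simp: in_keys_iff lookup_rat_chain split: if_splits)

text \<open>An additive operator on integral chains is determined by its values on simplices, so
  extending these linearly defines its rational version.\<close>

lemma rat_chain_qextend:
  assumes "T p 0 = 0" "\<And>a b. T p (a - b) = T p a - T p b"
  shows "qextend (\<lambda>(p, f). rat_chain (n p) (T p (frag_of f))) (rat_chain p c) = rat_chain (n p) (T p c)"
proof -
  have "Poly_Mapping.keys c \<subseteq> UNIV" by simp
  then show ?thesis
  proof (induction c rule: frag_induction)
    case zero
    then show ?case using assms(1) by simp
  next
    case (one x)
    then show ?case by (simp add: rat_chain_of qextend_single)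
  next
    case (diff a b)
    then show ?case by (simp add: rat_chain_diff qextend_diff assms(2))
  qed
qed

lemma bdry_rat_chain: "bdry (rat_chain p c) = rat_chain (p - Suc 0) (chain_boundary p c)"
proof -
  have "Poly_Mapping.keys c \<subseteq> UNIV" by simp
  then show ?thesis
  proof (induction c rule: frag_induction)
    case (one f)
    show ?case
      by (simp add: rat_chain_of bdry_single chain_boundary_of rat_chain_sum rat_chain_cmul_of)
  qed (simp_all add: rat_chain_diff bdry_diff chain_boundary_diff)
qed

lemma bdry_bdry:
  assumes "c \<in> qchains X"
  shows "bdry (bdry c) = 0"
proof -
  have "bdry (bdry c) = qextend (\<lambda>s. bdry (bdry (Poly_Mapping.single s 1))) c"
    unfolding bdry_def qextend_qextend by (rule qextend_cong) (simp add: qextend_single)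
  also have "\<dots> = qextend (\<lambda>s. 0) c"
  proof (rule qextend_cong)
    fix s assume "s \<in> Poly_Mapping.keys c"
    then have "s \<in> simplices X" using assms by (auto simp: qchains_def)
    then obtain p f where s: "s = (p, f)" "singular_simplex p X f" by (auto simp: simplices_def)
    have "chain_boundary (p - Suc 0) (chain_boundary p (frag_of f)) = 0"
      by (rule chain_boundary_boundary[of p X]) (simp add: s(2) singular_chain_of)
    then show "bdry (bdry (Poly_Mapping.single s 1)) = 0"
      unfolding s(1) rat_chain_of[symmetric] bdry_rat_chain by simp
  qed
  finally show ?thesis by simp
qed

lemma qchain_split:
  assumes "Poly_Mapping.keys c \<subseteq> simplices X \<union> simplices Y"
  obtains a b where "a \<in> qchains X" "b \<in> qchains Y" "c = a + b"
proof
  let ?a = "\<Sum>s\<in>Poly_Mapping.keys c \<inter> simplices X. Poly_Mapping.single s (Poly_Mapping.lookup c s)"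
  have l: "Poly_Mapping.lookup ?a t = (if t \<in> simplices X then Poly_Mapping.lookup c t else 0)" for t
  proof -
    have "Poly_Mapping.lookup ?a t = (\<Sum>s\<in>Poly_Mapping.keys c \<inter> simplices X. if s = t then Poly_Mapping.lookup c s else 0)"
      unfolding lookup_sum lookup_single when_def by (intro sum.cong) auto
    then show ?thesis by (simp add: in_keys_iff)
  qed
  show "?a \<in> qchains X" by (intro qchains_sum qchains_single) auto
  show "c - ?a \<in> qchains Y"
    unfolding qchains_def
  proof (intro CollectI subsetI)
    fix t assume "t \<in> Poly_Mapping.keys (c - ?a)"
    then have ne: "Poly_Mapping.lookup c t - (if t \<in> simplices X then Poly_Mapping.lookup c t else 0) \<noteq> 0"
      unfolding in_keys_iff lookup_minus l by simp
    have tX: "t \<notin> simplices X"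
    proof
      assume "t \<in> simplices X"
      then show False using ne by simp
    qed
    then have "t \<in> Poly_Mapping.keys c" using ne by (simp add: in_keys_iff)
    then show "t \<in> simplices Y" using assms tX by blast
  qed
  show "c = ?a + (c - ?a)" by simp
qed

section \<open>Subdivision and excision\<close>

lemma singular_chain_iterated_subdivision:
  "singular_chain p X c \<Longrightarrow> singular_chain p X ((singular_subdivision p ^^ n) c)"
  by (induction n) (auto intro: singular_chain_singular_subdivision)

text \<open>\<open>sd\<close> is an iterated barycentric subdivision and \<open>h\<close> its
  homotopy to the identity. Only \<open>c0\<close> is promised to become small, but both operators
  act on all chains and preserve every subspace, which is what excision uses.\<close>

lemma qchain_subdivision:
  assumes W: "openin X W" and N: "openin X N" and WN: "topspace X \<subseteq> W \<union> N" and c0: "c0 \<in> qchains X"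
  obtains sd h :: "'b qchain \<Rightarrow> 'b qchain" where
    "\<forall>a b. sd (a + b) = sd a + sd b" "\<forall>a b. h (a + b) = h a + h b"
    "\<forall>S c. c \<in> qchains (subtopology X S) \<longrightarrow> sd c \<in> qchains (subtopology X S) \<and> h c \<in> qchains (subtopology X S)"
    "\<forall>c\<in>qchains X. bdry (h c) + h (bdry c) = sd c - c"
    "\<exists>a\<in>qchains (subtopology X W). \<exists>b\<in>qchains (subtopology X N). sd c0 = a + b"
proof -
  have "\<forall>s\<in>Poly_Mapping.keys c0. \<exists>n. \<forall>m g. n \<le> m \<longrightarrow>
      g \<in> Poly_Mapping.keys ((singular_subdivision (fst s) ^^ m) (frag_of (snd s))) \<longrightarrow>
      (\<exists>V\<in>{W, N}. g ` standard_simplex (fst s) \<subseteq> V)"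
  proof
    fix s assume "s \<in> Poly_Mapping.keys c0"
    then have "s \<in> simplices X" using c0 by (auto simp: qchains_def)
    then have s: "singular_chain (fst s) X (frag_of (snd s))" by (auto simp: simplices_def singular_chain_of)
    obtain n where n: "\<And>m f. \<lbrakk>n \<le> m; f \<in> Poly_Mapping.keys ((singular_subdivision (fst s) ^^ m) (frag_of (snd s)))\<rbrakk>
        \<Longrightarrow> \<exists>V\<in>{W, N}. f \<in> standard_simplex (fst s) \<rightarrow> V"
      by (rule sufficient_iterated_singular_subdivision_exists[of "{W, N}" X "fst s" "frag_of (snd s)"])
        (use W N WN s in auto)
    then show "\<exists>n. \<forall>m g. n \<le> m \<longrightarrow>
        g \<in> Poly_Mapping.keys ((singular_subdivision (fst s) ^^ m) (frag_of (snd s))) \<longrightarrow>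
        (\<exists>V\<in>{W, N}. g ` standard_simplex (fst s) \<subseteq> V)"
    proof (intro exI[of _ n] allI impI)
      fix m g assume "n \<le> m" "g \<in> Poly_Mapping.keys ((singular_subdivision (fst s) ^^ m) (frag_of (snd s)))"
      from n[OF this] obtain V where "V \<in> {W, N}" "g \<in> standard_simplex (fst s) \<rightarrow> V" by (rule bexE)
      then show "\<exists>V\<in>{W, N}. g ` standard_simplex (fst s) \<subseteq> V" by (intro bexI[of _ V] image_subsetI) (erule Pi_mem, assumption+)
    qed
  qed
  then obtain n where n: "\<forall>s\<in>Poly_Mapping.keys c0. \<forall>m g. n s \<le> m \<longrightarrow>
      g \<in> Poly_Mapping.keys ((singular_subdivision (fst s) ^^ m) (frag_of (snd s))) \<longrightarrow>
      (\<exists>V\<in>{W, N}. g ` standard_simplex (fst s) \<subseteq> V)"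
    by (rule bchoice[THEN exE])
  \<comment> \<open>The sum is a common bound for the numbers of subdivisions that the simplices of
    \<open>c0\<close> require.\<close>
  define m where "m = (\<Sum>s\<in>Poly_Mapping.keys c0. n s)"
  have nm: "n s \<le> m" if "s \<in> Poly_Mapping.keys c0" for s
    unfolding m_def using that by (intro member_le_sum) auto
  obtain h where h0: "\<And>p. h p 0 = (0 :: 'b chain)" and hd: "\<And>p c1 c2. h p (c1 - c2) = h p c1 - h p c2"
    and hc: "\<And>p X c. singular_chain p X c \<Longrightarrow> singular_chain (Suc p) X (h p c)"
    and hb: "\<And>p X c. singular_chain p X c \<Longrightarrow> chain_boundary (Suc p) (h p c) + h (p - Suc 0) (chain_boundary p c) =
        (singular_subdivision p ^^ m) c - c"
    by (rule chain_homotopic_iterated_singular_subdivision[of m]) blast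
  define sd :: "'b qchain \<Rightarrow> 'b qchain"
    where "sd = qextend (\<lambda>(p, f). rat_chain p ((singular_subdivision p ^^ m) (frag_of f)))"
  define H :: "'b qchain \<Rightarrow> 'b qchain" where "H = qextend (\<lambda>(p, f). rat_chain (Suc p) (h p (frag_of f)))"
  have H_rat: "H (rat_chain p c) = rat_chain (Suc p) (h p c)" for p c
    unfolding H_def by (rule rat_chain_qextend[of h p Suc, OF h0 hd])
  show thesis
  proof (rule that)
    show "\<forall>a b. sd (a + b) = sd a + sd b" "\<forall>a b. H (a + b) = H a + H b"
      by (simp_all add: sd_def H_def qextend_add)
    show "\<forall>S c. c \<in> qchains (subtopology X S) \<longrightarrow> sd c \<in> qchains (subtopology X S) \<and> H c \<in> qchains (subtopology X S)"
      unfolding sd_def H_def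
      by (auto intro!: qchains_qextend rat_chain_qchains singular_chain_iterated_subdivision hc
          simp: simplices_def singular_chain_of)
    show "\<forall>c\<in>qchains X. bdry (H c) + H (bdry c) = sd c - c"
    proof
      fix c assume c: "c \<in> qchains X"
      have "bdry (H c) + H (bdry c) =
          qextend (\<lambda>s. bdry (H (Poly_Mapping.single s 1)) + H (bdry (Poly_Mapping.single s 1))) c"
        unfolding bdry_def H_def qextend_qextend qextend_fun_add
        by (intro arg_cong2[where f = "(+)"] qextend_cong) (simp_all add: qextend_single)
      also have "\<dots> = qextend (\<lambda>s. sd (Poly_Mapping.single s 1) - Poly_Mapping.single s 1) c"
      proof (rule qextend_cong)
        fix s assume "s \<in> Poly_Mapping.keys c"
        then have "s \<in> simplices X" using c by (auto simp: qchains_def)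
        then obtain p f where s: "s = (p, f)" "singular_simplex p X f" by (auto simp: simplices_def)
        have ch: "singular_chain p X (frag_of f)" by (simp add: s(2) singular_chain_of)
        \<comment> \<open>\<open>H\<close> tags the result with dimension
          \<open>Suc (p - Suc 0)\<close>, which is not \<open>p\<close> for \<open>p = 0\<close>; in
          that case the boundary is zero anyway.\<close>
        have "H (bdry (rat_chain p (frag_of f))) = rat_chain p (h (p - Suc 0) (chain_boundary p (frag_of f)))"
        proof (cases "p = 0")
          case True
          then show ?thesis unfolding bdry_rat_chain H_rat by (simp add: chain_boundary_def h0)
        next
          case False
          then show ?thesis unfolding bdry_rat_chain H_rat by simp
        qed
        moreover have "bdry (H (rat_chain p (frag_of f))) = rat_chain p (chain_boundary (Suc p) (h p (frag_of f)))"
          unfolding H_rat bdry_rat_chain by simp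
        moreover have "sd (rat_chain p (frag_of f)) = rat_chain p ((singular_subdivision p ^^ m) (frag_of f))"
          by (simp add: sd_def rat_chain_of qextend_single)
        ultimately show "bdry (H (Poly_Mapping.single s 1)) + H (bdry (Poly_Mapping.single s 1)) =
            sd (Poly_Mapping.single s 1) - Poly_Mapping.single s 1"
          unfolding s(1) rat_chain_of[symmetric] using hb[OF ch]
          by (simp add: rat_chain_add[symmetric] rat_chain_diff[symmetric])
      qed
      also have "\<dots> = sd c - c"
        unfolding qextend_fun_diff qextend_id
        by (intro arg_cong2[where f = "(-)"] refl) (simp add: sd_def qextend_single)
      finally show "bdry (H c) + H (bdry c) = sd c - c" .
    qed
    have "Poly_Mapping.keys (sd c0) \<subseteq> simplices (subtopology X W) \<union> simplices (subtopology X N)"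
    proof
      fix t assume "t \<in> Poly_Mapping.keys (sd c0)"
      then obtain s where s: "s \<in> Poly_Mapping.keys c0"
        and t: "t \<in> Poly_Mapping.keys (case s of (p, f) \<Rightarrow> rat_chain p ((singular_subdivision p ^^ m) (frag_of f)))"
        using keys_qextend unfolding sd_def by blast
      obtain p f where pf: "s = (p, f)" by (cases s)
      obtain g where g: "t = (p, g)" "g \<in> Poly_Mapping.keys ((singular_subdivision p ^^ m) (frag_of f))"
        using keys_rat_chain[of t p] t unfolding pf by auto
      have "(p, f) \<in> simplices X" using s c0 unfolding pf by (auto simp: qchains_def)
      then have "singular_chain p X ((singular_subdivision p ^^ m) (frag_of f))"
        by (intro singular_chain_iterated_subdivision) (simp add: simplices_def singular_chain_of)
      then have "(p, g) \<in> simplices X" using g(2) by (auto simp: singular_chain_def simplices_def)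
      moreover have "\<exists>V\<in>{W, N}. g ` standard_simplex p \<subseteq> V"
        using n[rule_format, OF s nm[OF s], of g] g(2) unfolding pf by simp
      ultimately show "t \<in> simplices (subtopology X W) \<union> simplices (subtopology X N)"
        unfolding g(1) by (auto simp: simplices_subtopology)
    qed
    then obtain a b where "a \<in> qchains (subtopology X W)" "b \<in> qchains (subtopology X N)" "sd c0 = a + b"
      by (rule qchain_split)
    then show "\<exists>a\<in>qchains (subtopology X W). \<exists>b\<in>qchains (subtopology X N). sd c0 = a + b" by blast
  qed
qed

text \<open>Surjectivity of excision: after subdivision the part inside \<open>N\<close> is
  dropped.\<close>

lemma excision_exists:
  assumes W: "openin X W" and N: "openin X N" and WN: "topspace X \<subseteq> W \<union> N" and \<mu>: "cycle X \<mu>"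
  shows "\<exists>c\<in>qchains (subtopology X W). homologous X N c \<mu>"
proof -
  have \<mu>c: "\<mu> \<in> qchains X" and b\<mu>: "bdry \<mu> = 0" using \<mu> by (auto simp: cycle_def)
  obtain sd h :: "'a qchain \<Rightarrow> 'a qchain" where
    "\<forall>a b. sd (a + b) = sd a + sd b" and ha: "\<forall>a b. h (a + b) = h a + h b"
    and ch: "\<forall>S c. c \<in> qchains (subtopology X S) \<longrightarrow> sd c \<in> qchains (subtopology X S) \<and> h c \<in> qchains (subtopology X S)"
    and hb: "\<forall>c\<in>qchains X. bdry (h c) + h (bdry c) = sd c - c"
    and small: "\<exists>a\<in>qchains (subtopology X W). \<exists>b\<in>qchains (subtopology X N). sd \<mu> = a + b"
    by (rule qchain_subdivision[OF W N WN \<mu>c])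
  obtain a b where ab: "a \<in> qchains (subtopology X W)" "b \<in> qchains (subtopology X N)" "sd \<mu> = a + b"
    using small by blast
  have h0: "h 0 = 0" using ha[rule_format, of 0 0] by simp
  have "bdry (h \<mu>) = sd \<mu> - \<mu>" using hb \<mu>c b\<mu> h0 by fastforce
  then have "a - \<mu> = bdry (h \<mu>) + (0 - b)" unfolding ab(3) by simp
  moreover have "h \<mu> \<in> qchains X" using ch[rule_format, of \<mu> "topspace X"] \<mu>c by simp
  moreover have "0 - b \<in> qchains (subtopology X N)" using ab(2) by (intro qchains_diff) auto
  ultimately show ?thesis using ab(1) unfolding homologous_def by blast
qed

text \<open>Injectivity of excision: a bounding chain in \<open>X\<close> is subdivided into parts
  \<open>x\<close> in \<open>W\<close> and \<open>y\<close> in \<open>N\<close>. Only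
  \<open>x\<close> is kept, and the corrections land in \<open>W \<inter> N\<close>.\<close>

lemma excision_injective:
  assumes W: "openin X W" and N: "openin X N" and WN: "topspace X \<subseteq> W \<union> N"
    and e: "e \<in> qchains (subtopology X W)" "e = bdry b + a" and b: "b \<in> qchains X" and a: "a \<in> qchains (subtopology X N)"
  shows "\<exists>b'\<in>qchains (subtopology X W). \<exists>a'\<in>qchains (subtopology X (W \<inter> N)). e = bdry b' + a'"
proof -
  obtain sd h :: "'a qchain \<Rightarrow> 'a qchain" where
    sda: "\<forall>a b. sd (a + b) = sd a + sd b" and ha: "\<forall>a b. h (a + b) = h a + h b"
    and ch: "\<forall>S c. c \<in> qchains (subtopology X S) \<longrightarrow> sd c \<in> qchains (subtopology X S) \<and> h c \<in> qchains (subtopology X S)"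
    and hb: "\<forall>c\<in>qchains X. bdry (h c) + h (bdry c) = sd c - c"
    and small: "\<exists>x\<in>qchains (subtopology X W). \<exists>y\<in>qchains (subtopology X N). sd b = x + y"
    by (rule qchain_subdivision[OF W N WN b])
  obtain x y where xy: "x \<in> qchains (subtopology X W)" "y \<in> qchains (subtopology X N)" "sd b = x + y"
    using small by blast
  have h0: "h 0 = 0" using ha[rule_format, of 0 0] by simp
  have eX: "e \<in> qchains X" and aX: "a \<in> qchains X" using e(1) a qchains_subtopology by blast+
  have bbX: "bdry b \<in> qchains X" by (rule bdry_qchains[OF b])
  have hbX: "h (bdry b) \<in> qchains X" using ch[rule_format, of "bdry b" "topspace X"] bbX by simp
  have sd_bdry: "sd (bdry b) = bdry (sd b)"
  proof -
    have "sd (bdry b) = bdry b + bdry (h (bdry b))"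
      using hb[rule_format, OF bbX] bdry_bdry[OF b] h0 by (simp add: algebra_simps)
    moreover have "sd b = b + (bdry (h b) + h (bdry b))"
      using hb[rule_format, OF b] by (simp add: algebra_simps)
    moreover have "h b \<in> qchains X" using ch[rule_format, of b "topspace X"] b by simp
    ultimately show ?thesis by (simp add: bdry_add bdry_bdry)
  qed
  have be: "bdry e = bdry a" unfolding e(2) by (simp add: bdry_add bdry_bdry[OF b])
  \<comment> \<open>The boundary of \<open>e\<close> lies in \<open>W\<close> because
    \<open>e\<close> does, and in \<open>N\<close> because it equals that of
    \<open>a\<close>.\<close>
  have beW: "bdry e \<in> qchains (subtopology X (W \<inter> N))"
    by (rule qchains_subtopology_Int[OF bdry_qchains[OF e(1)]]) (unfold be, rule bdry_qchains[OF a])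
  have "sd e = bdry x + bdry y + sd a"
    unfolding e(2) sda[rule_format] sd_bdry xy(3) bdry_add by simp
  moreover have "sd e - e = bdry (h e) + h (bdry e)" using hb eX by simp
  \<comment> \<open>The term \<open>bdry y + sd a\<close> lies in \<open>N\<close> by its form, and
    in \<open>W\<close> because it equals \<open>sd e - bdry x\<close>.\<close>
  ultimately have eq: "e = bdry (x - h e) + ((bdry y + sd a) - h (bdry e))"
    by (simp add: bdry_diff algebra_simps)
  have heW: "h e \<in> qchains (subtopology X W)" using ch e(1) by blast
  have "bdry y + sd a \<in> qchains (subtopology X N)"
    using bdry_qchains[OF xy(2)] ch a by (intro qchains_add) auto
  moreover have "bdry y + sd a = sd e - bdry x" using \<open>sd e = _\<close> by simp
  then have "bdry y + sd a \<in> qchains (subtopology X W)"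
    using ch e(1) bdry_qchains[OF xy(1)] by (auto intro: qchains_diff)
  ultimately have "bdry y + sd a \<in> qchains (subtopology X (W \<inter> N))"
    by (intro qchains_subtopology_Int)
  then have "(bdry y + sd a) - h (bdry e) \<in> qchains (subtopology X (W \<inter> N))"
    using ch beW by (intro qchains_diff) auto
  then show ?thesis using eq qchains_diff[OF xy(1) heW] by blast
qed

section \<open>The cap product\<close>

text \<open>The affine embedding of a simplex as the face spanned by the last vertices; composition
  with it gives the back face.\<close>

definition shift :: "nat \<Rightarrow> (nat \<Rightarrow> real) \<Rightarrow> nat \<Rightarrow> real" where
  "shift k y = (\<lambda>i. if i < k then 0 else y (i - k))"

lemma shift_standard_simplex:
  assumes "k \<le> p" "y \<in> standard_simplex (p - k)"
  shows "shift k y \<in> standard_simplex p"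
proof -
  have "(\<Sum>i\<le>p. shift k y i) = (\<Sum>i\<in>{k..p}. y (i - k))"
    using assms(1) by (intro sum.mono_neutral_cong_right) (auto simp: shift_def)
  also have "\<dots> = (\<Sum>i\<le>p - k. y i)"
    by (rule sum.reindex_bij_witness[of _ "\<lambda>i. i + k" "\<lambda>i. i - k"]) (use assms(1) in auto)
  finally show ?thesis
    using assms by (auto simp: standard_simplex_def shift_def)
qed

lemma back_face_eq: "back_face k (p, f) = (p - k, restrict (f \<circ> shift k) (standard_simplex (p - k)))"
  by (simp add: back_face_def shift_def o_def)

lemma front_face_eq: "front_face k (p, f) = (k, restrict f (standard_simplex k))"
  by (simp add: front_face_def)

lemma front_face_simplex:
  assumes "(p, f) \<in> simplices X" "k \<le> p"
  shows "front_face k (p, f) \<in> simplices X"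
proof -
  have f: "continuous_map (subtopology (powertop_real UNIV) (standard_simplex p)) X f"
    using assms by (simp add: simplices_def singular_simplex_def)
  have "continuous_map (subtopology (powertop_real UNIV) (standard_simplex k)) X f"
    by (rule continuous_map_from_subtopology_mono[OF f standard_simplex_mono[OF assms(2)]])
  then have "continuous_map (subtopology (powertop_real UNIV) (standard_simplex k)) X (restrict f (standard_simplex k))"
    by (rule continuous_map_eq) auto
  then show ?thesis by (simp add: front_face_eq simplices_def singular_simplex_def)
qed

lemma back_face_simplex:
  assumes "(p, f) \<in> simplices X" "k \<le> p"
  shows "back_face k (p, f) \<in> simplices X"
proof -
  let ?P = "powertop_real UNIV :: (nat \<Rightarrow> real) topology"
  have f: "continuous_map (subtopology ?P (standard_simplex p)) X f"
    using assms by (simp add: simplices_def singular_simplex_def)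
  have "continuous_map ?P ?P (shift k)"
    unfolding continuous_map_componentwise_UNIV shift_def
    by (auto intro: continuous_map_product_projection)
  then have "continuous_map (subtopology ?P (standard_simplex (p - k))) (subtopology ?P (standard_simplex p)) (shift k)"
    using shift_standard_simplex[OF assms(2)]
    by (intro continuous_map_into_subtopology continuous_map_from_subtopology) auto
  then have "continuous_map (subtopology ?P (standard_simplex (p - k))) X (f \<circ> shift k)"
    by (rule continuous_map_compose[OF _ f])
  then have "continuous_map (subtopology ?P (standard_simplex (p - k))) X (restrict (f \<circ> shift k) (standard_simplex (p - k)))"
    by (rule continuous_map_eq) auto
  then show ?thesis by (simp add: back_face_eq simplices_def singular_simplex_def)
qed

lemma cap_diff: "cap u (a - b) = cap u a - cap u b" and cap_add: "cap u (a + b) = cap u a + cap u b"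
  by (simp_all add: cap_def qextend_diff qextend_add)

lemma cap_qchains: "c \<in> qchains X \<Longrightarrow> cap u c \<in> qchains X"
  unfolding cap_def
proof (erule qchains_qextend)
  fix s assume s: "s \<in> simplices X"
  obtain p f where "s = (p, f)" by (cases s)
  then show "(\<Sum>k\<le>fst s. Poly_Mapping.single (back_face k s) (u (front_face k s))) \<in> qchains X"
    using s back_face_simplex by (intro qchains_sum qchains_single) auto
qed

text \<open>Front faces of simplices in a subspace stay there, so a relative cocycle caps its chains
  to zero.\<close>

lemma cap_vanish:
  assumes "c \<in> qchains X" "\<And>s. s \<in> simplices X \<Longrightarrow> u s = 0"
  shows "cap u c = 0"
proof -
  have "cap u c = qextend (\<lambda>s. 0) c"
    unfolding cap_def
  proof (rule qextend_cong)
    fix s assume "s \<in> Poly_Mapping.keys c"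
    then have s: "s \<in> simplices X" using assms(1) by (auto simp: qchains_def)
    obtain p f where "s = (p, f)" by (cases s)
    then show "(\<Sum>k\<le>fst s. Poly_Mapping.single (back_face k s) (u (front_face k s))) = 0"
      using assms(2)[OF front_face_simplex] s by (intro sum.neutral) simp
  qed
  then show ?thesis by simp
qed

lemma pairing_single: "pairing u (Poly_Mapping.single s r) = r * u s"
  by (cases "r = 0") (simp_all add: pairing_def)

lemma pairing_add: "pairing u (a + b) = pairing u a + pairing u b"
proof -
  have *: "pairing u c = (\<Sum>s\<in>S. Poly_Mapping.lookup c s * u s)" if "finite S" "Poly_Mapping.keys c \<subseteq> S" for c S
    unfolding pairing_def using that by (intro sum.mono_neutral_left) (auto simp: in_keys_iff)
  let ?S = "Poly_Mapping.keys a \<union> Poly_Mapping.keys b"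
  have "Poly_Mapping.keys (a + b) \<subseteq> ?S" by (rule Poly_Mapping.keys_add)
  then show ?thesis
    by (simp add: *[of ?S] lookup_add sum.distrib algebra_simps)
qed

lemma pairing_sum: "pairing u (\<Sum>i\<in>I. c i) = (\<Sum>i\<in>I. pairing u (c i))"
  by (induction I rule: infinite_finite_induct) (simp_all add: pairing_add, simp_all add: pairing_def)

section \<open>How front and back faces interact with the boundary\<close>

lemma simplical_face_beyond: "y \<in> standard_simplex k \<Longrightarrow> k < i \<Longrightarrow> simplical_face i y = y"
  by (auto simp: simplical_face_def standard_simplex_def fun_eq_iff)

lemma front_face_low:
  assumes "i \<le> k" "k < p"
  shows "front_face k (p - 1, singular_face p i f) = (k, singular_face (Suc k) i (restrict f (standard_simplex (Suc k))))"
proof -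
  have "standard_simplex k \<subseteq> standard_simplex (p - Suc 0)"
    using assms by (intro standard_simplex_mono) auto
  moreover have "simplical_face i y \<in> standard_simplex (Suc k)" if "y \<in> standard_simplex k" for y
    using simplical_face_in_standard_simplex[of "Suc k" i y] that assms by simp
  ultimately show ?thesis
    by (auto simp: front_face_eq singular_face_def fun_eq_iff restrict_def)
qed

lemma front_face_last: "singular_face (Suc k) (Suc k) (restrict f (standard_simplex (Suc k))) = restrict f (standard_simplex k)"
proof -
  have "standard_simplex k \<subseteq> standard_simplex (Suc k)" by (intro standard_simplex_mono) auto
  then show ?thesis
    by (auto simp: singular_face_def fun_eq_iff restrict_def simplical_face_beyond)
qed

lemma front_face_high:
  assumes "k < i" "k < p"
  shows "front_face k (p - 1, singular_face p i f) = front_face k (p, f)"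
proof -
  have "standard_simplex k \<subseteq> standard_simplex (p - Suc 0)"
    using assms by (intro standard_simplex_mono) auto
  then show ?thesis
    using assms(1) by (auto simp: front_face_eq singular_face_def fun_eq_iff restrict_def simplical_face_beyond)
qed

lemma back_face_low:
  assumes "i \<le> k" "k < p"
  shows "back_face k (p - 1, singular_face p i f) = back_face (Suc k) (p, f)"
proof -
  have eq: "simplical_face i (shift k y) = shift (Suc k) y" for y
    using assms(1) by (auto simp: simplical_face_def shift_def fun_eq_iff)
  have "shift k y \<in> standard_simplex (p - Suc 0)" if "y \<in> standard_simplex (p - Suc k)" for y
    using shift_standard_simplex[of k "p - Suc 0" y] that assms(2) by simp
  then show ?thesis
    by (auto simp: back_face_eq singular_face_def eq intro!: restrict_ext)
qed

lemma back_face_high: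
  assumes "k < i" "i \<le> p"
  shows "back_face k (p - 1, singular_face p i f) =
    (p - k - 1, singular_face (p - k) (i - k) (restrict (f \<circ> shift k) (standard_simplex (p - k))))"
proof -
  have eq: "simplical_face i (shift k y) = shift k (simplical_face (i - k) y)" for y
  proof
    fix j
    consider "j < k" | "k \<le> j" "j < i" | "j = i" | "i < j" by linarith
    then show "simplical_face i (shift k y) j = shift k (simplical_face (i - k) y) j"
      using assms(1) by cases (auto simp: simplical_face_def shift_def)
  qed
  have "shift k y \<in> standard_simplex (p - Suc 0)" if "y \<in> standard_simplex (p - Suc k)" for y
    using shift_standard_simplex[of k "p - Suc 0" y] that assms by simp
  moreover have "simplical_face (i - k) y \<in> standard_simplex (p - k)" if "y \<in> standard_simplex (p - Suc k)" for y
    using simplical_face_in_standard_simplex[of "p - k" "i - k" y] that assms by simp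
  ultimately show ?thesis
    by (auto simp: back_face_eq singular_face_def eq intro!: restrict_ext)
qed

lemma back_face_zero:
  assumes "k < p"
  shows "back_face (Suc k) (p, f) =
    (p - k - 1, singular_face (p - k) 0 (restrict (f \<circ> shift k) (standard_simplex (p - k))))"
proof -
  have eq: "shift (Suc k) y = shift k (simplical_face 0 y)" for y
  proof
    fix j
    consider "j < k" | "j = k" | "k < j" by linarith
    then show "shift (Suc k) y j = shift k (simplical_face 0 y) j"
      by cases (auto simp: simplical_face_def shift_def)
  qed
  have "simplical_face 0 y \<in> standard_simplex (p - k)" if "y \<in> standard_simplex (p - Suc k)" for y
    using simplical_face_in_standard_simplex[of "p - k" 0 y] that assms by simp
  then show ?thesis
    by (auto simp: back_face_eq singular_face_def eq intro!: restrict_ext)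
qed

text \<open>The cocycle condition on a simplex of dimension \<open>Suc k\<close>, solved for the
  last face.\<close>

lemma cocycle_alternating_sum:
  assumes "cocycle X A u" "(Suc k, g) \<in> simplices X"
  shows "(\<Sum>i\<le>k. (-1) ^ i * u (k, singular_face (Suc k) i g)) = (-1) ^ k * u (k, singular_face (Suc k) (Suc k) g)"
proof -
  have "cobdry u (Suc k, g) = 0" using assms unfolding cocycle_def by blast
  then have "(\<Sum>i\<le>Suc k. (-1) ^ i * u (k, singular_face (Suc k) i g)) = 0"
    by (simp add: cobdry_def bdry_single pairing_sum pairing_single pairing_add del: sum.atMost_Suc)
  then show ?thesis by simp
qed

lemma single_sum: "Poly_Mapping.single t (\<Sum>i\<in>I. f i) = (\<Sum>i\<in>I. Poly_Mapping.single t (f i))"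
  by (induction I rule: infinite_finite_induct) (simp_all add: single_add)

text \<open>With the signs \<open>(-1)\<^sup>k\<close> on the part of degree \<open>k\<close> this is the Leibniz rule for a cocycle of mixed
  degree.\<close>

lemma cap_bdry:
  assumes u: "cocycle X A u" and c: "c \<in> qchains X"
  shows "cap u (bdry c) = bdry (cap (\<lambda>s. (-1) ^ fst s * u s) c)"
proof -
  let ?u = "\<lambda>s. (-1) ^ fst s * u s"
  have "cap u (bdry c) = qextend (\<lambda>s. cap u (bdry (Poly_Mapping.single s 1))) c"
    unfolding cap_def bdry_def qextend_qextend by (rule qextend_cong) (simp add: qextend_single)
  also have "\<dots> = qextend (\<lambda>s. bdry (cap ?u (Poly_Mapping.single s 1))) c"
  proof (rule qextend_cong)
    fix s assume "s \<in> Poly_Mapping.keys c"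
    then have s: "s \<in> simplices X" using c by (auto simp: qchains_def)
    obtain p f where pf: "s = (p, f)" by (cases s)
    let ?b = "\<lambda>k. restrict (f \<circ> shift k) (standard_simplex (p - k))"
    let ?a = "\<lambda>k. u (front_face k (p, f))"
    have R: "bdry (cap ?u (Poly_Mapping.single s 1)) =
        (\<Sum>k\<le>p. bdry (Poly_Mapping.single (p - k, ?b k) ((-1) ^ k * ?a k)))"
      unfolding pf cap_def
      by (simp add: qextend_single bdry_def qextend_sum back_face_eq) (simp add: front_face_eq)
    show "cap u (bdry (Poly_Mapping.single s 1)) = bdry (cap ?u (Poly_Mapping.single s 1))"
    proof (cases "p = 0")
      case True
      then show ?thesis unfolding R by (simp add: pf bdry_single cap_def)
    next
      case False
      have "cap u (bdry (Poly_Mapping.single s 1)) =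
          (\<Sum>i\<le>p. \<Sum>k<p. Poly_Mapping.single (back_face k (p - 1, singular_face p i f))
             ((-1) ^ i * u (front_face k (p - 1, singular_face p i f))))"
      proof -
        have "{..p - 1} = {..<p}" using False by auto
        then show ?thesis
          unfolding pf cap_def using False
          by (simp add: bdry_single qextend_sum qextend_single scale_sum)
      qed
      also have "\<dots> = (\<Sum>k<p. \<Sum>i\<le>p. Poly_Mapping.single (back_face k (p - 1, singular_face p i f))
             ((-1) ^ i * u (front_face k (p - 1, singular_face p i f))))"
        by (rule sum.swap)
      also have "\<dots> = (\<Sum>k<p. bdry (Poly_Mapping.single (p - k, ?b k) ((-1) ^ k * ?a k)))"
      proof (rule sum.cong[OF refl])
        fix k assume "k \<in> {..<p}"
        then have k: "k < p" by simp
        let ?t = "\<lambda>i. Poly_Mapping.single (back_face k (p - 1, singular_face p i f))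
             ((-1) ^ i * u (front_face k (p - 1, singular_face p i f)))"
        let ?g = "restrict f (standard_simplex (Suc k))"
        \<comment> \<open>The faces with \<open>i \<le> k\<close> all have the same back face. Their
          coefficients therefore add up, and the cocycle condition turns the sum into the value on
          the front face of the whole simplex.\<close>
        have "(\<Sum>i\<le>k. ?t i) = (\<Sum>i\<le>k. Poly_Mapping.single (back_face (Suc k) (p, f))
            ((-1) ^ i * u (k, singular_face (Suc k) i ?g)))"
        proof (rule sum.cong[OF refl])
          fix i assume "i \<in> {..k}"
          then have "i \<le> k" by simp
          then show "?t i = Poly_Mapping.single (back_face (Suc k) (p, f)) ((-1) ^ i * u (k, singular_face (Suc k) i ?g))"
            by (simp only: back_face_low[OF _ k] front_face_low[OF _ k])
        qed
        also have "\<dots> = Poly_Mapping.single (back_face (Suc k) (p, f)) (\<Sum>i\<le>k. (-1) ^ i * u (k, singular_face (Suc k) i ?g))"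
          by (rule single_sum[symmetric])
        also have "\<dots> = Poly_Mapping.single (back_face (Suc k) (p, f)) ((-1) ^ k * ?a k)"
        proof -
          have "(Suc k, ?g) \<in> simplices X"
            using front_face_simplex[of p f X "Suc k"] s k unfolding pf by (simp add: front_face_eq)
          show ?thesis
            unfolding cocycle_alternating_sum[OF u \<open>(Suc k, ?g) \<in> simplices X\<close>] front_face_last front_face_eq ..
        qed
        finally have low: "(\<Sum>i\<le>k. ?t i) =
            Poly_Mapping.single (p - k - 1, singular_face (p - k) 0 (?b k)) ((-1) ^ k * ?a k)"
          by (simp only: back_face_zero[OF k])
        \<comment> \<open>The faces with \<open>i > k\<close> leave the front face alone and run
          through the faces of the back face other than its zeroth, which the low part
          supplies.\<close>
        have high: "(\<Sum>i\<in>{k<..p}. ?t i) =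
            (\<Sum>j\<in>{0<..p - k}. Poly_Mapping.single (p - k - 1, singular_face (p - k) j (?b k)) ((-1) ^ j * ((-1) ^ k * ?a k)))"
        proof (rule sum.reindex_bij_witness[of _ "\<lambda>j. j + k" "\<lambda>i. i - k"])
          fix i assume i: "i \<in> {k<..p}"
          then have ki: "k < i" "i \<le> p" by auto
          have pw: "(-1 :: rat) ^ i = (-1) ^ (i - k) * (-1) ^ k" using ki by (simp flip: power_add)
          show "Poly_Mapping.single (p - k - 1, singular_face (p - k) (i - k) (?b k)) ((-1) ^ (i - k) * ((-1) ^ k * ?a k)) = ?t i"
            unfolding back_face_high[OF ki] front_face_high[OF ki(1) k] pw by (simp only: mult.assoc)
        qed auto
        have "{..p} = {..k} \<union> {k<..p}" using k by auto
        then have "(\<Sum>i\<le>p. ?t i) = (\<Sum>i\<le>k. ?t i) + (\<Sum>i\<in>{k<..p}. ?t i)"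
          by (simp only:) (rule sum.union_disjoint, auto)
        also have "\<dots> = (\<Sum>j\<le>p - k. Poly_Mapping.single (p - k - 1, singular_face (p - k) j (?b k)) ((-1) ^ j * ((-1) ^ k * ?a k)))"
        proof -
          have "{..p - k} = insert 0 {0<..p - k}" by auto
          then show ?thesis unfolding low high by simp
        qed
        also have "\<dots> = bdry (Poly_Mapping.single (p - k, ?b k) ((-1) ^ k * ?a k))"
          using k by (simp add: bdry_single)
        finally show "(\<Sum>i\<le>p. ?t i) = bdry (Poly_Mapping.single (p - k, ?b k) ((-1) ^ k * ?a k))" .
      qed
      \<comment> \<open>The additional term \<open>k = p\<close> is the boundary of a
        0-simplex.\<close>
      also have "\<dots> = (\<Sum>k\<le>p. bdry (Poly_Mapping.single (p - k, ?b k) ((-1) ^ k * ?a k)))"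
        by (simp add: lessThan_Suc_atMost[symmetric] bdry_single)
      finally show ?thesis unfolding R .
    qed
  qed
  also have "\<dots> = bdry (cap ?u c)"
    unfolding cap_def bdry_def qextend_qextend by (rule qextend_cong) (simp add: qextend_single)
  finally show ?thesis .
qed

section \<open>Alexander duality for a larger subvariety\<close>

text \<open>Simplices are extensional on the standard simplex, so the restriction inside
  \<open>simplex_map\<close> has no effect.\<close>

lemma push_chain_id:
  assumes "c \<in> qchains X"
  shows "push_chain (\<lambda>x. x) c = c"
proof -
  have "push_chain (\<lambda>x. x) c = qextend (\<lambda>s. Poly_Mapping.single s 1) c"
    unfolding push_chain_def
  proof (rule qextend_cong)
    fix s assume "s \<in> Poly_Mapping.keys c"
    then have "s \<in> simplices X" using assms by (auto simp: qchains_def)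
    then obtain p f where s: "s = (p, f)" "f \<in> extensional (standard_simplex p)"
      by (auto simp: simplices_def singular_simplex_def)
    have "simplex_map p (\<lambda>x. x) f = f"
      using s(2) by (simp add: simplex_map_def o_def extensional_restrict)
    then show "(case s of (p, f) \<Rightarrow> Poly_Mapping.single (p, simplex_map p (\<lambda>x. x) f) 1) = Poly_Mapping.single s 1"
      by (simp add: s(1))
  qed
  then show ?thesis by (simp add: qextend_id)
qed

lemma ctop_subset: "Y \<subseteq> X \<Longrightarrow> ctop Y = subtopology (ctop X) Y"
  by (simp add: ctop_def subtopology_subtopology Int_absorb1)

lemma homologous_mono:
  assumes "homologous X A c c'" "A \<subseteq> B"
  shows "homologous X B c c'"
  using assms qchains_subtopology_mono[of A B X] unfolding homologous_def by blast

lemma homologous_refl: "homologous X A c c"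
  unfolding homologous_def by (intro bexI[of _ 0]) auto

lemma homologous_trans:
  assumes "homologous X A a b" "homologous X A b c"
  shows "homologous X A a c"
proof -
  obtain x y x' y' where "x \<in> qchains X" "y \<in> qchains (subtopology X A)" "a - b = bdry x + y"
      "x' \<in> qchains X" "y' \<in> qchains (subtopology X A)" "b - c = bdry x' + y'"
    using assms unfolding homologous_def by blast
  moreover have "a - c = (a - b) + (b - c)" by simp
  ultimately have "a - c = bdry (x + x') + (y + y')" "x + x' \<in> qchains X" "y + y' \<in> qchains (subtopology X A)"
    by (auto simp: bdry_add intro: qchains_add)
  then show ?thesis unfolding homologous_def by blast
qed

lemma homologous_sym:
  assumes "homologous X A a b"
  shows "homologous X A b a"
proof -
  obtain x y where xy: "x \<in> qchains X" "y \<in> qchains (subtopology X A)" "a - b = bdry x + y"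
    using assms unfolding homologous_def by blast
  have "b - a = 0 - (a - b)" by simp
  also have "\<dots> = bdry (0 - x) + (0 - y)" unfolding xy(3) bdry_diff by simp
  finally have "b - a = bdry (0 - x) + (0 - y)" .
  moreover have "0 - x \<in> qchains X" by (intro qchains_diff qchains_zero xy)
  moreover have "0 - y \<in> qchains (subtopology X A)" by (intro qchains_diff qchains_zero xy)
  ultimately show ?thesis unfolding homologous_def by blast
qed

lemma hom_class_eq: "homologous X {} a b \<Longrightarrow> hom_class X a = hom_class X b"
  unfolding hom_class_def using homologous_trans homologous_sym by blast

text \<open>The chain \<open>c\<close> provided for \<open>Y\<close> agrees with \<mu> only modulo
  the complement of j(Y), which is too large for \<open>X\<close>. Excision along j(X) gives a new
  chain \<open>c'\<close>, and injectivity of excision along j(Y) compares the two inside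
  \<open>W\<close>.\<close>

lemma alexander_dual_enlarge:
  assumes YX: "Y \<subseteq> X" and oX: "openin (ctop M) (M - j ` X)" and oY: "openin (ctop M) (M - j ` Y)"
    and M: "topspace (ctop M) = M"
    and u: "cocycle (ctop M) (M - j ` Y) u" and z: "alexander_dual M Y j u z"
  shows "alexander_dual M X j u z"
proof -
  let ?T = "ctop M"
  let ?u = "\<lambda>s. (-1) ^ fst s * u s"
  obtain \<mu> where \<mu>: "fundamental_cycle M \<mu>" and cz: "cycle (ctop Y) z"
    and W: "\<forall>W. openin ?T W \<and> j ` Y \<subseteq> W \<longrightarrow> (\<exists>c\<in>qchains (subtopology ?T W). homologous ?T (M - j ` Y) c \<mu> \<and>
           homologous (subtopology ?T W) {} (push_chain j z) (cap u c))"
    using z unfolding alexander_dual_def by blast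
  have "cycle (ctop X) z"
    using cz qchains_subtopology[of "ctop X" Y] unfolding cycle_def ctop_subset[OF YX] by blast
  moreover have "\<exists>c\<in>qchains (subtopology ?T W). homologous ?T (M - j ` X) c \<mu> \<and>
      homologous (subtopology ?T W) {} (push_chain j z) (cap u c)"
    if W': "openin ?T W \<and> j ` X \<subseteq> W" for W
  proof -
    have oW: "openin ?T W" and jW: "j ` X \<subseteq> W" using W' by blast+
    have "j ` Y \<subseteq> W" using jW YX by blast
    then obtain c where c: "c \<in> qchains (subtopology ?T W)" "homologous ?T (M - j ` Y) c \<mu>"
        "homologous (subtopology ?T W) {} (push_chain j z) (cap u c)"
      using W oW by blast
    have c\<mu>: "cycle ?T \<mu>" using \<mu> unfolding fundamental_cycle_def by blast
    obtain c' where c': "c' \<in> qchains (subtopology ?T W)" "homologous ?T (M - j ` X) c' \<mu>"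
      using excision_exists[OF oW oX _ c\<mu>] jW M by blast
    have "homologous ?T (M - j ` Y) c' \<mu>"
      by (rule homologous_mono[OF c'(2)]) (use YX in blast)
    then have "homologous ?T (M - j ` Y) c c'"
      using c(2) homologous_sym homologous_trans by blast
    then obtain b a where ba: "b \<in> qchains ?T" "a \<in> qchains (subtopology ?T (M - j ` Y))" "c - c' = bdry b + a"
      unfolding homologous_def by blast
    obtain b' a' where b': "b' \<in> qchains (subtopology ?T W)" "a' \<in> qchains (subtopology ?T (W \<inter> (M - j ` Y)))"
        "c - c' = bdry b' + a'"
      using excision_injective[OF oW oY _ qchains_diff[OF c(1) c'(1)] ba(3,1,2)] \<open>j ` Y \<subseteq> W\<close> M by blast
    \<comment> \<open>The error term avoids j(Y), where the relative cocycle \<open>u\<close> is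
      zero; what is left of the difference is a boundary by the Leibniz rule.\<close>
    have "cap u a' = 0"
    proof (rule cap_vanish[OF b'(2)])
      fix s assume "s \<in> simplices (subtopology ?T (W \<inter> (M - j ` Y)))"
      then have "s \<in> simplices (subtopology ?T (M - j ` Y))"
        using simplices_subtopology_mono[of "W \<inter> (M - j ` Y)" "M - j ` Y" ?T] by blast
      then show "u s = 0" using u unfolding cocycle_def by blast
    qed
    moreover have "b' \<in> qchains ?T" using b'(1) qchains_subtopology by blast
    ultimately have "cap u c - cap u c' = bdry (cap ?u b')"
      unfolding cap_diff[symmetric] b'(3) cap_add by (simp add: cap_bdry[OF u])
    then have "homologous (subtopology ?T W) {} (cap u c) (cap u c')"
      unfolding homologous_def using cap_qchains[OF b'(1), of ?u] by (intro bexI[of _ "cap ?u b'"] bexI[of _ 0]) auto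
    then show ?thesis using c' c(3) homologous_trans by blast
  qed
  ultimately show ?thesis
    unfolding alexander_dual_def using \<mu> by blast
qed

section \<open>Resolutions and charges\<close>

lemma carrier_sections: "carrier (Sec (sheaf_of_sections M E) U) = {s \<in> extensional U. vb_section (regular_on M) E U s}"
  and Rst_sections: "Rst (sheaf_of_sections M E) U V s = restrict s V"
  and zero_sections: "\<zero>\<^bsub>Sec (sheaf_of_sections M E) U\<^esub> = restrict (\<lambda>x k. 0) U"
  by (simp_all add: sheaf_of_sections_def)

lemma restrict_section:
  assumes M: "variety M" and t: "vb_section (regular_on M) E U t"
  shows "restrict t U \<in> carrier (Sec (sheaf_of_sections M E) U)"
  unfolding carrier_sections
  using fun_space.vb_section_cong[OF zariski_fun_space[OF M] t, of "restrict t U"] by simp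

text \<open>Where the resolved sheaf has no sections, the augmentation kills every section of
  \<open>E 0\<close>. Exactness at \<open>E 0\<close> then has the same form as in higher degrees,
  with \<open>d 0 = 0\<close>.\<close>

lemma resolution_exact:
  assumes M: "variety M" and R: "resolution M E d \<epsilon> G" and U: "zopen M U" and G: "carrier (Sec G U) = {\<zero>\<^bsub>Sec G U\<^esub>}"
    and t: "vb_section (regular_on M) (E i) U t" and dt: "\<And>y. y \<in> U \<Longrightarrow> d i y (t y) = (\<lambda>k. 0)"
    and x: "x \<in> U"
  shows "\<exists>V u. zopen M V \<and> x \<in> V \<and> V \<subseteq> U \<and> vb_section (regular_on M) (E (Suc i)) V u \<and>
    (\<forall>y\<in>V. d (Suc i) y (u y) = t y)"
proof -
  note t' = restrict_section[OF M t]
  have "locally_in_image M (sheaf_of_sections M (E (Suc i))) (on_sections (d (Suc i)))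
      (sheaf_of_sections M (E i)) U (restrict t U)"
  proof (cases i)
    case 0
    have ex: "sheaf_exact M (sheaf_of_sections M (E 1)) (on_sections (d 1)) (sheaf_of_sections M (E 0)) \<epsilon> G"
      and hom: "sheaf_hom M (sheaf_of_sections M (E 0)) G \<epsilon>"
      using R unfolding resolution_def by simp_all
    have "\<epsilon> U \<in> carrier (Sec (sheaf_of_sections M (E 0)) U) \<rightarrow> carrier (Sec G U)"
      using hom U unfolding sheaf_hom_def by simp
    then have "\<epsilon> U (restrict t U) = \<zero>\<^bsub>Sec G U\<^esub>" using t' unfolding G 0 by blast
    moreover have "\<epsilon> U (restrict t U) = \<zero>\<^bsub>Sec G U\<^esub> \<longleftrightarrow> locally_in_image M (sheaf_of_sections M (E 1)) (on_sections (d 1))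
        (sheaf_of_sections M (E 0)) U (restrict t U)"
      using ex U t' unfolding sheaf_exact_def 0 by blast
    ultimately show ?thesis unfolding 0 One_nat_def by simp
  next
    case (Suc n)
    have ex: "sheaf_exact M (sheaf_of_sections M (E (Suc (Suc n)))) (on_sections (d (Suc (Suc n))))
        (sheaf_of_sections M (E (Suc n))) (on_sections (d (Suc n))) (sheaf_of_sections M (E n))"
      using R unfolding resolution_def by simp
    have "on_sections (d (Suc n)) U (restrict t U) = \<zero>\<^bsub>Sec (sheaf_of_sections M (E n)) U\<^esub>"
      unfolding on_sections_def zero_sections by (rule restrict_ext) (use dt Suc in simp)
    then show ?thesis using ex U t' unfolding sheaf_exact_def Suc by blast
  qed
  then obtain V s where V: "zopen M V" "x \<in> V" "V \<subseteq> U"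
    and s: "s \<in> carrier (Sec (sheaf_of_sections M (E (Suc i))) V)"
    and eq: "on_sections (d (Suc i)) V s = Rst (sheaf_of_sections M (E i)) U V (restrict t U)"
    using x unfolding locally_in_image_def by blast
  have "d (Suc i) y (s y) = t y" if y: "y \<in> V" for y
    using fun_cong[OF eq, of y] y V(3) unfolding on_sections_def Rst_sections by auto
  then show ?thesis using V s unfolding carrier_sections by blast
qed

text \<open>Exactness is stated for sections, so a vector is first extended to a local section with
  constant coefficients. Its image lies in the image of the differential and is killed by the next
  one.\<close>

lemma resolution_square_zero:
  assumes M: "variety M" and R: "resolution M E d \<epsilon> G" and x: "x \<in> M" and v: "v \<in> fib (E (Suc i)) x"
  shows "d i x (d (Suc i) x v) = (\<lambda>k. 0)"
proof (cases i)
  case 0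
  then show ?thesis using R unfolding resolution_def by simp
next
  case (Suc n)
  interpret Z: fun_space "zopen M" "regular_on M" by (rule zariski_fun_space[OF M])
  have E: "alg_vb M (E k)" for k using R unfolding resolution_def by simp
  have dmap: "vb_map (zopen M) (regular_on M) M (E (Suc (Suc n))) (E (Suc n)) (d (Suc (Suc n)))"
    and ex: "sheaf_exact M (sheaf_of_sections M (E (Suc (Suc n)))) (on_sections (d (Suc (Suc n))))
        (sheaf_of_sections M (E (Suc n))) (on_sections (d (Suc n))) (sheaf_of_sections M (E n))"
    using R unfolding resolution_def by simp_all
  obtain V r e where V: "(V, r, e) \<in> frames (E (Suc (Suc n)))" "x \<in> V" using E x by (rule Z.vbundle_frameE)
  note D = Z.vbundle_frameD[OF E V(1)]
  obtain c where c: "v = vcomb r c (\<lambda>i. e i x)" using basis_ofE[OF D(3)[OF V(2)]] v unfolding Suc by metis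
  let ?w = "\<lambda>y. vcomb r (\<lambda>j. c j) (\<lambda>j. e j y)"
  let ?t = "\<lambda>y. d (Suc (Suc n)) y (?w y)"
  have w: "vb_section (regular_on M) (E (Suc (Suc n))) V ?w"
    by (rule Z.vb_section_vcomb[OF E D(1,2) D(4) Z.fn_const[OF D(1)]])
  have t: "vb_section (regular_on M) (E (Suc n)) V ?t"
    using dmap w D(1,2) unfolding vb_map_def by blast
  have "locally_in_image M (sheaf_of_sections M (E (Suc (Suc n)))) (on_sections (d (Suc (Suc n))))
      (sheaf_of_sections M (E (Suc n))) V (restrict ?t V)"
    unfolding locally_in_image_def
  proof
    fix y assume "y \<in> V"
    moreover have "on_sections (d (Suc (Suc n))) V (restrict ?w V) =
        Rst (sheaf_of_sections M (E (Suc n))) V V (restrict ?t V)"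
      unfolding on_sections_def Rst_sections by (auto simp: restrict_def)
    ultimately show "\<exists>V' s. zopen M V' \<and> y \<in> V' \<and> V' \<subseteq> V \<and>
        s \<in> carrier (Sec (sheaf_of_sections M (E (Suc (Suc n)))) V') \<and>
        on_sections (d (Suc (Suc n))) V' s = Rst (sheaf_of_sections M (E (Suc n))) V V' (restrict ?t V)"
      using D(1) restrict_section[OF M w] by blast
  qed
  then have "on_sections (d (Suc n)) V (restrict ?t V) = \<zero>\<^bsub>Sec (sheaf_of_sections M (E n)) V\<^esub>"
    using ex D(1) restrict_section[OF M t] unfolding sheaf_exact_def by blast
  from fun_cong[OF this, of x] show ?thesis
    using V(2) unfolding Suc c on_sections_def zero_sections by simp
qed

text \<open>An equality of records and not only an isomorphism, so a resolution with its
  augmentation serves for both sheaves unchanged.\<close>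

lemma direct_image_extend_by_zero:
  assumes "Y \<subseteq> X"
  shows "direct_image X j (extend_by_zero Y F) = direct_image Y j F"
proof -
  have "{x \<in> Y. x \<in> {x \<in> X. j x \<in> U}} = {x \<in> Y. j x \<in> U}" for U using assms by blast
  moreover have "restrict (restrict (f \<circ> j) {x \<in> X. j x \<in> U} \<circ> (\<lambda>x. x)) {x \<in> Y. j x \<in> U} =
      restrict (f \<circ> j) {x \<in> Y. j x \<in> U}" for f :: "pt \<Rightarrow> complex" and U
    using assms by (auto simp: restrict_def fun_eq_iff)
  ultimately show ?thesis
    unfolding extend_by_zero_def direct_image_def by (simp add: Let_def)
qed

text \<open>For a zero sheaf the identities form a short exact sequence with all three terms equal
  to \<open>F\<close>; its relation is the negative of the generator.\<close>

lemma frag_of_zero_sheaf: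
  assumes F: "coherent Z F" and zero: "is_zero_sheaf Z F"
  shows "frag_of F \<in> K0_rel Z"
proof -
  have ms: "modsheaf_on Z F" using F unfolding coherent_def by blast
  have z: "t = \<zero>\<^bsub>Sec F U\<^esub>" if "zopen Z U" "t \<in> carrier (Sec F U)" for U t
    using zero that unfolding is_zero_sheaf_def by blast
  have loc: "locally_in_image Z F (\<lambda>U s. s) F U t" if "zopen Z U" "t \<in> carrier (Sec F U)" for U t
    unfolding locally_in_image_def using that modsheaf_onD(5)[OF ms that] by (metis subset_refl)
  have "short_exact Z F (\<lambda>U s. s) F (\<lambda>U s. s) F"
    unfolding short_exact_def sheaf_hom_def sheaf_inj_def sheaf_exact_def sheaf_surj_def
    using loc z by (simp add: inj_on_def)
  from K0_rel.ses[OF F F F this] have "- frag_of F \<in> K0_rel Z" by simp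
  from K0_rel.diff[OF K0_rel.zero this] show ?thesis by simp
qed

text \<open>\<open>brane_class\<close> sums over the nonzero objects. For a zero sheaf this sum is
  empty, and the relations of the Grothendieck group are needed to identify its class.\<close>

lemma brane_class_in_degree_0:
  assumes F: "coherent Z F"
  shows "brane_class Z (in_degree_0 F) = K0_class Z (frag_of F)"
proof (cases "is_zero_sheaf Z F")
  case True
  note f = frag_of_zero_sheaf[OF F True]
  have "is_zero_sheaf Z (Obj (in_degree_0 F) k)" for k
    using True by (simp add: in_degree_0_def is_zero_sheaf_def zero_sheaf_def)
  then have "brane_class Z (in_degree_0 F) = K0_class Z 0" unfolding brane_class_def by simp
  also have "\<dots> = K0_class Z (frag_of F)"
  proof -
    have "b - 0 \<in> K0_rel Z \<longleftrightarrow> b - frag_of F \<in> K0_rel Z" for b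
    proof
      assume "b - 0 \<in> K0_rel Z"
      then show "b - frag_of F \<in> K0_rel Z" using K0_rel.diff[OF _ f, of b] by simp
    next
      assume "b - frag_of F \<in> K0_rel Z"
      from K0_rel.diff[OF this K0_rel.diff[OF K0_rel.zero f]] show "b - 0 \<in> K0_rel Z" by simp
    qed
    then show ?thesis unfolding K0_class_def by simp
  qed
  finally show ?thesis .
next
  case False
  then have "{k. \<not> is_zero_sheaf Z (Obj (in_degree_0 F) k)} = {0}"
    by (auto simp: in_degree_0_def is_zero_sheaf_def zero_sheaf_def)
  then show ?thesis unfolding brane_class_def by (simp add: in_degree_0_def)
qed

lemma resolution_splitting:
  assumes M: "variety M" and YM: "variety (j ` Y)" "j ` Y \<subseteq> M" and Y: "variety Y" and F: "modsheaf_on Y F"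
    and R: "resolution M E d \<epsilon> (direct_image Y j F)"
  shows "top_vb (ctop M) (E_even M E)" "top_vb (ctop M) (E_odd M E)"
    "\<exists>\<rho> \<beta>. splittings M (M - j ` Y) E d \<rho> \<and> even_odd_iso M (M - j ` Y) E d \<rho> \<beta> \<and>
      vb_map (openin (ctop M)) (cont_fn (ctop M)) (M - j ` Y) (E_even M E) (E_odd M E) \<beta> \<and>
      (\<forall>x\<in>M - j ` Y. bij_betw (\<beta> x) (fib (E_even M E) x) (fib (E_odd M E) x))"
proof -
  have A: "zopen M (M - j ` Y)" by (rule zopen_diff[OF YM])
  have E: "alg_vb M (E i)" for i using R unfolding resolution_def by simp
  have dmap: "vb_map (zopen M) (regular_on M) M (E (Suc i)) (E i) (d (Suc i))" for i
    using R unfolding resolution_def by simp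
  have d0: "d 0 = (\<lambda>x v k. 0)" and fin: "\<exists>r. \<forall>i>r. \<forall>x\<in>M. fib (E i) x = {\<lambda>k. 0}"
    using R unfolding resolution_def by simp_all
  have exact: "\<exists>V u. zopen M V \<and> x \<in> V \<and> V \<subseteq> U \<and> vb_section (regular_on M) (E (Suc i)) V u \<and>
      (\<forall>y\<in>V. d (Suc i) y (u y) = t y)"
    if U: "zopen M U" "U \<subseteq> M - j ` Y" and t: "vb_section (regular_on M) (E i) U t"
      "\<And>y. y \<in> U \<Longrightarrow> d i y (t y) = (\<lambda>k. 0)" and x: "x \<in> U" for i U t x
  proof (rule resolution_exact[OF M R U(1) _ t x])
    \<comment> \<open>Over \<open>U\<close> the direct image has the sections of \<open>F\<close>
      over the empty set.\<close>
    have empty: "{x \<in> Y. j x \<in> U} = {}" using U(2) by blast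
    show "carrier (Sec (direct_image Y j F) U) = {\<zero>\<^bsub>Sec (direct_image Y j F) U\<^esub>}"
      unfolding direct_image_def modsheaf.simps Let_def empty using modsheaf_empty[OF F Y] by simp
  qed
  note S = even_odd_splitting[OF M A E dmap d0 resolution_square_zero[OF M R] exact fin]
  show "top_vb (ctop M) (E_even M E)" "top_vb (ctop M) (E_odd M E)"
    "\<exists>\<rho> \<beta>. splittings M (M - j ` Y) E d \<rho> \<and> even_odd_iso M (M - j ` Y) E d \<rho> \<beta> \<and>
      vb_map (openin (ctop M)) (cont_fn (ctop M)) (M - j ` Y) (E_even M E) (E_odd M E) \<beta> \<and>
      (\<forall>x\<in>M - j ` Y. bij_betw (\<beta> x) (fib (E_even M E) x) (fib (E_odd M E) x))"
    by (rule S; assumption)+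
qed

lemma splittings_mono:
  assumes "splittings M A E d \<rho>" "A' \<subseteq> A"
  shows "splittings M A' E d \<rho>"
  using assms vb_map_subset unfolding splittings_def by (metis subsetD)

lemma even_odd_iso_mono: "even_odd_iso M A E d \<rho> \<beta> \<Longrightarrow> A' \<subseteq> A \<Longrightarrow> even_odd_iso M A' E d \<rho> \<beta>"
  unfolding even_odd_iso_def by (meson subsetD)

text \<open>\<open>hom_push\<close> unites the classes of all representatives; representatives
  homologous in \<open>Y\<close> are homologous in \<open>X\<close>, so these classes
  coincide.\<close>

lemma hom_push_hom_class:
  assumes YX: "Y \<subseteq> X" and q: "q \<in> qchains (ctop Y)"
  shows "hom_push (ctop X) (\<lambda>x. x) (hom_class (ctop Y) q) = hom_class (ctop X) q"
proof -
  have sub: "qchains (ctop Y) \<subseteq> qchains (ctop X)" unfolding ctop_subset[OF YX] by (rule qchains_subtopology)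
  have "hom_class (ctop X) (push_chain (\<lambda>x. x) c) = hom_class (ctop X) q" if c: "c \<in> hom_class (ctop Y) q" for c
  proof -
    have cq: "c \<in> qchains (ctop Y)" "homologous (ctop Y) {} c q" using c unfolding hom_class_def by simp_all
    have "homologous (ctop X) {} c q"
    proof -
      obtain b a where "b \<in> qchains (ctop Y)" "a \<in> qchains (subtopology (ctop Y) {})" "c - q = bdry b + a"
        using cq(2) unfolding homologous_def by (elim bexE)
      moreover have "subtopology (ctop Y) {} = subtopology (ctop X) {}" by simp
      ultimately show ?thesis unfolding homologous_def using sub by (intro bexI[of _ b] bexI[of _ a]) auto
    qed
    then show ?thesis unfolding push_chain_id[OF cq(1)] by (rule hom_class_eq)
  qed
  moreover have "q \<in> hom_class (ctop Y) q" unfolding hom_class_def using q homologous_refl by blast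
  ultimately show ?thesis unfolding hom_push_def by blast
qed

theorem proposition1:
  fixes X Y :: "pt set" and F :: "'a modsheaf"
    and \<tau> :: "pt set \<Rightarrow> ('a modsheaf \<Rightarrow>\<^sub>0 int) set \<Rightarrow> pt qchain set"
  assumes "BFM_transformation \<tau>"
    and "variety X" and "variety Y" and "Y \<subseteq> X"
    and "coherent Y F"
  shows "hom_push (ctop X) (\<lambda>x. x) (charge \<tau> Y (in_degree_0 F)) =
         charge \<tau> X (in_degree_0 (extend_by_zero Y F))"
proof -
  let ?G = "extend_by_zero Y F"
  note X = \<open>variety X\<close> and Y = \<open>variety Y\<close> and YX = \<open>Y \<subseteq> X\<close>
  have F: "modsheaf_on Y F" using \<open>coherent Y F\<close> unfolding coherent_def by blast
  have G: "coherent X ?G" by (rule coherent_extend_by_zero[OF X Y YX F \<open>coherent Y F\<close>])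
  have \<tau>: "(\<exists>M j E d \<epsilon> \<rho> \<beta>. BFM_data Z H M j E d \<epsilon> \<rho> \<beta>) \<and>
      (\<forall>M j E d \<epsilon> \<rho> \<beta>. BFM_data Z H M j E d \<epsilon> \<rho> \<beta> \<longrightarrow>
        (\<forall>q. BFM_value M Z j E \<beta> q \<longleftrightarrow> q = \<tau> Z (K0_class Z (frag_of H))))"
    if "variety Z" "coherent Z H" for Z H
    using \<open>BFM_transformation \<tau>\<close> that unfolding BFM_transformation_def by simp
  obtain M j E d \<epsilon> \<rho>0 \<beta>0 where "BFM_data X ?G M j E d \<epsilon> \<rho>0 \<beta>0"
    using \<tau>[OF X G] by (elim exE conjE)
  then have sm: "smooth_variety M" and jX: "closed_embedding X M j"
    and R: "resolution M E d \<epsilon> (direct_image Y j F)"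
    unfolding BFM_data_def direct_image_extend_by_zero[OF YX] by simp_all
  have M: "variety M" using sm unfolding smooth_variety_def by simp
  note jY = closed_embedding_restrict[OF X Y YX M jX]
  have jXM: "j ` X \<subseteq> M" "variety (j ` X)"
    using jX unfolding closed_embedding_def regular_map_def by blast+
  then have jYM: "j ` Y \<subseteq> M" using YX by blast
  have sub: "M - j ` X \<subseteq> M - j ` Y" using YX by blast
  note S = resolution_splitting[OF M jY(2) jYM Y F R]
  obtain \<rho> \<beta> where \<rho>: "splittings M (M - j ` Y) E d \<rho>" and \<beta>: "even_odd_iso M (M - j ` Y) E d \<rho> \<beta>"
    and map: "vb_map (openin (ctop M)) (cont_fn (ctop M)) (M - j ` Y) (E_even M E) (E_odd M E) \<beta>"
    and bij: "\<forall>x\<in>M - j ` Y. bij_betw (\<beta> x) (fib (E_even M E) x) (fib (E_odd M E) x)"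
    using S(3) by (elim exE conjE)
  have DY: "BFM_data Y F M j E d \<epsilon> \<rho> \<beta>"
    unfolding BFM_data_def by (intro conjI sm jY(1) R \<rho> \<beta>)
  have DX: "BFM_data X ?G M j E d \<epsilon> \<rho> \<beta>"
    unfolding BFM_data_def direct_image_extend_by_zero[OF YX]
    by (intro conjI sm jX R splittings_mono[OF \<rho> sub] even_odd_iso_mono[OF \<beta> sub])
  \<comment> \<open>The specification is applied from right to left: the value of
    \<open>\<tau>\<close> is attained, which supplies the Todd cocycle, \<open>u\<close> and
    \<open>z\<close>.\<close>
  have "BFM_value M Y j E \<beta> (\<tau> Y (K0_class Y (frag_of F)))"
    using \<tau>[OF Y \<open>coherent Y F\<close>] DY by simp
  then obtain a z where a: "is_td (ctop M) (tangent_bundle M) a" and z: "localized_ch M Y j E \<beta> z"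
    and eqY: "\<tau> Y (K0_class Y (frag_of F)) = hom_class (ctop Y) (cap (pull_cochain j a) z)"
    unfolding BFM_value_def by (elim exE conjE)
  obtain u where u: "is_ch_rel (ctop M) (M - j ` Y)
      (difference_bundle (ctop M) (M - j ` Y) (E_even M E) (E_odd M E) \<beta>) u"
    and dual: "alexander_dual M Y j u z"
    using z unfolding localized_ch_def by (elim exE conjE)
  have oX: "openin (ctop M) (M - j ` X)" by (rule zopen_imp_openin[OF M zopen_diff[OF jXM(2,1)]])
  have oY: "openin (ctop M) (M - j ` Y)" by (rule zopen_imp_openin[OF M zopen_diff[OF jY(2) jYM]])
  have "is_ch_rel (ctop M) (M - j ` X)
      (difference_bundle (ctop M) (M - j ` X) (E_even M E) (E_odd M E) \<beta>) u"
    by (rule is_ch_rel_restrict[OF S(1,2) oY oX sub map bij[rule_format] u])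
  moreover have "alexander_dual M X j u z"
    by (rule alexander_dual_enlarge[OF YX oX oY topspace_ctop[OF M] _ dual])
      (use u in \<open>simp add: is_ch_rel_def\<close>)
  ultimately have "BFM_value M X j E \<beta> (hom_class (ctop X) (cap (pull_cochain j a) z))"
    unfolding BFM_value_def localized_ch_def using a by blast
  \<comment> \<open>Now from left to right: any value obtained from admissible data on
    \<open>X\<close> is that of \<open>\<tau>\<close>.\<close>
  then have eqX: "hom_class (ctop X) (cap (pull_cochain j a) z) = \<tau> X (K0_class X (frag_of ?G))"
    using \<tau>[OF X G] DX by simp
  have "z \<in> qchains (ctop Y)" using dual unfolding alexander_dual_def cycle_def by simp
  then have "hom_push (ctop X) (\<lambda>x. x) (hom_class (ctop Y) (cap (pull_cochain j a) z)) =
      hom_class (ctop X) (cap (pull_cochain j a) z)"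
    by (intro hom_push_hom_class[OF YX] cap_qchains)
  then show ?thesis
    unfolding charge_def brane_class_in_degree_0[OF \<open>coherent Y F\<close>] brane_class_in_degree_0[OF G] eqY eqX .
qed

end
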